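(* Suppose Assumptions (A1) and (A2) below hold for the integral difference equation (IDE) described in the context. Then there exist real-valued, compactly supported functions $f, g_1,\dots,g_n \in L^2((0,\infty),\mathbb{R})$, with $\operatorname{supp} g_i\subset[0,S_i]$ for $i=1,\dots,n$ and $\operatorname{supp} f\subset[0,S_{n+1}]$ for some finite $S_1,\dots,S_{n+1}>0$, such that the closed-loop system formed by the IDE and the control law (CL) is exponentially stable. That is, there exist $\nu>0$ and $C\ge 1$ such that for all initial data $(X_0,U_0)\in L^p([-\tau_*,0],\mathbb{R}^n)\times L^p([-\theta_*,0],\mathbb{R})$ and all $t\ge0$, $$\|X_t\|_{L^p}+\|U_t\|_{L^p}\le Ce^{-\nu t}\big(\|X_0\|_{L^p}+\|U_0\|_{L^p}\big),$$ where $(X,U)$ is the corresponding solution of the closed-loop system.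
   Context: Let $n\in\mathbb{N}_{>0}$ and $p\in\mathbb{N}_{>0}\cup\{+\infty\}$. Let $\tau_*>0$ and $\theta_*>0$. Let $(A_k)_{k\ge1}$ be a sequence of real $n\times n$ matrices and $(B_j)_{j\ge0}$ a sequence of real $n\times 1$ matrices with $\sum_{k\ge1}|A_k|+\sum_{j\ge0}|B_j|<\infty$. Let $(\tau_k)_{k\ge1}$ and $(\theta_j)_{j\ge0}$ be strictly increasing sequences with $\tau_k\in(0,\tau_*]$ and $\theta_j\in[0,\theta_*]$. Let $N\in L^2((0,\tau_* ),\mathbb{R}^{n\times n})$ and $M\in L^2((0,\theta_* ),\mathbb{R}^{n})$. The IDE is: for $X_0\in L^p([-\tau_*,0],\mathbb{R}^n)$, $$X(t)-\sum_{k\ge1}A_kX(t-\tau_k)-\int_0^{\tau_*}N(\eta)X(t-\eta)\,d\eta=\sum_{j\ge0}B_jU(t-\theta_j)+\int_0^{\theta_*}M(\eta)U(t-\eta)\,d\eta,\quad t>0,$$ with $X(t)=X_0(t)$ for $-\tau_*\le t\le0$, where $U$ is a real scalar input. The control law (CL) is: for $U_0\in L^p([-\theta_*,0],\mathbb{R})$, $$U(t)=\sum_{i=1}^n\int_0^{\min(t,S_i)}g_i(\eta)X_i(t-\eta)\,d\eta+\int_0^{\min(t,S_{n+1})}f(\eta)U(t-\eta)\,d\eta,\quad t>0,$$ with $U(t)=U_0(t)$ for $-\theta_*\le t\le 0$, where $X_i$ is the $i$-th component of $X$. For a function $X$, $X_t(\tau):=X(t+\tau)$. A solution is a function with $X_t\in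 L^p$ for all $t\ge0$ satisfying the equations almost everywhere; the closed-loop system is well posed. Notation: for $\nu\ge0$, $\mathbb{C}_\nu:=\{z\in\mathbb{C}:\operatorname{Re}z>-\nu\}$. Define, for $z\in\mathbb{C}$, $$\Delta_0(z):=I_n-\sum_{k\ge1}A_ke^{-\tau_kz},\quad q(z):=\Delta_0(z)-\int_0^{\tau_*}N(\eta)e^{-\eta z}d\eta\in\mathbb{C}^{n\times n},$$ $$p(z):=\sum_{j\ge0}B_je^{-\theta_jz}+\int_0^{\theta_*}M(\eta)e^{-\eta z}d\eta\in\mathbb{C}^{n\times1}.$$ Assumption (A1) (stability of the principal part): there exist $\tilde\nu>0$ and $\eta>0$ such that $|\det\Delta_0(z)|>\eta$ for all $z\in\mathbb{C}_{\tilde\nu}$. Assumption (A2) (spectral stabilizability): there exists $\bar\nu>0$ such that $\operatorname{rank}[\,q(z),\,-p(z)\,]=n$ for all $z\in\mathbb{C}_{\bar\nu}$. *)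

theory Defs
  imports "HOL-Analysis.Analysis" "HOL-Probability.Essential_Supremum" "HOL-Library.Extended_Nat"
begin

definition memLp :: "enat \<Rightarrow> real set \<Rightarrow> (real \<Rightarrow> 'b::euclidean_space) \<Rightarrow> bool" where
  "memLp p S h \<longleftrightarrow> h \<in> borel_measurable (lebesgue_on S) \<and>
     (case p of enat q \<Rightarrow> integrable (lebesgue_on S) (\<lambda>x. norm (h x) ^ q)
              | \<infinity> \<Rightarrow> esssup (lebesgue_on S) (\<lambda>x. ereal (norm (h x))) < \<infinity>)"

definition Lp_norm :: "enat \<Rightarrow> real set \<Rightarrow> (real \<Rightarrow> 'b::euclidean_space) \<Rightarrow> real" where
  "Lp_norm p S h =
     (case p of enat q \<Rightarrow> (\<integral>x. norm (h x) ^ q \<partial>lebesgue_on S) powr (1 / real q)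
              | \<infinity> \<Rightarrow> real_of_ereal (esssup (lebesgue_on S) (\<lambda>x. ereal (norm (h x)))))"

definition L2_on :: "real set \<Rightarrow> (real \<Rightarrow> 'b::euclidean_space) \<Rightarrow> bool" where
  "L2_on S h \<longleftrightarrow> memLp (enat 2) S h"

definition cmat :: "real^'n^'m \<Rightarrow> complex^'n^'m" where
  "cmat A = (\<chi> i j. complex_of_real (A $ i $ j))"
definition cvec :: "real^'n \<Rightarrow> complex^'n" where
  "cvec v = (\<chi> i. complex_of_real (v $ i))"

definition cscaleM :: "complex \<Rightarrow> complex^'n^'m \<Rightarrow> complex^'n^'m" where
  "cscaleM c A = (\<chi> i j. c * A $ i $ j)"
definition cscaleV :: "complex \<Rightarrow> complex^'n \<Rightarrow> complex^'n" where
  "cscaleV c v = (\<chi> i. c * v $ i)"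

text \<open>Delta_0(z) = I - sum_{k>=1} A_k e^{-tau_k z}  (the sequences are indexed by nat; index 0 of A, tau is unused)\<close>
definition Delta0 :: "(nat \<Rightarrow> real^'n^'n) \<Rightarrow> (nat \<Rightarrow> real) \<Rightarrow> complex \<Rightarrow> complex^'n^'n" where
  "Delta0 A tau z = mat 1 - (\<Sum>k. cscaleM (exp (- complex_of_real (tau (Suc k)) * z)) (cmat (A (Suc k))))"

definition qfun :: "(nat \<Rightarrow> real^'n^'n) \<Rightarrow> (nat \<Rightarrow> real) \<Rightarrow> real \<Rightarrow> (real \<Rightarrow> real^'n^'n) \<Rightarrow> complex \<Rightarrow> complex^'n^'n" where
  "qfun A tau taus N z = Delta0 A tau z -
     (\<integral>\<eta>. cscaleM (exp (- complex_of_real \<eta> * z)) (cmat (N \<eta>)) \<partial>lebesgue_on {0..taus})"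

definition pfun :: "(nat \<Rightarrow> real^'n) \<Rightarrow> (nat \<Rightarrow> real) \<Rightarrow> real \<Rightarrow> (real \<Rightarrow> real^'n) \<Rightarrow> complex \<Rightarrow> complex^'n" where
  "pfun B theta thetas M z = (\<Sum>j. cscaleV (exp (- complex_of_real (theta j) * z)) (cvec (B j))) +
     (\<integral>\<eta>. cscaleV (exp (- complex_of_real \<eta> * z)) (cvec (M \<eta>)) \<partial>lebesgue_on {0..thetas})"

definition block_qp :: "complex^'n^'n \<Rightarrow> complex^'n \<Rightarrow> complex^('n + unit)^'n" where
  "block_qp Q P = (\<chi> i j. case j of Inl k \<Rightarrow> Q $ i $ k | Inr _ \<Rightarrow> - (P $ i))"

definition closed_loop_solution ::
  "enat \<Rightarrow> real \<Rightarrow> real \<Rightarrow> (nat \<Rightarrow> real^'n^'n) \<Rightarrow> (nat \<Rightarrow> real) \<Rightarrow> (nat \<Rightarrow> real^'n) \<Rightarrow> (nat \<Rightarrow> real)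
   \<Rightarrow> (real \<Rightarrow> real^'n^'n) \<Rightarrow> (real \<Rightarrow> real^'n)
   \<Rightarrow> ('n \<Rightarrow> real \<Rightarrow> real) \<Rightarrow> ('n \<Rightarrow> real) \<Rightarrow> (real \<Rightarrow> real) \<Rightarrow> real
   \<Rightarrow> (real \<Rightarrow> real^'n) \<Rightarrow> (real \<Rightarrow> real) \<Rightarrow> (real \<Rightarrow> real^'n) \<Rightarrow> (real \<Rightarrow> real) \<Rightarrow> bool" where
  "closed_loop_solution p taus thetas A tau B theta N M g S f Sf X0 U0 X U \<longleftrightarrow>
     (\<forall>t\<ge>0. memLp p {-taus..0} (\<lambda>s. X (t + s)) \<and> memLp p {-thetas..0} (\<lambda>s. U (t + s))) \<and>
     (AE t in lebesgue_on {-taus..0}. X t = X0 t) \<and>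
     (AE t in lebesgue_on {-thetas..0}. U t = U0 t) \<and>
     (AE t in lebesgue_on {0<..}.
        summable (\<lambda>k. A (Suc k) *v X (t - tau (Suc k))) \<and>
        summable (\<lambda>j. U (t - theta j) *\<^sub>R B j) \<and>
        integrable (lebesgue_on {0..taus}) (\<lambda>\<eta>. N \<eta> *v X (t - \<eta>)) \<and>
        integrable (lebesgue_on {0..thetas}) (\<lambda>\<eta>. U (t - \<eta>) *\<^sub>R M \<eta>) \<and>
        X t - (\<Sum>k. A (Suc k) *v X (t - tau (Suc k))) - (\<integral>\<eta>. N \<eta> *v X (t - \<eta>) \<partial>lebesgue_on {0..taus})
          = (\<Sum>j. U (t - theta j) *\<^sub>R B j) + (\<integral>\<eta>. U (t - \<eta>) *\<^sub>R M \<eta> \<partial>lebesgue_on {0..thetas})) \<and>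
     (AE t in lebesgue_on {0<..}.
        (\<forall>i. integrable (lebesgue_on {0..min t (S i)}) (\<lambda>\<eta>. g i \<eta> * (X (t - \<eta>) $ i))) \<and>
        integrable (lebesgue_on {0..min t Sf}) (\<lambda>\<eta>. f \<eta> * U (t - \<eta>)) \<and>
        U t = (\<Sum>i\<in>UNIV. \<integral>\<eta>. g i \<eta> * (X (t - \<eta>) $ i) \<partial>lebesgue_on {0..min t (S i)})
              + (\<integral>\<eta>. f \<eta> * U (t - \<eta>) \<partial>lebesgue_on {0..min t Sf}))"

end

theory Submission
  imports Defs "HOL-Complex_Analysis.Complex_Analysis"
begin

text \<open>
  After multiplication of all signals by \<open>exp (\<nu> * t)\<close> exponential stability becomes boundedness of
  the weighted closed loop, uniformly over time windows. Transfer functions act on $L^q$ signals as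
  Laplace multipliers. The determinant of the principal part is an almost periodic Dirichlet series bounded
  away from zero on a half plane, so it can be inverted up to small errors by Newman's elementary proof of
  Wiener's lemma. The rank condition says that the maximal minors of \<open>[q, -p]\<close> have no common zero in the
  closed right half plane; a Gelfand--Mazur argument turns this into a Bezout identity, whose
  distributed coefficients are truncated to compactly supported bounded kernels. These form an additional row of
  the plant matrix that makes the determinant invertible up to a small error, and Cramer's rule bounds the signals.
\<close>

section \<open>Signals and Laplace transforms\<close>

text \<open>A feedback with distributed terms only cannot realise the Bezout coefficients, which are
  general multipliers and may contain pure delays. The cofactor of the control entry is F + H, with
  F the determinant of the weighted principal part and H an L1 transform. For a last row e - k, with
  e the unit row at the control entry, the closed-loop determinant is F + H - sum k_j c_j; taking
  k_j near H b_j with sum b_j c_j near 1 leaves about F, and H b_j is an L1 transform because these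
  form an ideal among the multipliers. The rank condition gives nonvanishing at each point, with no
  lower bound and no hold at infinity. Gelfand-Mazur is applied to x = 1/(z + 1) modulo the minors
  because it asks for local statements only: finite points use the rank, infinity uses F. Solutions
  are a priori only locally in L^p and might grow, so a window (0,T] is cut out; the damage of the
  cut lies after T, and causality removes it. Norms occur as upper bounds and inverses up to small
  errors, so the algebra stays one of plain functions.\<close>

lemma power_tangent_le:
  fixes u a :: real
  assumes "0 \<le> u" "0 \<le> a"
  shows "real (Suc k) * a ^ k * u \<le> u ^ Suc k + real k * a ^ Suc k"
proof (induction k)
  case 0
  then show ?case by simp
next
  case (Suc k)
  have "0 \<le> real (Suc k) * a ^ k * (u - a)\<^sup>2"
    using assms by simp
  moreover have "real (Suc k) * a ^ k * u * u \<le> (u ^ Suc k + real k * a ^ Suc k) * u"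
    by (intro mult_right_mono Suc assms)
  ultimately show ?case
    by (simp add: algebra_simps power2_eq_square)
qed

text \<open>Jensen's inequality for u^(k+1), obtained by integrating the tangent of
  \<open>power_tangent_le\<close> at a = (integral of w u) / W. Since W only bounds the total
  weight, a need not be the exact mean; this only overestimates the constant term of the
  tangent.\<close>

lemma nn_integral_power_le:
  fixes w u :: "'a \<Rightarrow> real"
  assumes [measurable]: "w \<in> borel_measurable M" "u \<in> borel_measurable M"
    and w0: "\<And>x. 0 \<le> w x" and u0: "\<And>x. 0 \<le> u x"
    and W: "(\<integral>\<^sup>+x. ennreal (w x) \<partial>M) \<le> ennreal W" "0 \<le> W"
  shows "(\<integral>\<^sup>+x. ennreal (w x * u x) \<partial>M) ^ Suc k
    \<le> ennreal (W ^ k) * (\<integral>\<^sup>+x. ennreal (w x * u x ^ Suc k) \<partial>M)"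
proof (cases "W = 0")
  case True
  then have "AE x in M. w x = 0"
    using W w0 by (auto simp: nn_integral_0_iff_AE ennreal_eq_0_iff antisym)
  then have "(\<integral>\<^sup>+x. ennreal (w x * u x) \<partial>M) = 0"
    by (subst nn_integral_0_iff_AE) auto
  then show ?thesis by simp
next
  case False
  with W have Wpos: "0 < W" by simp
  let ?J = "\<integral>\<^sup>+x. ennreal (w x * u x ^ Suc k) \<partial>M"
  show ?thesis
  proof (cases "?J = \<infinity>")
    case True
    then show ?thesis using Wpos by (simp add: ennreal_mult_top)
  next
    case False
    then obtain j where j: "?J = ennreal j" "0 \<le> j"
      by (cases ?J) auto
    \<comment> \<open>Finiteness of the right-hand integral thereby forces that of
      \<open>w x * u x\<close>, so the base point a of the tangent is a real number.\<close>
    have *: "u x \<le> 1 + u x ^ Suc k" for x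
    proof (cases "u x \<le> 1")
      case False
      then have "u x ^ 1 \<le> u x ^ Suc k" by (intro power_increasing) auto
      then show ?thesis by simp
    qed (use u0[of x] in \<open>auto intro: add_increasing2\<close>)
    have "(\<integral>\<^sup>+x. ennreal (w x * u x) \<partial>M) \<le> (\<integral>\<^sup>+x. ennreal (w x) + ennreal (w x * u x ^ Suc k) \<partial>M)"
      proof (intro nn_integral_mono)
      fix x
      have "w x * u x \<le> w x * (1 + u x ^ Suc k)" using * w0 by (intro mult_left_mono)
      then show "ennreal (w x * u x) \<le> ennreal (w x) + ennreal (w x * u x ^ Suc k)"
        using w0[of x] u0[of x] by (simp add: distrib_left flip: ennreal_plus)
    qed
    also have "\<dots> \<le> ennreal (W + j)"
      using W j w0 u0 by (subst nn_integral_add) (auto simp: add_mono)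
    finally obtain a' where a': "(\<integral>\<^sup>+x. ennreal (w x * u x) \<partial>M) = ennreal a'" "0 \<le> a'"
      by (cases "\<integral>\<^sup>+x. ennreal (w x * u x) \<partial>M") (auto simp: top_unique)
    define a where "a = a' / W"
    have a0: "0 \<le> a" using a' Wpos by (simp add: a_def)
    have "ennreal (real (Suc k) * a ^ k) * ennreal a' = (\<integral>\<^sup>+x. ennreal (real (Suc k) * a ^ k) * ennreal (w x * u x) \<partial>M)"
      by (subst nn_integral_cmult) (auto simp: a')
    also have "\<dots> \<le> (\<integral>\<^sup>+x. ennreal (w x * u x ^ Suc k) + ennreal (real k * a ^ Suc k) * ennreal (w x) \<partial>M)"
    proof (rule nn_integral_mono)
      fix x
      have "(real (Suc k) * a ^ k) * (w x * u x) \<le> w x * u x ^ Suc k + real k * a ^ Suc k * w x"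
        using mult_left_mono[OF power_tangent_le[OF u0[of x] a0, of k] w0[of x]] by (simp add: algebra_simps)
      then show "ennreal (real (Suc k) * a ^ k) * ennreal (w x * u x)
        \<le> ennreal (w x * u x ^ Suc k) + ennreal (real k * a ^ Suc k) * ennreal (w x)"
        using w0[of x] u0[of x] a0 by (simp flip: ennreal_mult ennreal_plus)
    qed
    also have "\<dots> \<le> ennreal j + ennreal (real k * a ^ Suc k) * ennreal W"
      using W j by (subst nn_integral_add) (auto simp: nn_integral_cmult intro!: add_mono mult_left_mono)
    finally have "(real (Suc k) * a ^ k) * a' \<le> j + real k * a ^ Suc k * W"
      using a' a0 j Wpos by (simp flip: ennreal_mult ennreal_plus)
    moreover have "a' = a * W" using Wpos by (simp add: a_def)
    ultimately have *: "a ^ Suc k * W \<le> j" by (simp add: algebra_simps)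
    have "a' ^ Suc k = W ^ k * (a ^ Suc k * W)"
      by (simp add: \<open>a' = a * W\<close> power_mult_distrib algebra_simps)
    also have "\<dots> \<le> W ^ k * j" using * Wpos by (intro mult_left_mono) auto
    finally show ?thesis
      using a' j Wpos by (simp only: a'(1) j(1) ennreal_power) (simp flip: ennreal_mult)
  qed
qed

definition Lq :: "enat \<Rightarrow> (real \<Rightarrow> complex) \<Rightarrow> real \<Rightarrow> bool" where
  "Lq q x c \<longleftrightarrow> x \<in> borel_measurable borel \<and> 0 \<le> c \<and>
     (case q of enat k \<Rightarrow> (\<integral>\<^sup>+t. ennreal (cmod (x t) ^ k) \<partial>lborel) \<le> ennreal (c ^ k)
              | \<infinity> \<Rightarrow> AE t in lborel. cmod (x t) \<le> c)"

lemma LqD: "Lq q x c \<Longrightarrow> x \<in> borel_measurable borel" "Lq q x c \<Longrightarrow> 0 \<le> c"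
  by (auto simp: Lq_def)

lemma Lq_AE_mono:
  assumes "Lq q x c" "y \<in> borel_measurable borel" "AE t in lborel. cmod (y t) \<le> cmod (x t)" "c \<le> d"
  shows "Lq q y d"
proof (cases q)
  case (enat k)
  have "(\<integral>\<^sup>+t. ennreal (cmod (y t) ^ k) \<partial>lborel) \<le> (\<integral>\<^sup>+t. ennreal (cmod (x t) ^ k) \<partial>lborel)"
    using assms(3) by (intro nn_integral_mono_AE) (auto elim!: eventually_mono simp: power_mono)
  also have "\<dots> \<le> ennreal (c ^ k)" using assms(1) enat by (simp add: Lq_def)
  also have "\<dots> \<le> ennreal (d ^ k)" using assms(1,4) by (intro ennreal_leI power_mono) (auto simp: Lq_def)
  finally show ?thesis using assms enat by (auto simp: Lq_def)
next
  case infinity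
  have "AE t in lborel. cmod (x t) \<le> c" using assms(1) infinity by (simp add: Lq_def)
  with assms(3) have "AE t in lborel. cmod (y t) \<le> d" by eventually_elim (use assms(4) in auto)
  then show ?thesis using assms infinity by (auto simp: Lq_def)
qed

lemma Lq_mono: "Lq q x c \<Longrightarrow> c \<le> d \<Longrightarrow> Lq q x d"
  by (rule Lq_AE_mono[of q x c]) (auto dest: LqD)

lemma Lq_zero: "q \<ge> 1 \<Longrightarrow> 0 \<le> c \<Longrightarrow> Lq q (\<lambda>_. 0) c"
  by (cases q) (auto simp: Lq_def one_enat_def zero_power)

lemma Lq_shift:
  assumes "Lq q x c" shows "Lq q (\<lambda>t. x (t - s)) c"
proof -
  have [measurable]: "x \<in> borel_measurable borel" using assms by (rule LqD)
  show ?thesis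
  proof (cases q)
    case (enat k)
    have "(\<integral>\<^sup>+t. ennreal (cmod (x t) ^ k) \<partial>lborel) = (\<integral>\<^sup>+t. ennreal (cmod (x (- s + 1 * t)) ^ k) \<partial>lborel)"
      by (subst nn_integral_real_affine[where c=1 and t="-s"]) auto
    then show ?thesis using assms enat by (simp add: Lq_def add.commute[of "-s"])
  next
    case infinity
    then have "AE t in lborel. cmod (x t) \<le> c" using assms by (simp add: Lq_def)
    then have "AE t in lborel. cmod (x (- s + 1 * t)) \<le> c"
      by (subst AE_borel_affine) auto
    then show ?thesis using assms infinity by (simp add: Lq_def add.commute[of "-s"])
  qed
qed

lemma Lq_cmult: assumes "Lq q x c" "q \<ge> 1" shows "Lq q (\<lambda>t. a * x t) (cmod a * c)"
proof -
  have [measurable]: "x \<in> borel_measurable borel" using assms by (auto dest: LqD)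
  show ?thesis
  proof (cases q)
    case (enat k)
    have "(\<integral>\<^sup>+t. ennreal (cmod (a * x t) ^ k) \<partial>lborel) = ennreal (cmod a ^ k) * (\<integral>\<^sup>+t. ennreal (cmod (x t) ^ k) \<partial>lborel)"
      by (subst nn_integral_cmult[symmetric]) (auto simp: norm_mult power_mult_distrib ennreal_mult)
    also have "\<dots> \<le> ennreal (cmod a ^ k) * ennreal (c ^ k)"
      using assms enat by (intro mult_left_mono) (auto simp: Lq_def)
    finally show ?thesis using assms enat by (simp add: Lq_def power_mult_distrib ennreal_mult)
  next
    case infinity
    then show ?thesis using assms by (auto simp: Lq_def norm_mult elim!: eventually_mono intro: mult_left_mono)
  qed
qed

lemma ennreal_le_ennreal_rightI:
  fixes a :: ennreal
  assumes "\<And>c'. c' > c \<Longrightarrow> a \<le> ennreal (c' ^ k)" "0 \<le> c"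
  shows "a \<le> ennreal (c ^ k)"
proof (rule tendsto_lowerbound)
  show "((\<lambda>c'. ennreal (c' ^ k)) \<longlongrightarrow> ennreal (c ^ k)) (at_right c)"
    by (intro tendsto_ennrealI tendsto_intros)
  show "\<forall>\<^sub>F c' in at_right c. a \<le> ennreal (c' ^ k)"
    using assms by (auto simp: eventually_at_right_field intro: exI[of _ "c+1"])
qed simp

text \<open>Passage to the infimum of the admissible bounds; it removes positivity assumptions from
  intermediate estimates and the slack left by \<open>contraction_le\<close>.\<close>

lemma Lq_closed:
  assumes "\<And>c'. c' > c \<Longrightarrow> Lq q x c'" "0 \<le> c"
  shows "Lq q x c"
proof (cases q)
  case (enat k)
  have "(\<integral>\<^sup>+t. ennreal (cmod (x t) ^ k) \<partial>lborel) \<le> ennreal (c ^ k)"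
    by (rule ennreal_le_ennreal_rightI) (use assms enat in \<open>simp_all add: Lq_def\<close>)
  then show ?thesis
    using assms(2) assms(1)[of "c+1"] enat by (simp add: Lq_def)
next
  case infinity
  have "AE t in lborel. \<forall>n. cmod (x t) \<le> c + 1 / real (Suc n)"
    using assms infinity by (subst AE_all_countable) (auto simp: Lq_def)
  then have "AE t in lborel. cmod (x t) \<le> c"
  proof eventually_elim
    case (elim t)
    have "(\<lambda>n. c + 1 / real (Suc n)) \<longlonglongrightarrow> c + 0"
      by (intro tendsto_add tendsto_const LIMSEQ_Suc[OF lim_1_over_n])
    then show ?case using elim by (intro LIMSEQ_le_const[of "\<lambda>n. c + 1 / real (Suc n)"]) auto
  qed
  then show ?thesis using assms(1)[of "c+1"] assms(2) infinity by (auto simp: Lq_def)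
qed

text \<open>Minkowski's integral inequality for a superposition, of total weight W, of signals of
  norm at most c. Pointwise it is the power mean inequality with weight w, and Tonelli integrates it
  over t; for q infinite the two almost-everywhere quantifiers are swapped. The triangle inequality
  and Young's inequality are both instances.\<close>

lemma Lq_minkowski:
  assumes M: "sigma_finite_measure M" and q: "q \<ge> 1"
    and [measurable]: "w \<in> borel_measurable M" "case_prod g \<in> borel_measurable (lborel \<Otimes>\<^sub>M M)" "y \<in> borel_measurable borel"
    and w0: "\<And>i. 0 \<le> w i" and W: "(\<integral>\<^sup>+i. ennreal (w i) \<partial>M) \<le> ennreal W" "0 \<le> W"
    and g: "\<And>i. i \<in> space M \<Longrightarrow> Lq q (\<lambda>t. g t i) c" and c: "0 \<le> c"
    and y: "AE t in lborel. ennreal (cmod (y t)) \<le> (\<integral>\<^sup>+i. ennreal (w i * cmod (g t i)) \<partial>M)"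
  shows "Lq q y (W * c)"
proof -
  interpret M: sigma_finite_measure M by fact
  interpret P: pair_sigma_finite lborel M ..
  show ?thesis
  proof (cases q)
    case (enat k')
    then obtain k where k: "q = enat (Suc k)"
      using q by (cases k') (auto simp: one_enat_def)
    have "(\<integral>\<^sup>+t. ennreal (cmod (y t) ^ Suc k) \<partial>lborel) \<le> (\<integral>\<^sup>+t. ennreal (W ^ k) * (\<integral>\<^sup>+i. ennreal (w i * cmod (g t i) ^ Suc k) \<partial>M) \<partial>lborel)"
    proof (rule nn_integral_mono_AE, use y in eventually_elim)
      case (elim t)
      have "ennreal (cmod (y t) ^ Suc k) = ennreal (cmod (y t)) ^ Suc k" by (simp only: ennreal_power norm_ge_zero)
      also have "\<dots> \<le> (\<integral>\<^sup>+i. ennreal (w i * cmod (g t i)) \<partial>M) ^ Suc k" by (intro power_mono elim) auto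
      also have "\<dots> \<le> ennreal (W ^ k) * (\<integral>\<^sup>+i. ennreal (w i * cmod (g t i) ^ Suc k) \<partial>M)"
        by (rule nn_integral_power_le) (use w0 W in auto)
      finally show ?case .
    qed
    also have "\<dots> = ennreal (W ^ k) * (\<integral>\<^sup>+t. (\<integral>\<^sup>+i. ennreal (w i * cmod (g t i) ^ Suc k) \<partial>M) \<partial>lborel)"
      by (rule nn_integral_cmult) measurable
    also have "(\<integral>\<^sup>+t. (\<integral>\<^sup>+i. ennreal (w i * cmod (g t i) ^ Suc k) \<partial>M) \<partial>lborel)
        = (\<integral>\<^sup>+i. (\<integral>\<^sup>+t. ennreal (w i * cmod (g t i) ^ Suc k) \<partial>lborel) \<partial>M)"
      by (rule P.Fubini'[symmetric]) measurable
    also have "\<dots> = (\<integral>\<^sup>+i. ennreal (w i) * (\<integral>\<^sup>+t. ennreal (cmod (g t i) ^ Suc k) \<partial>lborel) \<partial>M)"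
    proof (rule nn_integral_cong)
      fix i assume [measurable]: "i \<in> space M"
      show "(\<integral>\<^sup>+t. ennreal (w i * cmod (g t i) ^ Suc k) \<partial>lborel) = ennreal (w i) * (\<integral>\<^sup>+t. ennreal (cmod (g t i) ^ Suc k) \<partial>lborel)"
        using w0 by (subst nn_integral_cmult[symmetric]) (auto simp: ennreal_mult)
    qed
    also have "\<dots> \<le> (\<integral>\<^sup>+i. ennreal (w i) * ennreal (c ^ Suc k) \<partial>M)"
      using g k by (intro nn_integral_mono mult_left_mono) (auto simp: Lq_def)
    also have "\<dots> \<le> ennreal W * ennreal (c ^ Suc k)"
      by (subst nn_integral_multc) (auto intro: mult_right_mono W)
    finally have "(\<integral>\<^sup>+t. ennreal (cmod (y t) ^ Suc k) \<partial>lborel) \<le> ennreal (W ^ k) * (ennreal W * ennreal (c ^ Suc k))"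
      by (simp add: mult_left_mono)
    also have "\<dots> = ennreal ((W * c) ^ Suc k)"
      using W c by (simp add: power_mult_distrib flip: ennreal_mult)
    finally show ?thesis using k W c by (simp add: Lq_def)
  next
    case infinity
    have "AE i in M. AE t in lborel. cmod (g t i) \<le> c"
      by (rule AE_I2) (use g infinity in \<open>simp add: Lq_def\<close>)
    then have "AE t in lborel. AE i in M. cmod (g t i) \<le> c"
      by (subst P.AE_commute) measurable
    with y have "AE t in lborel. cmod (y t) \<le> W * c"
    proof eventually_elim
      case (elim t)
      note elim(1)
      also have "(\<integral>\<^sup>+i. ennreal (w i * cmod (g t i)) \<partial>M) \<le> (\<integral>\<^sup>+i. ennreal (w i) * ennreal c \<partial>M)"
        by (rule nn_integral_mono_AE) (use elim(2) w0 c in \<open>auto elim!: eventually_mono simp: mult_left_mono simp flip: ennreal_mult\<close>)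
      also have "\<dots> \<le> ennreal W * ennreal c"
        by (subst nn_integral_multc) (auto intro: mult_right_mono W)
      finally show ?case using W c by (simp flip: ennreal_mult)
    qed
    then show ?thesis using infinity W c by (simp add: Lq_def)
  qed
qed

text \<open>Minkowski over a two-point measure space, with weights c and d on the normalised signals
  x / c and y / d. The normalisation needs c, d > 0, which \<open>Lq_closed\<close> removes.\<close>

lemma Lq_add:
  assumes q: "q \<ge> 1" and x: "Lq q x c" and y: "Lq q y d"
  shows "Lq q (\<lambda>t. x t + y t) (c + d)"
proof -
  have [measurable]: "x \<in> borel_measurable borel" "y \<in> borel_measurable borel" using x y by (auto dest: LqD)
  have *: "Lq q (\<lambda>t. x t + y t) (c + d)" if x: "Lq q x c" and y: "Lq q y d" and cd: "c > 0" "d > 0" for c d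
  proof -
    let ?g = "\<lambda>t b. if b then (1/c) * x t else (1/d) * y t"
    have "Lq q (\<lambda>t. x t + y t) ((c + d) * 1)"
    proof (rule Lq_minkowski[where M="count_space (UNIV::bool set)" and w="\<lambda>b. if b then c else d" and g="?g"])
      show "sigma_finite_measure (count_space (UNIV::bool set))"
        by (rule sigma_finite_measure_count_space_countable) simp
      show "case_prod ?g \<in> borel_measurable (lborel \<Otimes>\<^sub>M count_space UNIV)"
        by measurable
      show "Lq q (\<lambda>t. ?g t i) 1" for i
        using Lq_cmult[OF x q, of "1/c"] Lq_cmult[OF y q, of "1/d"] cd
        by (cases i) (auto simp: norm_divide)
      show "AE t in lborel. ennreal (cmod (x t + y t)) \<le> (\<integral>\<^sup>+i. ennreal ((if i then c else d) * cmod (?g t i)) \<partial>count_space UNIV)"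
        using cd by (auto simp: nn_integral_count_space_finite UNIV_bool norm_divide norm_mult add.commute[of "cmod (y _)"] norm_triangle_ineq simp flip: ennreal_plus)
    qed (use q cd in \<open>auto simp: nn_integral_count_space_finite UNIV_bool simp flip: ennreal_plus\<close>)
    then show ?thesis by simp
  qed
  show ?thesis
  proof (rule Lq_closed)
    fix c' assume "c' > c + d"
    then have "Lq q (\<lambda>t. x t + y t) ((c + (c' - (c + d)) / 2) + (d + (c' - (c + d)) / 2))"
      using LqD(2)[OF x] LqD(2)[OF y] by (intro * Lq_mono[OF x] Lq_mono[OF y]) (auto intro: add_nonneg_pos)
    then show "Lq q (\<lambda>t. x t + y t) c'" by (simp add: field_simps)
  qed (use LqD(2)[OF x] LqD(2)[OF y] in auto)
qed

lemma Lq_sum: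
  assumes "q \<ge> 1" "\<And>i. i \<in> I \<Longrightarrow> Lq q (x i) (c i)"
  shows "Lq q (\<lambda>t. \<Sum>i\<in>I. x i t) (\<Sum>i\<in>I. c i)"
proof (cases "finite I")
  case True
  then show ?thesis using assms
    by (induction I) (auto simp: Lq_zero intro: Lq_add)
qed (use assms in \<open>simp add: Lq_zero\<close>)

lemma le_one_plus_power:
  fixes u :: real assumes "0 \<le> u" "k \<ge> 1" shows "u \<le> 1 + u ^ k"
proof (cases "u \<le> 1")
  case False
  then have "u ^ 1 \<le> u ^ k" using assms by (intro power_increasing) auto
  then show ?thesis by simp
qed (use assms in \<open>auto intro: add_increasing2\<close>)

text \<open>For finite q the bound \<phi> |x| <= \<phi> + K |x|^q reduces every exponent to two
  integrable functions. With \<phi> an exponential cut off at 0 this gives convergence of Laplace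
  integrals.\<close>

lemma Lq_integrable_weight:
  fixes \<phi> :: "real \<Rightarrow> real"
  assumes x: "Lq q x c" and q: "q \<ge> 1" and \<phi>: "integrable lborel \<phi>" "\<And>t. 0 \<le> \<phi> t" "\<And>t. \<phi> t \<le> K"
  shows "integrable lborel (\<lambda>t. complex_of_real (\<phi> t) * x t)"
proof -
  have [measurable]: "x \<in> borel_measurable borel" "\<phi> \<in> borel_measurable borel"
    using x \<phi>(1) by (auto dest: LqD)
  have K: "0 \<le> K" using \<phi>(2,3)[of 0] by simp
  show ?thesis
  proof (cases q)
    case (enat k)
    then have k: "k \<ge> 1" using q by (simp add: one_enat_def)
    have "integrable lborel (\<lambda>t. cmod (x t) ^ k)"
      using x enat by (intro integrableI_bounded) (auto simp: Lq_def less_top[symmetric] top_unique)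
    then have "integrable lborel (\<lambda>t. \<phi> t + K * cmod (x t) ^ k)"
      using \<phi> by auto
    then show ?thesis
    proof (rule Bochner_Integration.integrable_bound)
      show "AE t in lborel. norm (complex_of_real (\<phi> t) * x t) \<le> norm (\<phi> t + K * cmod (x t) ^ k)"
      proof (rule AE_I2)
        fix t
        have "norm (complex_of_real (\<phi> t) * x t) = \<phi> t * cmod (x t)" using \<phi>(2)[of t] by (simp add: norm_mult)
        also have "\<dots> \<le> \<phi> t * (1 + cmod (x t) ^ k)"
          using k \<phi>(2) by (intro mult_left_mono le_one_plus_power) auto
        also have "\<dots> \<le> \<phi> t + K * cmod (x t) ^ k"
          using \<phi>(3)[of t] by (auto simp: distrib_left intro: mult_right_mono)
        also have "\<dots> \<le> norm (\<phi> t + K * cmod (x t) ^ k)" by (simp only: real_norm_def abs_ge_self)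
        finally show "norm (complex_of_real (\<phi> t) * x t) \<le> norm (\<phi> t + K * cmod (x t) ^ k)" .
      qed
    qed measurable
  next
    case infinity
    then have *: "AE t in lborel. cmod (x t) \<le> c" using x by (simp add: Lq_def)
    have "integrable lborel (\<lambda>t. \<phi> t * c)" using \<phi> by auto
    then show ?thesis
      by (rule Bochner_Integration.integrable_bound)
        (use * \<phi>(2) LqD(2)[OF x] in \<open>auto elim!: eventually_mono simp: norm_mult mult_left_mono\<close>)
  qed
qed

text \<open>Signals vanish at every negative time, not just at almost every one, so nonnegative
  delays preserve this pointwise and no null sets have to be tracked.\<close>

definition sig :: "enat \<Rightarrow> (real \<Rightarrow> complex) \<Rightarrow> real \<Rightarrow> bool" where
  "sig q x c \<longleftrightarrow> Lq q x c \<and> (\<forall>t<0. x t = 0)"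

definition lap :: "(real \<Rightarrow> complex) \<Rightarrow> real \<Rightarrow> complex" where
  "lap x z = (\<integral>t. complex_of_real (exp (- (z * t))) * x t \<partial>lborel)"

lemma integrable_exp_Ici:
  fixes z :: real assumes "z > 0"
  shows "integrable lborel (\<lambda>t. exp (- (z * t)) * indicator {0..} t)"
proof -
  have "(\<lambda>t. exp (- z * t)) absolutely_integrable_on {0..}"
    by (intro nonnegative_absolutely_integrable_1 integrable_on_exp_minus_to_infinity assms) auto
  then have "integrable lebesgue (\<lambda>t. exp (- (z * t)) * indicator {0..} t)"
    by (simp add: set_integrable_def mult.commute)
  then show ?thesis by (subst (asm) integrable_completion) measurable
qed

lemma sig_lap_integrable:
  assumes "sig q x c" "q \<ge> 1" "z > 0"
  shows "integrable lborel (\<lambda>t. complex_of_real (exp (- (z * t))) * x t)"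
proof -
  have "integrable lborel (\<lambda>t. complex_of_real (exp (- (z * t)) * indicator {0..} t) * x t)"
    using assms by (intro Lq_integrable_weight[where q=q and c=c and K=1] integrable_exp_Ici)
      (auto simp: sig_def indicator_def)
  moreover have "complex_of_real (exp (- (z * t)) * indicator {0..} t) * x t = complex_of_real (exp (- (z * t))) * x t" for t
    using assms(1) by (auto simp: sig_def indicator_def)
  ultimately show ?thesis by (simp only:)
qed

lemma lap_add:
  assumes "sig q x c" "sig q y d" "q \<ge> 1" "z > 0"
  shows "lap (\<lambda>t. x t + y t) z = lap x z + lap y z"
  using sig_lap_integrable[OF assms(1,3,4)] sig_lap_integrable[OF assms(2,3,4)]
  by (simp add: lap_def distrib_left)

lemma lap_cmult: "lap (\<lambda>t. a * x t) z = a * lap x z"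
  by (simp add: lap_def mult.left_commute[of _ a])

lemma lap_zero: "lap (\<lambda>t. 0) z = 0"
  by (simp add: lap_def)

lemma lap_cnj: "lap (\<lambda>t. cnj (x t)) z = cnj (lap x z)"
proof -
  have "lap (\<lambda>t. cnj (x t)) z = (\<integral>t. cnj (complex_of_real (exp (- (z * t))) * x t) \<partial>lborel)"
    by (simp add: lap_def)
  also have "\<dots> = cnj (lap x z)" unfolding lap_def by (rule integral_bounded_linear'[OF bounded_linear_cnj bounded_linear_cnj]) simp
  finally show ?thesis .
qed

lemma lap_shift:
  shows "lap (\<lambda>t. x (t - s)) z = complex_of_real (exp (- (z * s))) * lap x z"
proof -
  have "lap (\<lambda>t. x (t - s)) z = (\<integral>t. complex_of_real (exp (- (z * (s + 1 * t)))) * x (s + 1 * t - s) \<partial>lborel)"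
    unfolding lap_def by (subst lborel_integral_real_affine[where c=1 and t=s]) auto
  also have "\<dots> = complex_of_real (exp (- (z * s))) * lap x z"
    unfolding lap_def by (simp add: distrib_left exp_diff exp_minus divide_inverse ring_distribs flip: integral_mult_right_zero) (simp add: mult_ac)
  finally show ?thesis .
qed

lemma sig_add: "q \<ge> 1 \<Longrightarrow> sig q x c \<Longrightarrow> sig q y d \<Longrightarrow> sig q (\<lambda>t. x t + y t) (c + d)"
  by (auto simp: sig_def intro: Lq_add)

lemma sig_cmult: "q \<ge> 1 \<Longrightarrow> sig q x c \<Longrightarrow> sig q (\<lambda>t. a * x t) (cmod a * c)"
  by (auto simp: sig_def intro: Lq_cmult)

lemma sig_mono: "sig q x c \<Longrightarrow> c \<le> d \<Longrightarrow> sig q x d"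
  by (auto simp: sig_def intro: Lq_mono)

lemma sig_zero: "q \<ge> 1 \<Longrightarrow> 0 \<le> c \<Longrightarrow> sig q (\<lambda>_. 0) c"
  by (auto simp: sig_def intro: Lq_zero)

lemma sig_sum:
  assumes "q \<ge> 1" "\<And>i. i \<in> I \<Longrightarrow> sig q (x i) (c i)"
  shows "sig q (\<lambda>t. \<Sum>i\<in>I. x i t) (\<Sum>i\<in>I. c i)"
  using assms by (auto simp: sig_def intro: Lq_sum)

lemma lap_sum:
  assumes "q \<ge> 1" "\<And>i. i \<in> I \<Longrightarrow> sig q (x i) (c i)" "z > 0"
  shows "lap (\<lambda>t. \<Sum>i\<in>I. x i t) z = (\<Sum>i\<in>I. lap (x i) z)"
  unfolding lap_def sum_distrib_left
  by (rule Bochner_Integration.integral_sum) (rule sig_lap_integrable[OF assms(2,1,3)])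

section \<open>Convolution with delay kernels\<close>

definition cv :: "'i measure \<Rightarrow> ('i \<Rightarrow> complex) \<Rightarrow> ('i \<Rightarrow> real) \<Rightarrow> (real \<Rightarrow> complex) \<Rightarrow> real \<Rightarrow> complex" where
  "cv M w \<tau> x t = (\<integral>i. w i * x (t - \<tau> i) \<partial>M)"

text \<open>One form for both parts of the equation: with M counting measure \<open>cv\<close> is a
  sum over point delays, with M Lebesgue measure it is a convolution integral. Bounds and transforms
  are thus proved once.\<close>

locale delay_kernel = sigma_finite_measure M for M :: "'i measure" +
  fixes w :: "'i \<Rightarrow> complex" and \<tau> :: "'i \<Rightarrow> real"
  assumes w: "integrable M w" and \<tau>[measurable]: "\<tau> \<in> borel_measurable M"
begin

lemma w_meas[measurable]: "w \<in> borel_measurable M" using w by auto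

sublocale P: pair_sigma_finite lborel M ..

lemma cv_meas: assumes [measurable]: "x \<in> borel_measurable borel" shows "cv M w \<tau> x \<in> borel_measurable borel"
proof -
  have "(\<lambda>t. \<integral>i. w i * x (t - \<tau> i) \<partial>M) \<in> borel_measurable lborel"
    by (rule borel_measurable_lebesgue_integral) measurable
  then show ?thesis by (simp add: cv_def[abs_def])
qed

text \<open>Young's inequality with an L1 kernel; the superposition is over translates of x.\<close>

lemma Lq_cv:
  assumes q: "q \<ge> 1" and x: "Lq q x c"
  shows "Lq q (cv M w \<tau> x) ((\<integral>i. cmod (w i) \<partial>M) * c)"
proof (rule Lq_minkowski[where M=M and w="\<lambda>i. cmod (w i)" and g="\<lambda>t i. x (t - \<tau> i)"])
  have [measurable]: "x \<in> borel_measurable borel" using x by (rule LqD)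
  show "(\<lambda>(t, i). x (t - \<tau> i)) \<in> borel_measurable (lborel \<Otimes>\<^sub>M M)" by measurable
  show "cv M w \<tau> x \<in> borel_measurable borel" by (rule cv_meas) measurable
  show "(\<integral>\<^sup>+ i. ennreal (cmod (w i)) \<partial>M) \<le> ennreal (\<integral>i. cmod (w i) \<partial>M)"
    using w by (subst nn_integral_eq_integral) auto
  show "AE t in lborel. ennreal (cmod (cv M w \<tau> x t)) \<le> (\<integral>\<^sup>+ i. ennreal (cmod (w i) * cmod (x (t - \<tau> i))) \<partial>M)"
  proof (rule AE_I2)
    fix t
    show "ennreal (cmod (cv M w \<tau> x t)) \<le> (\<integral>\<^sup>+ i. ennreal (cmod (w i) * cmod (x (t - \<tau> i))) \<partial>M)"
      unfolding cv_def
      \<comment> \<open>Where the integrand is not integrable, \<open>cv\<close> has the default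
        value 0 and the bound is trivial.\<close>
      by (cases "integrable M (\<lambda>i. w i * x (t - \<tau> i))")
        (auto simp: not_integrable_integral_eq norm_mult simp flip: norm_mult intro: integral_norm_bound_ennreal)
  qed
qed (use assms Lq_shift in \<open>auto intro: sigma_finite_measure_axioms dest: LqD\<close>)

text \<open>Additivity of \<open>cv\<close> in the signal is available where both integrals
  converge; the exceptional times form a null set.\<close>

lemma cv_AE_integrable:
  assumes q: "q \<ge> 1" and x: "Lq q x c"
  shows "AE t in lborel. integrable M (\<lambda>i. w i * x (t - \<tau> i))"
proof -
  have [measurable]: "x \<in> borel_measurable borel" using x by (rule LqD)
  have c: "0 \<le> c" using x by (rule LqD)
  show ?thesis
  proof (cases q)
    case (enat k)
    then have k: "k \<ge> 1" using q by (simp add: one_enat_def)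
    have "(\<integral>\<^sup>+t. (\<integral>\<^sup>+i. ennreal (cmod (w i) * cmod (x (t - \<tau> i)) ^ k) \<partial>M) \<partial>lborel)
        = (\<integral>\<^sup>+i. (\<integral>\<^sup>+t. ennreal (cmod (w i) * cmod (x (t - \<tau> i)) ^ k) \<partial>lborel) \<partial>M)"
      by (rule P.Fubini'[symmetric]) measurable
    also have "\<dots> = (\<integral>\<^sup>+i. ennreal (cmod (w i)) * (\<integral>\<^sup>+t. ennreal (cmod (x (t - \<tau> i)) ^ k) \<partial>lborel) \<partial>M)"
      by (intro nn_integral_cong, subst nn_integral_cmult[symmetric]) (auto simp: ennreal_mult)
    also have "\<dots> \<le> (\<integral>\<^sup>+i. ennreal (cmod (w i)) * ennreal (c ^ k) \<partial>M)"
      using Lq_shift[OF x] enat by (intro nn_integral_mono mult_left_mono) (auto simp: Lq_def)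
    also have "\<dots> < \<infinity>"
      using w by (subst nn_integral_multc) (auto simp: integrable_iff_bounded ennreal_mult_less_top)
    finally have "AE t in lborel. (\<integral>\<^sup>+i. ennreal (cmod (w i) * cmod (x (t - \<tau> i)) ^ k) \<partial>M) \<noteq> \<infinity>"
      by (intro nn_integral_PInf_AE) (auto simp: top_unique)
    then show ?thesis
    proof eventually_elim
      case (elim t)
      then have "integrable M (\<lambda>i. cmod (w i) * cmod (x (t - \<tau> i)) ^ k)"
        by (intro integrableI_bounded) (auto simp: less_top)
      then have "integrable M (\<lambda>i. cmod (w i) + cmod (w i) * cmod (x (t - \<tau> i)) ^ k)"
        using w by auto
      then show ?case
      proof (rule Bochner_Integration.integrable_bound)
        have "cmod (w i) * cmod (x (t - \<tau> i)) \<le> cmod (w i) * (1 + cmod (x (t - \<tau> i)) ^ k)" for i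
          using k by (intro mult_left_mono le_one_plus_power) auto
        then show "AE i in M. norm (w i * x (t - \<tau> i)) \<le> norm (cmod (w i) + cmod (w i) * cmod (x (t - \<tau> i)) ^ k)"
          by (auto simp: norm_mult distrib_left)
      qed measurable
    qed
  next
    case infinity
    then have *: "AE t in lborel. cmod (x (t - \<tau> i)) \<le> c" for i using Lq_shift[OF x] by (simp add: Lq_def)
    have "AE i in M. AE t in lborel. cmod (x (t - \<tau> i)) \<le> c" by (rule AE_I2) (rule *)
    then have "AE t in lborel. AE i in M. cmod (x (t - \<tau> i)) \<le> c"
      by (subst P.AE_commute) measurable
    then show ?thesis
    proof eventually_elim
      case (elim t)
      have "integrable M (\<lambda>i. w i * complex_of_real c)" using w by auto
      then show ?case
        by (rule Bochner_Integration.integrable_bound)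
          (use elim c in \<open>auto elim!: eventually_mono simp: norm_mult mult_left_mono\<close>)
    qed
  qed
qed

lemma sig_cv:
  assumes q: "q \<ge> 1" and x: "sig q x c" and \<tau>0: "\<And>i. i \<in> space M \<Longrightarrow> 0 \<le> \<tau> i"
  shows "sig q (cv M w \<tau> x) ((\<integral>i. cmod (w i) \<partial>M) * c)"
proof -
  have "cv M w \<tau> x t = 0" if "t < 0" for t
  proof -
    have "(\<integral>i. w i * x (t - \<tau> i) \<partial>M) = (\<integral>i. 0 \<partial>M)"
    proof (rule Bochner_Integration.integral_cong)
      fix i assume "i \<in> space M"
      with \<tau>0[of i] that have "t - \<tau> i < 0" by simp
      then show "w i * x (t - \<tau> i) = 0" using x by (simp add: sig_def)
    qed simp
    then show ?thesis by (simp add: cv_def)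
  qed
  then show ?thesis using Lq_cv[OF q] x by (auto simp: sig_def)
qed

text \<open>The convolution theorem, by Fubini. Nonnegative delays give exp(-z \<tau>) <= 1, so the
  kernel weighted by it stays integrable.\<close>

lemma lap_cv:
  assumes q: "q \<ge> 1" and x: "sig q x c" and \<tau>0: "\<And>i. i \<in> space M \<Longrightarrow> 0 \<le> \<tau> i" and z: "z > 0"
  shows "lap (cv M w \<tau> x) z = (\<integral>i. w i * complex_of_real (exp (- (z * \<tau> i))) \<partial>M) * lap x z"
proof -
  have [measurable]: "x \<in> borel_measurable borel" using x by (auto simp: sig_def dest: LqD)
  let ?f = "\<lambda>t i. complex_of_real (exp (- (z * t))) * (w i * x (t - \<tau> i))"
  have int_x: "integrable lborel (\<lambda>t. complex_of_real (exp (- (z * t))) * x t)"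
    by (rule sig_lap_integrable[OF x q z])
  have eq: "(\<integral>t. cmod (?f t i) \<partial>lborel) = cmod (w i) * exp (- (z * \<tau> i)) * (\<integral>t. cmod (complex_of_real (exp (- (z * t))) * x t) \<partial>lborel)"
    and int1: "integrable lborel (\<lambda>t. ?f t i)" for i
  proof -
    have "(\<integral>t. cmod (?f t i) \<partial>lborel) = (\<integral>t. cmod (?f (\<tau> i + 1 * t) i) \<partial>lborel)"
      by (subst lborel_integral_real_affine[where c=1 and t="\<tau> i"]) auto
    also have "\<dots> = (\<integral>t. (cmod (w i) * exp (- (z * \<tau> i))) * cmod (complex_of_real (exp (- (z * t))) * x t) \<partial>lborel)"
      by (intro Bochner_Integration.integral_cong) (auto simp: norm_mult distrib_left exp_diff exp_minus divide_inverse norm_inverse)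
    finally show "(\<integral>t. cmod (?f t i) \<partial>lborel) = cmod (w i) * exp (- (z * \<tau> i)) * (\<integral>t. cmod (complex_of_real (exp (- (z * t))) * x t) \<partial>lborel)"
      by simp
    have "integrable lborel (\<lambda>t. (w i * complex_of_real (exp (- (z * \<tau> i)))) * (complex_of_real (exp (- (z * t))) * x t))"
      using int_x by auto
    then have "integrable lborel (\<lambda>t. ?f (\<tau> i + 1 * t) i)"
      by (simp add: distrib_left exp_diff exp_minus divide_inverse mult_ac)
    then show "integrable lborel (\<lambda>t. ?f t i)"
      by (subst (asm) lborel_integrable_real_affine_iff) auto
  qed
  have we: "integrable M (\<lambda>i. w i * complex_of_real (exp (- (z * \<tau> i))))"
    using w by (rule Bochner_Integration.integrable_bound)
      (use \<tau>0 z in \<open>auto simp: norm_mult intro!: AE_I2 mult_left_le\<close>)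
  interpret Q: pair_sigma_finite M lborel ..
  have int: "integrable (M \<Otimes>\<^sub>M lborel) (\<lambda>(i, t). ?f t i)"
  proof (rule Q.Fubini_integrable)
    show "integrable M (\<lambda>i. \<integral>t. norm (case (i, t) of (i, t) \<Rightarrow> ?f t i) \<partial>lborel)"
      using integrable_norm[OF we] by (simp only: case_prod_conv eq) (intro integrable_mult_left, simp add: norm_mult)
    show "AE i in M. integrable lborel (\<lambda>t. case (i, t) of (i, t) \<Rightarrow> ?f t i)"
      using int1 by simp
  qed measurable
  have "lap (cv M w \<tau> x) z = (\<integral>t. \<integral>i. ?f t i \<partial>M \<partial>lborel)"
    by (simp add: lap_def cv_def flip: integral_mult_right_zero)
  also have "\<dots> = (\<integral>i. \<integral>t. ?f t i \<partial>lborel \<partial>M)"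
    using Q.Fubini_integral[OF int] by simp
  also have "\<dots> = (\<integral>i. w i * complex_of_real (exp (- (z * \<tau> i))) * lap x z \<partial>M)"
  proof (rule Bochner_Integration.integral_cong)
    fix i
    have "(\<integral>t. ?f t i \<partial>lborel) = w i * lap (\<lambda>t. x (t - \<tau> i)) z"
      by (simp add: lap_def mult.left_commute[of _ "w i"])
    then show "(\<integral>t. ?f t i \<partial>lborel) = w i * complex_of_real (exp (- (z * \<tau> i))) * lap x z"
      by (simp add: lap_shift)
  qed simp
  finally show ?thesis by simp
qed

end

section \<open>Uniqueness of the Laplace transform\<close>

lemma real_polynomial_exp_integral_zero:
  fixes \<phi> :: "real \<Rightarrow> real"
  assumes \<phi>: "integrable lborel \<phi>" "\<And>t. t < 0 \<Longrightarrow> \<phi> t = 0"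
    and z: "\<And>m::nat. (\<integral>t. exp (- (real m * t)) * \<phi> t \<partial>lborel) = 0"
    and g: "real_polynomial_function g"
  shows "(\<integral>t. g (exp (- t)) * \<phi> t \<partial>lborel) = 0"
proof -
  obtain a n where g: "g = (\<lambda>x. \<Sum>i\<le>n. a i * x ^ i)"
    using g by (auto simp: real_polynomial_function_iff_sum)
  have [measurable]: "\<phi> \<in> borel_measurable borel" using \<phi>(1) by auto
  have int: "integrable lborel (\<lambda>t. exp (- (real i * t)) * \<phi> t)" for i
  proof (rule Bochner_Integration.integrable_bound[OF \<phi>(1)])
    have "\<bar>exp (- (real i * t)) * \<phi> t\<bar> \<le> \<bar>\<phi> t\<bar>" for t
      by (cases "t < 0") (auto simp: \<phi>(2) abs_mult intro!: mult_left_le_one_le)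
    then show "AE t in lborel. norm (exp (- (real i * t)) * \<phi> t) \<le> norm (\<phi> t)" by simp
  qed measurable
  have "(\<integral>t. g (exp (- t)) * \<phi> t \<partial>lborel) = (\<integral>t. (\<Sum>i\<le>n. a i * (exp (- (real i * t)) * \<phi> t)) \<partial>lborel)"
    by (intro Bochner_Integration.integral_cong) (auto simp: g sum_distrib_right exp_of_nat_mult[symmetric] mult.assoc)
  also have "\<dots> = (\<Sum>i\<le>n. (\<integral>t. a i * (exp (- (real i * t)) * \<phi> t) \<partial>lborel))"
    by (rule Bochner_Integration.integral_sum) (use int in auto)
  also have "\<dots> = 0" by (simp add: z)
  finally show ?thesis .
qed

text \<open>The substitution u = exp(-t) maps t >= 0 into (0,1] and turns integer exponentials into
  monomials, so Weierstrass approximation on [0,1] extends the vanishing from polynomials to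
  continuous g.\<close>

lemma continuous_exp_integral_zero:
  fixes \<phi> :: "real \<Rightarrow> real"
  assumes \<phi>: "integrable lborel \<phi>" "\<And>t. t < 0 \<Longrightarrow> \<phi> t = 0"
    and z: "\<And>m::nat. (\<integral>t. exp (- (real m * t)) * \<phi> t \<partial>lborel) = 0"
    and g: "continuous_on UNIV g"
  shows "(\<integral>t. g (exp (- t)) * \<phi> t \<partial>lborel) = 0"
proof -
  have [measurable]: "\<phi> \<in> borel_measurable borel" using \<phi>(1) by auto
  have gm[measurable]: "g \<in> borel_measurable borel" using g by (rule borel_measurable_continuous_onI)
  define L where "L = (\<integral>t. \<bar>\<phi> t\<bar> \<partial>lborel)"
  have L: "0 \<le> L" by (simp add: L_def)
  have bd: "integrable lborel (\<lambda>t. h (exp (- t)) * \<phi> t)" "\<bar>\<integral>t. h (exp (- t)) * \<phi> t \<partial>lborel\<bar> \<le> e * L"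
    if h[measurable]: "h \<in> borel_measurable borel" and le: "\<And>u. u \<in> {0..1} \<Longrightarrow> \<bar>h u\<bar> \<le> e" for h :: "real \<Rightarrow> real" and e
  proof -
    have le': "\<bar>h (exp (- t)) * \<phi> t\<bar> \<le> e * \<bar>\<phi> t\<bar>" for t
    proof (cases "t < 0")
      case False
      then show ?thesis using le[of "exp (- t)"] by (auto simp: abs_mult intro: mult_right_mono)
    qed (simp add: \<phi>(2))
    have i: "integrable lborel (\<lambda>t. e * \<bar>\<phi> t\<bar>)" using \<phi>(1) by auto
    then show int: "integrable lborel (\<lambda>t. h (exp (- t)) * \<phi> t)"
      by (rule Bochner_Integration.integrable_bound) (use le' in \<open>auto intro!: AE_I2 intro: order_trans[OF _ abs_ge_self]\<close>)
    have "\<bar>\<integral>t. h (exp (- t)) * \<phi> t \<partial>lborel\<bar> \<le> (\<integral>t. \<bar>h (exp (- t)) * \<phi> t\<bar> \<partial>lborel)"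
      by (rule integral_abs_bound)
    also have "\<dots> \<le> (\<integral>t. e * \<bar>\<phi> t\<bar> \<partial>lborel)"
      using int i le' by (intro integral_mono) auto
    finally show "\<bar>\<integral>t. h (exp (- t)) * \<phi> t \<partial>lborel\<bar> \<le> e * L" by (simp add: L_def)
  qed
  obtain B where B: "\<And>u. u \<in> {0..1} \<Longrightarrow> \<bar>g u\<bar> \<le> B"
  proof -
    have "bounded (g ` {0..1})"
      by (intro compact_imp_bounded compact_continuous_image continuous_on_subset[OF g]) auto
    then obtain a where "\<forall>v\<in>g ` {0..1}. norm v \<le> a" unfolding bounded_iff by blast
    then show ?thesis by (intro that[of a]) auto
  qed
  have "\<bar>\<integral>t. g (exp (- t)) * \<phi> t \<partial>lborel\<bar> \<le> 0 + e" if e: "e > 0" for e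
  proof -
    have "0 < e / (L + 1)" using e L by simp
    then obtain p where p: "real_polynomial_function p" "\<And>u. u \<in> {0..1} \<Longrightarrow> \<bar>g u - p u\<bar> < e / (L + 1)"
      using Stone_Weierstrass_real_polynomial_function[of "{0..1::real}" g "e / (L+1)"] continuous_on_subset[OF g]
      by auto
    have pc: "continuous_on UNIV p" by (rule continuous_on_polymonial_function) (use p(1) in \<open>simp flip: real_polynomial_function_eq\<close>)
    have [measurable]: "p \<in> borel_measurable borel" by (rule borel_measurable_continuous_onI[OF pc])
    have ig: "integrable lborel (\<lambda>t. g (exp (- t)) * \<phi> t)" by (rule bd(1)[OF gm B])
    have id: "integrable lborel (\<lambda>t. (g (exp (- t)) - p (exp (- t))) * \<phi> t)"
      by (rule bd(1)[of "\<lambda>u. g u - p u" "e / (L+1)"]) (use p(2) in \<open>auto simp: less_imp_le\<close>)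
    have "integrable lborel (\<lambda>t. g (exp (- t)) * \<phi> t - (g (exp (- t)) - p (exp (- t))) * \<phi> t)"
      by (rule Bochner_Integration.integrable_diff[OF ig id])
    then have ip: "integrable lborel (\<lambda>t. p (exp (- t)) * \<phi> t)" by (simp add: algebra_simps)
    have "(\<integral>t. (g (exp (- t)) - p (exp (- t))) * \<phi> t \<partial>lborel) = (\<integral>t. g (exp (- t)) * \<phi> t \<partial>lborel) - (\<integral>t. p (exp (- t)) * \<phi> t \<partial>lborel)"
      unfolding left_diff_distrib by (rule Bochner_Integration.integral_diff[OF ig ip])
    also have "\<dots> = (\<integral>t. g (exp (- t)) * \<phi> t \<partial>lborel)"
      by (simp add: real_polynomial_exp_integral_zero[OF \<phi> z p(1)])
    finally have eq: "(\<integral>t. g (exp (- t)) * \<phi> t \<partial>lborel) = (\<integral>t. (g (exp (- t)) - p (exp (- t))) * \<phi> t \<partial>lborel)" ..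
    have "\<bar>\<integral>t. (g (exp (- t)) - p (exp (- t))) * \<phi> t \<partial>lborel\<bar> \<le> e / (L + 1) * L"
      by (rule bd(2)[of "\<lambda>u. g u - p u" "e / (L+1)"]) (use p(2) in \<open>auto simp: less_imp_le\<close>)
    also have "\<dots> \<le> e" using e L by (simp add: field_simps)
    finally show ?thesis by (simp add: eq)
  qed
  then have "\<bar>\<integral>t. g (exp (- t)) * \<phi> t \<partial>lborel\<bar> \<le> 0" by (rule field_le_epsilon)
  then show ?thesis by simp
qed

lemma greaterThanLessThan_integral_zero:
  fixes \<phi> :: "real \<Rightarrow> real"
  assumes \<phi>: "integrable lborel \<phi>" "\<And>t. t < 0 \<Longrightarrow> \<phi> t = 0"
    and z: "\<And>m::nat. (\<integral>t. exp (- (real m * t)) * \<phi> t \<partial>lborel) = 0"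
  shows "(\<integral>t. indicator {a<..<b} t * \<phi> t \<partial>lborel) = 0"
proof -
  have [measurable]: "\<phi> \<in> borel_measurable borel" using \<phi>(1) by auto
  \<comment> \<open>Trapezoids in u = exp(-t) that increase to the indicator of the open interval; a
    < t < b means exp(-b) < u < exp(-a).\<close>
  define g where "g n u = min 1 (real n * max 0 (min (u - exp (- b)) (exp (- a) - u)))" for n u
  have lim: "(\<lambda>n. \<integral>t. g n (exp (- t)) * \<phi> t \<partial>lborel) \<longlonglongrightarrow> (\<integral>t. indicator {a<..<b} t * \<phi> t \<partial>lborel)"
  proof (rule integral_dominated_convergence[where w="\<lambda>t. \<bar>\<phi> t\<bar>"])
    show "AE t in lborel. (\<lambda>n. g n (exp (- t)) * \<phi> t) \<longlonglongrightarrow> indicator {a<..<b} t * \<phi> t"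
    proof (intro AE_I2 tendsto_mult tendsto_const)
      fix t
      let ?m = "min (exp (- t) - exp (- b)) (exp (- a) - exp (- t))"
      show "(\<lambda>n. g n (exp (- t))) \<longlonglongrightarrow> indicator {a<..<b} t"
      proof (cases "t \<in> {a<..<b}")
        case True
        then have m: "0 < ?m" by simp
        have "\<forall>\<^sub>F n in sequentially. g n (exp (- t)) = 1"
        proof (rule eventually_mono[OF eventually_ge_at_top[of "nat \<lceil>1 / ?m\<rceil>"]])
          fix n assume "nat \<lceil>1 / ?m\<rceil> \<le> n"
          then have "1 / ?m \<le> real n" by linarith
          then have "1 \<le> real n * ?m" using m by (simp only: pos_divide_le_eq)
          then show "g n (exp (- t)) = 1" using m unfolding g_def by (simp only: max.absorb2[OF less_imp_le[OF m]] min.absorb1)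
        qed
        then show ?thesis using True by (auto intro: tendsto_eventually)
      next
        case False
        then have "?m \<le> 0" by (auto simp: min_le_iff_disj)
        then have "g n (exp (- t)) = 0" for n unfolding g_def by (simp only: max.absorb1 mult_zero_right min.absorb2 zero_le_one)
        then show ?thesis using False by simp
      qed
    qed
    show "AE t in lborel. norm (g n (exp (- t)) * \<phi> t) \<le> \<bar>\<phi> t\<bar>" for n
    proof (rule AE_I2)
      fix t
      have "0 \<le> g n u" "g n u \<le> 1" for u by (auto simp: g_def)
      then show "norm (g n (exp (- t)) * \<phi> t) \<le> \<bar>\<phi> t\<bar>" by (simp add: abs_mult mult_left_le_one_le)
    qed
    show "(\<lambda>t. g n (exp (- t)) * \<phi> t) \<in> borel_measurable lborel" for n
      unfolding g_def by measurable
  qed (use \<phi>(1) in auto)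
  have "(\<integral>t. g n (exp (- t)) * \<phi> t \<partial>lborel) = 0" for n
    by (rule continuous_exp_integral_zero[OF \<phi> z]) (auto simp: g_def intro!: continuous_intros)
  with lim show ?thesis by (simp add: LIMSEQ_const_iff)
qed

text \<open>The positive and negative parts of \<phi>, taken as densities, give measures that agree
  on all open intervals, an intersection-stable generator of the Borel sets.\<close>

lemma real_lerch:
  fixes \<phi> :: "real \<Rightarrow> real"
  assumes \<phi>: "integrable lborel \<phi>" "\<And>t. t < 0 \<Longrightarrow> \<phi> t = 0"
    and z: "\<And>m::nat. (\<integral>t. exp (- (real m * t)) * \<phi> t \<partial>lborel) = 0"
  shows "AE t in lborel. \<phi> t = 0"
proof -
  have [measurable]: "\<phi> \<in> borel_measurable borel" using \<phi>(1) by auto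
  let ?p = "density lborel (\<lambda>t. ennreal (\<phi> t))" and ?m = "density lborel (\<lambda>t. ennreal (- \<phi> t))"
  have fin: "(\<integral>\<^sup>+t. ennreal \<bar>\<phi> t\<bar> \<partial>lborel) < \<infinity>" using \<phi>(1) by (simp add: integrable_iff_bounded)
  have em: "emeasure ?p {a<..<b} = emeasure ?m {a<..<b}" "emeasure ?p {a<..<b} \<noteq> \<infinity>" for a b
  proof -
    have i: "integrable lborel (\<lambda>t. indicator {a<..<b} t * \<phi> t)"
      using integrable_mult_indicator[OF _ \<phi>(1), of "{a<..<b}"] by simp
    have e1: "emeasure ?p {a<..<b} = (\<integral>\<^sup>+t. ennreal (indicator {a<..<b} t * \<phi> t) \<partial>lborel)"
      by (subst emeasure_density) (auto intro!: nn_integral_cong simp: indicator_def)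
    have e2: "emeasure ?m {a<..<b} = (\<integral>\<^sup>+t. ennreal (- (indicator {a<..<b} t * \<phi> t)) \<partial>lborel)"
      by (subst emeasure_density) (auto intro!: nn_integral_cong simp: indicator_def)
    have f1: "emeasure ?p {a<..<b} < \<infinity>" unfolding e1
      by (rule order.strict_trans1[OF nn_integral_mono fin]) (auto simp: indicator_def ennreal_leI)
    have f2: "emeasure ?m {a<..<b} < \<infinity>" unfolding e2
      by (rule order.strict_trans1[OF nn_integral_mono fin]) (auto simp: indicator_def ennreal_leI)
    show "emeasure ?p {a<..<b} \<noteq> \<infinity>" using f1 by simp
    have "enn2real (emeasure ?p {a<..<b}) = enn2real (emeasure ?m {a<..<b})"
      using greaterThanLessThan_integral_zero[OF \<phi> z, of a b] unfolding real_lebesgue_integral_def[OF i] e1 e2 by simp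
    then show "emeasure ?p {a<..<b} = emeasure ?m {a<..<b}" using f1 f2
      by (metis ennreal_enn2real infinity_ennreal_def)
  qed
  have "?p = ?m"
  proof (rule measure_eqI_generator_eq[where E="range (\<lambda>(a, b). {a<..<b})" and \<Omega>=UNIV and A="\<lambda>n::nat. {- real n<..<real n}"])
    show "Int_stable (range (\<lambda>(a, b). {a<..<b::real}))"
      by (auto simp: Int_stable_def intro!: image_eqI[where x="(max _ _, min _ _)"])
    show "sets ?p = sigma_sets UNIV (range (\<lambda>(a, b). {a<..<b::real}))"
      by (simp add: borel_eq_box case_prod_beta')
    show "sets ?m = sigma_sets UNIV (range (\<lambda>(a, b). {a<..<b::real}))"
      by (simp add: borel_eq_box case_prod_beta')
    show "(\<Union>i. {- real i<..<real i}) = (UNIV :: real set)"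
    proof -
      have "\<exists>i. - real i < x \<and> x < real i" for x
        using reals_Archimedean2[of "\<bar>x\<bar>"] by (metis abs_less_iff minus_less_iff)
      then show ?thesis by auto
    qed
  qed (use em in auto)
  then have "AE t in lborel. ennreal (\<phi> t) = ennreal (- \<phi> t)"
    by (intro sigma_finite_measure.density_unique[OF sigma_finite_lborel]) auto
  then show ?thesis
  proof eventually_elim
    case (elim t)
    then show ?case by (cases "0 \<le> \<phi> t") (auto simp: ennreal_neg ennreal_eq_0_iff)
  qed
qed

text \<open>The factor exp(-R t) brings both signals into L1, and the points R + m suffice for
  \<open>real_lerch\<close>. Only large real arguments enter, which is why multipliers are later
  specified through transforms along \<open>at_top\<close>.\<close>

lemma lap_inject:
  assumes x: "sig q x c" and y: "sig q y d" and q: "q \<ge> 1"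
    and eq: "\<forall>\<^sub>F z in at_top. lap x z = lap y z"
  shows "AE t in lborel. x t = y t"
proof -
  have [measurable]: "x \<in> borel_measurable borel" "y \<in> borel_measurable borel"
    using x y by (auto simp: sig_def dest: LqD)
  obtain R0 where R0: "\<And>z. z \<ge> R0 \<Longrightarrow> lap x z = lap y z" using eq by (auto simp: eventually_at_top_linorder)
  define R where "R = max R0 1"
  have R: "R > 0" "\<And>z. z \<ge> R \<Longrightarrow> lap x z = lap y z" using R0 by (auto simp: R_def)
  define u where "u t = complex_of_real (exp (- (R * t))) * x t - complex_of_real (exp (- (R * t))) * y t" for t
  have iu: "integrable lborel u" unfolding u_def
    by (intro Bochner_Integration.integrable_diff sig_lap_integrable[OF x] sig_lap_integrable[OF y] q R)
  have u0: "u t = 0" if "t < 0" for t using x y that by (auto simp: u_def sig_def)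
  have int: "(\<integral>t. complex_of_real (exp (- (real m * t))) * u t \<partial>lborel) = 0"
    and ii: "integrable lborel (\<lambda>t. complex_of_real (exp (- (real m * t))) * u t)" for m
  proof -
    let ?z = "R + real m"
    have z: "?z > 0" "lap x ?z = lap y ?z" using R by auto
    have e: "complex_of_real (exp (- (real m * t))) * u t = complex_of_real (exp (- (?z * t))) * x t - complex_of_real (exp (- (?z * t))) * y t" for t
    proof -
      have "exp (- (?z * t)) = exp (- (real m * t)) * exp (- (R * t))"
        by (simp add: mult_exp_exp algebra_simps)
      then show ?thesis by (simp only: u_def of_real_mult right_diff_distrib mult.assoc)
    qed
    show "(\<integral>t. complex_of_real (exp (- (real m * t))) * u t \<partial>lborel) = 0"
      unfolding e using z
      by (subst Bochner_Integration.integral_diff[OF sig_lap_integrable[OF x q z(1)] sig_lap_integrable[OF y q z(1)]]) (simp add: lap_def)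
    show "integrable lborel (\<lambda>t. complex_of_real (exp (- (real m * t))) * u t)"
      unfolding e by (intro Bochner_Integration.integrable_diff sig_lap_integrable[OF x q z(1)] sig_lap_integrable[OF y q z(1)])
  qed
  have "AE t in lborel. Re (u t) = 0"
  proof (rule real_lerch)
    show "(\<integral>t. exp (- (real m * t)) * Re (u t) \<partial>lborel) = 0" for m
      using integral_Re[OF ii[of m]] int[of m] by simp
  qed (use iu u0 in auto)
  moreover have "AE t in lborel. Im (u t) = 0"
  proof (rule real_lerch)
    show "(\<integral>t. exp (- (real m * t)) * Im (u t) \<partial>lborel) = 0" for m
      using integral_Im[OF ii[of m]] int[of m] by simp
  qed (use iu u0 in auto)
  ultimately show ?thesis
  proof eventually_elim
    case (elim t)
    then have "u t = 0" by (simp add: complex_eq_iff)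
    then show ?case by (simp add: u_def)
  qed
qed

section \<open>Complete normed algebras\<close>

text \<open>A submultiplicative seminorm on functions, presented by its upper bounds:
  \<open>bnd r C\<close> reads as norm of r at most C. The instances are the multiplier norm, sup
  norms, weighted l1 norms of Dirichlet polynomials and a quotient by an ideal. Bounds suit the last
  one, whose norm would be an infimum over representatives.\<close>

locale nrm =
  fixes bnd :: "('z \<Rightarrow> complex) \<Rightarrow> real \<Rightarrow> bool"
  assumes const: "bnd (\<lambda>_. a) (cmod a)"
    and add: "bnd r C \<Longrightarrow> bnd s D \<Longrightarrow> bnd (\<lambda>z. r z + s z) (C + D)"
    and mult: "bnd r C \<Longrightarrow> bnd s D \<Longrightarrow> bnd (\<lambda>z. r z * s z) (C * D)"
    and mono: "bnd r C \<Longrightarrow> C \<le> D \<Longrightarrow> bnd r D"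
    and nonneg: "bnd r C \<Longrightarrow> 0 \<le> C"
begin

lemma one: "bnd (\<lambda>_. 1) 1" using const[of 1] by simp

lemma zero: "0 \<le> C \<Longrightarrow> bnd (\<lambda>_. 0) C" using const[of 0] mono by simp

lemma cmult: "bnd r C \<Longrightarrow> bnd (\<lambda>z. a * r z) (cmod a * C)"
  by (rule mult[OF const])

lemma uminus: "bnd r C \<Longrightarrow> bnd (\<lambda>z. - r z) C"
  using cmult[of r C "- 1"] by simp

lemma diff: "bnd r C \<Longrightarrow> bnd s D \<Longrightarrow> bnd (\<lambda>z. r z - s z) (C + D)"
  using add[OF _ uminus, of r C s D] by simp

lemma power: "bnd r C \<Longrightarrow> bnd (\<lambda>z. r z ^ n) (C ^ n)"
  by (induction n) (auto intro: one mult)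

lemma sum: "(\<And>i. i \<in> I \<Longrightarrow> bnd (r i) (C i)) \<Longrightarrow> bnd (\<lambda>z. \<Sum>i\<in>I. r i z) (\<Sum>i\<in>I. C i)"
proof (induction I rule: infinite_finite_induct)
  case (insert i I)
  then have "bnd (\<lambda>z. r i z + (\<Sum>i\<in>I. r i z)) (C i + (\<Sum>i\<in>I. C i))" by (intro add) auto
  with insert show ?case by simp
qed (auto intro: zero)

lemma prod: "(\<And>i. i \<in> I \<Longrightarrow> bnd (r i) (C i)) \<Longrightarrow> bnd (\<lambda>z. \<Prod>i\<in>I. r i z) (\<Prod>i\<in>I. C i)"
proof (induction I rule: infinite_finite_induct)
  case (insert i I)
  then have "bnd (\<lambda>z. r i z * (\<Prod>i\<in>I. r i z)) (C i * (\<Prod>i\<in>I. C i))" by (intro mult) auto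
  with insert show ?case by simp
qed (auto intro: one)

end

text \<open>Iterating X -> a + X/2 from any finite bound approaches the fixed point 2a. A finite but
  uncontrolled bound thereby becomes an explicit one; this is how half of an unknown norm is
  absorbed.\<close>

lemma contraction_le:
  fixes P :: "real \<Rightarrow> bool"
  assumes step: "\<And>X. P X \<Longrightarrow> P (a + X / 2)" and mono: "\<And>X Y. P X \<Longrightarrow> X \<le> Y \<Longrightarrow> P Y"
    and P: "P X" and e: "e > 0"
  shows "P (2 * a + e)"
proof -
  have *: "P (2 * a + (X - 2 * a) / 2 ^ n)" for n
  proof (induction n)
    case (Suc n)
    from step[OF this] show ?case by (simp add: field_simps)
  qed (simp add: P)
  obtain n where n: "\<bar>X - 2 * a\<bar> / e < 2 ^ n"
    using real_arch_pow[of 2] by auto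
  have "(X - 2 * a) / 2 ^ n \<le> e"
    using n e by (simp add: field_simps abs_if split: if_splits)
  then show ?thesis using mono[OF *[of n]] by simp
qed

lemma sum_roots_of_unity:
  assumes "n \<ge> 1"
  defines "\<omega> \<equiv> exp (2 * of_real pi * \<i> / of_nat n)"
  shows "(\<Sum>j<n. (\<omega> ^ j) ^ k) = (if n dvd k then of_nat n else 0)"
proof -
  have eq: "\<omega> ^ m = exp (2 * of_real pi * \<i> * of_nat m / of_nat n)" for m
    unfolding \<omega>_def by (simp add: exp_of_nat_mult[symmetric] mult_ac)
  have "(\<Sum>j<n. (\<omega> ^ j) ^ k) = (\<Sum>j<n. (\<omega> ^ k) ^ j)"
    by (simp add: power_mult[symmetric] mult.commute)
  also have "\<dots> = (if n dvd k then of_nat n else 0)"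
  proof (cases "n dvd k")
    case True
    then have "\<omega> ^ k = 1" using complex_root_unity_eq_1[OF assms(1), of k] eq by simp
    then show ?thesis using True by simp
  next
    case False
    then have "\<omega> ^ k \<noteq> 1" using complex_root_unity_eq_1[OF assms(1), of k] eq by simp
    moreover have "(\<omega> ^ k) ^ n = 1"
    proof -
      have "\<omega> ^ n = 1" using assms(1) unfolding \<omega>_def by (simp flip: exp_of_nat_mult)
      then show ?thesis by (simp add: power_mult[symmetric] mult.commute[of k]) (simp add: power_mult)
    qed
    ultimately show ?thesis using False by (simp add: geometric_sum)
  qed
  finally show ?thesis .
qed

section \<open>Approximate resolvents and the Gelfand-Mazur theorem\<close>

context nrm
begin

text \<open>Stand-in for: x - l has an inverse of norm at most M. The bound M must not depend on the
  accuracy e, since accuracies are chosen after constants built from M.\<close>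

definition reg :: "('z \<Rightarrow> complex) \<Rightarrow> complex \<Rightarrow> real \<Rightarrow> bool" where
  "reg x l M \<longleftrightarrow> (\<forall>e>0. \<exists>y. bnd y M \<and> bnd (\<lambda>z. 1 - y z * (x z - l)) e)"

lemma reg_mono: "reg x l M \<Longrightarrow> M \<le> N \<Longrightarrow> reg x l N"
  unfolding reg_def using mono by blast

text \<open>Neumann series: b times a partial geometric sum in u = 1 - b (x - m) inverts x - m up to
  u^k. The radius \<eta> lets m move so little that u stays bounded by \<kappa> = (1 + \<delta>) /
  2, and all these inverses share the bound B / (1 - \<kappa>).\<close>

lemma reg_local:
  assumes b: "bnd b B" and bd: "bnd (\<lambda>z. 1 - b z * (x z - l)) \<delta>" and \<delta>: "\<delta> < 1"
  shows "\<exists>\<eta>>0. \<exists>M. \<forall>m. cmod (m - l) < \<eta> \<longrightarrow> reg x m M"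
proof -
  have B: "0 \<le> B" and \<delta>0: "0 \<le> \<delta>" using b bd by (auto intro: nonneg)
  define \<eta> where "\<eta> = (1 - \<delta>) / (2 * (B + 1))"
  define \<kappa> where "\<kappa> = (1 + \<delta>) / 2"
  have \<kappa>: "0 \<le> \<kappa>" "\<kappa> < 1" using \<delta> \<delta>0 by (auto simp: \<kappa>_def)
  have \<eta>: "\<eta> > 0" using \<delta> B by (simp add: \<eta>_def)
  have "reg x m (B / (1 - \<kappa>))" if m: "cmod (m - l) < \<eta>" for m
    unfolding reg_def
  proof (intro allI impI)
    fix e :: real assume e: "e > 0"
    let ?u = "\<lambda>z. 1 - b z * (x z - m)"
    have "bnd (\<lambda>z. (1 - b z * (x z - l)) + (m - l) * b z) (\<delta> + cmod (m - l) * B)"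
      by (intro add bd cmult b)
    moreover have "\<delta> + cmod (m - l) * B \<le> \<kappa>"
    proof -
      have "cmod (m - l) * B \<le> \<eta> * (B + 1)" using m B \<eta> by (intro mult_mono) auto
      also have "\<dots> = (1 - \<delta>) / 2" using B by (simp add: \<eta>_def field_simps)
      finally show ?thesis by (simp add: \<kappa>_def field_simps)
    qed
    ultimately have u: "bnd ?u \<kappa>" by (auto simp: algebra_simps dest: mono)
    obtain k where k: "\<kappa> ^ k < e" using real_arch_pow_inv[OF e \<kappa>(2)] by auto
    have "bnd (\<lambda>z. \<Sum>i<k. ?u z ^ i) (\<Sum>i<k. \<kappa> ^ i)" by (intro sum power u)
    moreover have "(\<Sum>i<k. \<kappa> ^ i) \<le> 1 / (1 - \<kappa>)"
      using \<kappa> by (simp add: sum_gp_strict divide_right_mono)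
    ultimately have y: "bnd (\<lambda>z. b z * (\<Sum>i<k. ?u z ^ i)) (B * (1 / (1 - \<kappa>)))"
      by (intro mult b) (rule mono)
    have "1 - b z * (\<Sum>i<k. ?u z ^ i) * (x z - m) = ?u z ^ k" for z
      using one_diff_power_eq[of "?u z" k] by (simp add: algebra_simps)
    then have "bnd (\<lambda>z. 1 - b z * (\<Sum>i<k. ?u z ^ i) * (x z - m)) e"
      using mono[OF power[OF u, of k], of e] k by simp
    with y show "\<exists>y. bnd y (B / (1 - \<kappa>)) \<and> bnd (\<lambda>z. 1 - y z * (x z - m)) e"
      by (intro exI[of _ "\<lambda>z. b z * (\<Sum>i<k. ?u z ^ i)"]) simp
  qed
  then show ?thesis using \<eta> by blast
qed

lemma reg_compact:
  assumes loc: "\<And>l. \<exists>b B \<delta>. bnd b B \<and> bnd (\<lambda>z. 1 - b z * (x z - l)) \<delta> \<and> \<delta> < 1"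
  shows "\<exists>M\<ge>1. \<forall>l. cmod l \<le> R \<longrightarrow> reg x l M"
proof -
  have "\<exists>\<eta>>0. \<exists>M. \<forall>m. cmod (m - l) < \<eta> \<longrightarrow> reg x m M" for l
    using loc[of l] reg_local by blast
  then obtain \<eta> M where *: "\<And>l. \<eta> l > 0" "\<And>l m. cmod (m - l) < \<eta> l \<Longrightarrow> reg x m (M l)"
    by metis
  have cov: "cball 0 R \<subseteq> (\<Union>l\<in>UNIV. ball l (\<eta> l))"
    using *(1) centre_in_ball by blast
  obtain F where F: "finite F" "cball 0 R \<subseteq> (\<Union>l\<in>F. ball l (\<eta> l))"
    by (rule compactE_image[OF compact_cball _ cov]) auto
  have "reg x l (Max (insert 1 (M ` F)))" if "cmod l \<le> R" for l
  proof -
    from that have "l \<in> cball 0 R" by simp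
    then obtain m where m: "m \<in> F" "l \<in> ball m (\<eta> m)" using F by blast
    then have "reg x l (M m)" by (intro *(2)) (auto simp: dist_norm norm_minus_commute)
    then show ?thesis by (rule reg_mono) (use F m in auto)
  qed
  moreover have "Max (insert 1 (M ` F)) \<ge> 1" using F by simp
  ultimately show ?thesis by blast
qed

text \<open>The average of resolvents over the n-th roots of \<open>s ^ n\<close> is the resolvent of \<open>x ^ n\<close>:
  \<open>(1 / n) \<Sum>\<^sub>j (1 - x / (s \<omega> ^ j))\<^sup>- \<^sup>1 = (1 - x ^ n / s ^ n)\<^sup>- \<^sup>1\<close>.\<close>

lemma roots_average:
  assumes n: "n \<ge> 1" and s: "s > 0" and x: "bnd x K"
    and y: "\<And>j. j < n \<Longrightarrow> bnd (\<lambda>z. 1 - y j z * (x z - s * \<omega> ^ j)) e"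
    and \<omega>: "\<omega> = exp (2 * of_real pi * \<i> / of_nat n)"
  shows "bnd (\<lambda>z. 1 - (- (\<Sum>j<n. complex_of_real s * \<omega> ^ j * y j z) / of_nat n) * (1 - x z ^ n / complex_of_real s ^ n))
     (s * (\<Sum>i<n. s ^ (n - Suc i) * K ^ i) / s ^ n * e)"
proof -
  let ?l = "\<lambda>j. complex_of_real s * \<omega> ^ j"
  \<comment> \<open>The quotient of x^n - s^n by x - s \<omega>^j. Multiplication by it turns the
    error e of each resolvent into one whose size depends on n, which is harmless because e is
    chosen after n.\<close>
  let ?T = "\<lambda>j z. \<Sum>i<n. ?l j ^ (n - Suc i) * x z ^ i"
  have w1: "cmod \<omega> = 1" unfolding \<omega> by (simp add: norm_exp_eq_Re)
  have wn: "(\<omega> ^ j) ^ n = 1" for j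
  proof -
    have "\<omega> ^ n = 1" using n unfolding \<omega> by (simp flip: exp_of_nat_mult)
    then show ?thesis by (simp add: power_mult[symmetric] mult.commute[of j]) (simp add: power_mult)
  qed
  have T: "?T j z * (x z - ?l j) = x z ^ n - s ^ n" for j z
    using power_diff_sumr2[of "x z" n "?l j"] wn[of j] by (simp add: power_mult_distrib mult.commute)
  have avg: "(\<Sum>j<n. ?l j * ?T j z) = of_nat n * s ^ n" for z
  proof -
    have "(\<Sum>j<n. ?l j * ?T j z) = (\<Sum>j<n. \<Sum>i<n. s ^ (n - i) * x z ^ i * (\<omega> ^ j) ^ (n - i))"
    proof (intro sum.cong refl, subst sum_distrib_left, intro sum.cong refl)
      fix j i assume "i \<in> {..<n}"
      then have "?l j * ?l j ^ (n - Suc i) = ?l j ^ (n - i)"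
        by (simp add: Suc_diff_Suc flip: power_Suc)
      then show "?l j * (?l j ^ (n - Suc i) * x z ^ i) = s ^ (n - i) * x z ^ i * (\<omega> ^ j) ^ (n - i)"
        by (simp add: power_mult_distrib flip: mult.assoc)
    qed
    also have "\<dots> = (\<Sum>i<n. s ^ (n - i) * x z ^ i * (\<Sum>j<n. (\<omega> ^ j) ^ (n - i)))"
      by (subst sum.swap) (simp add: sum_distrib_left)
    also have "\<dots> = (\<Sum>i<n. if i = 0 then complex_of_real s ^ n * of_nat n else 0)"
    proof (intro sum.cong refl)
      fix i assume i: "i \<in> {..<n}"
      then have "n dvd (n - i) \<longleftrightarrow> i = 0" by (auto dest: dvd_imp_le)
      then show "s ^ (n - i) * x z ^ i * (\<Sum>j<n. (\<omega> ^ j) ^ (n - i)) = (if i = 0 then complex_of_real s ^ n * of_nat n else 0)"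
        using sum_roots_of_unity[OF n, of "n - i"] unfolding \<omega>[symmetric] by simp
    qed
    also have "\<dots> = of_nat n * s ^ n" using n by (subst sum.delta) auto
    finally show ?thesis .
  qed
  have h: "(\<Sum>j<n. ?l j * ?T j z * (1 - y j z * (x z - ?l j)))
      = (\<Sum>j<n. ?l j * ?T j z) - (\<Sum>j<n. ?l j * y j z) * (x z ^ n - s ^ n)" for z
    unfolding sum_distrib_right sum_subtractf[symmetric]
  proof (intro sum.cong refl)
    fix j
    have "?l j * t * (1 - y j z * (x z - ?l j)) = ?l j * t - ?l j * y j z * (t * (x z - ?l j))" for t
      by (simp add: algebra_simps)
    then show "?l j * ?T j z * (1 - y j z * (x z - ?l j)) = ?l j * ?T j z - ?l j * y j z * (x z ^ n - s ^ n)"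
      by (simp only: T)
  qed
  have eq: "1 - (- (\<Sum>j<n. ?l j * y j z) / of_nat n) * (1 - x z ^ n / complex_of_real s ^ n)
     = (1 / (of_nat n * complex_of_real s ^ n)) * (\<Sum>j<n. ?l j * ?T j z * (1 - y j z * (x z - ?l j)))" for z
    unfolding h avg using n s by (simp add: field_simps)
  let ?t = "\<Sum>i<n. s ^ (n - Suc i) * K ^ i"
  have "bnd (\<lambda>z. ?T j z) ?t" if "j < n" for j
  proof (intro sum mult[OF _ power[OF x]])
    show "bnd (\<lambda>z. ?l j ^ (n - Suc i)) (s ^ (n - Suc i))" for i
      using const[of "?l j ^ (n - Suc i)"] s w1 by (simp add: norm_power norm_mult power_mult_distrib)
  qed
  then have "bnd (\<lambda>z. ?l j * ?T j z * (1 - y j z * (x z - ?l j))) (s * ?t * e)" if "j < n" for j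
  proof (intro mult[OF mult y])
    show "bnd (\<lambda>z. ?l j) s" using const[of "?l j"] s w1 by (simp add: norm_mult norm_power)
  qed (use that in auto)
  then have "bnd (\<lambda>z. \<Sum>j<n. ?l j * ?T j z * (1 - y j z * (x z - ?l j))) (\<Sum>j<n. s * ?t * e)"
    by (intro sum) auto
  from cmult[OF this, of "1 / (of_nat n * complex_of_real s ^ n)"]
  have "bnd (\<lambda>z. (1 / (of_nat n * complex_of_real s ^ n)) * (\<Sum>j<n. ?l j * ?T j z * (1 - y j z * (x z - ?l j))))
    (s * ?t / s ^ n * e)"
    using n s by (simp add: norm_divide norm_mult norm_power)
  then show ?thesis using eq by presburger
qed

text \<open>If every x - l is invertible up to an error below 1, the algebra is trivial: 1 has
  arbitrarily small bounds. Modulo an ideal this says that 1 lies in its closure. Only the spectral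
  radius r of x enters. If r = 0, some power of x is too small for an invertible x. If r > 0,
  resolvent averages on a circle of radius s > r are near 1, Lipschitz continuity of the resolvent
  carries this to radius r, and then x^n is so small that r is not the infimum.\<close>

theorem gelfand_mazur:
  assumes x: "bnd x K"
    and loc: "\<And>l. \<exists>b B \<delta>. bnd b B \<and> bnd (\<lambda>z. 1 - b z * (x z - l)) \<delta> \<and> \<delta> < 1"
    and \<epsilon>: "\<epsilon> > 0"
  shows "bnd (\<lambda>_. 1) \<epsilon>"
proof -
  have K: "0 \<le> K" by (rule nonneg[OF x])
  define S where "S = {s. 0 \<le> s \<and> (\<exists>n\<ge>1. bnd (\<lambda>z. x z ^ n) (s ^ n))}"
  have KS: "K \<in> S" using K power[OF x, of 1] unfolding S_def by (intro CollectI conjI exI[of _ 1]) auto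
  have bdd: "bdd_below S" by (auto simp: S_def)
  define r where "r = Inf S"
  have r0: "0 \<le> r" unfolding r_def using KS by (intro cInf_greatest) (auto simp: S_def)
  have above: "\<exists>s'\<in>S. s' < s" if "r < s" for s
    using that KS cInf_lessD[of S s] by (auto simp: r_def)
  have below: "r \<le> s" if "s \<in> S" for s unfolding r_def using that bdd by (rule cInf_lower)
  obtain M where M: "M \<ge> 1" "\<And>l. cmod l \<le> r + 1 \<Longrightarrow> reg x l M"
    using reg_compact[OF loc, of "r + 1"] by auto
  show ?thesis
  proof (cases "r = 0")
    case True
    have "1 / (2 * M) > r" using True M by simp
    then obtain s where "s \<in> S" and s: "s < 1 / (2 * M)"
      using above by blast
    then obtain n where s: "0 \<le> s" "s < 1 / (2 * M)" and n: "n \<ge> 1" and xn: "bnd (\<lambda>z. x z ^ n) (s ^ n)"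
      unfolding S_def by blast
    define T where "T = (\<Sum>k<n. (M * K) ^ k)"
    have T: "0 \<le> T" unfolding T_def using M K by (intro sum_nonneg) auto
    have "reg x 0 M" using r0 by (intro M) auto
    then obtain y where y: "bnd y M" "bnd (\<lambda>z. 1 - y z * (x z - 0)) (1 / (4 * (T + 1)))"
      unfolding reg_def using T by (metis add_nonneg_pos mult_pos_pos zero_less_divide_1_iff zero_less_numeral zero_less_one)
    \<comment> \<open>Here 1 = (1 - y x) sum (y x)^k + (y x)^n. The accuracy 1 / (4 (T + 1)) makes
      the first term at most 1/4, and M s < 1/2 makes the second at most 1/2; powers of the bound
      3/4 then tend to 0.\<close>
    have "bnd (\<lambda>z. (1 - y z * (x z - 0)) * (\<Sum>k<n. (y z * x z) ^ k) + y z ^ n * x z ^ n) (1 / (4 * (T + 1)) * T + M ^ n * s ^ n)"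
    proof (intro add mult[OF y(2)] mult[OF power[OF y(1)] xn])
      show "bnd (\<lambda>z. \<Sum>k<n. (y z * x z) ^ k) T" unfolding T_def by (intro sum power mult y x)
    qed
    moreover have "(1 - y z * (x z - 0)) * (\<Sum>k<n. (y z * x z) ^ k) + y z ^ n * x z ^ n = 1" for z
      using one_diff_power_eq[of "y z * x z" n, symmetric] by (simp add: power_mult_distrib)
    moreover have "1 / (4 * (T + 1)) * T + M ^ n * s ^ n \<le> 3 / 4"
    proof -
      have "1 / (4 * (T + 1)) * T \<le> 1 / 4" using T by (simp add: field_simps)
      moreover have "(M * s) ^ n \<le> (1 / 2) ^ n" using s M by (intro power_mono) (auto simp: field_simps)
      moreover have "(1 / 2) ^ n \<le> (1 / 2 :: real) ^ 1" using n by (intro power_decreasing) auto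
      ultimately show ?thesis by (simp add: power_mult_distrib)
    qed
    ultimately have "bnd (\<lambda>_. 1) (3 / 4)" by (simp add: mono)
    then have *: "bnd (\<lambda>_. 1) ((3 / 4) ^ m)" for m using power[of "\<lambda>_. 1" "3/4" m] by simp
    obtain m where "(3 / 4 :: real) ^ m < \<epsilon>" using real_arch_pow_inv[OF \<epsilon>, of "3/4"] by auto
    then show ?thesis using mono[OF *[of m]] by simp
  next
    case False
    with r0 have r: "r > 0" by simp
    \<comment> \<open>Lipschitz constant, by the resolvent identity, of l times the resolvent at l
      between the circles of radius r and s; s exceeds r by at most 1 / (16 c).\<close>
    define c where "c = M + r * M\<^sup>2"
    have c: "c > 0" using M r by (auto simp: c_def intro!: add_pos_pos)
    define s where "s = r + min 1 (1 / (16 * c))"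
    have s: "r < s" "s \<le> r + 1" "(s - r) * c \<le> 1 / 16" "0 < s"
    proof -
      show "(s - r) * c \<le> 1 / 16"
        using c by (simp add: s_def min_def field_simps)
    qed (use c r in \<open>auto simp: s_def intro: add_pos_pos\<close>)
    obtain s' n0 where s': "0 \<le> s'" "s' < s" and n0: "n0 \<ge> 1" and xn0: "bnd (\<lambda>z. x z ^ n0) (s' ^ n0)"
      using above[OF s(1)] unfolding S_def by blast
    have q: "0 \<le> (s' / s) ^ n0" "(s' / s) ^ n0 < 1"
      using s' s n0 by (auto simp: power_less_one_iff)
    have "0 < 1 / (16 * (s * M))" using s M by simp
    then obtain m where m0: "((s' / s) ^ n0) ^ m < 1 / (16 * (s * M))"
      using real_arch_pow_inv[OF _ q(2)] by blast
    define n where "n = n0 * Suc m"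
    have n: "n \<ge> 1" using n0 by (simp add: n_def)
    define \<theta> where "\<theta> = ((s' / s) ^ n0) ^ Suc m"
    have "\<theta> \<le> ((s' / s) ^ n0) ^ m" unfolding \<theta>_def power_Suc using q by (intro mult_left_le_one_le) auto
    with m0 have "\<theta> \<le> 1 / (16 * (s * M))" by simp
    then have "s * M * \<theta> \<le> s * M * (1 / (16 * (s * M)))" using s M by (intro mult_left_mono) auto
    then have \<theta>: "s * M * \<theta> \<le> 1 / 16" using s M by simp
    have \<xi>s: "bnd (\<lambda>z. x z ^ n / complex_of_real s ^ n) \<theta>"
    proof -
      have "bnd (\<lambda>z. (1 / complex_of_real s ^ n) * (x z ^ n0) ^ Suc m) (cmod (1 / complex_of_real s ^ n) * (s' ^ n0) ^ Suc m)"
        by (intro cmult power xn0)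
      moreover have "cmod (1 / complex_of_real s ^ n) * (s' ^ n0) ^ Suc m = \<theta>"
        using s by (simp add: \<theta>_def n_def norm_divide norm_power norm_mult power_divide power_mult power_add)
      ultimately show ?thesis by (simp add: n_def power_mult power_add)
    qed
    define \<omega> where "\<omega> = exp (2 * of_real pi * \<i> / of_nat n)"
    have w1: "cmod (\<omega> ^ j) = 1" for j unfolding \<omega>_def by (simp add: norm_power norm_exp_eq_Re)
    define k where "k s = s * (\<Sum>i<n. s ^ (n - Suc i) * K ^ i) / s ^ n" for s :: real
    have k0: "0 \<le> k s" if "s > 0" for s unfolding k_def using that K by (auto intro!: divide_nonneg_pos mult_nonneg_nonneg sum_nonneg)
    \<comment> \<open>The accuracy is fixed only now, because the constants \<open>k s\<close> and
      \<open>k r\<close> coming from \<open>roots_average\<close> depend on n, whereas M does not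
      depend on e.\<close>
    define e where "e = 1 / (16 * (k s + k r + 2 * r * M + 1))"
    have den: "k s + k r + 2 * r * M + 1 > 0"
      using k0[of s] k0[of r] s r M by (auto intro!: add_nonneg_pos)
    have e: "e > 0" using den by (simp add: e_def)
    have es: "e * (k s + k r + 2 * r * M + 1) = 1 / 16" using den by (simp add: e_def)
    have e1: "e * k s + 2 * r * M * e \<le> 1 / 16" "e * k r \<le> 1 / 16"
    proof -
      have "0 \<le> e * k r" "0 \<le> e * k s" "0 \<le> e * (2 * r * M)" using e k0 s r M by auto
      then show "e * k s + 2 * r * M * e \<le> 1 / 16" "e * k r \<le> 1 / 16"
        using es e by (auto simp: algebra_simps)
    qed
    have "\<exists>y. bnd y M \<and> bnd (\<lambda>z. 1 - y z * (x z - s * \<omega> ^ j)) e" for j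
      using M(2)[of "s * \<omega> ^ j"] s w1[of j] e unfolding reg_def by (auto simp: norm_mult)
    then obtain y where y: "\<And>j. bnd (y j) M" "\<And>j. bnd (\<lambda>z. 1 - y j z * (x z - s * \<omega> ^ j)) e"
      by metis
    have "\<exists>y. bnd y M \<and> bnd (\<lambda>z. 1 - y z * (x z - r * \<omega> ^ j)) e" for j
      using M(2)[of "r * \<omega> ^ j"] r w1[of j] e unfolding reg_def by (auto simp: norm_mult)
    then obtain v where v: "\<And>j. bnd (v j) M" "\<And>j. bnd (\<lambda>z. 1 - v j z * (x z - r * \<omega> ^ j)) e"
      by metis
    let ?Y = "\<lambda>s y z. - (\<Sum>j<n. complex_of_real s * \<omega> ^ j * y j z) / of_nat n"
    have avg: "bnd (?Y s y) D" if "\<And>j. bnd (\<lambda>z. complex_of_real s * \<omega> ^ j * y j z) D" for s y D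
    proof -
      have "bnd (\<lambda>z. \<Sum>j<n. complex_of_real s * \<omega> ^ j * y j z) (\<Sum>j<n. D)" by (intro sum that)
      from cmult[OF this, of "- 1 / of_nat n"] show ?thesis using n by (simp add: norm_divide)
    qed
    have Ys: "bnd (?Y s y) (s * M)"
      using cmult[OF y(1), of "s * \<omega> ^ j" j for j] s w1 by (intro avg) (simp add: norm_mult)
    have As: "bnd (\<lambda>z. 1 - ?Y s y z * (1 - x z ^ n / complex_of_real s ^ n)) (k s * e)"
      unfolding k_def by (rule roots_average[OF n s(4) x y(2) \<omega>_def])
    have Ar: "bnd (\<lambda>z. 1 - ?Y r v z * (1 - x z ^ n / complex_of_real r ^ n)) (k r * e)"
      unfolding k_def by (rule roots_average[OF n r x v(2) \<omega>_def])
    have "bnd (\<lambda>z. s * \<omega> ^ j * y j z - r * \<omega> ^ j * v j z) ((s - r) * c + 2 * r * M * e)" for j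
    proof -
      \<comment> \<open>Approximate resolvent identity: y - v is (l - m) y v up to the two inversion
        errors.\<close>
      let ?l = "s * \<omega> ^ j" and ?m = "r * \<omega> ^ j"
      have "bnd (\<lambda>z. (?l - ?m) * y j z + ?m * ((?l - ?m) * (y j z * v j z)
            + (y j z * (1 - v j z * (x z - ?m)) - v j z * (1 - y j z * (x z - ?l)))))
          (cmod (?l - ?m) * M + cmod ?m * (cmod (?l - ?m) * (M * M) + (M * e + M * e)))"
        by (intro add cmult mult diff y v)
      moreover have "cmod (?l - ?m) = s - r" "cmod ?m = r"
        using s r w1[of j] by (auto simp: norm_mult left_diff_distrib[symmetric] simp flip: of_real_diff)
      moreover have "(?l - ?m) * y j z + ?m * ((?l - ?m) * (y j z * v j z)
            + (y j z * (1 - v j z * (x z - ?m)) - v j z * (1 - y j z * (x z - ?l)))) = ?l * y j z - ?m * v j z" for z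
        by (simp add: algebra_simps)
      moreover have "(s - r) * M + r * ((s - r) * (M * M) + (M * e + M * e)) = (s - r) * c + 2 * r * M * e"
        by (simp add: c_def algebra_simps power2_eq_square)
      ultimately show ?thesis by simp
    qed
    then have "bnd (\<lambda>z. \<Sum>j<n. s * \<omega> ^ j * y j z - r * \<omega> ^ j * v j z) (\<Sum>j<n. (s - r) * c + 2 * r * M * e)"
      by (intro sum)
    from cmult[OF this, of "- 1 / of_nat n"]
    have D: "bnd (\<lambda>z. ?Y s y z - ?Y r v z) ((s - r) * c + 2 * r * M * e)"
      using n by (simp add: norm_divide sum_subtractf diff_divide_distrib)
    have b1: "bnd (\<lambda>z. (?Y s y z - ?Y r v z) - (?Y s y z * (x z ^ n / complex_of_real s ^ n) - (1 - ?Y s y z * (1 - x z ^ n / complex_of_real s ^ n))))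
        (((s - r) * c + 2 * r * M * e) + (s * M * \<theta> + k s * e))"
      by (intro diff mult D Ys \<xi>s As)
    have b2: "((s - r) * c + 2 * r * M * e) + (s * M * \<theta> + k s * e) \<le> 1 / 4"
      using s(3) \<theta> e1(1) by (simp add: mult.commute[of _ e])
    \<comment> \<open>With \<xi> = x^n / s^n of bound \<theta>, the identity Y_s - 1 = Y_s \<xi> -
      (1 - Y_s (1 - \<xi>)) makes Y_s close to 1; the estimate of Y_s - Y_r then places Y_r within
      1/4 of 1.\<close>
    have b3: "(?Y s y z - ?Y r v z) - (?Y s y z * (x z ^ n / complex_of_real s ^ n) - (1 - ?Y s y z * (1 - x z ^ n / complex_of_real s ^ n))) = 1 - ?Y r v z" for z
    proof -
      have "(a - b) - (a * c - (1 - a * (1 - c))) = 1 - b" for a b c :: complex by (simp add: algebra_simps)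
      then show ?thesis .
    qed
    have Yr: "bnd (\<lambda>z. 1 - ?Y r v z) (1 / 4)" using mono[OF b1 b2] by (simp only: b3)
    let ?\<xi> = "\<lambda>z. x z ^ n / complex_of_real r ^ n"
    \<comment> \<open>Y_r is near 1 and nearly inverse to 1 - \<xi>, so \<xi> is small: a bound X
      improves to 5/16 + X/2. The fixed point 5/8 with slack 1/8 gives 3/4 < 1, hence an element of
      S below r.\<close>
    have step: "bnd ?\<xi> (5 / 16 + X / 2)" if X: "bnd ?\<xi> X" for X
    proof -
      have b1: "bnd (\<lambda>z. (1 - ?Y r v z * (1 - ?\<xi> z)) - (1 - ?\<xi> z) * (1 - ?Y r v z)) (k r * e + (1 + X) * (1 / 4))"
        by (intro diff mult Ar Yr one X)
      have b3: "(1 - ?Y r v z * (1 - ?\<xi> z)) - (1 - ?\<xi> z) * (1 - ?Y r v z) = ?\<xi> z" for z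
      proof -
        have "(1 - b * (1 - c)) - (1 - c) * (1 - b) = c" for b c :: complex by (simp add: algebra_simps)
        then show ?thesis .
      qed
      have b2: "k r * e + (1 + X) * (1 / 4) \<le> 5 / 16 + X / 2"
      proof -
        have "k r * e \<le> 1 / 16" using e1(2) by (simp only: mult.commute)
        moreover have "(1 + X) * (1 / 4) \<le> 1 / 4 + X / 2" using nonneg[OF X] by (simp add: field_simps)
        ultimately show ?thesis by linarith
      qed
      show ?thesis using mono[OF b1 b2] by (simp only: b3)
    qed
    have "bnd ?\<xi> (cmod (1 / complex_of_real r ^ n) * K ^ n)"
      using cmult[OF power[OF x, of n], of "1 / complex_of_real r ^ n"] by simp
    then have "bnd ?\<xi> (2 * (5 / 16) + 1 / 8)"
      by (intro contraction_le[of "bnd ?\<xi>" "5/16"] step) (auto intro: mono)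
    then have "bnd ?\<xi> (3 / 4)" by simp
    from cmult[OF this, of "complex_of_real r ^ n"] have xn: "bnd (\<lambda>z. x z ^ n) (r ^ n * (3 / 4))"
      using r by (simp add: norm_power)
    define s2 where "s2 = r * root n (3 / 4)"
    have "s2 ^ n = r ^ n * (3 / 4)" using n by (simp add: s2_def power_mult_distrib)
    with xn have "bnd (\<lambda>z. x z ^ n) (s2 ^ n)" by (simp only:)
    moreover have "0 \<le> s2" using r n by (simp add: s2_def)
    ultimately have "s2 \<in> S" using n unfolding S_def by blast
    moreover have "root n (3 / 4) < 1" using n by (simp add: real_root_lt_1_iff)
    then have "s2 < r" using r by (simp add: s2_def)
    ultimately show ?thesis using below by force
  qed
qed

end

section \<open>Laplace multipliers\<close>

text \<open>An operator on signals, recorded by its symbol at large real z. One constant serves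
  every q >= 1: q = 1 makes L1 transforms an ideal, and q = p yields the closed-loop estimate.
  Inputs and outputs being signals, causality at time 0 is built in.\<close>

definition mlt :: "(real \<Rightarrow> complex) \<Rightarrow> real \<Rightarrow> bool" where
  "mlt r C \<longleftrightarrow> 0 \<le> C \<and> (\<forall>q x c. q \<ge> 1 \<longrightarrow> sig q x c \<longrightarrow>
     (\<exists>y. sig q y (C * c) \<and> (\<forall>\<^sub>F z in at_top. lap y z = r z * lap x z)))"

lemma mltD: "mlt r C \<Longrightarrow> q \<ge> 1 \<Longrightarrow> sig q x c \<Longrightarrow> \<exists>y. sig q y (C * c) \<and> (\<forall>\<^sub>F z in at_top. lap y z = r z * lap x z)"
  by (auto simp: mlt_def)

lemma sig_nonneg: "sig q x c \<Longrightarrow> 0 \<le> c" by (auto simp: sig_def dest: LqD)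

interpretation mlt: nrm mlt
proof
  show "mlt (\<lambda>_. a) (cmod a)" for a
    unfolding mlt_def by (auto intro!: exI[of _ "\<lambda>t. a * _ t"] sig_cmult simp: lap_cmult)
next
  fix r C s D assume r: "mlt r C" and s: "mlt s D"
  show "mlt (\<lambda>z. r z + s z) (C + D)"
    unfolding mlt_def
  proof (intro conjI allI impI)
    fix q x c assume q: "q \<ge> 1" and x: "sig q x c"
    obtain y where y: "sig q y (C * c)" "\<forall>\<^sub>F z in at_top. lap y z = r z * lap x z" using mltD[OF r q x] by auto
    obtain y' where y': "sig q y' (D * c)" "\<forall>\<^sub>F z in at_top. lap y' z = s z * lap x z" using mltD[OF s q x] by auto
    have "\<forall>\<^sub>F z in at_top. lap (\<lambda>t. y t + y' t) z = (r z + s z) * lap x z"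
      using y(2) y'(2) eventually_gt_at_top[of 0]
      by eventually_elim (simp add: lap_add[OF y(1) y'(1) q] distrib_right)
    then show "\<exists>y. sig q y ((C + D) * c) \<and> (\<forall>\<^sub>F z in at_top. lap y z = (r z + s z) * lap x z)"
      using sig_add[OF q y(1) y'(1)] by (intro exI[of _ "\<lambda>t. y t + y' t"]) (simp add: distrib_right)
  qed (use r s in \<open>auto simp: mlt_def\<close>)
  show "mlt (\<lambda>z. r z * s z) (C * D)"
    unfolding mlt_def
  proof (intro conjI allI impI)
    fix q x c assume q: "q \<ge> 1" and x: "sig q x c"
    obtain y where y: "sig q y (D * c)" "\<forall>\<^sub>F z in at_top. lap y z = s z * lap x z" using mltD[OF s q x] by auto
    obtain y' where y': "sig q y' (C * (D * c))" "\<forall>\<^sub>F z in at_top. lap y' z = r z * lap y z" using mltD[OF r q y(1)] by auto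
    have "\<forall>\<^sub>F z in at_top. lap y' z = r z * s z * lap x z"
      using y(2) y'(2) by eventually_elim simp
    then show "\<exists>y. sig q y (C * D * c) \<and> (\<forall>\<^sub>F z in at_top. lap y z = r z * s z * lap x z)"
      using y'(1) by (intro exI[of _ y']) (simp add: mult.assoc)
  qed (use r s in \<open>auto simp: mlt_def\<close>)
next
  fix r C D assume r: "mlt r C" and CD: "C \<le> D"
  have "C * c \<le> D * c" if "sig q x c" for q x c
    using CD sig_nonneg[OF that] by (rule mult_right_mono)
  then show "mlt r D" using r CD sig_mono unfolding mlt_def by (metis order.trans)
qed (auto simp: mlt_def)

lemma mlt_cong: "mlt r C \<Longrightarrow> \<forall>\<^sub>F z in at_top. r z = s z \<Longrightarrow> mlt s C"
  unfolding mlt_def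
proof (intro conjI allI impI; (elim conjE)?)
  fix q x c assume *: "\<forall>q x c. 1 \<le> q \<longrightarrow> sig q x c \<longrightarrow> (\<exists>y. sig q y (C * c) \<and> (\<forall>\<^sub>F z in at_top. lap y z = r z * lap x z))"
    and ev: "\<forall>\<^sub>F z in at_top. r z = s z" and q: "1 \<le> q" and x: "sig q x c"
  obtain y where y: "sig q y (C * c)" "\<forall>\<^sub>F z in at_top. lap y z = r z * lap x z" using * q x by blast
  have "\<forall>\<^sub>F z in at_top. lap y z = s z * lap x z" using y(2) ev by eventually_elim simp
  then show "\<exists>y. sig q y (C * c) \<and> (\<forall>\<^sub>F z in at_top. lap y z = s z * lap x z)" using y by blast
qed

lemma Lq_cnj: "Lq q x c \<Longrightarrow> Lq q (\<lambda>t. cnj (x t)) c"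
  by (rule Lq_AE_mono[of q x c]) (auto dest: LqD intro!: borel_measurable_continuous_on[OF continuous_on_cnj[OF continuous_on_id]])

lemma sig_cnj: "sig q x c \<Longrightarrow> sig q (\<lambda>t. cnj (x t)) c"
  by (auto simp: sig_def intro: Lq_cnj)

lemma mlt_cnj: "mlt r C \<Longrightarrow> mlt (\<lambda>z. cnj (r z)) C"
  unfolding mlt_def
proof (intro conjI allI impI; (elim conjE)?)
  fix q x c assume *: "\<forall>q x c. 1 \<le> q \<longrightarrow> sig q x c \<longrightarrow> (\<exists>y. sig q y (C * c) \<and> (\<forall>\<^sub>F z in at_top. lap y z = r z * lap x z))"
    and q: "1 \<le> q" and x: "sig q x c"
  obtain y where y: "sig q y (C * c)" "\<forall>\<^sub>F z in at_top. lap y z = r z * lap (\<lambda>t. cnj (x t)) z"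
    using * q sig_cnj[OF x] by blast
  have "\<forall>\<^sub>F z in at_top. lap (\<lambda>t. cnj (y t)) z = cnj (r z) * lap x z"
    using y(2) by eventually_elim (simp add: lap_cnj)
  then show "\<exists>y. sig q y (C * c) \<and> (\<forall>\<^sub>F z in at_top. lap y z = cnj (r z) * lap x z)"
    using sig_cnj[OF y(1)] by blast
qed

text \<open>Conjugating input and output shows that the conjugate symbol is again a multiplier.
  Taking real parts will make the feedback kernels real-valued.\<close>

lemma mlt_Re: assumes "mlt r C" shows "mlt (\<lambda>z. complex_of_real (Re (r z))) C"
proof -
  have "mlt (\<lambda>z. (1 / 2) * (r z + cnj (r z))) (cmod (1 / 2) * (C + C))"
    by (intro mlt.cmult mlt.add mlt_cnj assms)
  moreover have "(1 / 2) * (r z + cnj (r z)) = complex_of_real (Re (r z))" for z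
    by (simp add: complex_add_cnj)
  ultimately show ?thesis by simp
qed

lemma (in delay_kernel) mlt_kernel:
  assumes \<tau>0: "\<And>i. i \<in> space M \<Longrightarrow> 0 \<le> \<tau> i"
  shows "mlt (\<lambda>z. \<integral>i. w i * complex_of_real (exp (- (z * \<tau> i))) \<partial>M) (\<integral>i. cmod (w i) \<partial>M)"
  unfolding mlt_def
proof (intro conjI allI impI)
  fix q x c assume q: "q \<ge> 1" and x: "sig q x c"
  show "\<exists>y. sig q y ((\<integral>i. cmod (w i) \<partial>M) * c) \<and> (\<forall>\<^sub>F z in at_top. lap y z = (\<integral>i. w i * complex_of_real (exp (- (z * \<tau> i))) \<partial>M) * lap x z)"
    using sig_cv[OF q x \<tau>0] lap_cv[OF q x \<tau>0]
    by (intro exI[of _ "cv M w \<tau> x"] conjI eventually_mono[OF eventually_gt_at_top[of 0]]) auto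
qed simp

lemma Lq_1: "Lq 1 h c \<longleftrightarrow> integrable lborel h \<and> (\<integral>t. cmod (h t) \<partial>lborel) \<le> c"
proof
  assume "Lq 1 h c"
  then have h: "h \<in> borel_measurable lborel" "0 \<le> c" "(\<integral>\<^sup>+t. ennreal (cmod (h t)) \<partial>lborel) \<le> ennreal c"
    by (simp_all add: Lq_def one_enat_def)
  then have i: "integrable lborel h"
    by (intro integrableI_bounded) (auto intro: le_less_trans)
  moreover have "ennreal (\<integral>t. cmod (h t) \<partial>lborel) \<le> ennreal c"
    using h(3) i by (subst (asm) nn_integral_eq_integral) auto
  ultimately show "integrable lborel h \<and> (\<integral>t. cmod (h t) \<partial>lborel) \<le> c" using h(2) by simp
next
  assume *: "integrable lborel h \<and> (\<integral>t. cmod (h t) \<partial>lborel) \<le> c"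
  have "0 \<le> (\<integral>t. cmod (h t) \<partial>lborel)" by simp
  then have "0 \<le> c" using * by linarith
  moreover have "h \<in> borel_measurable lborel" using * by auto
  moreover have "(\<integral>\<^sup>+t. ennreal (cmod (h t)) \<partial>lborel) \<le> ennreal c"
    using * by (subst nn_integral_eq_integral) (auto intro: ennreal_leI)
  ultimately show "Lq 1 h c" by (simp add: Lq_def one_enat_def)
qed

lemma sig_1: "sig 1 h c \<longleftrightarrow> integrable lborel h \<and> (\<integral>t. cmod (h t) \<partial>lborel) \<le> c \<and> (\<forall>t<0. h t = 0)"
  by (simp add: sig_def Lq_1)

text \<open>The transform results for \<open>delay_kernel\<close> ask for nonnegative delays at
  every index, so the delay at t is taken as max 0 t; where the two differ, h vanishes.\<close>

lemma lap_as_kernel: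
  assumes "\<And>t. t < 0 \<Longrightarrow> h t = 0"
  shows "lap h z = (\<integral>t. h t * complex_of_real (exp (- (z * max 0 t))) \<partial>lborel)"
  unfolding lap_def
proof (rule Bochner_Integration.integral_cong)
  fix t show "complex_of_real (exp (- (z * t))) * h t = h t * complex_of_real (exp (- (z * max 0 t)))"
    using assms[of t] by (cases "t < 0") (auto simp: max_def)
qed simp

lemma delay_kernel_sig: "integrable lborel h \<Longrightarrow> delay_kernel lborel h (\<lambda>t. max 0 t)"
  by (auto simp: delay_kernel_def delay_kernel_axioms_def intro: sigma_finite_lborel)

lemma mlt_lap: assumes "sig 1 h c" shows "mlt (lap h) c"
proof -
  have h: "integrable lborel h" "(\<integral>t. cmod (h t) \<partial>lborel) \<le> c" "\<And>t. t < 0 \<Longrightarrow> h t = 0"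
    using assms by (auto simp: sig_1)
  have "lap h = (\<lambda>z. \<integral>t. h t * complex_of_real (exp (- (z * max 0 t))) \<partial>lborel)"
    by (rule ext) (rule lap_as_kernel[OF h(3)])
  then show ?thesis
    using mlt.mono[OF delay_kernel.mlt_kernel[OF delay_kernel_sig[OF h(1)]] h(2)] by simp
qed

text \<open>The distributed kernels on the transform side. \<open>L1h_mult\<close> makes them an
  ideal among the multipliers, by letting a multiplier act on the kernel itself as a signal with q =
  1.\<close>

definition L1h :: "(real \<Rightarrow> complex) \<Rightarrow> bool" where
  "L1h r \<longleftrightarrow> (\<exists>h c. sig 1 h c \<and> (\<forall>\<^sub>F z in at_top. lap h z = r z))"

lemma L1h_mlt: "L1h r \<Longrightarrow> \<exists>C. mlt r C"
  unfolding L1h_def using mlt_lap mlt_cong by blast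

lemma L1h_lap: "sig 1 h c \<Longrightarrow> L1h (lap h)"
  unfolding L1h_def by auto

lemma L1h_zero: "L1h (\<lambda>_. 0)"
  unfolding L1h_def by (rule exI[of _ "\<lambda>_. 0"]) (auto intro!: exI[of _ 0] sig_zero simp: lap_zero)

lemma L1h_add: assumes "L1h r" "L1h s" shows "L1h (\<lambda>z. r z + s z)"
proof -
  obtain h c where h: "sig 1 h c" "\<forall>\<^sub>F z in at_top. lap h z = r z" using assms by (auto simp: L1h_def)
  obtain k d where k: "sig 1 k d" "\<forall>\<^sub>F z in at_top. lap k z = s z" using assms by (auto simp: L1h_def)
  have "\<forall>\<^sub>F z in at_top. lap (\<lambda>t. h t + k t) z = r z + s z"
    using h(2) k(2) eventually_gt_at_top[of 0] by eventually_elim (simp add: lap_add[OF h(1) k(1)])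
  then show ?thesis unfolding L1h_def using sig_add[OF _ h(1) k(1)] by blast
qed

lemma L1h_mult: assumes "mlt r C" "L1h s" shows "L1h (\<lambda>z. r z * s z)"
proof -
  obtain h c where h: "sig 1 h c" "\<forall>\<^sub>F z in at_top. lap h z = s z" using assms by (auto simp: L1h_def)
  obtain y where y: "sig 1 y (C * c)" "\<forall>\<^sub>F z in at_top. lap y z = r z * lap h z"
    using mltD[OF assms(1) order_refl h(1)] by auto
  have "\<forall>\<^sub>F z in at_top. lap y z = r z * s z" using h(2) y(2) by eventually_elim simp
  then show ?thesis unfolding L1h_def using y(1) by blast
qed

section \<open>Quotients by ideals and perturbation of determinants\<close>

lemma sup_nrm: "nrm (\<lambda>r C. 0 \<le> C \<and> (\<forall>z\<in>S. cmod (r z) \<le> C))"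
proof
  fix r C s D
  assume *: "0 \<le> C \<and> (\<forall>z\<in>S. cmod (r z) \<le> C)" "0 \<le> D \<and> (\<forall>z\<in>S. cmod (s z) \<le> D)"
  then show "0 \<le> C + D \<and> (\<forall>z\<in>S. cmod (r z + s z) \<le> C + D)"
    by (auto intro: norm_triangle_le add_mono)
  show "0 \<le> C * D \<and> (\<forall>z\<in>S. cmod (r z * s z) \<le> C * D)"
    using * by (auto simp: norm_mult intro!: mult_mono)
qed (auto intro: order_trans)

context nrm
begin

text \<open>A bound modulo J is a bound for some representative. For products, r s differs from (r -
  j)(s - k) by (r - j) k + s j, which lies in J: s is bounded, as a bounded element plus an element
  of J.\<close>

lemma quotient_nrm:
  assumes J0: "J (\<lambda>_. 0)" and Jadd: "\<And>r s. J r \<Longrightarrow> J s \<Longrightarrow> J (\<lambda>z. r z + s z)"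
    and Jmult: "\<And>r s C. bnd r C \<Longrightarrow> J s \<Longrightarrow> J (\<lambda>z. r z * s z)"
    and Jbnd: "\<And>r. J r \<Longrightarrow> \<exists>C. bnd r C"
  shows "nrm (\<lambda>r C. \<exists>j. J j \<and> bnd (\<lambda>z. r z - j z) C)"
proof
  show "\<exists>j. J j \<and> bnd (\<lambda>z. a - j z) (cmod a)" for a
    using J0 const by (intro exI[of _ "\<lambda>_. 0"]) simp
next
  fix r C s D
  assume "\<exists>j. J j \<and> bnd (\<lambda>z. r z - j z) C" "\<exists>j. J j \<and> bnd (\<lambda>z. s z - j z) D"
  then obtain j k where j: "J j" "bnd (\<lambda>z. r z - j z) C" and k: "J k" "bnd (\<lambda>z. s z - k z) D" by blast
  show "\<exists>j. J j \<and> bnd (\<lambda>z. r z + s z - j z) (C + D)"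
    using Jadd[OF j(1) k(1)] add[OF j(2) k(2)]
    by (intro exI[of _ "\<lambda>z. j z + k z"]) (simp add: algebra_simps)
  obtain K where "bnd k K" using Jbnd[OF k(1)] ..
  with k(2) have s: "bnd (\<lambda>z. (s z - k z) + k z) (D + K)" by (rule add)
  have "J (\<lambda>z. (r z - j z) * k z + s z * j z)"
    using s by (intro Jadd Jmult[OF j(2) k(1)] Jmult[OF _ j(1)]) simp
  moreover have "bnd (\<lambda>z. r z * s z - ((r z - j z) * k z + s z * j z)) (C * D)"
    using mult[OF j(2) k(2)] by (simp add: algebra_simps)
  ultimately show "\<exists>j. J j \<and> bnd (\<lambda>z. r z * s z - j z) (C * D)" by blast
qed (use mono nonneg in blast)+

lemma prod_perturb:
  assumes I: "finite I" and a: "\<And>i. i \<in> I \<Longrightarrow> bnd (a i) K" and b: "\<And>i. i \<in> I \<Longrightarrow> bnd (b i) d"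
    and K: "0 \<le> K" and d: "0 \<le> d" "d \<le> 1"
  shows "bnd (\<lambda>z. (\<Prod>i\<in>I. a i z + b i z) - (\<Prod>i\<in>I. a i z)) (real (card I) * (K + 1) ^ card I * d)"
  using I a b
proof (induction I)
  case (insert i I)
  let ?m = "card I"
  have p: "bnd (\<lambda>z. \<Prod>i\<in>I. a i z + b i z) ((K + 1) ^ ?m)"
    using prod[of I "\<lambda>i z. a i z + b i z" "\<lambda>_. K + 1"] mono[OF add[OF insert.prems], of _ _ "K + 1"] d by auto
  have b1: "bnd (\<lambda>z. a i z * ((\<Prod>i\<in>I. a i z + b i z) - (\<Prod>i\<in>I. a i z)) + b i z * (\<Prod>i\<in>I. a i z + b i z))
    (K * (real ?m * (K + 1) ^ ?m * d) + d * (K + 1) ^ ?m)"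
    using insert.prems by (intro add mult insert.IH p) auto
  have "d * (K + 1) ^ ?m * 1 \<le> d * (K + 1) ^ ?m * (K + 1)" using K d by (intro mult_left_mono) auto
  moreover have "K * (real ?m * (K + 1) ^ ?m * d) \<le> (K + 1) * (real ?m * (K + 1) ^ ?m * d)"
    using K d by (intro mult_right_mono) auto
  ultimately have b2: "K * (real ?m * (K + 1) ^ ?m * d) + d * (K + 1) ^ ?m \<le> real (Suc ?m) * (K + 1) ^ Suc ?m * d"
    by (simp add: algebra_simps)
  show ?case using mono[OF b1 b2] insert.hyps by (simp add: algebra_simps)
qed (simp add: zero)

text \<open>The constant is explicit, linear in d and the same for every seminorm, so that one
  truncation index can serve the sup norm and the multiplier norm at once.\<close>

lemma det_perturb:
  fixes A D :: "'z \<Rightarrow> complex^'k^'k"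
  assumes A: "\<And>i j. bnd (\<lambda>z. A z $ i $ j) K" and D: "\<And>i j. bnd (\<lambda>z. D z $ i $ j) d" and d: "d \<le> 1"
  shows "bnd (\<lambda>z. det (A z + D z) - det (A z)) (fact CARD('k) * (real CARD('k) * (K + 1) ^ CARD('k)) * d)"
proof -
  let ?P = "{p. p permutes (UNIV :: 'k set)}"
  have K: "0 \<le> K" using nonneg[OF A] .
  have "bnd (\<lambda>z. \<Sum>p\<in>?P. of_int (sign p) * ((\<Prod>i\<in>UNIV. A z $ i $ p i + D z $ i $ p i) - (\<Prod>i\<in>UNIV. A z $ i $ p i)))
      (\<Sum>p\<in>?P. cmod (of_int (sign p)) * (real CARD('k) * (K + 1) ^ CARD('k) * d))"
    using nonneg[OF D] by (intro sum cmult prod_perturb A D K d) auto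
  also have "(\<Sum>p\<in>?P. cmod (of_int (sign p)) * (real CARD('k) * (K + 1) ^ CARD('k) * d)) = fact CARD('k) * (real CARD('k) * (K + 1) ^ CARD('k)) * d"
  proof -
    have "cmod (of_int (sign p)) = 1" for p :: "'k \<Rightarrow> 'k" by (cases "evenperm p") (auto simp: sign_def)
    then show ?thesis by (simp add: card_permutations)
  qed
  finally show ?thesis
    by (simp add: det_def sum_subtractf right_diff_distrib)
qed

lemma det_bnd:
  fixes A :: "'z \<Rightarrow> complex^'k^'k"
  assumes A: "\<And>i j. bnd (\<lambda>z. A z $ i $ j) K"
  shows "\<exists>C. bnd (\<lambda>z. det (A z)) C"
proof -
  let ?P = "{p. p permutes (UNIV :: 'k set)}"
  have "bnd (\<lambda>z. \<Sum>p\<in>?P. of_int (sign p) * (\<Prod>i\<in>UNIV. A z $ i $ p i))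
      (\<Sum>p\<in>?P. cmod (of_int (sign p)) * (\<Prod>i\<in>(UNIV :: 'k set). K))"
    by (intro sum cmult prod A)
  then show ?thesis unfolding det_def by blast
qed

text \<open>Each difference of products telescopes into terms containing one entry of D. As J is
  only asked to be closed under sums and multiples, it can be the L1 transforms or the multiples of
  1 / (z + 1) - 1 / (z0 + 1).\<close>

lemma det_ideal:
  fixes A D :: "'z \<Rightarrow> complex^'k^'k"
  assumes J0: "J (\<lambda>_. 0)" and Jadd: "\<And>r s. J r \<Longrightarrow> J s \<Longrightarrow> J (\<lambda>z. r z + s z)"
    and Jmult: "\<And>r s C. bnd r C \<Longrightarrow> J s \<Longrightarrow> J (\<lambda>z. r z * s z)"
    and A: "\<And>i j. bnd (\<lambda>z. A z $ i $ j) K" and D: "\<And>i j. bnd (\<lambda>z. D z $ i $ j) L"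
    and DJ: "\<And>i j. J (\<lambda>z. D z $ i $ j)"
  shows "J (\<lambda>z. det (A z + D z) - det (A z))"
proof -
  have prd: "J (\<lambda>z. (\<Prod>i\<in>I. A z $ i $ p i + D z $ i $ p i) - (\<Prod>i\<in>I. A z $ i $ p i))" if "finite I" for I and p :: "'k \<Rightarrow> 'k"
    using that
  proof (induction I)
    case (insert i I)
    have "J (\<lambda>z. A z $ i $ p i * ((\<Prod>i\<in>I. A z $ i $ p i + D z $ i $ p i) - (\<Prod>i\<in>I. A z $ i $ p i))
         + (\<Prod>i\<in>I. A z $ i $ p i + D z $ i $ p i) * D z $ i $ p i)"
      by (rule Jadd[OF Jmult[OF A insert.IH] Jmult[OF prod[where C="\<lambda>_. K + L"] DJ]]) (intro add A D)
    then show ?case using insert.hyps by (simp add: algebra_simps)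
  qed (simp add: J0)
  have "J (\<lambda>z. \<Sum>p\<in>P. of_int (sign p) * ((\<Prod>i\<in>UNIV. A z $ i $ p i + D z $ i $ p i) - (\<Prod>i\<in>UNIV. A z $ i $ p i)))"
    if "finite P" for P
    using that
  proof (induction P)
    case (insert p P)
    then show ?case using Jadd[OF Jmult[OF const prd[of UNIV p]] insert.IH] by simp
  qed (simp add: J0)
  from this[of "{p. p permutes UNIV}"] show ?thesis
    by (simp add: det_def sum_subtractf right_diff_distrib)
qed

end

section \<open>Inverting almost periodic Dirichlet series\<close>

text \<open>Dirichlet polynomials with exponents in G under the l1 norm weighted by exp(-R s). For G
  in [0,\<infinity>) it dominates the supremum over Re z >= R, and a large R shrinks all terms of
  positive exponent.\<close>

definition fd :: "real set \<Rightarrow> real \<Rightarrow> (complex \<Rightarrow> complex) \<Rightarrow> real \<Rightarrow> bool" where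
  "fd G R r C \<longleftrightarrow> (\<exists>S c. finite S \<and> S \<subseteq> G \<and> (\<forall>z. r z = (\<Sum>s\<in>S. c s * exp (- (complex_of_real s * z)))) \<and>
     (\<Sum>s\<in>S. cmod (c s) * exp (- (R * s))) \<le> C)"

text \<open>Exponents of the family may coincide, and merging them can only lower the weighted sum;
  sums and products of polynomials are thus handled without collecting terms.\<close>

lemma fd_family:
  fixes I :: "'i set" and s :: "'i \<Rightarrow> real" and a :: "'i \<Rightarrow> complex"
  assumes I: "finite I" and s: "\<And>i. i \<in> I \<Longrightarrow> s i \<in> G"
    and r: "\<And>z. r z = (\<Sum>i\<in>I. a i * exp (- (complex_of_real (s i) * z)))"
    and C: "(\<Sum>i\<in>I. cmod (a i) * exp (- (R * s i))) \<le> C"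
  shows "fd G R r C"
proof -
  define c where "c t = (\<Sum>i\<in>{i\<in>I. s i = t}. a i)" for t
  have "r z = (\<Sum>t\<in>s ` I. c t * exp (- (complex_of_real t * z)))" for z
    unfolding r c_def sum_distrib_right
    by (subst sum.image_gen[OF I, of _ s]) (auto intro!: sum.cong)
  moreover have "(\<Sum>t\<in>s ` I. cmod (c t) * exp (- (R * t))) \<le> C"
  proof -
    have "(\<Sum>t\<in>s ` I. cmod (c t) * exp (- (R * t))) \<le> (\<Sum>t\<in>s ` I. \<Sum>i\<in>{i\<in>I. s i = t}. cmod (a i) * exp (- (R * s i)))"
    proof (rule sum_mono)
      fix t
      have "cmod (c t) * exp (- (R * t)) \<le> (\<Sum>i\<in>{i\<in>I. s i = t}. cmod (a i)) * exp (- (R * t))"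
        unfolding c_def by (intro mult_right_mono norm_sum) auto
      also have "\<dots> = (\<Sum>i\<in>{i\<in>I. s i = t}. cmod (a i) * exp (- (R * s i)))"
        by (auto simp: sum_distrib_right intro!: sum.cong)
      finally show "cmod (c t) * exp (- (R * t)) \<le> (\<Sum>i\<in>{i\<in>I. s i = t}. cmod (a i) * exp (- (R * s i)))" .
    qed
    also have "\<dots> = (\<Sum>i\<in>I. cmod (a i) * exp (- (R * s i)))"
      by (rule sum.image_gen[OF I, symmetric])
    finally show ?thesis using C by simp
  qed
  ultimately show ?thesis using I s unfolding fd_def by (intro exI[of _ "s ` I"] exI[of _ c]) auto
qed

lemma fd_nrm:
  assumes G0: "0 \<in> G" and Gadd: "\<And>s t. s \<in> G \<Longrightarrow> t \<in> G \<Longrightarrow> s + t \<in> G"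
  shows "nrm (fd G R)"
proof
  show "fd G R (\<lambda>_. a) (cmod a)" for a
    by (rule fd_family[where I="{0}" and s="\<lambda>_. 0" and a="\<lambda>_. a"]) (auto simp: G0)
next
  fix r C s D assume "fd G R r C" "fd G R s D"
  then obtain A a B b where A: "finite A" "A \<subseteq> G" "\<And>z. r z = (\<Sum>s\<in>A. a s * exp (- (complex_of_real s * z)))"
      "(\<Sum>s\<in>A. cmod (a s) * exp (- (R * s))) \<le> C"
    and B: "finite B" "B \<subseteq> G" "\<And>z. s z = (\<Sum>s\<in>B. b s * exp (- (complex_of_real s * z)))"
      "(\<Sum>s\<in>B. cmod (b s) * exp (- (R * s))) \<le> D"
    unfolding fd_def by blast
  show "fd G R (\<lambda>z. r z + s z) (C + D)"
  proof (rule fd_family[where I="A <+> B" and s="case_sum id id" and a="case_sum a b"])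
    show "case_sum id id i \<in> G" if "i \<in> A <+> B" for i using that A B by auto
    show "r z + s z = (\<Sum>i\<in>A <+> B. case_sum a b i * exp (- (complex_of_real (case_sum id id i) * z)))" for z
      using A(1) B(1) by (simp add: A(3) B(3) sum.Plus)
    show "(\<Sum>i\<in>A <+> B. cmod (case_sum a b i) * exp (- (R * case_sum id id i))) \<le> C + D"
      using A(1,4) B(1,4) by (simp add: sum.Plus)
  qed (use A B in auto)
  show "fd G R (\<lambda>z. r z * s z) (C * D)"
  proof (rule fd_family[where I="A \<times> B" and s="\<lambda>(x, y). x + y" and a="\<lambda>(x, y). a x * b y"])
    show "(case i of (x, y) \<Rightarrow> x + y) \<in> G" if "i \<in> A \<times> B" for i using that A(2) B(2) by (auto intro!: Gadd)
    show "r z * s z = (\<Sum>i\<in>A \<times> B. (case i of (x, y) \<Rightarrow> a x * b y) * exp (- (complex_of_real (case i of (x, y) \<Rightarrow> x + y) * z)))" for z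
      by (simp add: A(3) B(3) sum_product sum.cartesian_product exp_add[symmetric] algebra_simps case_prod_beta' mult_exp_exp)
    have "(\<Sum>i\<in>A \<times> B. cmod (case i of (x, y) \<Rightarrow> a x * b y) * exp (- (R * (case i of (x, y) \<Rightarrow> x + y))))
      = (\<Sum>s\<in>A. cmod (a s) * exp (- (R * s))) * (\<Sum>s\<in>B. cmod (b s) * exp (- (R * s)))"
      by (simp add: sum_product sum.cartesian_product norm_mult algebra_simps case_prod_beta' mult_exp_exp)
    also have "\<dots> \<le> C * D"
      using A(4) B(4) by (intro mult_mono) (auto intro!: sum_nonneg order_trans[OF _ A(4)])
    finally show "(\<Sum>i\<in>A \<times> B. cmod (case i of (x, y) \<Rightarrow> a x * b y) * exp (- (R * (case i of (x, y) \<Rightarrow> x + y)))) \<le> C * D" .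
  qed (use A B in auto)
next
  fix r C assume "fd G R r C"
  then obtain A a where "(\<Sum>s\<in>A. cmod (a s) * exp (- (R * s))) \<le> C" unfolding fd_def by blast
  moreover have "0 \<le> (\<Sum>s\<in>A. cmod (a s) * exp (- (R * s)))" by (intro sum_nonneg) auto
  ultimately show "0 \<le> C" by linarith
qed (fastforce simp: fd_def intro: order_trans)

lemma fd_bound:
  assumes "fd G R r C" "Re z \<ge> R" "G \<subseteq> {0..}" shows "cmod (r z) \<le> C"
proof -
  obtain A a where A: "A \<subseteq> G" "r z = (\<Sum>s\<in>A. a s * exp (- (complex_of_real s * z)))"
      "(\<Sum>s\<in>A. cmod (a s) * exp (- (R * s))) \<le> C"
    using assms(1) unfolding fd_def by blast
  have "cmod (r z) \<le> (\<Sum>s\<in>A. cmod (a s * exp (- (complex_of_real s * z))))"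
    unfolding A(2) by (rule norm_sum)
  also have "\<dots> \<le> (\<Sum>s\<in>A. cmod (a s) * exp (- (R * s)))"
  proof (rule sum_mono)
    fix s assume "s \<in> A"
    then have "R * s \<le> s * Re z" using A assms mult_right_mono[of R "Re z" s] by (auto simp: mult.commute)
    then show "cmod (a s * exp (- (complex_of_real s * z))) \<le> cmod (a s) * exp (- (R * s))"
      by (auto simp: norm_mult norm_exp_eq_Re intro!: mult_left_mono)
  qed
  finally show ?thesis using A(3) by simp
qed

text \<open>Limits are kept as series of polynomials, so that Cauchy products and geometric series
  apply directly; single coefficients are recovered only in \<open>dser_coeffs\<close>.\<close>

definition dser :: "real set \<Rightarrow> real \<Rightarrow> (complex \<Rightarrow> complex) \<Rightarrow> bool" where
  "dser G R r \<longleftrightarrow> (\<exists>T \<gamma>. (\<forall>m. fd G R (T m) (\<gamma> m)) \<and> summable \<gamma> \<and> (\<forall>z. Re z \<ge> R \<longrightarrow> (\<lambda>m. T m z) sums r z))"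

lemma dser_mult:
  assumes G: "nrm (fd G R)" "G \<subseteq> {0..}" and "dser G R r" "dser G R s"
  shows "dser G R (\<lambda>z. r z * s z)"
proof -
  interpret nrm "fd G R" by fact
  obtain T \<gamma> where T: "\<And>m. fd G R (T m) (\<gamma> m)" "summable \<gamma>" "\<And>z. Re z \<ge> R \<Longrightarrow> (\<lambda>m. T m z) sums r z"
    using assms(3) unfolding dser_def by blast
  obtain U \<delta> where U: "\<And>m. fd G R (U m) (\<delta> m)" "summable \<delta>" "\<And>z. Re z \<ge> R \<Longrightarrow> (\<lambda>m. U m z) sums s z"
    using assms(4) unfolding dser_def by blast
  have nn: "0 \<le> \<gamma> m" "0 \<le> \<delta> m" for m using nonneg[OF T(1)] nonneg[OF U(1)] by auto
  have sT: "summable (\<lambda>m. norm (T m z))" if "Re z \<ge> R" for z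
    using T(2) by (rule summable_comparison_test[rotated]) (use fd_bound[OF T(1) that G(2)] in auto)
  have sU: "summable (\<lambda>m. norm (U m z))" if "Re z \<ge> R" for z
    using U(2) by (rule summable_comparison_test[rotated]) (use fd_bound[OF U(1) that G(2)] in auto)
  show ?thesis
    unfolding dser_def
  proof (intro exI conjI allI impI)
    show "fd G R (\<lambda>z. \<Sum>i\<le>k. T i z * U (k - i) z) (\<Sum>i\<le>k. \<gamma> i * \<delta> (k - i))" for k
      by (intro sum mult T U)
    show "summable (\<lambda>k. \<Sum>i\<le>k. \<gamma> i * \<delta> (k - i))"
      using summable_Cauchy_product[of \<gamma> \<delta>] T(2) U(2) nn by simp
    show "(\<lambda>k. \<Sum>i\<le>k. T i z * U (k - i) z) sums (r z * s z)" if "Re z \<ge> R" for z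
      using Cauchy_product_sums[OF sT[OF that] sU[OF that]]
      unfolding sums_unique[OF T(3)[OF that], symmetric] sums_unique[OF U(3)[OF that], symmetric] .
  qed
qed

lemma dser_inverse:
  assumes G: "nrm (fd G R)" "G \<subseteq> {0..}" and P: "fd G R (\<lambda>z. 1 - P z) (1 / 2)"
  shows "dser G R (\<lambda>z. 1 / P z ^ n)"
proof (induction n)
  interpret nrm "fd G R" by fact
  case 0
  have "fd G R (\<lambda>z. if m = 0 then 1 else 0) (if m = 0 then 1 else 0)" for m :: nat
    using one zero by simp
  then show ?case unfolding dser_def
    using sums_single[of 0 "\<lambda>_. 1 :: complex"] summable_single[of 0 "\<lambda>_. 1 :: real"]
    by (intro exI[of _ "\<lambda>m z. if m = 0 then 1 else 0"] exI[of _ "\<lambda>m. if m = 0 then 1 else 0"]) simp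
next
  interpret nrm "fd G R" by fact
  case (Suc n)
  have "dser G R (\<lambda>z. 1 / P z)"
    unfolding dser_def
  proof (intro exI conjI allI impI)
    show "fd G R (\<lambda>z. (1 - P z) ^ m) ((1 / 2) ^ m)" for m by (intro power P)
    show "(\<lambda>m. (1 - P z) ^ m) sums (1 / P z)" if "Re z \<ge> R" for z
      using geometric_sums[of "1 - P z"] fd_bound[OF P that G(2)] by simp
  qed (simp add: summable_geometric)
  from dser_mult[OF G this Suc] show ?case by simp
qed

section \<open>Coefficients of Dirichlet series from vertical means\<close>

lemma exp_linepath_mean:
  fixes a :: real and R :: real
  assumes T: "T > 0"
  shows "\<exists>I. ((\<lambda>w. exp (complex_of_real a * w)) has_contour_integral I) (linepath (of_real R) (Complex R T)) \<and>
     cmod (I / (\<i> * T) - (if a = 0 then 1 else 0)) \<le> (if a = 0 then 0 else 2 * exp (a * R) / \<bar>a\<bar>) / T"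
proof (cases "a = 0")
  case True
  have "((\<lambda>w. 1) has_contour_integral 1 * (Complex R T - of_real R)) (linepath (of_real R) (Complex R T))"
    by (rule has_contour_integral_const_linepath)
  moreover have "1 * (Complex R T - of_real R) = \<i> * T" by (simp add: complex_eq_iff)
  ultimately show ?thesis using T True by (intro exI[of _ "\<i> * T"]) simp
next
  case False
  let ?F = "\<lambda>w. exp (complex_of_real a * w) / a"
  have "((\<lambda>w. exp (complex_of_real a * w)) has_contour_integral
      ?F (pathfinish (linepath (of_real R) (Complex R T))) - ?F (pathstart (linepath (of_real R) (Complex R T))))
      (linepath (of_real R) (Complex R T))"
    by (rule contour_integral_primitive[where S=UNIV]) (use False in \<open>auto intro!: derivative_eq_intros\<close>)
  moreover have "cmod ((?F (Complex R T) - ?F (of_real R)) / (\<i> * T)) \<le> 2 * exp (a * R) / \<bar>a\<bar> / T"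
  proof -
    have "cmod (?F (Complex R T) - ?F (of_real R)) \<le> cmod (?F (Complex R T)) + cmod (?F (of_real R))"
      by (rule norm_triangle_ineq4)
    also have "\<dots> = 2 * exp (a * R) / \<bar>a\<bar>" by (simp add: norm_divide norm_exp_eq_Re)
    finally show ?thesis using T divide_right_mono[of _ "2 * exp (a * R) / \<bar>a\<bar>" T]
      by (simp only: norm_divide norm_mult norm_ii mult_1 norm_of_real abs_of_pos)
  qed
  ultimately show ?thesis using False by auto
qed

text \<open>Bohr's formula: after multiplication by exp(s0 w), the mean over a vertical segment of
  length T isolates the coefficient at s0, since every other frequency averages to O(1/T).\<close>

lemma dirichlet_mean:
  fixes c :: "real \<Rightarrow> complex"
  assumes S: "finite S" and T: "T > 0"
  shows "\<exists>I. ((\<lambda>w. (\<Sum>s\<in>S. c s * exp (- (complex_of_real s * w))) * exp (complex_of_real s0 * w)) has_contour_integral I) (linepath (of_real R) (Complex R T)) \<and>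
     cmod (I / (\<i> * T) - (if s0 \<in> S then c s0 else 0)) \<le> (\<Sum>s\<in>S. cmod (c s) * (if s0 = s then 0 else 2 * exp ((s0 - s) * R) / \<bar>s0 - s\<bar>)) / T"
proof -
  obtain I where I: "\<And>s. ((\<lambda>w. exp (complex_of_real (s0 - s) * w)) has_contour_integral I s) (linepath (of_real R) (Complex R T))"
     "\<And>s. cmod (I s / (\<i> * T) - (if s0 - s = 0 then 1 else 0)) \<le> (if s0 - s = 0 then 0 else 2 * exp ((s0 - s) * R) / \<bar>s0 - s\<bar>) / T"
    using exp_linepath_mean[OF T, of "s0 - _" R] by metis
  have "((\<lambda>w. \<Sum>s\<in>S. c s * exp (complex_of_real (s0 - s) * w)) has_contour_integral (\<Sum>s\<in>S. c s * I s)) (linepath (of_real R) (Complex R T))"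
    by (intro has_contour_integral_sum[OF S] has_contour_integral_lmul I)
  moreover have "(\<Sum>s\<in>S. c s * exp (complex_of_real (s0 - s) * w)) = (\<Sum>s\<in>S. c s * exp (- (complex_of_real s * w))) * exp (complex_of_real s0 * w)" for w
    unfolding sum_distrib_right by (intro sum.cong refl) (simp add: mult_exp_exp algebra_simps)
  moreover have "cmod ((\<Sum>s\<in>S. c s * I s) / (\<i> * T) - (if s0 \<in> S then c s0 else 0))
      \<le> (\<Sum>s\<in>S. cmod (c s) * (if s0 = s then 0 else 2 * exp ((s0 - s) * R) / \<bar>s0 - s\<bar>)) / T"
  proof -
    have "(if s0 \<in> S then c s0 else 0) = (\<Sum>s\<in>S. c s * (if s0 - s = 0 then 1 else 0))"
      using S by (simp add: if_distrib cong: if_cong)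
    then have "cmod ((\<Sum>s\<in>S. c s * I s) / (\<i> * T) - (if s0 \<in> S then c s0 else 0)) = cmod (\<Sum>s\<in>S. c s * (I s / (\<i> * T) - (if s0 - s = 0 then 1 else 0)))"
      by (simp only: sum_divide_distrib times_divide_eq_right sum_subtractf right_diff_distrib)
    also have "\<dots> \<le> (\<Sum>s\<in>S. norm (c s) * ((if s0 - s = 0 then 0 else 2 * exp ((s0 - s) * R) / \<bar>s0 - s\<bar>) / T))"
      by (rule sum_norm_le) (simp only: norm_mult, rule mult_left_mono[OF I(2) norm_ge_zero])
    also have "\<dots> = (\<Sum>s\<in>S. cmod (c s) * (if s0 = s then 0 else 2 * exp ((s0 - s) * R) / \<bar>s0 - s\<bar>)) / T"
      by (simp add: sum_divide_distrib)
    finally show ?thesis .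
  qed
  ultimately show ?thesis by auto
qed

text \<open>Cauchy's theorem moves the segment from abscissa R to \<sigma>, where exp(s0 w) is no
  larger; the two horizontal sides have fixed length and contribute O(1/T) to the mean.\<close>

lemma vertical_shift:
  fixes r :: "complex \<Rightarrow> complex"
  assumes hol: "r holomorphic_on {z. Re z > a}" and ab: "a < \<sigma>" "\<sigma> < R"
    and bd: "\<And>z. Re z \<ge> \<sigma> \<Longrightarrow> cmod (r z) \<le> B" and s0: "s0 \<ge> 0" and T: "T > 0"
    and I: "((\<lambda>w. r w * exp (complex_of_real s0 * w)) has_contour_integral I) (linepath (of_real R) (Complex R T))"
  shows "cmod (I / (\<i> * T)) \<le> B * exp (s0 * \<sigma>) + 2 * B * exp (s0 * R) * (R - \<sigma>) / T"
proof -
  let ?S = "{z. Re z > a}" and ?f = "\<lambda>w. r w * exp (complex_of_real s0 * w)"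
  have B0: "0 \<le> B" using bd[of "of_real \<sigma>"] norm_ge_zero[of "r (of_real \<sigma>)"] by (simp del: norm_ge_zero)
  have conv: "convex ?S" "open ?S" by (auto simp: convex_halfspace_Re_gt open_halfspace_Re_gt)
  have "?f holomorphic_on ?S" by (intro holomorphic_intros hol)
  then obtain F where F: "\<And>z. z \<in> ?S \<Longrightarrow> (F has_field_derivative ?f z) (at z within ?S)"
    using holomorphic_convex_primitive'[OF conv] by blast
  have prim: "(?f has_contour_integral (F v - F u)) (linepath u v)" if "u \<in> ?S" "v \<in> ?S" for u v
    using contour_integral_primitive[of ?S F ?f "linepath u v"] F closed_segment_subset[OF that conv(1)] by auto
  have bound: "cmod (F v - F u) \<le> B * exp (s0 * M) * cmod (v - u)"
    if uv: "\<sigma> \<le> Re u" "\<sigma> \<le> Re v" "Re u \<le> M" "Re v \<le> M" for u v M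
  proof (rule has_contour_integral_bound_linepath[OF prim])
    fix x assume "x \<in> closed_segment u v"
    then obtain t where t: "0 \<le> t" "t \<le> 1" "x = (1 - t) *\<^sub>R u + t *\<^sub>R v" by (auto simp: in_segment)
    have "Re x = (1 - t) * Re u + t * Re v" by (simp add: t)
    then have "\<sigma> \<le> Re x" "Re x \<le> M"
      using convex_bound_le[of "- Re u" "- \<sigma>" "- Re v" "1 - t" t] convex_bound_le[of "Re u" M "Re v" "1 - t" t] uv t by auto
    then show "cmod (?f x) \<le> B * exp (s0 * M)"
      using bd[of x] s0 B0 by (auto simp: norm_mult norm_exp_eq_Re intro!: mult_mono mult_left_mono)
  qed (use uv ab B0 in auto)
  let ?p = "of_real \<sigma> :: complex" and ?q = "Complex \<sigma> T" and ?u = "of_real R :: complex" and ?v = "Complex R T"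
  have "I = F ?v - F ?u"
    using has_contour_integral_unique[OF I prim] ab by simp
  then have "I = (F ?q - F ?p) + (F ?p - F ?u) + (F ?v - F ?q)" by simp
  then have "cmod I \<le> cmod (F ?q - F ?p) + cmod (F ?p - F ?u) + cmod (F ?v - F ?q)"
    by (metis norm_triangle_mono norm_triangle_ineq order_refl)
  also have "\<dots> \<le> B * exp (s0 * \<sigma>) * cmod (?q - ?p) + B * exp (s0 * R) * cmod (?p - ?u) + B * exp (s0 * R) * cmod (?v - ?q)"
    by (intro add_mono bound) (use ab in auto)
  also have "cmod (?q - ?p) = T"
    using T by (simp add: cmod_def)
  also have "cmod (?p - ?u) = R - \<sigma>"
    using ab by (simp add: cmod_def)
  also have "cmod (?v - ?q) = R - \<sigma>"
    using ab by (simp add: cmod_def)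
  finally have "cmod I / T \<le> (B * exp (s0 * \<sigma>) * T + B * exp (s0 * R) * (R - \<sigma>) + B * exp (s0 * R) * (R - \<sigma>)) / T"
    using T by (intro divide_right_mono) auto
  also have "\<dots> = B * exp (s0 * \<sigma>) + 2 * B * exp (s0 * R) * (R - \<sigma>) / T"
    using T by (simp add: add_divide_distrib)
  finally show ?thesis using T by (simp add: norm_divide norm_mult)
qed

text \<open>Cauchy estimates: the series is only known to converge for Re z >= R, but its
  coefficients obey the bound of the continued function at abscissa \<sigma>. For negative \<sigma>
  this is exponential decay along the exponents.\<close>

lemma dser_coeffs:
  assumes G: "nrm (fd G R)" "G \<subseteq> {0..}" "countable G" and r: "dser G R r"
    and hol: "r holomorphic_on {z. Re z > a}" and ab: "a < \<sigma>" "\<sigma> < R"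
    and bd: "\<And>z. Re z \<ge> \<sigma> \<Longrightarrow> cmod (r z) \<le> B"
  shows "\<exists>d. (\<forall>s\<in>G. cmod (d s) \<le> B * exp (s * \<sigma>)) \<and>
    (\<forall>z. Re z \<ge> R \<longrightarrow> r z = infsetsum (\<lambda>s. d s * exp (- (complex_of_real s * z))) G)"
proof -
  interpret nrm "fd G R" by fact
  obtain T \<gamma> where T: "\<And>m. fd G R (T m) (\<gamma> m)" "summable \<gamma>" "\<And>z. Re z \<ge> R \<Longrightarrow> (\<lambda>m. T m z) sums r z"
    using r unfolding dser_def by blast
  obtain S c where S: "\<And>m. finite (S m)" "\<And>m. S m \<subseteq> G"
    "\<And>m z. T m z = (\<Sum>s\<in>S m. c m s * exp (- (complex_of_real s * z)))"
    "\<And>m. (\<Sum>s\<in>S m. cmod (c m s) * exp (- (R * s))) \<le> \<gamma> m"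
  proof -
    have "\<forall>m. \<exists>S c. finite S \<and> S \<subseteq> G \<and> (\<forall>z. T m z = (\<Sum>s\<in>S. c s * exp (- (complex_of_real s * z)))) \<and>
       (\<Sum>s\<in>S. cmod (c s) * exp (- (R * s))) \<le> \<gamma> m"
      using T(1) unfolding fd_def by blast
    then have "\<exists>S c. \<forall>m. finite (S m) \<and> S m \<subseteq> G \<and> (\<forall>z. T m z = (\<Sum>s\<in>S m. c m s * exp (- (complex_of_real s * z)))) \<and>
       (\<Sum>s\<in>S m. cmod (c m s) * exp (- (R * s))) \<le> \<gamma> m"
      by (simp only: choice_iff)
    then show ?thesis using that by blast
  qed
  define e where "e m s = (if s \<in> S m then c m s else 0)" for m s
  have g0: "0 \<le> \<gamma> m" for m by (rule nonneg[OF T(1)])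
  have es: "cmod (e m s) * exp (- (R * s)) \<le> \<gamma> m" for m s
  proof (cases "s \<in> S m")
    case True
    have "cmod (c m s) * exp (- (R * s)) \<le> (\<Sum>s\<in>S m. cmod (c m s) * exp (- (R * s)))"
      by (rule member_le_sum[OF True]) (auto simp: S)
    then show ?thesis using True S(4)[of m] by (simp add: e_def)
  qed (simp add: e_def g0)
  have es': "cmod (e m s) \<le> \<gamma> m * exp (R * s)" for m s
    using es[of m s] by (simp add: exp_minus field_simps)
  have sume: "summable (\<lambda>m. norm (e m s))" for s
    by (rule summable_comparison_test[OF _ summable_mult2[OF T(2), of "exp (R * s)"]]) (use es' in auto)
  define d where "d s = (\<Sum>m. e m s)" for s
  have dbound: "cmod (d s0) \<le> B * exp (s0 * \<sigma>)" if s0G: "s0 \<in> G" for s0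
  proof -
    have s0: "s0 \<ge> 0" using s0G G(2) by auto
    have main: "cmod (\<Sum>m<M. e m s0) \<le> B * exp (s0 * \<sigma>) + (\<Sum>m. \<gamma> (m + M)) * exp (s0 * R)" for M
    proof -
      let ?t = "\<Sum>m. \<gamma> (m + M)"
      \<comment> \<open>Collects the errors that vanish as the segment grows with M fixed. The tail
        of the series beyond M contributes a term independent of the length; letting M grow
        afterwards removes it.\<close>
      define K where "K = 2 * B * exp (s0 * R) * (R - \<sigma>) + (\<Sum>m<M. \<Sum>s\<in>S m. cmod (c m s) * (if s0 = s then 0 else 2 * exp ((s0 - s) * R) / \<bar>s0 - s\<bar>))"
      have "cmod (\<Sum>m<M. e m s0) \<le> B * exp (s0 * \<sigma>) + ?t * exp (s0 * R) + K / \<theta>" if \<theta>: "\<theta> > 0" for \<theta>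
      proof -
        let ?l = "linepath (of_real R) (Complex R \<theta>)"
        have "\<exists>I. ((\<lambda>w. T m w * exp (complex_of_real s0 * w)) has_contour_integral I) ?l \<and>
          cmod (I / (\<i> * \<theta>) - e m s0) \<le> (\<Sum>s\<in>S m. cmod (c m s) * (if s0 = s then 0 else 2 * exp ((s0 - s) * R) / \<bar>s0 - s\<bar>)) / \<theta>" for m
          using dirichlet_mean[OF S(1)[of m] \<theta>, of "c m" s0 R] unfolding S(3) e_def .
        then have "\<exists>I. \<forall>m. ((\<lambda>w. T m w * exp (complex_of_real s0 * w)) has_contour_integral I m) ?l \<and>
          cmod (I m / (\<i> * \<theta>) - e m s0) \<le> (\<Sum>s\<in>S m. cmod (c m s) * (if s0 = s then 0 else 2 * exp ((s0 - s) * R) / \<bar>s0 - s\<bar>)) / \<theta>"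
          by (intro choice allI)
        then obtain I where I: "\<And>m. ((\<lambda>w. T m w * exp (complex_of_real s0 * w)) has_contour_integral I m) ?l"
          "\<And>m. cmod (I m / (\<i> * \<theta>) - e m s0) \<le> (\<Sum>s\<in>S m. cmod (c m s) * (if s0 = s then 0 else 2 * exp ((s0 - s) * R) / \<bar>s0 - s\<bar>)) / \<theta>"
          by blast
        have seg: "Re x = R" if "x \<in> closed_segment (of_real R) (Complex R \<theta>)" for x
        proof -
          obtain u where "x = (1 - u) *\<^sub>R complex_of_real R + u *\<^sub>R Complex R \<theta>"
            using \<open>x \<in> _\<close> by (auto simp: in_segment)
          then have "Re x = (1 - u) * R + u * R" by simp
          then show ?thesis by (simp add: algebra_simps)
        qed
        have seg': "closed_segment (of_real R) (Complex R \<theta>) \<subseteq> {z. Re z > a}" using seg ab by auto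
        have "(\<lambda>w. r w * exp (complex_of_real s0 * w)) contour_integrable_on ?l"
          by (intro contour_integrable_holomorphic_simple[where S="{z. Re z > a}"] holomorphic_intros hol)
            (use seg' in \<open>auto simp: open_halfspace_Re_gt\<close>)
        then obtain J where J: "((\<lambda>w. r w * exp (complex_of_real s0 * w)) has_contour_integral J) ?l"
          by (auto simp: contour_integrable_on_def)
        have "((\<lambda>w. r w * exp (complex_of_real s0 * w) - (\<Sum>m<M. T m w * exp (complex_of_real s0 * w))) has_contour_integral (J - (\<Sum>m<M. I m))) ?l"
          by (intro has_contour_integral_diff J has_contour_integral_sum I) auto
        then have "cmod (J - (\<Sum>m<M. I m)) \<le> ?t * exp (s0 * R) * cmod (Complex R \<theta> - of_real R)"
        proof (rule has_contour_integral_bound_linepath)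
          show "0 \<le> ?t * exp (s0 * R)"
            using g0 T(2) by (intro mult_nonneg_nonneg suminf_nonneg) (auto simp: summable_iff_shift)
          fix w assume "w \<in> closed_segment (of_real R) (Complex R \<theta>)"
          then have w: "Re w = R" by (rule seg)
          then have sm: "(\<lambda>m. T m w) sums r w" by (intro T(3)) simp
          have "r w - (\<Sum>m<M. T m w) = (\<Sum>m. T (m + M) w)"
            using suminf_minus_initial_segment[OF sums_summable[OF sm], of M] sums_unique[OF sm] by simp
          moreover have "cmod (\<Sum>m. T (m + M) w) \<le> ?t"
            using fd_bound[OF T(1) _ G(2)] w T(2) by (intro norm_suminf_le) (auto simp: summable_iff_shift)
          ultimately have "cmod (r w - (\<Sum>m<M. T m w)) \<le> ?t" by simp
          then show "cmod (r w * exp (complex_of_real s0 * w) - (\<Sum>m<M. T m w * exp (complex_of_real s0 * w))) \<le> ?t * exp (s0 * R)"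
            using w by (simp add: sum_distrib_right[symmetric] left_diff_distrib[symmetric] norm_mult norm_exp_eq_Re mult_right_mono)
        qed
        then have "cmod (J - (\<Sum>m<M. I m)) / \<theta> \<le> ?t * exp (s0 * R)"
          using \<theta> by (simp add: cmod_def field_simps)
        then have h1: "cmod ((\<Sum>m<M. I m) / (\<i> * \<theta>) - J / (\<i> * \<theta>)) \<le> ?t * exp (s0 * R)"
          using \<theta> by (simp add: diff_divide_distrib[symmetric] norm_divide norm_mult norm_minus_commute)
        have h2: "cmod (J / (\<i> * \<theta>)) \<le> B * exp (s0 * \<sigma>) + 2 * B * exp (s0 * R) * (R - \<sigma>) / \<theta>"
          by (rule vertical_shift[OF hol ab bd s0 \<theta> J])
        have "cmod (\<Sum>m<M. I m / (\<i> * \<theta>) - e m s0) \<le> (\<Sum>m<M. (\<Sum>s\<in>S m. cmod (c m s) * (if s0 = s then 0 else 2 * exp ((s0 - s) * R) / \<bar>s0 - s\<bar>)) / \<theta>)"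
          by (rule sum_norm_le) (rule I(2))
        then have h3: "cmod ((\<Sum>m<M. e m s0) - (\<Sum>m<M. I m) / (\<i> * \<theta>)) \<le> (\<Sum>m<M. \<Sum>s\<in>S m. cmod (c m s) * (if s0 = s then 0 else 2 * exp ((s0 - s) * R) / \<bar>s0 - s\<bar>)) / \<theta>"
          by (simp only: sum_subtractf sum_divide_distrib norm_minus_commute)
        have "(\<Sum>m<M. e m s0) = ((\<Sum>m<M. e m s0) - (\<Sum>m<M. I m) / (\<i> * \<theta>)) + ((\<Sum>m<M. I m) / (\<i> * \<theta>) - J / (\<i> * \<theta>)) + J / (\<i> * \<theta>)"
          by simp
        then have "cmod (\<Sum>m<M. e m s0) \<le> cmod ((\<Sum>m<M. e m s0) - (\<Sum>m<M. I m) / (\<i> * \<theta>)) + cmod ((\<Sum>m<M. I m) / (\<i> * \<theta>) - J / (\<i> * \<theta>)) + cmod (J / (\<i> * \<theta>))"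
          by (metis norm_triangle_mono norm_triangle_ineq order_refl)
        then show ?thesis using h1 h2 h3 by (simp add: K_def add_divide_distrib)
      qed
      then have "\<forall>\<^sub>F \<theta> in at_top. cmod (\<Sum>m<M. e m s0) \<le> B * exp (s0 * \<sigma>) + ?t * exp (s0 * R) + K / \<theta>"
        using eventually_gt_at_top[of 0] by (rule eventually_mono[rotated])
      moreover have "((\<lambda>\<theta>. B * exp (s0 * \<sigma>) + ?t * exp (s0 * R) + K / \<theta>) \<longlongrightarrow> B * exp (s0 * \<sigma>) + ?t * exp (s0 * R) + 0) at_top"
        by (intro tendsto_intros tendsto_divide_0[OF tendsto_const] filterlim_at_top_imp_at_infinity filterlim_ident)
      ultimately show ?thesis using tendsto_lowerbound by fastforce
    qed
    have "(\<lambda>M. cmod (\<Sum>m<M. e m s0)) \<longlonglongrightarrow> cmod (d s0)"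
      unfolding d_def by (intro tendsto_norm summable_LIMSEQ summable_norm_cancel[OF sume])
    moreover have "(\<lambda>M. B * exp (s0 * \<sigma>) + (\<Sum>m. \<gamma> (m + M)) * exp (s0 * R)) \<longlonglongrightarrow> B * exp (s0 * \<sigma>) + 0 * exp (s0 * R)"
      by (intro tendsto_intros suminf_exist_split2 T(2))
    ultimately show ?thesis using LIMSEQ_le[of _ _ _ "B * exp (s0 * \<sigma>) + 0 * exp (s0 * R)"] main by fastforce
  qed
  \<comment> \<open>The sum over polynomials and the sum over exponents may be exchanged because the
    double family converges absolutely: its inner sums are at most \<gamma> m.\<close>
  have rep: "r z = infsetsum (\<lambda>s. d s * exp (- (complex_of_real s * z))) G" if z: "Re z \<ge> R" for z
  proof -
    let ?f = "\<lambda>m s. e m s * exp (- (complex_of_real s * z))"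
    have fin: "infsetsum (\<lambda>s. g s * (if s \<in> S m then 1 else 0)) G = (\<Sum>s\<in>S m. g s)" for m and g :: "real \<Rightarrow> 'x::{real_normed_field,banach,second_countable_topology}"
    proof -
      have "infsetsum (\<lambda>s. g s * (if s \<in> S m then 1 else 0)) G = infsetsum g (S m)"
        by (rule infsetsum_cong_neutral) (use S(2) in auto)
      then show ?thesis using S(1) by simp
    qed
    have fe: "?f m s = (c m s * exp (- (complex_of_real s * z))) * (if s \<in> S m then 1 else 0)" for m s
      by (simp add: e_def)
    have fn: "norm (?f m s) = (cmod (c m s) * exp (- (s * Re z))) * (if s \<in> S m then 1 else 0)" for m s
      by (simp add: e_def norm_mult norm_exp_eq_Re)
    have Tm: "infsetsum (?f m) G = T m z" for m unfolding fe S(3) by (rule fin)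
    have "Infinite_Set_Sum.abs_summable_on (\<lambda>(m, s). ?f m s) (UNIV \<times> G)"
    proof (subst abs_summable_on_Sigma_iff, simp, simp add: G(3), intro conjI ballI)
      show "Infinite_Set_Sum.abs_summable_on (\<lambda>s. case (m, s) of (m, s) \<Rightarrow> ?f m s) (G)" for m
      proof -
        have "Infinite_Set_Sum.abs_summable_on (\<lambda>s. ?f m s) (S m)" using S(1) by simp
        then have "Infinite_Set_Sum.abs_summable_on (\<lambda>s. ?f m s) (G)"
          by (subst abs_summable_on_cong_neutral[of G "S m"]) (use S(2) in \<open>auto simp: e_def\<close>)
        then show ?thesis by simp
      qed
      have "infsetsum (\<lambda>s. norm (?f m s)) G \<le> \<gamma> m" for m
      proof -
        have "infsetsum (\<lambda>s. norm (?f m s)) G = (\<Sum>s\<in>S m. cmod (c m s) * exp (- (s * Re z)))" unfolding fn by (rule fin)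
        also have "\<dots> \<le> (\<Sum>s\<in>S m. cmod (c m s) * exp (- (R * s)))"
          using z S(2)[of m] G(2) by (intro sum_mono mult_left_mono) (auto simp: mult.commute[of R] intro!: mult_left_mono)
        finally show ?thesis using S(4)[of m] by linarith
      qed
      moreover have "0 \<le> infsetsum (\<lambda>s. norm (?f m s)) G" for m by (rule infsetsum_nonneg) simp
      ultimately show "Infinite_Set_Sum.abs_summable_on (\<lambda>m. infsetsum (\<lambda>s. norm (case (m, s) of (m, s) \<Rightarrow> ?f m s)) G) (UNIV)"
        unfolding abs_summable_on_nat_iff' using T(2) by (intro summable_comparison_test[OF _ T(2)]) auto
    qed
    then have "infsetsum (\<lambda>m. infsetsum (?f m) G) UNIV = infsetsum (\<lambda>s. infsetsum (\<lambda>m. ?f m s) UNIV) G"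
      by (intro infsetsum_swap G(3)) auto
    moreover have "infsetsum (\<lambda>m. infsetsum (?f m) G) UNIV = r z"
    proof -
      have "summable (\<lambda>m. norm (T m z))"
        using T(2) by (rule summable_comparison_test[rotated]) (use fd_bound[OF T(1) z G(2)] in auto)
      then show ?thesis unfolding Tm using sums_unique[OF T(3)[OF z], symmetric] by (subst infsetsum_nat') (auto simp: abs_summable_on_nat_iff')
    qed
    moreover have "infsetsum (\<lambda>m. ?f m s) UNIV = d s * exp (- (complex_of_real s * z))" for s
    proof -
      have "summable (\<lambda>m. norm (?f m s))" using sume[of s] by (auto simp: norm_mult intro: summable_mult2)
      then show ?thesis using suminf_mult2[OF summable_norm_cancel[OF sume[of s]], of "exp (- (complex_of_real s * z))"]
        by (subst infsetsum_nat') (auto simp: abs_summable_on_nat_iff' d_def)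
    qed
    ultimately show ?thesis by simp
  qed
  show ?thesis using dbound rep by blast
qed

section \<open>Finitely generated monoids of exponents\<close>

fun mon :: "real list \<Rightarrow> real set" where
  "mon [] = {0}"
| "mon (t # ts) = (\<lambda>(s, k). s + real k * t) ` (mon ts \<times> (UNIV :: nat set))"

lemma mon_countable: "countable (mon ts)"
  by (induction ts) (auto intro: countable_image countable_SIGMA)

lemma mon_subset: "mon ts \<subseteq> mon (t # ts)"
  by (force simp: image_iff)

lemma mon_zero: "0 \<in> mon ts"
proof (induction ts)
  case (Cons t ts)
  then show ?case using mon_subset by blast
qed simp

lemma mon_add: "s \<in> mon ts \<Longrightarrow> u \<in> mon ts \<Longrightarrow> s + u \<in> mon ts"
proof (induction ts arbitrary: s u)
  case (Cons t ts)
  then obtain s' k u' l where *: "s' \<in> mon ts" "u' \<in> mon ts" "s = s' + real k * t" "u = u' + real l * t" by auto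
  then have "s + u = (\<lambda>(s, k). s + real k * t) (s' + u', k + l)" by (simp add: algebra_simps)
  moreover have "(s' + u', k + l) \<in> mon ts \<times> UNIV" using Cons.IH * by auto
  ultimately show ?case unfolding mon.simps by (rule image_eqI)
qed simp

lemma mon_gen: "t \<in> set ts \<Longrightarrow> t \<in> mon ts"
proof (induction ts)
  case (Cons u ts)
  show ?case
  proof (cases "t = u")
    case True
    have "(0, 1) \<in> mon ts \<times> (UNIV :: nat set)" using mon_zero by simp
    then show ?thesis unfolding True mon.simps by (rule image_eqI[rotated]) simp
  next
    case False
    then show ?thesis using Cons mon_subset by auto
  qed
qed simp

lemma mon_nonneg: "(\<And>t. t \<in> set ts \<Longrightarrow> 0 \<le> t) \<Longrightarrow> mon ts \<subseteq> {0..}"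
  by (induction ts) force+

lemma mon_nrm: "nrm (fd (mon ts) R)"
  by (rule fd_nrm) (auto intro: mon_zero mon_add)

text \<open>The sum is dominated by a product of geometric series, one for each of the finitely many
  positive generators; repeated representations of an exponent only enlarge the product.\<close>

lemma mon_summable:
  assumes "\<And>t. t \<in> set ts \<Longrightarrow> 0 < t" "\<kappa> > 0"
  shows "Infinite_Set_Sum.abs_summable_on (\<lambda>s. exp (- (\<kappa> * s))) (mon ts)"
  using assms(1)
proof (induction ts)
  case (Cons t ts)
  have eq: "exp (- (\<kappa> * (s + real k * t))) = exp (- (\<kappa> * s)) * exp (- (\<kappa> * t)) ^ k" for s k
    by (simp add: exp_of_nat_mult[symmetric] mult_exp_exp algebra_simps)
  have q: "exp (- (\<kappa> * t)) < 1" using Cons.prems[of t] assms(2) by simp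
  have IH: "Infinite_Set_Sum.abs_summable_on (\<lambda>s. exp (- (\<kappa> * s))) (mon ts)" using Cons by simp
  have geo: "Infinite_Set_Sum.abs_summable_on (\<lambda>k. exp (- (\<kappa> * t)) ^ k) (UNIV :: nat set)"
    using q by (simp add: abs_summable_on_nat_iff' summable_geometric)
  have "Infinite_Set_Sum.abs_summable_on (\<lambda>(s, k). exp (- (\<kappa> * s)) * exp (- (\<kappa> * t)) ^ k) (mon ts \<times> (UNIV :: nat set))"
  proof (subst abs_summable_on_Sigma_iff, rule mon_countable, simp, intro conjI ballI)
    fix s
    show "Infinite_Set_Sum.abs_summable_on (\<lambda>k. case (s, k) of (s, k) \<Rightarrow> exp (- (\<kappa> * s)) * exp (- (\<kappa> * t)) ^ k) (UNIV :: nat set)"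
      using abs_summable_on_cmult_right[OF geo] by simp
  next
    have "infsetsum (\<lambda>k. norm (case (s, k) of (s, k) \<Rightarrow> exp (- (\<kappa> * s)) * exp (- (\<kappa> * t)) ^ k)) (UNIV :: nat set)
        = exp (- (\<kappa> * s)) * infsetsum (\<lambda>k. exp (- (\<kappa> * t)) ^ k) (UNIV :: nat set)" for s
      using infsetsum_cmult_right[OF geo] by (simp add: norm_mult norm_power)
    then show "Infinite_Set_Sum.abs_summable_on (\<lambda>s. infsetsum (\<lambda>k. norm (case (s, k) of (s, k) \<Rightarrow> exp (- (\<kappa> * s)) * exp (- (\<kappa> * t)) ^ k)) (UNIV :: nat set)) (mon ts)"
      using abs_summable_on_cmult_left[OF IH] by simp
  qed
  then show ?case
    unfolding mon.simps by (intro abs_summable_on_reindex) (simp add: eq case_prod_beta')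
qed simp

text \<open>Shifting the argument by \<nu> multiplies the coefficient at s by exp(\<nu> s), leaving
  the bound B exp((\<sigma> + \<nu>) s). The resulting factor depends on the monoid, \<sigma> and
  \<nu> but not on r, so all powers of an inverse are estimated by their suprema.\<close>

lemma dirichlet_mlt:
  assumes ts: "\<And>t. t \<in> set ts \<Longrightarrow> 0 < t" and r: "dser (mon ts) R r"
    and hol: "r holomorphic_on {z. Re z > a}" and ab: "a < \<sigma>" "\<sigma> < R" and \<nu>: "\<sigma> + \<nu> < 0"
    and bd: "\<And>z. Re z \<ge> \<sigma> \<Longrightarrow> cmod (r z) \<le> B"
  shows "mlt (\<lambda>z. r (complex_of_real (z - \<nu>))) (B * infsetsum (\<lambda>s. exp (- (- (\<sigma> + \<nu>) * s))) (mon ts))"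
proof -
  let ?G = "mon ts"
  have nn: "?G \<subseteq> {0..}" by (rule mon_nonneg) (use ts in force)
  obtain d where d: "\<And>s. s \<in> ?G \<Longrightarrow> cmod (d s) \<le> B * exp (s * \<sigma>)"
     "\<And>z. Re z \<ge> R \<Longrightarrow> r z = infsetsum (\<lambda>s. d s * exp (- (complex_of_real s * z))) ?G"
    using dser_coeffs[OF mon_nrm nn mon_countable r hol ab bd] by blast
  let ?w = "\<lambda>s. d s * complex_of_real (exp (\<nu> * s))"
  let ?e = "\<lambda>s. exp (- (- (\<sigma> + \<nu>) * s))"
  have es: "Infinite_Set_Sum.abs_summable_on ?e ?G" by (rule mon_summable[OF ts]) (use \<nu> in auto)
  have wb: "cmod (?w s) \<le> B * ?e s" if "s \<in> ?G" for s
  proof -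
    have "cmod (?w s) \<le> B * exp (s * \<sigma>) * exp (\<nu> * s)" using d(1)[OF that] by (simp add: norm_mult)
    then show ?thesis by (simp add: mult_exp_exp algebra_simps)
  qed
  have ws: "Infinite_Set_Sum.abs_summable_on ?w ?G"
    by (rule abs_summable_on_comparison_test'[OF abs_summable_on_cmult_right[OF es]]) (rule wb)
  interpret k: delay_kernel "count_space ?G" ?w "\<lambda>s. s"
    unfolding delay_kernel_def delay_kernel_axioms_def
    using ws by (auto simp: abs_summable_on_def intro: sigma_finite_measure_count_space_countable mon_countable)
  have m: "mlt (\<lambda>z. \<integral>s. ?w s * complex_of_real (exp (- (z * s))) \<partial>count_space ?G) (\<integral>s. cmod (?w s) \<partial>count_space ?G)"
    by (rule k.mlt_kernel) (use nn in auto)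
  have "(\<integral>s. cmod (?w s) \<partial>count_space ?G) \<le> (\<integral>s. B * ?e s \<partial>count_space ?G)"
    using ws abs_summable_on_cmult_right[OF es, of B] wb
    by (intro integral_mono) (auto simp: abs_summable_on_def)
  also have "\<dots> = B * infsetsum ?e ?G" by (simp add: infsetsum_def)
  finally have m2: "mlt (\<lambda>z. \<integral>s. ?w s * complex_of_real (exp (- (z * s))) \<partial>count_space ?G) (B * infsetsum ?e ?G)"
    by (rule mlt.mono[OF m])
  show ?thesis
  proof (rule mlt_cong[OF m2], rule eventually_mono[OF eventually_ge_at_top[of "R + \<nu>"]])
    fix z assume z: "R + \<nu> \<le> z"
    have eqw: "?w s * complex_of_real (exp (- (z * s))) = d s * exp (- (complex_of_real s * complex_of_real (z - \<nu>)))" for s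
    proof -
      have "exp (- (complex_of_real s * complex_of_real (z - \<nu>))) = complex_of_real (exp (\<nu> * s)) * complex_of_real (exp (- (z * s)))"
        by (simp add: exp_of_real[symmetric] mult_exp_exp algebra_simps flip: of_real_mult)
      then show ?thesis by simp
    qed
    show "(\<integral>s. ?w s * complex_of_real (exp (- (z * s))) \<partial>count_space ?G) = r (complex_of_real (z - \<nu>))"
      unfolding eqw using d(2)[of "complex_of_real (z - \<nu>)"] z by (simp add: infsetsum_def)
  qed
qed

text \<open>Newman's argument: \<open>F\<close> is inverted by the Neumann series around a nearby Dirichlet polynomial \<open>P\<close>.
  The norms of the powers \<open>P ^- n\<close> grow no faster than their suprema, because the coefficients of
  \<open>P ^- n\<close> are bounded by its supremum and decay exponentially along the exponents, which are
  sparse in the finitely generated monoid \<open>mon ts\<close>.\<close>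

lemma newman_inverse:
  fixes F P :: "complex \<Rightarrow> complex"
  assumes ts: "\<And>t. t \<in> set ts \<Longrightarrow> 0 < t" and fdP: "fd (mon ts) R (\<lambda>z. 1 - P z) (1 / 2)"
    and hol: "P holomorphic_on {z. Re z > a}" and ab: "a < \<sigma>" "\<sigma> < R" and \<nu>: "\<sigma> + \<nu> < 0"
    and B: "B > 0" "\<And>z. Re z > a \<Longrightarrow> cmod (P z) \<ge> 1 / B"
    and FP: "mlt (\<lambda>z. F (complex_of_real (z - \<nu>)) - P (complex_of_real (z - \<nu>))) \<delta>" and \<delta>: "\<delta> * B \<le> 1 / 2"
    and \<epsilon>: "\<epsilon> > 0"
  shows "\<exists>W C. mlt W C \<and> mlt (\<lambda>z. W z * F (complex_of_real (z - \<nu>)) - 1) \<epsilon>"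
proof -
  let ?z = "\<lambda>z. complex_of_real (z - \<nu>)"
  define \<Sigma> where "\<Sigma> = infsetsum (\<lambda>s. exp (- (- (\<sigma> + \<nu>) * s))) (mon ts)"
  have \<Sigma>: "0 \<le> \<Sigma>" unfolding \<Sigma>_def by (rule infsetsum_nonneg) simp
  have nn: "mon ts \<subseteq> {0..}" by (rule mon_nonneg) (use ts in force)
  have P0: "P z \<noteq> 0" if "Re z > a" for z using B(2)[OF that] B(1) by auto
  have Pn: "mlt (\<lambda>z. 1 / P (?z z) ^ n) (B ^ n * \<Sigma>)" for n
    unfolding \<Sigma>_def
  proof (rule dirichlet_mlt[OF ts dser_inverse[OF mon_nrm nn fdP] _ ab \<nu>])
    show "(\<lambda>z. 1 / P z ^ n) holomorphic_on {z. Re z > a}"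
      by (intro holomorphic_intros hol) (use P0 in auto)
    show "cmod (1 / P z ^ n) \<le> B ^ n" if "Re z \<ge> \<sigma>" for z
    proof -
      have "1 / cmod (P z) \<le> B" using B(2)[of z] B(1) that ab P0[of z] by (simp add: field_simps)
      then have "(1 / cmod (P z)) ^ n \<le> B ^ n" by (intro power_mono) auto
      then show ?thesis by (simp add: norm_divide norm_power power_divide)
    qed
  qed
  have \<delta>0: "0 \<le> \<delta>" using FP by (rule mlt.nonneg)
  \<comment> \<open>The remainder of the Neumann series has bound (\<delta> B)^m \<Sigma> with
    \<delta> B <= 1/2, and \<Sigma> does not depend on m.\<close>
  obtain m where m: "(1 / 2) ^ m * (\<Sigma> + 1) < \<epsilon>"
    using real_arch_pow_inv[of "\<epsilon> / (\<Sigma> + 1)" "1/2"] \<epsilon> \<Sigma> by (auto simp: field_simps)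
  define W where "W z = (\<Sum>n<m. (P (?z z) - F (?z z)) ^ n * (1 / P (?z z) ^ Suc n))" for z
  have PF: "mlt (\<lambda>z. P (?z z) - F (?z z)) \<delta>" using mlt.uminus[OF FP] by simp
  have "mlt W (\<Sum>n<m. \<delta> ^ n * (B ^ Suc n * \<Sigma>))"
    unfolding W_def[abs_def] by (intro mlt.sum mlt.mult mlt.power PF Pn)
  moreover have "mlt (\<lambda>z. W z * F (?z z) - 1) \<epsilon>"
  proof (rule mlt_cong)
    have "mlt (\<lambda>z. - ((P (?z z) - F (?z z)) ^ m * (1 / P (?z z) ^ m))) (\<delta> ^ m * (B ^ m * \<Sigma>))"
      by (intro mlt.uminus mlt.mult mlt.power PF Pn)
    moreover have "\<delta> ^ m * (B ^ m * \<Sigma>) \<le> \<epsilon>"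
    proof -
      have "(\<delta> * B) ^ m \<le> (1 / 2) ^ m" using \<delta> \<delta>0 B by (intro power_mono) auto
      then have "(\<delta> * B) ^ m * \<Sigma> \<le> (1 / 2) ^ m * (\<Sigma> + 1)" using \<Sigma> by (intro mult_mono) auto
      then show ?thesis using m by (simp add: power_mult_distrib mult.assoc)
    qed
    ultimately show "mlt (\<lambda>z. - ((P (?z z) - F (?z z)) ^ m * (1 / P (?z z) ^ m))) \<epsilon>" by (rule mlt.mono)
    show "\<forall>\<^sub>F z in at_top. - ((P (?z z) - F (?z z)) ^ m * (1 / P (?z z) ^ m)) = W z * F (?z z) - 1"
    proof (rule eventually_mono[OF eventually_gt_at_top[of "a + \<nu>"]])
      fix z :: real assume "a + \<nu> < z"
      then have p: "P (?z z) \<noteq> 0" by (intro P0) simp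
      let ?u = "(P (?z z) - F (?z z)) / P (?z z)"
      have "W z * F (?z z) = (\<Sum>n<m. ?u ^ n) * (1 - ?u)"
        unfolding W_def sum_distrib_right using p
        by (intro sum.cong) (auto simp: field_simps)
      also have "\<dots> = 1 - ?u ^ m" using one_diff_power_eq[of ?u m] by (simp add: mult.commute)
      finally show "- ((P (?z z) - F (?z z)) ^ m * (1 / P (?z z) ^ m)) = W z * F (?z z) - 1"
        by (simp add: power_divide)
    qed
  qed
  ultimately show ?thesis by blast
qed

section \<open>Delay series and the determinant of the principal part\<close>

definition ser :: "(nat \<Rightarrow> real) \<Rightarrow> (nat \<Rightarrow> real) \<Rightarrow> complex \<Rightarrow> complex" where
  "ser c t z = (\<Sum>k. complex_of_real (c k) * exp (- (complex_of_real (t k) * z)))"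

lemma ser_term_bound:
  assumes t: "0 \<le> t" "t \<le> T" and z: "Re z \<ge> - \<nu>" and \<nu>: "0 \<le> \<nu>"
  shows "cmod (complex_of_real c * exp (- (complex_of_real t * z))) \<le> \<bar>c\<bar> * exp (\<nu> * T)"
proof -
  have "- (t * Re z) \<le> t * \<nu>" using mult_left_mono[OF z t(1)] by simp
  also have "\<dots> \<le> \<nu> * T" using t \<nu> mult_left_mono[of t T \<nu>] by (simp add: mult.commute)
  finally show ?thesis by (simp add: norm_mult norm_exp_eq_Re mult_left_mono)
qed

lemma ser_summable:
  assumes c: "summable (\<lambda>k. \<bar>c k\<bar>)" and t: "\<And>k. 0 \<le> t k \<and> t k \<le> T"
  shows "summable (\<lambda>k. cmod (complex_of_real (c k) * exp (- (complex_of_real (t k) * z))))"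
proof (rule summable_comparison_test)
  show "\<exists>N. \<forall>n\<ge>N. norm (cmod (complex_of_real (c n) * exp (- (complex_of_real (t n) * z)))) \<le> \<bar>c n\<bar> * exp (\<bar>Re z\<bar> * T)"
    using t by (intro exI[of _ 0] allI impI) (auto intro!: ser_term_bound)
qed (use c in \<open>auto intro: summable_mult2\<close>)

lemma ser_bound:
  assumes c: "summable (\<lambda>k. \<bar>c k\<bar>)" and t: "\<And>k. 0 \<le> t k \<and> t k \<le> T" and z: "Re z \<ge> - \<nu>" and \<nu>: "0 \<le> \<nu>"
  shows "cmod (ser c t z) \<le> (\<Sum>k. \<bar>c k\<bar>) * exp (\<nu> * T)"
  unfolding ser_def suminf_mult2[OF c]
  by (intro norm_suminf_le ser_term_bound summable_mult2 c) (use t z \<nu> in auto)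

lemma ser_mlt:
  assumes c: "summable (\<lambda>k. \<bar>c k\<bar>)" and t: "\<And>k. 0 \<le> t k \<and> t k \<le> T" and \<nu>: "0 \<le> \<nu>"
  shows "mlt (\<lambda>z. ser c t (complex_of_real (z - \<nu>))) ((\<Sum>k. \<bar>c k\<bar>) * exp (\<nu> * T))"
proof -
  let ?w = "\<lambda>k. complex_of_real (c k * exp (\<nu> * t k))"
  have wb: "cmod (?w k) \<le> \<bar>c k\<bar> * exp (\<nu> * T)" for k
    using t[of k] \<nu> by (simp add: norm_mult mult_left_mono)
  have ws: "summable (\<lambda>k. cmod (?w k))"
    by (rule summable_comparison_test[OF _ summable_mult2[OF c, of "exp (\<nu> * T)"]]) (use wb in auto)
  interpret k: delay_kernel "count_space (UNIV :: nat set)" ?w t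
    unfolding delay_kernel_def delay_kernel_axioms_def
    using ws by (auto simp: integrable_count_space_nat_iff intro: sigma_finite_measure_count_space_countable)
  have m: "mlt (\<lambda>z. \<integral>k. ?w k * complex_of_real (exp (- (z * t k))) \<partial>count_space UNIV) (\<integral>k. cmod (?w k) \<partial>count_space UNIV)"
    by (rule k.mlt_kernel) (use t in auto)
  have "(\<integral>k. cmod (?w k) \<partial>count_space UNIV) = (\<Sum>k. cmod (?w k))"
    using ws by (intro integral_count_space_nat) (simp add: integrable_count_space_nat_iff)
  also have "\<dots> \<le> (\<Sum>k. \<bar>c k\<bar> * exp (\<nu> * T))" by (rule suminf_le[OF wb ws summable_mult2[OF c]])
  also have "\<dots> = (\<Sum>k. \<bar>c k\<bar>) * exp (\<nu> * T)" by (rule suminf_mult2[OF c, symmetric])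
  finally have m2: "mlt (\<lambda>z. \<integral>k. ?w k * complex_of_real (exp (- (z * t k))) \<partial>count_space UNIV) ((\<Sum>k. \<bar>c k\<bar>) * exp (\<nu> * T))"
    by (rule mlt.mono[OF m])
  have "(\<integral>k. ?w k * complex_of_real (exp (- (z * t k))) \<partial>count_space UNIV) = ser c t (complex_of_real (z - \<nu>))" for z
  proof -
    have eq: "?w k * complex_of_real (exp (- (z * t k))) = complex_of_real (c k) * exp (- (complex_of_real (t k) * complex_of_real (z - \<nu>)))" for k
    proof -
      have "exp (- (complex_of_real (t k) * complex_of_real (z - \<nu>))) = complex_of_real (exp (\<nu> * t k)) * complex_of_real (exp (- (z * t k)))"
        by (simp add: exp_of_real[symmetric] mult_exp_exp algebra_simps flip: of_real_mult)
      then show ?thesis by simp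
    qed
    show ?thesis
      unfolding eq ser_def using ser_summable[OF c t]
      by (intro integral_count_space_nat) (auto simp: integrable_count_space_nat_iff)
  qed
  then show ?thesis using m2 by simp
qed

lemma ser_split:
  assumes c: "summable (\<lambda>k. \<bar>c k\<bar>)" and t: "\<And>k. 0 \<le> t k \<and> t k \<le> T"
  shows "ser c t z = (\<Sum>k<K. complex_of_real (c k) * exp (- (complex_of_real (t k) * z))) + ser (\<lambda>k. c (k + K)) (\<lambda>k. t (k + K)) z"
  unfolding ser_def
  using suminf_split_initial_segment[OF summable_norm_cancel[OF ser_summable[OF c, of t T z, OF t]], of K] by simp

lemma norm_cscaleV: "norm (cscaleV c (cvec v)) = cmod c * norm v"
  by (simp add: norm_vec_def cscaleV_def cvec_def norm_mult L2_set_right_distrib)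

lemma norm_cscaleM: "norm (cscaleM c (cmat A)) = cmod c * norm A"
proof -
  have "norm (cscaleM c (cmat A) $ i) = cmod c * norm (A $ i)" for i
    by (simp add: norm_vec_def cscaleM_def cmat_def norm_mult L2_set_right_distrib)
  then show ?thesis by (simp add: norm_vec_def[of "cscaleM c (cmat A)"] norm_vec_def[of A] L2_set_right_distrib)
qed

lemma abs_nth2_le: "\<bar>(A :: real^'n^'m) $ i $ j\<bar> \<le> norm A"
  using Finite_Cartesian_Product.norm_nth_le[of "A $ i" j] Finite_Cartesian_Product.norm_nth_le[of A i] by simp

lemma cexp_norm_le:
  assumes "0 \<le> t" "t \<le> T" shows "cmod (exp (- (complex_of_real t * z))) \<le> exp (\<bar>Re z\<bar> * T)"
  using ser_term_bound[of t T "\<bar>Re z\<bar>" z 1] assms by simp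

lemma suminf_nth2:
  fixes f :: "nat \<Rightarrow> complex^'n^'m"
  assumes "summable f" shows "(\<Sum>k. f k) $ i $ j = (\<Sum>k. f k $ i $ j)"
proof -
  have "bounded_linear (\<lambda>x :: complex^'n^'m. x $ i $ j)"
    by (rule bounded_linear_compose[OF bounded_linear_vec_nth bounded_linear_vec_nth])
  from bounded_linear.suminf[OF this assms] show ?thesis .
qed

lemma suminf_nth1:
  fixes f :: "nat \<Rightarrow> complex^'n"
  assumes "summable f" shows "(\<Sum>k. f k) $ i = (\<Sum>k. f k $ i)"
  using bounded_linear.suminf[OF bounded_linear_vec_nth assms, of i] by simp

lemma Delta0_nth:
  assumes A: "summable (\<lambda>k. norm (A (Suc k)))" and t: "\<And>k. 0 \<le> tau (Suc k) \<and> tau (Suc k) \<le> taus"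
  shows "Delta0 A tau z $ i $ j = mat 1 $ i $ j - ser (\<lambda>k. A (Suc k) $ i $ j) (\<lambda>k. tau (Suc k)) z"
proof -
  have "summable (\<lambda>k. cscaleM (exp (- complex_of_real (tau (Suc k)) * z)) (cmat (A (Suc k))))"
  proof (rule summable_norm_cancel, rule summable_comparison_test)
    show "\<exists>N. \<forall>n\<ge>N. norm (norm (cscaleM (exp (- complex_of_real (tau (Suc n)) * z)) (cmat (A (Suc n))))) \<le> exp (\<bar>Re z\<bar> * taus) * norm (A (Suc n))"
      using cexp_norm_le[of "tau (Suc _)" taus z] t by (intro exI[of _ 0] allI impI) (simp add: norm_cscaleM mult_right_mono)
  qed (intro summable_mult A)
  from suminf_nth2[OF this, of i j] show ?thesis
    by (simp add: Delta0_def ser_def cscaleM_def cmat_def mult.commute)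
qed

lemma ser_trunc: "ser (\<lambda>k. if k < K then c k else 0) t z = (\<Sum>k<K. complex_of_real (c k) * exp (- (complex_of_real (t k) * z)))"
  unfolding ser_def by (subst suminf_finite[where N="{..<K}"]) auto

lemma cmod_mat_1: "cmod (mat 1 $ i $ j) \<le> 1"
  by (simp add: mat_def)

text \<open>Truncating every entry to K delays gives a determinant P with exponents in a finitely
  generated monoid. K makes the error at most \<eta> / 4, both in sup norm and as a multiplier, so
  |P| >= \<eta> / 2 and Newman's condition \<delta> B <= 1/2 holds with B = 2 / \<eta>. Far to the
  right P is near 1 because the delays are strictly positive.\<close>

lemma Delta0_approx_inverse:
  fixes A :: "nat \<Rightarrow> real^'n^'n"
  assumes A: "summable (\<lambda>k. norm (A (Suc k)))" and t: "\<And>k. 0 < tau (Suc k) \<and> tau (Suc k) \<le> taus"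
    and \<nu>: "0 \<le> \<nu>" "\<nu> < \<mu>" and \<eta>: "\<eta> > 0" and bd: "\<And>z. Re z > - \<mu> \<Longrightarrow> cmod (det (Delta0 A tau z)) > \<eta>"
    and \<epsilon>: "\<epsilon> > 0"
  shows "\<exists>W C. mlt W C \<and> mlt (\<lambda>z. W z * det (Delta0 A tau (complex_of_real (z - \<nu>))) - 1) \<epsilon>"
proof -
  define \<alpha> where "\<alpha> k = norm (A (Suc k))" for k
  let ?t = "\<lambda>k. tau (Suc k)" and ?c = "\<lambda>i j k. A (Suc k) $ i $ j"
  have \<alpha>: "summable \<alpha>" "\<And>k. 0 \<le> \<alpha> k" using A by (auto simp: \<alpha>_def[abs_def])
  have c\<alpha>: "\<bar>?c i j k\<bar> \<le> \<alpha> k" for i j k unfolding \<alpha>_def by (rule abs_nth2_le)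
  have t': "\<And>k. 0 \<le> ?t k \<and> ?t k \<le> taus" using t less_imp_le by blast
  have cs: "summable (\<lambda>k. \<bar>?c i j k\<bar>)" for i j
    by (rule summable_comparison_test[OF _ \<alpha>(1)]) (use c\<alpha> in auto)
  define E where "E = exp (\<mu> * taus)"
  have E: "exp (\<nu> * taus) \<le> E" "0 < E" using \<nu> t[of 0] by (auto simp: E_def intro!: mult_right_mono)
  define M where "M = 1 + suminf \<alpha> * E"
  have M: "1 \<le> M" using E suminf_nonneg[OF \<alpha>] by (simp add: M_def)
  define c0 where "c0 = fact CARD('n) * (real CARD('n) * (M + 1) ^ CARD('n))"
  have c0: "0 < c0" using M by (auto simp: c0_def intro!: mult_pos_pos)
  define tl where "tl K = (\<Sum>k. \<alpha> (k + K)) * E" for K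
  have "tl \<longlonglongrightarrow> 0 * E" unfolding tl_def[abs_def] by (intro tendsto_mult suminf_exist_split2 \<alpha>(1) tendsto_const)
  then have "\<forall>\<^sub>F K in sequentially. tl K < min 1 (\<eta> / (4 * c0))"
    using \<eta> c0 by (intro order_tendstoD(2)) auto
  then obtain K where "tl K < min 1 (\<eta> / (4 * c0))" by (auto simp: eventually_sequentially)
  then have K: "tl K \<le> 1" "c0 * tl K \<le> \<eta> / 4" using c0 by (auto simp: field_simps)
  let ?cK = "\<lambda>i j k. if k < K then ?c i j k else 0"
  define Ak where "Ak z = (\<chi> i j. mat 1 $ i $ j - ser (?cK i j) ?t z :: complex^'n^'n)" for z
  define Dk where "Dk z = (\<chi> i j. - ser (\<lambda>k. ?c i j (k + K)) (\<lambda>k. ?t (k + K)) z :: complex^'n^'n)" for z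
  define P where "P z = det (Ak z)" for z
  have split: "Delta0 A tau z = Ak z + Dk z" for z
    by (simp add: vec_eq_iff Ak_def Dk_def Delta0_nth[of A tau taus, OF A t'] ser_trunc ser_split[OF cs, where t="?t" and T=taus and z=z and K=K, OF t'])
  have csK: "summable (\<lambda>k. \<bar>?cK i j k\<bar>)" for i j
    by (rule summable_comparison_test[OF _ \<alpha>(1)]) (use c\<alpha> \<alpha> in auto)
  have csT: "summable (\<lambda>k. \<bar>?c i j (k + K)\<bar>)" for i j using summable_ignore_initial_segment[OF cs[of i j], of K] by simp
  have bK: "(\<Sum>k. \<bar>?cK i j k\<bar>) * F \<le> suminf \<alpha> * E" if "0 \<le> F" "F \<le> E" for i j F
    using that c\<alpha> \<alpha> suminf_nonneg[OF \<alpha>] by (intro mult_mono suminf_le[OF _ csK \<alpha>(1)]) auto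
  have bT: "(\<Sum>k. \<bar>?c i j (k + K)\<bar>) * F \<le> tl K" if "0 \<le> F" "F \<le> E" for i j F
    unfolding tl_def using that c\<alpha> \<alpha> suminf_nonneg[of "\<lambda>k. \<alpha> (k + K)"]
    by (intro mult_mono suminf_le[OF _ csT]) (auto simp: summable_iff_shift)
  let ?S = "{z. Re z > - \<mu>}"
  interpret sup: nrm "\<lambda>r C. 0 \<le> C \<and> (\<forall>z\<in>?S. cmod (r z) \<le> C)" by (rule sup_nrm)
  have supd: "0 \<le> c0 * tl K \<and> (\<forall>z\<in>?S. cmod (det (Ak z + Dk z) - det (Ak z)) \<le> c0 * tl K)"
    unfolding c0_def
  proof (rule sup.det_perturb[OF _ _ K(1)])
    show "0 \<le> M \<and> (\<forall>z\<in>?S. cmod (Ak z $ i $ j) \<le> M)" for i j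
    proof (intro conjI ballI)
      fix z assume z: "z \<in> ?S"
      have "cmod (Ak z $ i $ j) \<le> cmod (mat 1 $ i $ j) + cmod (ser (?cK i j) ?t z)"
        unfolding Ak_def by (simp add: norm_triangle_ineq4)
      also have "\<dots> \<le> 1 + suminf \<alpha> * E"
        using z \<nu> E
        by (intro add_mono cmod_mat_1 order_trans[OF ser_bound[OF csK[of i j], where t="?t" and T=taus and \<nu>=\<mu> and z=z, OF t'] bK[of "exp (\<mu> * taus)"]])
          (auto simp: E_def)
      finally show "cmod (Ak z $ i $ j) \<le> M" by (simp add: M_def)
    qed (use M in auto)
    show "0 \<le> tl K \<and> (\<forall>z\<in>?S. cmod (Dk z $ i $ j) \<le> tl K)" for i j
    proof (intro conjI ballI)
      show "0 \<le> tl K" using bT[of E i j] E by (intro order_trans[OF _ bT[of E i j]] mult_nonneg_nonneg suminf_nonneg csT) auto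
      fix z assume z: "z \<in> ?S"
      show "cmod (Dk z $ i $ j) \<le> tl K"
        using ser_bound[OF csT[of i j], where t="\<lambda>k. ?t (k + K)" and T=taus and \<nu>=\<mu> and z=z, OF t'] z bT[of E i j] \<nu> E by (auto simp: Dk_def E_def)
    qed
  qed
  show ?thesis
  proof -
    let ?z = "\<lambda>z. complex_of_real (z - \<nu>)"
    have FP: "mlt (\<lambda>z. det (Ak (?z z) + Dk (?z z)) - det (Ak (?z z))) (c0 * tl K)"
      unfolding c0_def
    proof (rule mlt.det_perturb[OF _ _ K(1)])
      show "mlt (\<lambda>z. Ak (?z z) $ i $ j) M" for i j
      proof -
        have "mlt (\<lambda>z. mat 1 $ i $ j - ser (?cK i j) ?t (?z z)) (1 + suminf \<alpha> * E)"
          using E by (intro mlt.diff mlt.mono[OF mlt.const cmod_mat_1] mlt.mono[OF ser_mlt[OF csK, where t="?t" and T=taus, OF t' \<nu>(1)] bK]) auto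
        then show ?thesis by (simp add: Ak_def M_def)
      qed
      show "mlt (\<lambda>z. Dk (?z z) $ i $ j) (tl K)" for i j
      proof -
        have "mlt (\<lambda>z. - ser (\<lambda>k. ?c i j (k + K)) (\<lambda>k. ?t (k + K)) (?z z)) (tl K)"
          using E t' by (intro mlt.uminus mlt.mono[OF ser_mlt[OF csT, where t="\<lambda>k. ?t (k + K)" and T=taus, OF t' \<nu>(1)] bT]) auto
        then show ?thesis by (simp add: Dk_def)
      qed
    qed
    define ts where "ts = map ?t [0..<K]"
    have ts: "0 < s" if "s \<in> set ts" for s using that t by (auto simp: ts_def)
    define c1 where "c1 = fact CARD('n) * (real CARD('n) * (1 + 1) ^ CARD('n))"
    have c1: "0 < c1" by (auto simp: c1_def intro!: mult_pos_pos)
    define d where "d R = (\<Sum>k<K. \<alpha> k * exp (- (R * ?t k)))" for R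
    have "((\<lambda>R. \<Sum>k<K. \<alpha> k * exp (- (R * ?t k))) \<longlongrightarrow> (\<Sum>k<K. \<alpha> k * 0)) at_top"
    proof (intro tendsto_sum tendsto_mult tendsto_const)
      fix k
      have "filterlim (\<lambda>R. R * ?t k) at_top at_top"
        using filterlim_at_top_mult_tendsto_pos[OF tendsto_const, of "?t k" "\<lambda>x. x" at_top] t filterlim_ident by blast
      then show "((\<lambda>R. exp (- (R * ?t k))) \<longlongrightarrow> 0) at_top"
        by (intro filterlim_compose[OF exp_at_bot] filterlim_compose[OF filterlim_uminus_at_bot_at_top])
    qed
    then have "(d \<longlongrightarrow> 0) at_top" by (simp add: d_def[abs_def])
    then have "\<forall>\<^sub>F R in at_top. d R < min 1 (1 / (2 * c1))"
      using c1 by (intro order_tendstoD(2)) auto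
    then have "\<forall>\<^sub>F R in at_top. d R < min 1 (1 / (2 * c1)) \<and> R > 0" by (intro eventually_conj eventually_gt_at_top)
    then obtain R where "d R < min 1 (1 / (2 * c1))" and R0: "R > 0"
      using eventually_happens'[OF trivial_limit_at_top_linorder] by blast
    then have R: "d R \<le> 1" "c1 * d R \<le> 1 / 2" using c1 by (auto simp: field_simps)
    interpret fd: nrm "fd (mon ts) R" by (rule mon_nrm)
    have "fd (mon ts) R (\<lambda>z. det (mat 1 + (\<chi> i j. - ser (?cK i j) ?t z :: complex^'n^'n)) - det (mat 1 :: complex^'n^'n)) (c1 * d R)"
      unfolding c1_def
    proof (rule fd.det_perturb[OF _ _ R(1)])
      show "fd (mon ts) R (\<lambda>z. mat 1 $ i $ j) 1" for i j by (rule fd.mono[OF fd.const cmod_mat_1])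
      show "fd (mon ts) R (\<lambda>z. (\<chi> i j. - ser (?cK i j) ?t z :: complex^'n^'n) $ i $ j) (d R)" for i j
      proof -
        have "fd (mon ts) R (ser (?cK i j) ?t) (d R)"
        proof (rule fd_family[where I="{..<K}" and s="?t" and a="\<lambda>k. complex_of_real (?c i j k)"])
          show "(\<Sum>k<K. cmod (complex_of_real (?c i j k)) * exp (- (R * ?t k))) \<le> d R"
            unfolding d_def using c\<alpha> by (intro sum_mono mult_right_mono) auto
        qed (auto simp: ser_trunc ts_def intro!: mon_gen)
        from fd.uminus[OF this] show ?thesis by simp
      qed
    qed
    moreover have "mat 1 + (\<chi> i j. - ser (?cK i j) ?t z) = Ak z" for z by (simp add: vec_eq_iff Ak_def)
    ultimately have "fd (mon ts) R (\<lambda>z. P z - 1) (c1 * d R)" by (simp add: P_def)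
    from fd.uminus[OF fd.mono[OF this R(2)]] have fdP: "fd (mon ts) R (\<lambda>z. 1 - P z) (1 / 2)" by simp
    \<comment> \<open>Strictly between the edge -\<mu> of the lower bound and the weighted axis
      -\<nu>, so that \<sigma> + \<nu> < 0.\<close>
    define \<sigma> where "\<sigma> = - (\<mu> + \<nu>) / 2"
    have hol: "P holomorphic_on {z. Re z > - \<mu>}"
      unfolding P_def[abs_def] det_def Ak_def by (auto simp: ser_trunc intro!: holomorphic_intros)
    have "\<exists>W C. mlt W C \<and> mlt (\<lambda>z. W z * det (Delta0 A tau (?z z)) - 1) \<epsilon>"
    proof (rule newman_inverse[OF ts fdP hol, where \<sigma>=\<sigma> and \<delta>="c0 * tl K" and B="2 / \<eta>"])
      show "mlt (\<lambda>z. det (Delta0 A tau (?z z)) - P (?z z)) (c0 * tl K)" using FP by (simp add: split P_def)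
      show "1 / (2 / \<eta>) \<le> cmod (P z)" if "- \<mu> < Re z" for z
      proof -
        have "cmod (det (Delta0 A tau z) - P z) \<le> c0 * tl K" using supd that by (simp add: split P_def)
        moreover have "cmod (det (Delta0 A tau z)) \<le> cmod (det (Delta0 A tau z) - P z) + cmod (P z)"
          using norm_triangle_ineq[of "det (Delta0 A tau z) - P z" "P z"] by simp
        ultimately show ?thesis using bd[OF that] K(2) \<eta> by simp
      qed
      show "c0 * tl K * (2 / \<eta>) \<le> 1 / 2" using K(2) \<eta> by (simp add: field_simps)
    qed (use \<nu> R0 \<eta> \<epsilon> in \<open>auto simp: \<sigma>_def field_simps\<close>)
    then show ?thesis .
  qed
qed

section \<open>The Bezout identity and its compactly supported approximation\<close>

lemma eventually_at_top_gtE: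
  assumes "\<And>z::real. z > a \<Longrightarrow> P z" shows "\<forall>\<^sub>F z in at_top. P z"
  using eventually_gt_at_top[of a] by (rule eventually_mono) (rule assms)

text \<open>Transforms at complex arguments: the multiplier calculus lives on the real axis, whereas
  the rank condition concerns complex z0.\<close>

definition tf :: "'i measure \<Rightarrow> ('i \<Rightarrow> complex) \<Rightarrow> ('i \<Rightarrow> real) \<Rightarrow> complex \<Rightarrow> complex" where
  "tf M w \<tau> z = (\<integral>i. w i * exp (- (complex_of_real (\<tau> i) * z)) \<partial>M)"

lemma tf_of_real: "tf M w \<tau> (complex_of_real z) = (\<integral>i. w i * complex_of_real (exp (- (z * \<tau> i))) \<partial>M)"
proof -
  have "exp (- (complex_of_real (\<tau> i) * complex_of_real z)) = complex_of_real (exp (- (z * \<tau> i)))" for i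
    by (simp add: exp_of_real[symmetric] mult.commute)
  then show ?thesis by (simp add: tf_def)
qed

context delay_kernel
begin

lemma tf_mlt:
  assumes "\<And>i. i \<in> space M \<Longrightarrow> 0 \<le> \<tau> i"
  shows "mlt (\<lambda>z. tf M w \<tau> (complex_of_real z)) (\<integral>i. cmod (w i) \<partial>M)"
  unfolding tf_of_real by (rule mlt_kernel[OF assms])

text \<open>The quotient \<open>(e^{- \<tau> z} - e^{- \<tau> z0}) / (z - z0)\<close> is itself the transform of a kernel on \<open>[0, \<tau>]\<close>,
  whatever the sign of \<open>Re z0\<close>.\<close>

lemma tf_divisible:
  assumes \<tau>0: "\<And>i. i \<in> space M \<Longrightarrow> 0 \<le> \<tau> i \<and> \<tau> i \<le> T" and z0: "z0 \<noteq> - 1"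
  shows "\<exists>b C. mlt b C \<and> (\<forall>\<^sub>F z in at_top. tf M w \<tau> (complex_of_real z) - tf M w \<tau> z0
     = (1 / (complex_of_real z + 1) - 1 / (z0 + 1)) * b z)"
proof -
  interpret Q: pair_sigma_finite M lborel ..
  let ?N = "M \<Otimes>\<^sub>M (lborel :: real measure)"
  \<comment> \<open>For a single delay, integrating exp(-z0 (\<tau> - t)) exp(-z t) over 0 <= t <=
    \<tau> gives (exp(-z \<tau>) - exp(-z0 \<tau>)) / (z0 - z); the index set becomes a product with
    Lebesgue measure.\<close>
  define v where "v = (\<lambda>(i, t). w i * (exp (- (z0 * (complex_of_real (\<tau> i) - complex_of_real t))) * indicator {0..\<tau> i} t))"
  define E where "E = exp (\<bar>Re z0\<bar> * T)"
  have vb: "cmod (v (i, t)) \<le> cmod (w i) * (E * indicator {0..T} t)" if "i \<in> space M" for i t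
  proof (cases "t \<in> {0..\<tau> i}")
    case True
    have "- (Re z0 * (\<tau> i - t)) \<le> \<bar>Re z0\<bar> * (\<tau> i - t)"
      using True abs_ge_minus_self[of "Re z0"] mult_right_mono[of "- Re z0" "\<bar>Re z0\<bar>" "\<tau> i - t"] by simp
    also have "\<dots> \<le> \<bar>Re z0\<bar> * T" using True \<tau>0[OF that] by (intro mult_left_mono) auto
    finally have "exp (- (Re z0 * (\<tau> i - t))) \<le> E" by (simp add: E_def)
    then show ?thesis using True \<tau>0[OF that] by (simp add: v_def norm_mult norm_exp_eq_Re mult_left_mono)
  qed (simp add: v_def E_def)
  have [measurable]: "v \<in> borel_measurable ?N"
  proof -
    have "indicator {0..\<tau> i} t = (of_bool (0 \<le> t \<and> t \<le> \<tau> i) :: complex)" for i t by (auto simp: indicator_def)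
    then show ?thesis unfolding v_def by simp measurable
  qed
  have iv: "integrable ?N v"
  proof (rule Bochner_Integration.integrable_bound)
    show "integrable ?N (\<lambda>(i, t). cmod (w i) * (E * indicator {0..T} t))"
    proof (rule Q.Fubini_integrable)
      have "(\<integral>t. norm (case (i, t) of (i, t) \<Rightarrow> cmod (w i) * (E * indicator {0..T} t)) \<partial>lborel) = cmod (w i) * (\<integral>t. \<bar>E * indicator {0..T} t\<bar> \<partial>lborel)" for i
        by (simp add: abs_mult)
      then show "integrable M (\<lambda>i. \<integral>t. norm (case (i, t) of (i, t) \<Rightarrow> cmod (w i) * (E * indicator {0..T} t)) \<partial>lborel)"
        using integrable_norm[OF w] by (simp only: integrable_mult_left)
      show "AE i in M. integrable lborel (\<lambda>t. case (i, t) of (i, t) \<Rightarrow> cmod (w i) * (E * indicator {0..T} t))"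
        unfolding case_prod_conv by (intro AE_I2 integrable_mult_right integrable_real_indicator) (auto simp: emeasure_lborel_Icc_eq)
    qed measurable
    show "AE x in ?N. norm (v x) \<le> norm (case x of (i, t) \<Rightarrow> cmod (w i) * (E * indicator {0..T} t))"
    proof (rule AE_I2)
      fix x assume "x \<in> space ?N"
      then obtain i t where x: "x = (i, t)" "i \<in> space M" by (auto simp: space_pair_measure)
      have "norm (v x) \<le> cmod (w i) * (E * indicator {0..T} t)" unfolding x(1) by (rule vb[OF x(2)])
      also have "\<dots> \<le> norm (cmod (w i) * (E * indicator {0..T} t))" by (simp only: real_norm_def abs_ge_self)
      finally show "norm (v x) \<le> norm (case x of (i, t) \<Rightarrow> cmod (w i) * (E * indicator {0..T} t))" by (simp add: x)
    qed
  qed measurable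
  interpret K: delay_kernel ?N v "\<lambda>x. max 0 (snd x)"
    using iv by unfold_locales auto
  define k where "k = (\<lambda>z. tf ?N v (\<lambda>x. max 0 (snd x)) (complex_of_real z))"
  have km: "mlt k (\<integral>x. cmod (v x) \<partial>?N)" unfolding k_def by (rule K.tf_mlt) simp
  have tm: "mlt (\<lambda>z. tf M w \<tau> (complex_of_real z)) (\<integral>i. cmod (w i) \<partial>M)" by (rule tf_mlt) (use \<tau>0 in auto)
  have keq: "tf M w \<tau> (complex_of_real z) - tf M w \<tau> z0 = - ((complex_of_real z - z0) * k z)" if z: "z > Re z0" "z > 0" for z
  proof -
    let ?z = "complex_of_real z"
    have zz: "z0 - ?z \<noteq> 0" using z by (auto simp: complex_eq_iff)
    have e1: "exp (- (complex_of_real t * ?z)) = complex_of_real (exp (- (z * t)))" for t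
      by (simp add: exp_of_real[symmetric] mult.commute)
    have we: "integrable M (\<lambda>i. w i * exp (- (complex_of_real (\<tau> i) * u)))" for u
    proof (rule Bochner_Integration.integrable_bound)
      show "integrable M (\<lambda>i. cmod (w i) * exp (\<bar>Re u\<bar> * T))" using w by auto
      show "AE i in M. norm (w i * exp (- (complex_of_real (\<tau> i) * u))) \<le> norm (cmod (w i) * exp (\<bar>Re u\<bar> * T))"
        using cexp_norm_le \<tau>0 by (intro AE_I2) (auto simp: norm_mult intro!: mult_left_mono)
    qed measurable
    have inner: "(\<integral>t. v (i, t) * exp (- (complex_of_real (max 0 t) * ?z)) \<partial>lborel)
        = w i * (exp (- (complex_of_real (\<tau> i) * ?z)) - exp (- (complex_of_real (\<tau> i) * z0))) / (z0 - ?z)"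
      if i: "i \<in> space M" for i
    proof -
      let ?F = "\<lambda>t::real. exp (- (complex_of_real (\<tau> i) * z0)) * exp ((z0 - ?z) * complex_of_real t) / (z0 - ?z)"
      let ?f = "\<lambda>t::real. exp (- (complex_of_real (\<tau> i) * z0)) * exp ((z0 - ?z) * complex_of_real t)"
      have s1: "(\<integral>t. indicator {0..\<tau> i} t *\<^sub>R ?f t \<partial>lborel) = ?F (\<tau> i) - ?F 0"
      proof (rule integral_FTC_Icc)
        show "(?F has_vector_derivative ?f t) (at t within {0..\<tau> i})" for t
          using zz by (auto intro!: derivative_eq_intros has_vector_derivative_real_field)
        show "continuous_on {0..\<tau> i} ?f" by (intro continuous_intros)
      qed (use \<tau>0[OF i] in auto)
      have s2: "v (i, t) * exp (- (complex_of_real (max 0 t) * ?z)) = w i * (indicator {0..\<tau> i} t *\<^sub>R ?f t)" for t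
        by (auto simp: v_def indicator_def mult_exp_exp algebra_simps max_def)
      have s3: "?F (\<tau> i) - ?F 0 = (exp (- (complex_of_real (\<tau> i) * ?z)) - exp (- (complex_of_real (\<tau> i) * z0))) / (z0 - ?z)"
        by (simp add: mult_exp_exp algebra_simps flip: diff_divide_distrib)
      have "(\<integral>t. v (i, t) * exp (- (complex_of_real (max 0 t) * ?z)) \<partial>lborel) = w i * (\<integral>t. indicator {0..\<tau> i} t *\<^sub>R ?f t \<partial>lborel)"
        unfolding s2 by (rule integral_mult_right_zero)
      then show ?thesis by (simp only: s1 s3 times_divide_eq_right)
    qed
    have iN: "integrable ?N (\<lambda>x. v x * exp (- (complex_of_real (max 0 (snd x)) * ?z)))"
      using iv by (rule Bochner_Integration.integrable_bound)
        (use z in \<open>auto simp: norm_mult norm_exp_eq_Re intro!: AE_I2 mult_left_le\<close>)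
    have "k z = (\<integral>i. (\<integral>t. v (i, t) * exp (- (complex_of_real (max 0 t) * ?z)) \<partial>lborel) \<partial>M)"
      using Q.integral_fst'[OF iN] by (simp add: k_def tf_def)
    also have "\<dots> = (\<integral>i. (w i * exp (- (complex_of_real (\<tau> i) * ?z)) - w i * exp (- (complex_of_real (\<tau> i) * z0))) / (z0 - ?z) \<partial>M)"
      by (rule Bochner_Integration.integral_cong) (simp_all add: inner right_diff_distrib)
    also have "\<dots> = (tf M w \<tau> ?z - tf M w \<tau> z0) / (z0 - ?z)"
      using we by (simp add: tf_def)
    finally show ?thesis using zz by (simp add: field_simps)
  qed
  \<comment> \<open>This is (z0 + 1)(z + 1) k with the unbounded factor eliminated: (z + 1) k = (z0
    + 1) k + (z - z0) k, and the last term is minus the difference of the transforms.\<close>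
  let ?b = "\<lambda>z. (z0 + 1) * ((z0 + 1) * k z - (tf M w \<tau> (complex_of_real z) - tf M w \<tau> z0))"
  show ?thesis
  proof (intro exI conjI)
    show "mlt ?b (cmod (z0 + 1) * (cmod (z0 + 1) * (\<integral>x. cmod (v x) \<partial>?N) + ((\<integral>i. cmod (w i) \<partial>M) + cmod (tf M w \<tau> z0))))"
      by (intro mlt.cmult mlt.diff km tm mlt.const)
    show "\<forall>\<^sub>F z in at_top. tf M w \<tau> (complex_of_real z) - tf M w \<tau> z0 = (1 / (complex_of_real z + 1) - 1 / (z0 + 1)) * ?b z"
    proof (rule eventually_at_top_gtE[of "max 0 (Re z0)"])
      fix z :: real assume "max 0 (Re z0) < z"
      then have z: "z > Re z0" "z > 0" by auto
      have z1: "complex_of_real z + 1 \<noteq> 0" using z by (auto simp: complex_eq_iff)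
      have z2: "z0 + 1 \<noteq> 0" using z0 by (simp add: add_eq_0_iff2)
      have "(1 / (Z + 1) - 1 / (z0 + 1)) * ((z0 + 1) * ((z0 + 1) * K - - ((Z - z0) * K))) = - ((Z - z0) * K)"
        if "Z + 1 \<noteq> 0" for Z K :: complex
        using that z2 by (simp add: divide_simps) (simp add: algebra_simps)
      from this[OF z1, of "k z"] show "tf M w \<tau> (complex_of_real z) - tf M w \<tau> z0 = (1 / (complex_of_real z + 1) - 1 / (z0 + 1)) * ?b z"
        unfolding keq[OF z] by simp
    qed
  qed
qed

end

section \<open>Approximation of L1 transforms by multiples of 1 / (z + 1)\<close>

lemma mlt_exp: "0 \<le> s \<Longrightarrow> mlt (\<lambda>z. complex_of_real (exp (- (z * s)))) 1"
  unfolding mlt_def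
proof (intro conjI allI impI)
  fix q x c assume "0 \<le> s" "1 \<le> q" "sig q x c"
  then show "\<exists>y. sig q y (1 * c) \<and> (\<forall>\<^sub>F z in at_top. lap y z = complex_of_real (exp (- (z * s))) * lap x z)"
    using lap_shift[of x s] by (intro exI[of _ "\<lambda>t. x (t - s)"]) (auto simp: sig_def intro: Lq_shift)
qed simp

text \<open>With x = 1 / (z + 1), the transform of h lies in the closure of x times the multipliers.
  This expresses that distributed kernels vanish at z = infinity, where x = 0.\<close>

definition xap :: "(real \<Rightarrow> complex) \<Rightarrow> bool" where
  "xap h \<longleftrightarrow> (\<forall>\<epsilon>>0. \<exists>b C. mlt b C \<and> mlt (\<lambda>z. lap h z - 1 / (complex_of_real z + 1) * b z) \<epsilon>)"

lemma integrable_sig_1: "integrable lborel h \<Longrightarrow> (\<And>t. t < 0 \<Longrightarrow> h t = 0) \<Longrightarrow> sig 1 h (\<integral>t. cmod (h t) \<partial>lborel)"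
  by (auto simp: sig_1)

lemma lap_diff:
  assumes "sig q x c" "sig q y d" "q \<ge> 1" "z > 0"
  shows "lap (\<lambda>t. x t - y t) z = lap x z - lap y z"
  using sig_lap_integrable[OF assms(1,3,4)] sig_lap_integrable[OF assms(2,3,4)]
  by (simp add: lap_def right_diff_distrib)

lemma integrable_complex_indicator:
  assumes "A \<in> sets M" "emeasure M A < \<infinity>" shows "integrable M (\<lambda>x. indicator A x :: complex)"
proof -
  have "integrable M (\<lambda>x. indicator A x *\<^sub>R (1 :: complex))"
    using has_bochner_integral_indicator[OF assms] by (rule integrable.intros)
  moreover have "indicator A x *\<^sub>R (1 :: complex) = indicator A x" for x by (simp add: indicator_def)
  ultimately show ?thesis by simp
qed

lemma xap_limit:
  assumes h: "integrable lborel h" "\<And>t. t < 0 \<Longrightarrow> h t = 0"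
    and s: "\<And>i::nat. integrable lborel (s i)" "\<And>i t. t < 0 \<Longrightarrow> s i t = 0" "\<And>i. xap (s i)"
    and lim: "(\<lambda>i. \<integral>t. cmod (h t - s i t) \<partial>lborel) \<longlonglongrightarrow> 0"
  shows "xap h"
  unfolding xap_def
proof (intro allI impI)
  fix \<epsilon> :: real assume \<epsilon>: "\<epsilon> > 0"
  then have "\<forall>\<^sub>F i in sequentially. (\<integral>t. cmod (h t - s i t) \<partial>lborel) < \<epsilon> / 2"
    by (intro order_tendstoD(2)[OF lim]) auto
  then obtain i where i: "(\<integral>t. cmod (h t - s i t) \<partial>lborel) < \<epsilon> / 2" by (auto simp: eventually_sequentially)
  obtain b C where b: "mlt b C" "mlt (\<lambda>z. lap (s i) z - 1 / (complex_of_real z + 1) * b z) (\<epsilon> / 2)"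
    using s(3)[of i] \<epsilon> unfolding xap_def by (meson half_gt_zero)
  have "sig 1 (\<lambda>t. h t - s i t) (\<epsilon> / 2)" using i h s by (auto simp: sig_1)
  then have "mlt (\<lambda>z. lap (\<lambda>t. h t - s i t) z + (lap (s i) z - 1 / (complex_of_real z + 1) * b z)) (\<epsilon> / 2 + \<epsilon> / 2)"
    by (intro mlt.add mlt_lap b)
  then have "mlt (\<lambda>z. lap h z - 1 / (complex_of_real z + 1) * b z) (\<epsilon> / 2 + \<epsilon> / 2)"
  proof (rule mlt_cong, intro eventually_at_top_gtE[of 0])
    fix z :: real assume "0 < z"
    then show "lap (\<lambda>t. h t - s i t) z + (lap (s i) z - 1 / (complex_of_real z + 1) * b z) = lap h z - 1 / (complex_of_real z + 1) * b z"
      using lap_diff[OF integrable_sig_1[OF h] integrable_sig_1[OF s(1)[of i] s(2)[where i=i]]] by simp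
  qed
  then show "\<exists>b C. mlt b C \<and> mlt (\<lambda>z. lap h z - 1 / (complex_of_real z + 1) * b z) \<epsilon>" using b(1) by auto
qed

lemma xap_add:
  assumes h: "integrable lborel h" "\<And>t. t < 0 \<Longrightarrow> h t = 0" "xap h"
    and g: "integrable lborel g" "\<And>t. t < 0 \<Longrightarrow> g t = 0" "xap g"
  shows "xap (\<lambda>t. h t + g t)"
  unfolding xap_def
proof (intro allI impI)
  fix \<epsilon> :: real assume \<epsilon>: "\<epsilon> > 0"
  obtain b C where b: "mlt b C" "mlt (\<lambda>z. lap h z - 1 / (complex_of_real z + 1) * b z) (\<epsilon> / 2)"
    using h(3) \<epsilon> unfolding xap_def by (meson half_gt_zero)
  obtain d D where d: "mlt d D" "mlt (\<lambda>z. lap g z - 1 / (complex_of_real z + 1) * d z) (\<epsilon> / 2)"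
    using g(3) \<epsilon> unfolding xap_def by (meson half_gt_zero)
  have "mlt (\<lambda>z. lap (\<lambda>t. h t + g t) z - 1 / (complex_of_real z + 1) * (b z + d z)) (\<epsilon> / 2 + \<epsilon> / 2)"
  proof (rule mlt_cong[OF mlt.add[OF b(2) d(2)]], intro eventually_at_top_gtE[of 0])
    fix z :: real assume "0 < z"
    then show "lap h z - 1 / (complex_of_real z + 1) * b z + (lap g z - 1 / (complex_of_real z + 1) * d z) =
         lap (\<lambda>t. h t + g t) z - 1 / (complex_of_real z + 1) * (b z + d z)"
      using lap_add[OF integrable_sig_1[OF h(1,2)] integrable_sig_1[OF g(1,2)]] by (simp add: algebra_simps add_divide_distrib)
  qed
  then show "\<exists>b C. mlt b C \<and> mlt (\<lambda>z. lap (\<lambda>t. h t + g t) z - 1 / (complex_of_real z + 1) * b z) \<epsilon>"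
    using mlt.add[OF b(1) d(1)] by (intro exI[of _ "\<lambda>z. b z + d z"] exI[of _ "C + D"]) simp
qed

lemma xap_cmult: assumes "xap h" shows "xap (\<lambda>t. a * h t)"
  unfolding xap_def
proof (intro allI impI)
  fix \<epsilon> :: real assume \<epsilon>: "\<epsilon> > 0"
  have "0 < \<epsilon> / (cmod a + 1)" using \<epsilon> by (intro divide_pos_pos) (auto intro: add_nonneg_pos)
  then obtain b C where b: "mlt b C" "mlt (\<lambda>z. lap h z - 1 / (complex_of_real z + 1) * b z) (\<epsilon> / (cmod a + 1))"
    using assms unfolding xap_def by meson
  have "mlt (\<lambda>z. a * (lap h z - 1 / (complex_of_real z + 1) * b z)) (cmod a * (\<epsilon> / (cmod a + 1)))"
    by (rule mlt.cmult[OF b(2)])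
  moreover have "cmod a * (\<epsilon> / (cmod a + 1)) \<le> \<epsilon>" 
  proof -
    have "\<epsilon> / (cmod a + 1) * cmod a \<le> \<epsilon> / (cmod a + 1) * (cmod a + 1)" using \<epsilon> by (intro mult_left_mono) auto
    moreover have "cmod a + 1 \<noteq> 0" using norm_ge_zero[of a] by linarith
    ultimately show ?thesis by (simp add: mult.commute)
  qed
  ultimately have "mlt (\<lambda>z. a * (lap h z - 1 / (complex_of_real z + 1) * b z)) \<epsilon>" by (rule mlt.mono)
  then have "mlt (\<lambda>z. lap (\<lambda>t. a * h t) z - 1 / (complex_of_real z + 1) * (a * b z)) \<epsilon>"
    by (simp add: lap_cmult algebra_simps)
  then show "\<exists>b C. mlt b C \<and> mlt (\<lambda>z. lap (\<lambda>t. a * h t) z - 1 / (complex_of_real z + 1) * b z) \<epsilon>"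
    using mlt.cmult[OF b(1), of a] by blast
qed

text \<open>Here the representation is exact: (1 - exp(-z s)) / z equals 1 / (z + 1) times the sum
  of 1 - exp(-z s) and the transform itself.\<close>

lemma xap_Icc: assumes "0 \<le> s" shows "xap (\<lambda>t. indicator {0..s} t)"
  unfolding xap_def
proof (intro allI impI)
  fix \<epsilon> :: real assume \<epsilon>: "\<epsilon> > 0"
  let ?g = "\<lambda>t. indicator {0..s} t :: complex"
  have g: "sig 1 ?g (\<integral>t. cmod (?g t) \<partial>lborel)" by (rule integrable_sig_1) (auto intro!: integrable_complex_indicator simp: emeasure_lborel_Icc_eq)
  have lg: "lap ?g z = (1 - complex_of_real (exp (- (z * s)))) / complex_of_real z" if "z > 0" for z
  proof -
    have "(\<integral>t. exp (- (z * t)) * indicator {0..s} t \<partial>lborel) = - exp (- (z * s)) / z - (- exp (- (z * 0)) / z)"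
      by (rule integral_FTC_Icc_real[OF assms]) (use that in \<open>auto intro!: derivative_eq_intros continuous_intros\<close>)
    moreover have "lap ?g z = complex_of_real (\<integral>t. exp (- (z * t)) * indicator {0..s} t \<partial>lborel)"
      unfolding lap_def by (subst integral_complex_of_real[symmetric]) (auto intro!: Bochner_Integration.integral_cong simp: indicator_def)
    moreover have "- exp (- (z * s)) / z - (- exp (- (z * 0)) / z) = (1 - exp (- (z * s))) / z"
      by (simp add: diff_divide_distrib)
    ultimately show ?thesis by (simp add: diff_divide_distrib)
  qed
  let ?b = "\<lambda>z. 1 - complex_of_real (exp (- (z * s))) + lap ?g z"
  have b: "mlt ?b (1 + 1 + (\<integral>t. cmod (?g t) \<partial>lborel))"
    by (intro mlt.add mlt.diff mlt.one mlt_exp mlt_lap g assms)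
  moreover have "mlt (\<lambda>z. lap ?g z - 1 / (complex_of_real z + 1) * ?b z) \<epsilon>"
  proof (rule mlt_cong[OF mlt.zero], use \<epsilon> in simp, intro eventually_at_top_gtE[of 0])
    fix z :: real assume z: "0 < z"
    have "complex_of_real z + 1 \<noteq> 0" using z by (auto simp: complex_eq_iff)
    moreover have "z \<noteq> 0" using z by simp
    ultimately show "0 = lap ?g z - 1 / (complex_of_real z + 1) * ?b z"
      unfolding lg[OF z] by (simp add: divide_simps) (simp add: algebra_simps)
  qed
  ultimately show "\<exists>b C. mlt b C \<and> mlt (\<lambda>z. lap ?g z - 1 / (complex_of_real z + 1) * b z) \<epsilon>" by blast
qed

text \<open>Dynkin induction from half-lines. Intersecting with [0,n] keeps measures finite, so
  complements become differences and disjoint unions become L1 limits.\<close>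

lemma xap_indicator:
  assumes "A \<in> sets borel" shows "xap (\<lambda>t. indicator (A \<inter> {0..real n}) t)"
proof -
  have int: "integrable lborel (\<lambda>t. indicator (B \<inter> {0..real n}) t :: complex)" if "B \<in> sets borel" for B
  proof (rule integrable_complex_indicator)
    have "emeasure lborel (B \<inter> {0..real n}) \<le> emeasure lborel {0..real n}"
      using that by (intro emeasure_mono) auto
    then show "emeasure lborel (B \<inter> {0..real n}) < \<infinity>"
      by (simp add: emeasure_lborel_Icc_eq order.strict_trans1[OF _ ennreal_less_top])
  qed (use that in auto)
  have "Int_stable (range (\<lambda>a::real. {..a}))" by (auto simp: Int_stable_def)
  moreover have "range (\<lambda>a::real. {..a}) \<subseteq> Pow UNIV" by simp
  moreover have "A \<in> sigma_sets UNIV (range (\<lambda>a::real. {..a}))" using assms by (simp add: borel_eq_atMost)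
  ultimately show ?thesis
  proof (induction rule: sigma_sets_induct_disjoint)
    case (basic A)
    then obtain a where A: "A = {..a}" by auto
    show ?case
    proof (cases "0 \<le> a")
      case True
      have "A \<inter> {0..real n} = {0..min a (real n)}" using A by auto
      then show ?thesis using xap_Icc[of "min a (real n)"] True by simp
    next
      case False
      then have "A \<inter> {0..real n} = {}" using A by auto
      then show ?thesis using xap_cmult[OF xap_Icc[of 0], of 0] by simp
    qed
  next
    case empty
    then show ?case using xap_cmult[OF xap_Icc[of 0], of 0] by simp
  next
    case (compl A)
    have [measurable]: "A \<in> sets borel" using compl(1) by (simp add: borel_eq_atMost)
    have "(indicator ((UNIV - A) \<inter> {0..real n}) t :: complex) = indicator {0..real n} t + (- 1) * indicator (A \<inter> {0..real n}) t" for t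
      by (auto simp: indicator_def)
    moreover have "xap (\<lambda>t. indicator {0..real n} t + (- 1) * indicator (A \<inter> {0..real n}) t)"
    proof (rule xap_add)
      show "integrable lborel (\<lambda>t. indicator {0..real n} t :: complex)" using int[of UNIV] by simp
      show "integrable lborel (\<lambda>t. - 1 * indicator (A \<inter> {0..real n}) t :: complex)"
        by (rule integrable_mult_right) (rule int, measurable)
      show "xap (\<lambda>t. - 1 * indicator (A \<inter> {0..real n}) t)" by (rule xap_cmult) (rule compl(2))
    qed (auto intro: xap_Icc)
    ultimately show ?case by simp
  next
    case (union A)
    have [measurable]: "A i \<in> sets borel" for i using union(2) by (auto simp: borel_eq_atMost)
    let ?I = "{0..real n}"
    have U: "xap (\<lambda>t. indicator ((\<Union>i<m. A i) \<inter> ?I) t)" for m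
    proof (induction m)
      case 0
      then show ?case using xap_cmult[OF xap_Icc[of 0], of 0] by simp
    next
      case (Suc m)
      have "A m \<inter> A i = {}" if "i < m" for i
        using union(1) that unfolding disjoint_family_on_def by (metis UNIV_I nat_neq_iff)
      then have "A m \<inter> (\<Union>i<m. A i) = {}" by blast
      then have "(indicator ((\<Union>i<Suc m. A i) \<inter> ?I) t :: complex) = indicator ((\<Union>i<m. A i) \<inter> ?I) t + indicator (A m \<inter> ?I) t" for t
        by (auto simp: indicator_def lessThan_Suc)
      moreover have "xap (\<lambda>t. indicator ((\<Union>i<m. A i) \<inter> ?I) t + indicator (A m \<inter> ?I) t)"
        by (rule xap_add[OF int _ Suc int _ union(3)]) auto
      ultimately show ?case by simp
    qed
    show ?case
    proof (rule xap_limit[OF _ _ _ _ U])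
      have "(\<lambda>m. \<integral>t. cmod (indicator ((\<Union>i. A i) \<inter> ?I) t - indicator ((\<Union>i<m. A i) \<inter> ?I) t) \<partial>lborel) \<longlonglongrightarrow> (\<integral>t. 0 \<partial>(lborel :: real measure))"
      proof (rule integral_dominated_convergence[where w="indicator ?I"])
        show "AE t in lborel. (\<lambda>m. cmod (indicator ((\<Union>i. A i) \<inter> ?I) t - indicator ((\<Union>i<m. A i) \<inter> ?I) t)) \<longlonglongrightarrow> 0"
        proof (rule AE_I2)
          fix t
          show "(\<lambda>m. cmod (indicator ((\<Union>i. A i) \<inter> ?I) t - indicator ((\<Union>i<m. A i) \<inter> ?I) t)) \<longlonglongrightarrow> 0"
          proof (cases "t \<in> (\<Union>i. A i) \<inter> ?I")
            case True
            then obtain i where i: "t \<in> A i" by auto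
            have "\<forall>\<^sub>F m in sequentially. cmod (indicator ((\<Union>i. A i) \<inter> ?I) t - indicator ((\<Union>i<m. A i) \<inter> ?I) t) = 0"
              by (rule eventually_mono[OF eventually_gt_at_top[of i]]) (use True i in \<open>auto simp: indicator_def\<close>)
            then show ?thesis by (rule tendsto_eventually)
          next
            case False
            then have "cmod (indicator ((\<Union>i. A i) \<inter> ?I) t - indicator ((\<Union>i<m. A i) \<inter> ?I) t) = 0" for m
              by (auto simp: indicator_def)
            then show ?thesis by simp
          qed
        qed
        show "AE t in lborel. norm (cmod (indicator ((\<Union>i. A i) \<inter> ?I) t - indicator ((\<Union>i<m. A i) \<inter> ?I) t)) \<le> indicator ?I t" for m
          by (auto simp: indicator_def)
      qed (auto simp: emeasure_lborel_Icc_eq)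
      then show "(\<lambda>m. \<integral>t. cmod (indicator ((\<Union>i. A i) \<inter> ?I) t - indicator ((\<Union>i<m. A i) \<inter> ?I) t) \<partial>lborel) \<longlonglongrightarrow> 0" by simp
    qed (auto intro!: int)
  qed
qed

lemma integrable_Ici_mult:
  fixes f :: "real \<Rightarrow> complex"
  assumes "integrable lborel f" shows "integrable lborel (\<lambda>t. indicator {0..} t * f t)"
  using assms by (rule Bochner_Integration.integrable_bound) (use assms in \<open>auto simp: indicator_def\<close>)

lemma xap_integrable:
  assumes "integrable lborel h" shows "xap (\<lambda>t. indicator {0..} t * h t)"
  using assms
proof (induction rule: integrable_induct)
  case (base A c)
  have iA: "integrable lborel (\<lambda>t. indicator A t :: complex)" using base by (intro integrable_complex_indicator) auto
  have [measurable]: "A \<in> sets borel" using base by simp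
  have fin: "emeasure lborel (A \<inter> B) < \<infinity>" if "B \<in> sets borel" for B
    using base that by (intro order.strict_trans1[OF emeasure_mono[of "A \<inter> B" A]]) auto
  have "xap (\<lambda>t. indicator (A \<inter> {0..}) t)"
  proof (rule xap_limit[OF _ _ _ _ xap_indicator[OF \<open>A \<in> sets borel\<close>]])
    have "(\<lambda>n. \<integral>t. cmod (indicator (A \<inter> {0..}) t - indicator (A \<inter> {0..real n}) t) \<partial>lborel) \<longlonglongrightarrow> (\<integral>t. 0 \<partial>(lborel :: real measure))"
    proof (rule integral_dominated_convergence[where w="\<lambda>t. cmod (indicator A t)"])
      show "AE t in lborel. (\<lambda>n. cmod (indicator (A \<inter> {0..}) t - indicator (A \<inter> {0..real n}) t)) \<longlonglongrightarrow> 0"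
      proof (rule AE_I2)
        fix t
        have "\<forall>\<^sub>F n in sequentially. cmod (indicator (A \<inter> {0..}) t - indicator (A \<inter> {0..real n}) t) = 0"
          by (rule eventually_mono[OF eventually_ge_at_top[of "nat \<lceil>t\<rceil>"]]) (auto simp: indicator_def)
        then show "(\<lambda>n. cmod (indicator (A \<inter> {0..}) t - indicator (A \<inter> {0..real n}) t)) \<longlonglongrightarrow> 0" by (rule tendsto_eventually)
      qed
      show "integrable lborel (\<lambda>t. cmod (indicator A t))" using integrable_norm[OF iA] .
    qed (auto simp: indicator_def)
    then show "(\<lambda>n. \<integral>t. cmod (indicator (A \<inter> {0..}) t - indicator (A \<inter> {0..real n}) t) \<partial>lborel) \<longlonglongrightarrow> 0" by simp
  qed (auto intro!: integrable_complex_indicator fin[simplified])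
  then have "xap (\<lambda>t. c * indicator (A \<inter> {0..}) t)" by (rule xap_cmult)
  moreover have "c * indicator (A \<inter> {0..}) t = indicator {0..} t * (indicator A t *\<^sub>R c)" for t by (auto simp: indicator_def)
  ultimately show ?case by simp
next
  case (add f g)
  have "xap (\<lambda>t. indicator {0..} t * f t + indicator {0..} t * g t)"
    by (intro xap_add add.IH integrable_Ici_mult add.hyps) auto
  then show ?case by (simp add: distrib_left)
next
  case (lim f s)
  show ?case
  proof (rule xap_limit[OF integrable_Ici_mult[OF lim.hyps(4)] _ integrable_Ici_mult[OF lim.hyps(1)] _ lim.IH])
    have [measurable]: "f \<in> borel_measurable borel" "s i \<in> borel_measurable borel" for i
      using lim.hyps(4) lim.hyps(1)[of i] by auto
    have "(\<lambda>i. \<integral>t. cmod (indicator {0..} t * f t - indicator {0..} t * s i t) \<partial>lborel) \<longlonglongrightarrow> (\<integral>t. 0 \<partial>(lborel :: real measure))"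
    proof (rule integral_dominated_convergence[where w="\<lambda>t. 3 * cmod (f t)"])
      show "AE t in lborel. (\<lambda>i. cmod (indicator {0..} t * f t - indicator {0..} t * s i t)) \<longlonglongrightarrow> 0"
      proof (rule AE_I2)
        fix t
        have "(\<lambda>i. cmod (indicator {0..} t * f t - indicator {0..} t * s i t)) \<longlonglongrightarrow> cmod (indicator {0..} t * f t - indicator {0..} t * f t)"
          using lim.hyps(2)[of t] by (intro tendsto_intros) simp
        then show "(\<lambda>i. cmod (indicator {0..} t * f t - indicator {0..} t * s i t)) \<longlonglongrightarrow> 0" by simp
      qed
      show "AE t in lborel. norm (cmod (indicator {0..} t * f t - indicator {0..} t * s i t)) \<le> 3 * cmod (f t)" for i
      proof (rule AE_I2)
        fix t
        have "cmod (f t - s i t) \<le> cmod (f t) + cmod (s i t)" by (rule norm_triangle_ineq4)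
        also have "\<dots> \<le> 3 * cmod (f t)" using lim.hyps(3)[of t i] by simp
        finally show "norm (cmod (indicator {0..} t * f t - indicator {0..} t * s i t)) \<le> 3 * cmod (f t)"
          by (simp add: indicator_def)
      qed
    qed (use lim.hyps(4) in auto)
    then show "(\<lambda>i. \<integral>t. cmod (indicator {0..} t * f t - indicator {0..} t * s i t) \<partial>lborel) \<longlonglongrightarrow> 0" by simp
  qed (auto simp: indicator_def)
qed

lemma L1h_approx:
  assumes "L1h r" "\<epsilon> > 0"
  shows "\<exists>b C. mlt b C \<and> mlt (\<lambda>z. r z - 1 / (complex_of_real z + 1) * b z) \<epsilon>"
proof -
  obtain h c where h: "sig 1 h c" "\<forall>\<^sub>F z in at_top. lap h z = r z" using assms(1) unfolding L1h_def by blast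
  then have i: "integrable lborel h" "\<And>t. t < 0 \<Longrightarrow> h t = 0" by (auto simp: sig_1)
  have "indicator {0..} t * h t = h t" for t using i(2)[of t] by (auto simp: indicator_def)
  then have "xap h" using xap_integrable[OF i(1)] by (simp only:)
  then obtain b C where b: "mlt b C" "mlt (\<lambda>z. lap h z - 1 / (complex_of_real z + 1) * b z) \<epsilon>"
    using assms(2) unfolding xap_def by blast
  have "mlt (\<lambda>z. r z - 1 / (complex_of_real z + 1) * b z) \<epsilon>"
    by (rule mlt_cong[OF b(2)]) (use h(2) in \<open>auto elim: eventually_mono\<close>)
  then show ?thesis using b(1) by blast
qed

section \<open>Maximal minors and the resolvent symbol\<close>

definition emat :: "complex^('n + unit)^'n \<Rightarrow> complex^('n + unit) \<Rightarrow> complex^('n + unit)^('n + unit)" where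
  "emat R v = (\<chi> i. case i of Inl k \<Rightarrow> R $ k | Inr _ \<Rightarrow> v)"

text \<open>Cofactors of an appended last row, up to sign the maximal minors of R. As determinants
  of \<open>emat\<close> they turn row expansion into plain linearity.\<close>

definition cof :: "complex^('n::finite + unit)^'n \<Rightarrow> 'n + unit \<Rightarrow> complex" where
  "cof R j = det (emat R (axis j 1))"

lemma emat_alt: "emat R v = (\<chi> i. if i = Inr () then v else emat R 0 $ i)"
  by (simp add: emat_def vec_eq_iff split: sum.split)

lemma det_emat:
  fixes R :: "complex^('n::finite + unit)^'n"
  shows "det (emat R v) = (\<Sum>j\<in>UNIV. v $ j * cof R j)"
proof -
  have "det (emat R v) = det (\<chi> i. if i = Inr () then (\<Sum>j\<in>UNIV. v $ j *s axis j 1) else emat R 0 $ i)"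
    by (subst emat_alt) (simp only: basis_expansion)
  also have "\<dots> = (\<Sum>j\<in>UNIV. det (\<chi> i. if i = Inr () then v $ j *s axis j 1 else emat R 0 $ i))"
    by (rule det_linear_row_sum) simp
  also have "\<dots> = (\<Sum>j\<in>UNIV. v $ j * cof R j)"
    unfolding det_row_mul cof_def by (subst (2) emat_alt) simp
  finally show ?thesis .
qed

text \<open>A vector outside the row span completes the rows to a basis, so some
  \<open>emat R v\<close> is invertible; its determinant is a combination of the cofactors.\<close>

lemma rank_cof:
  fixes R :: "complex^('n::finite + unit)^'n"
  assumes "rank R = CARD('n)" shows "\<exists>j. cof R j \<noteq> 0"
proof -
  let ?S = "rows R"
  have S: "?S = (\<lambda>i. R $ i) ` UNIV" by (auto simp: rows_def row_def vec_lambda_eta)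
  have fin: "finite ?S" unfolding S by simp
  have dS: "vec.dim ?S = CARD('n)" using assms by (simp add: row_rank_def_gen)
  have "card ?S \<le> CARD('n)" unfolding S by (rule card_image_le) simp
  moreover have "vec.dim ?S \<le> card ?S" by (rule vec.dim_le_card[OF vec.span_superset fin])
  ultimately have cS: "card ?S = CARD('n)" using dS by simp
  then have ind: "vec.independent ?S" using vec.card_eq_dim[of ?S ?S] fin dS vec.span_superset by simp
  have dU: "vec.dim (UNIV :: (complex^('n + unit)) set) = CARD('n) + 1" by (simp add: card_cart_basis)
  have "vec.span ?S \<noteq> UNIV"
  proof
    assume "vec.span ?S = UNIV"
    then show False using vec.dim_span[of ?S] dS dU by simp
  qed
  then obtain v where v: "v \<notin> vec.span ?S" by blast
  then have vS: "v \<notin> ?S" using vec.span_base by blast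
  have ind': "vec.independent (insert v ?S)" using ind v by (rule vec.independent_insertI[rotated])
  have "rows (emat R v) = (\<lambda>i. emat R v $ i) ` UNIV" by (auto simp: rows_def row_def vec_lambda_eta)
  also have "\<dots> = insert v ?S"
  proof
    show "(\<lambda>i. emat R v $ i) ` UNIV \<subseteq> insert v ?S"
      unfolding S by (auto simp: emat_def split: sum.split)
    have "emat R v $ Inr () = v" "emat R v $ Inl k = R $ k" for k by (auto simp: emat_def)
    then show "insert v ?S \<subseteq> (\<lambda>i. emat R v $ i) ` UNIV"
      unfolding S by (metis image_subset_iff insert_subset rangeI)
  qed
  finally have rows: "rows (emat R v) = insert v ?S" .
  have "UNIV \<subseteq> vec.span (insert v ?S)"
    by (rule vec.card_ge_dim_independent) (use ind' dU cS vS fin in auto)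
  then have "vec.span (rows (emat R v)) = UNIV" unfolding rows by auto
  then have "invertible (emat R v)" by (simp add: invertible_left_inverse matrix_left_invertible_span_rows_gen)
  then have "det (emat R v) \<noteq> 0" by (simp add: invertible_det_nz)
  moreover have "det (emat R v) = 0" if "\<forall>j. cof R j = 0" using that by (simp add: det_emat)
  ultimately show ?thesis by blast
qed

lemma bij_map_permutation_Inl:
  "bij_betw (map_permutation UNIV Inl) {s. s permutes (UNIV :: 'n::finite set)} {p. p permutes (range Inl :: ('n + unit) set)}"
proof -
  let ?m = "map_permutation UNIV (Inl :: 'n \<Rightarrow> 'n + unit)"
  have inj: "inj_on ?m {s. s permutes UNIV}"
  proof (rule inj_onI, rule ext)
    fix s t :: "'n \<Rightarrow> 'n" and x assume "?m s = ?m t"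
    then have "?m s (Inl x) = ?m t (Inl x)" by simp
    then show "s x = t x" by (simp add: map_permutation_apply)
  qed
  have sub: "?m ` {s. s permutes UNIV} \<subseteq> {p. p permutes range Inl}"
    by (auto intro!: map_permutation_permutes simp: bij_betw_def)
  have "card (?m ` {s. s permutes UNIV}) = fact CARD('n)" by (simp add: card_image[OF inj] card_permutations)
  moreover have "card {p. p permutes (range Inl :: ('n + unit) set)} = fact CARD('n)"
    by (rule card_permutations) (auto simp: card_image)
  ultimately have "?m ` {s. s permutes UNIV} = {p. p permutes range Inl}"
    using sub by (intro card_subset_eq) (auto simp: finite_permutations)
  then show ?thesis using inj by (simp add: bij_betw_def)
qed

text \<open>Only permutations fixing \<open>Inr ()\<close> survive, and these are the permutations
  of the left block transported by \<open>map_permutation\<close>.\<close>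

lemma cof_last:
  fixes R :: "complex^('n::finite + unit)^'n"
  shows "cof R (Inr ()) = det (\<chi> i j. R $ i $ Inl j)"
proof -
  let ?E = "emat R (axis (Inr ()) 1)" and ?L = "range Inl :: ('n + unit) set"
  have UN: "(UNIV :: ('n + unit) set) = UNIV <+> UNIV" by simp
  have fixed: "p (Inr ()) = Inr ()" if "p permutes ?L" for p using permutes_not_in[OF that] by auto
  have "cof R (Inr ()) = (\<Sum>p\<in>{p. p permutes (UNIV :: ('n + unit) set)}. of_int (sign p) * (\<Prod>i\<in>UNIV. ?E $ i $ p i))"
    by (simp add: cof_def det_def)
  also have "\<dots> = (\<Sum>p\<in>{p. p permutes ?L}. of_int (sign p) * (\<Prod>i\<in>UNIV. ?E $ i $ p i))"
  proof (rule sum.mono_neutral_right)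
    show "{p. p permutes ?L} \<subseteq> {p. p permutes UNIV}" by (auto intro: permutes_subset)
    show "\<forall>p\<in>{p. p permutes UNIV} - {p. p permutes ?L}. of_int (sign p) * (\<Prod>i\<in>UNIV. ?E $ i $ p i) = 0"
    proof
      fix p assume p: "p \<in> {p. p permutes (UNIV :: ('n + unit) set)} - {p. p permutes ?L}"
      have "p (Inr ()) \<noteq> Inr ()"
      proof
        assume pfix: "p (Inr ()) = Inr ()"
        have "p x = x" if "x \<in> UNIV - ?L" for x using that pfix by (cases x) auto
        moreover have "p permutes UNIV" using p by simp
        ultimately have "p permutes ?L" by (rule permutes_superset[rotated])
        then show False using p by simp
      qed
      then have "?E $ Inr () $ p (Inr ()) = 0" by (simp add: emat_def axis_def)
      then have "(\<Prod>i\<in>UNIV. ?E $ i $ p i) = 0" by (intro prod_zero) auto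
      then show "of_int (sign p) * (\<Prod>i\<in>UNIV. ?E $ i $ p i) = 0" by simp
    qed
  qed (simp add: finite_permutations)
  also have "\<dots> = (\<Sum>s\<in>{s. s permutes (UNIV :: 'n set)}. of_int (sign (map_permutation UNIV (Inl :: 'n \<Rightarrow> 'n + unit) s)) * (\<Prod>i\<in>UNIV. ?E $ i $ map_permutation UNIV Inl s i))"
    using sum.reindex_bij_betw[OF bij_map_permutation_Inl[where 'n='n], of "\<lambda>p. complex_of_int (sign p) * (\<Prod>i\<in>UNIV. ?E $ i $ p i)"] by (simp only:)
  also have "\<dots> = (\<Sum>s\<in>{s. s permutes (UNIV :: 'n set)}. of_int (sign s) * (\<Prod>i\<in>UNIV. R $ i $ Inl (s i)))"
  proof (rule sum.cong[OF refl])
    fix s assume s: "s \<in> {s. s permutes (UNIV :: 'n set)}"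
    then have m: "map_permutation UNIV Inl s permutes ?L" by (intro map_permutation_permutes) (auto simp: bij_betw_def)
    have "(\<Prod>i\<in>UNIV. ?E $ i $ map_permutation UNIV Inl s i) = (\<Prod>i\<in>UNIV. R $ i $ Inl (s i))"
      unfolding UN by (subst prod.Plus) (auto simp: emat_def map_permutation_apply fixed[OF m] UNIV_unit axis_def)
    then show "of_int (sign (map_permutation UNIV (Inl :: 'n \<Rightarrow> 'n + unit) s)) * (\<Prod>i\<in>UNIV. ?E $ i $ map_permutation UNIV Inl s i) = of_int (sign s) * (\<Prod>i\<in>UNIV. R $ i $ Inl (s i))"
      using s by (simp add: sign_map_permutation)
  qed
  also have "\<dots> = det (\<chi> i j. R $ i $ Inl j)" by (simp add: det_def)
  finally show ?thesis .
qed

text \<open>The symbol is the transform of exp(a t), integrable on t >= 0 since Re a < 0.\<close>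

lemma mlt_resolvent:
  assumes "Re a < 0" shows "\<exists>C. mlt (\<lambda>z. 1 / (complex_of_real z - a)) C"
proof -
  let ?h = "\<lambda>t. complex_of_real (indicator {0..} t) * exp (a * complex_of_real t)"
  have F: "((\<lambda>t. exp ((a - of_real z) * complex_of_real t) / (a - of_real z)) has_vector_derivative exp ((a - of_real z) * complex_of_real t)) (at t within S)"
    if "z \<ge> 0" for z t S
  proof -
    have "a - of_real z \<noteq> 0" using assms that by (auto simp: complex_eq_iff)
    then show ?thesis by (auto intro!: derivative_eq_intros has_vector_derivative_real_field)
  qed
  have int: "integrable lborel (\<lambda>t. complex_of_real (indicator {0..} t) * exp ((a - of_real z) * complex_of_real t))" if "z \<ge> 0" for z
  proof (rule Bochner_Integration.integrable_bound[OF integrable_exp_Ici])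
    show "- Re a > 0" using assms by simp
    show "AE t in lborel. norm (complex_of_real (indicator {0..} t) * exp ((a - of_real z) * complex_of_real t)) \<le> norm (exp (- (- Re a * t)) * indicator {0..} t)"
      using that by (auto simp: norm_mult norm_exp_eq_Re indicator_def algebra_simps intro!: AE_I2)
  qed measurable
  have lap: "lap ?h z = 1 / (complex_of_real z - a)" if z: "z \<ge> 0" for z
  proof -
    let ?f = "\<lambda>t. exp ((a - of_real z) * complex_of_real t)"
    have a: "a - of_real z \<noteq> 0" using assms that by (auto simp: complex_eq_iff)
    have "(\<lambda>n. \<integral>t. indicator {0..real n} t *\<^sub>R ?f t \<partial>lborel) \<longlonglongrightarrow> (\<integral>t. complex_of_real (indicator {0..} t) * ?f t \<partial>lborel)"
    proof (rule integral_dominated_convergence)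
      show "integrable lborel (\<lambda>t. norm (complex_of_real (indicator {0..} t) * ?f t))" by (rule integrable_norm[OF int[OF z]])
      show "AE t in lborel. (\<lambda>n. indicator {0..real n} t *\<^sub>R ?f t) \<longlonglongrightarrow> complex_of_real (indicator {0..} t) * ?f t"
      proof (rule AE_I2)
        fix t
        have "\<forall>\<^sub>F n in sequentially. indicator {0..real n} t *\<^sub>R ?f t = complex_of_real (indicator {0..} t) * ?f t"
          by (rule eventually_mono[OF eventually_ge_at_top[of "nat \<lceil>t\<rceil>"]]) (auto simp: indicator_def)
        then show "(\<lambda>n. indicator {0..real n} t *\<^sub>R ?f t) \<longlonglongrightarrow> complex_of_real (indicator {0..} t) * ?f t" by (rule tendsto_eventually)
      qed
    qed (auto simp: indicator_def)
    moreover have "(\<integral>t. indicator {0..real n} t *\<^sub>R ?f t \<partial>lborel) = ?f (real n) / (a - of_real z) - ?f 0 / (a - of_real z)" for n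
      by (rule integral_FTC_Icc) (use F[OF z] in \<open>auto intro!: continuous_intros\<close>)
    moreover have "(\<lambda>n. ?f (real n) / (a - of_real z) - ?f 0 / (a - of_real z)) \<longlonglongrightarrow> 0 / (a - of_real z) - ?f 0 / (a - of_real z)"
    proof (intro tendsto_intros a)
      have "?f (real n) = exp (a - of_real z) ^ n" for n by (simp add: exp_of_nat_mult[symmetric] mult.commute)
      moreover have "cmod (exp (a - of_real z)) < 1" using assms z by (simp add: norm_exp_eq_Re)
      ultimately show "(\<lambda>n. ?f (real n)) \<longlonglongrightarrow> 0" by (simp add: LIMSEQ_power_zero)
    qed
    ultimately have "(\<integral>t. complex_of_real (indicator {0..} t) * ?f t \<partial>lborel) = 0 / (a - of_real z) - ?f 0 / (a - of_real z)"
      by (auto intro: LIMSEQ_unique)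
    moreover have "lap ?h z = (\<integral>t. complex_of_real (indicator {0..} t) * ?f t \<partial>lborel)"
      unfolding lap_def by (intro Bochner_Integration.integral_cong) (auto simp: exp_of_real[symmetric] mult_exp_exp algebra_simps)
    ultimately show ?thesis using a by (simp add: field_simps)
  qed
  have "mlt (lap ?h) (\<integral>t. cmod (?h t) \<partial>lborel)"
    by (rule mlt_lap, rule integrable_sig_1) (use int[of 0] in auto)
  then have "mlt (\<lambda>z. 1 / (complex_of_real z - a)) (\<integral>t. cmod (?h t) \<partial>lborel)"
    by (rule mlt_cong) (auto intro!: eventually_at_top_gtE[of 0] lap)
  then show ?thesis by blast
qed

lemma common_bound:
  fixes f :: "'a::finite \<Rightarrow> 'b::finite \<Rightarrow> real \<Rightarrow> complex"
  assumes "\<And>i j. \<exists>C. mlt (f i j) C" shows "\<exists>K\<ge>1. \<forall>i j. mlt (f i j) K"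
proof -
  obtain C where C: "\<And>i j. mlt (f i j) (C i j)" using assms by metis
  have C0: "0 \<le> C i j" for i j using mlt.nonneg[OF C] .
  have "C i j \<le> 1 + (\<Sum>i\<in>UNIV. \<Sum>j\<in>UNIV. C i j)" for i j
  proof -
    have "C i j \<le> (\<Sum>j\<in>UNIV. C i j)" by (rule member_le_sum) (auto simp: C0)
    also have "\<dots> \<le> (\<Sum>i\<in>UNIV. \<Sum>j\<in>UNIV. C i j)" by (rule member_le_sum[of i _ "\<lambda>i. \<Sum>j\<in>UNIV. C i j"]) (auto simp: C0 sum_nonneg)
    finally show ?thesis by simp
  qed
  then show ?thesis using C C0 mlt.mono by (intro exI[of _ "1 + (\<Sum>i\<in>UNIV. \<Sum>j\<in>UNIV. C i j)"]) (auto intro!: sum_nonneg mlt.mono[OF C])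
qed

text \<open>What the choice of the control row needs of the weighted plant. \<open>FH\<close> splits
  the minor of the state columns into an approximately invertible part F and an L1 part H,
  \<open>Rdiv\<close> allows evaluation at complex z0, and reality on the real axis permits real
  kernels.\<close>

locale plant =
  fixes R :: "complex \<Rightarrow> complex^('n::finite + unit)^'n" and F H :: "real \<Rightarrow> complex"
  assumes Rm: "\<And>i j. \<exists>C. mlt (\<lambda>z. R (complex_of_real z) $ i $ j) C"
    and Rdiv: "\<And>i j z0. z0 \<noteq> - 1 \<Longrightarrow> \<exists>b C. mlt b C \<and> (\<forall>\<^sub>F z in at_top. R (complex_of_real z) $ i $ j - R z0 $ i $ j
       = (1 / (complex_of_real z + 1) - 1 / (z0 + 1)) * b z)"
    and Rreal: "\<And>i j z. R (complex_of_real z) $ i $ j \<in> \<real>"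
    and FH: "\<forall>\<^sub>F z in at_top. cof (R (complex_of_real z)) (Inr ()) = F z + H z"
    and HL: "L1h H"
    and Hreal: "\<forall>\<^sub>F z in at_top. H z \<in> \<real>"
    and Finv: "\<And>\<epsilon>. \<epsilon> > 0 \<Longrightarrow> \<exists>W C. mlt W C \<and> mlt (\<lambda>z. W z * F z - 1) \<epsilon>"
    and rank: "\<And>z0. Re z0 \<ge> 0 \<Longrightarrow> \<exists>j. cof (R z0) j \<noteq> 0"
begin

definition c :: "'n + unit \<Rightarrow> real \<Rightarrow> complex" where "c j z = cof (R (complex_of_real z)) j"

text \<open>The ideal generated by the maximal minors, with multiplier coefficients; the Bezout
  identity says that its closure contains 1.\<close>

definition J :: "(real \<Rightarrow> complex) \<Rightarrow> bool" where
  "J r \<longleftrightarrow> (\<exists>b. (\<forall>j. \<exists>C. mlt (b j) C) \<and> r = (\<lambda>z. \<Sum>j\<in>UNIV. b j z * c j z))"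

lemma emat_entries: "\<exists>K\<ge>1. \<forall>i j. mlt (\<lambda>z. emat (R (complex_of_real z)) v $ i $ j) K"
proof (rule common_bound)
  fix i :: "'n + unit" and j
  show "\<exists>C. mlt (\<lambda>z. emat (R (complex_of_real z)) v $ i $ j) C"
    by (cases i) (auto simp: emat_def intro: Rm mlt.const)
qed

lemma c_mlt: "\<exists>C. mlt (c j) C"
proof -
  obtain K where "\<And>i k. mlt (\<lambda>z. emat (R (complex_of_real z)) (axis j 1) $ i $ k) K" using emat_entries by blast
  then show ?thesis unfolding c_def[abs_def] cof_def by (rule mlt.det_bnd)
qed

lemma c_real: "c j z \<in> \<real>"
proof -
  have "emat (R (complex_of_real z)) (axis j 1) $ i $ k \<in> \<real>" for i k
    by (cases i) (auto simp: emat_def Rreal axis_def)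
  then show ?thesis unfolding c_def cof_def det_def by (intro sum_in_Reals Reals_mult prod_in_Reals Reals_of_int) auto
qed

lemma J_c: "J (c j)"
proof -
  have "\<exists>C. mlt (\<lambda>z. if k = j then 1 else 0) C" for k using mlt.const by (cases "k = j") auto
  moreover have "c j = (\<lambda>z. \<Sum>k\<in>UNIV. (if k = j then 1 else 0) * c k z)"
    by (simp add: if_distrib[of "\<lambda>x. x * _"] cong: if_cong)
  ultimately show ?thesis unfolding J_def by (intro exI[of _ "\<lambda>k z. if k = j then 1 else 0"]) simp
qed

lemma J_zero: "J (\<lambda>_. 0)"
  unfolding J_def by (rule exI[of _ "\<lambda>_ _. 0"]) (use mlt.const in auto)

lemma J_add: assumes "J r" "J s" shows "J (\<lambda>z. r z + s z)"
proof -
  obtain b where b: "\<And>j. \<exists>C. mlt (b j) C" "r = (\<lambda>z. \<Sum>j\<in>UNIV. b j z * c j z)" using assms unfolding J_def by blast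
  obtain d where d: "\<And>j. \<exists>C. mlt (d j) C" "s = (\<lambda>z. \<Sum>j\<in>UNIV. d j z * c j z)" using assms unfolding J_def by blast
  have "\<exists>C. mlt (\<lambda>z. b j z + d j z) C" for j using b(1)[of j] d(1)[of j] mlt.add by blast
  then show ?thesis unfolding J_def b(2) d(2)
    by (intro exI[of _ "\<lambda>j z. b j z + d j z"]) (simp add: distrib_right sum.distrib)
qed

lemma J_mult: assumes "mlt r C" "J s" shows "J (\<lambda>z. r z * s z)"
proof -
  obtain d where d: "\<And>j. \<exists>C. mlt (d j) C" "s = (\<lambda>z. \<Sum>j\<in>UNIV. d j z * c j z)" using assms unfolding J_def by blast
  have "\<exists>C. mlt (\<lambda>z. r z * d j z) C" for j using assms(1) d(1)[of j] mlt.mult by blast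
  then show ?thesis unfolding J_def d(2)
    by (intro exI[of _ "\<lambda>j z. r z * d j z"]) (simp add: sum_distrib_left mult.assoc)
qed

lemma J_mlt: assumes "J r" shows "\<exists>C. mlt r C"
proof -
  obtain b where b: "\<And>j. \<exists>C. mlt (b j) C" "r = (\<lambda>z. \<Sum>j\<in>UNIV. b j z * c j z)" using assms unfolding J_def by blast
  then obtain C where C: "\<And>j. mlt (b j) (C j)" by metis
  obtain D where D: "\<And>j. mlt (c j) (D j)" using c_mlt by metis
  have "mlt r (\<Sum>j\<in>UNIV. C j * D j)" unfolding b(2) by (intro mlt.sum mlt.mult C D)
  then show ?thesis by blast
qed

definition qb :: "(real \<Rightarrow> complex) \<Rightarrow> real \<Rightarrow> bool" where
  "qb r C \<longleftrightarrow> (\<exists>j. J j \<and> mlt (\<lambda>z. r z - j z) C)"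

lemma qb_nrm: "nrm qb"
  unfolding qb_def[abs_def] by (rule mlt.quotient_nrm) (fact J_zero J_add J_mult J_mlt)+

lemma qb_mlt: "mlt r C \<Longrightarrow> qb r C"
  unfolding qb_def by (rule exI[of _ "\<lambda>_. 0"]) (simp add: J_zero)

text \<open>Every \<open>c j - c j (z0)\<close> is a multiple of \<open>1 / (z + 1) - 1 / (z0 + 1)\<close>.\<close>

lemma c_divisible:
  assumes "z0 \<noteq> - 1"
  shows "\<exists>b C. mlt b C \<and> (\<forall>\<^sub>F z in at_top. c j z - cof (R z0) j = (1 / (complex_of_real z + 1) - 1 / (z0 + 1)) * b z)"
proof -
  let ?x = "\<lambda>z. 1 / (complex_of_real z + 1) - 1 / (z0 + 1)"
  define D where "D r \<longleftrightarrow> (\<exists>b C. mlt b C \<and> (\<forall>\<^sub>F z in at_top. r z = ?x z * b z))" for r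
  let ?A = "\<lambda>z. emat (R z0) (axis j 1)" and ?B = "\<lambda>z. emat (R (complex_of_real z)) (axis j 1)"
  obtain K where K: "\<And>i k. mlt (\<lambda>z. ?B z $ i $ k) K" using emat_entries by blast
  have "\<exists>L\<ge>1. \<forall>i k. mlt (\<lambda>z. ?A z $ i $ k) L" by (rule common_bound) (use mlt.const in blast)
  then obtain L where L: "\<And>i k. mlt (\<lambda>z. ?A z $ i $ k) L" by blast
  have "D (\<lambda>z. det (?A z + (?B z - ?A z)) - det (?A z))"
  proof (rule mlt.det_ideal[OF _ _ _ L])
    show "D (\<lambda>_. 0)" unfolding D_def by (rule exI[of _ "\<lambda>_. 0"]) (use mlt.zero[of 0] in auto)
    show "D (\<lambda>z. r z + s z)" if r: "D r" and s: "D s" for r s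
    proof -
      obtain b C where b: "mlt b C" "\<forall>\<^sub>F z in at_top. r z = ?x z * b z" using r unfolding D_def by blast
      obtain d E where d: "mlt d E" "\<forall>\<^sub>F z in at_top. s z = ?x z * d z" using s unfolding D_def by blast
      have "\<forall>\<^sub>F z in at_top. r z + s z = ?x z * (b z + d z)" using b(2) d(2) by eventually_elim (simp add: distrib_left)
      then show ?thesis unfolding D_def using mlt.add[OF b(1) d(1)] by blast
    qed
    show "D (\<lambda>z. r z * s z)" if r: "mlt r C" and s: "D s" for r s C
    proof -
      obtain d E where d: "mlt d E" "\<forall>\<^sub>F z in at_top. s z = ?x z * d z" using s unfolding D_def by blast
      have "\<forall>\<^sub>F z in at_top. r z * s z = ?x z * (r z * d z)" using d(2) by eventually_elim simp
      then show ?thesis unfolding D_def using mlt.mult[OF r d(1)] by blast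
    qed
    show "mlt (\<lambda>z. (?B z - ?A z) $ i $ k) (K + L)" for i k using mlt.diff[OF K L] by simp
    show "D (\<lambda>z. (?B z - ?A z) $ i $ k)" for i k
    proof (cases i)
      case (Inl l)
      then show ?thesis using Rdiv[OF assms, of l k] unfolding D_def by (simp add: emat_def)
    next
      case (Inr u)
      then show ?thesis using \<open>D (\<lambda>_. 0)\<close> by (simp add: emat_def)
    qed
  qed
  then show ?thesis unfolding D_def c_def cof_def by simp
qed

text \<open>l = 0 is the point at infinity: modulo J the sum F + H vanishes, W F is near 1 and H is
  near x b, so -W b nearly inverts x. Otherwise l = 1 / (z0 + 1). For Re z0 < 0, x - l is invertible
  among the multipliers. For Re z0 >= 0 some minor has a value k \<noteq> 0 at z0, and c = k + (x -
  l) b inverts x - l modulo J.\<close>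

lemma regular:
  "\<exists>b B \<delta>. qb b B \<and> qb (\<lambda>z. 1 - b z * (1 / (complex_of_real z + 1) - l)) \<delta> \<and> \<delta> < 1"
proof (cases "l = 0")
  case True
  obtain W C where W: "mlt W C" "mlt (\<lambda>z. W z * F z - 1) (1 / 4)" using Finv[of "1/4"] by auto
  have C: "0 \<le> C" using mlt.nonneg[OF W(1)] .
  \<comment> \<open>The tolerance for H is chosen after the bound C of W, which multiplies it; the
    total error stays below 1/2.\<close>
  have "0 < 1 / (4 * (C + 1))" using C by simp
  then obtain b B where b: "mlt b B" "mlt (\<lambda>z. H z - 1 / (complex_of_real z + 1) * b z) (1 / (4 * (C + 1)))"
    using L1h_approx[OF HL] by blast
  have m: "mlt (\<lambda>z. - (W z * F z - 1) - W z * (H z - 1 / (complex_of_real z + 1) * b z)) (1 / 4 + C * (1 / (4 * (C + 1))))"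
    by (intro mlt.diff mlt.uminus mlt.mult W b)
  have "mlt (\<lambda>z. (1 - (- (W z * b z)) * (1 / (complex_of_real z + 1) - l)) - W z * c (Inr ()) z) (1 / 4 + C * (1 / (4 * (C + 1))))"
    by (rule mlt_cong[OF m], use FH in eventually_elim) (simp add: True c_def algebra_simps)
  moreover have "J (\<lambda>z. W z * c (Inr ()) z)" by (rule J_mult[OF W(1) J_c])
  ultimately have "qb (\<lambda>z. 1 - (- (W z * b z)) * (1 / (complex_of_real z + 1) - l)) (1 / 4 + C * (1 / (4 * (C + 1))))"
    unfolding qb_def by blast
  moreover have "1 / 4 + C * (1 / (4 * (C + 1))) < 1" using C by (simp add: field_simps)
  moreover have "qb (\<lambda>z. - (W z * b z)) (C * B)" by (intro qb_mlt mlt.uminus mlt.mult W b)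
  ultimately show ?thesis by blast
next
  case False
  define z0 where "z0 = 1 / l - 1"
  have z0: "z0 \<noteq> - 1" "1 / (z0 + 1) = l" using False by (auto simp: z0_def)
  show ?thesis
  proof (cases "Re z0 < 0")
    case True
    obtain C where C: "mlt (\<lambda>z. 1 / (complex_of_real z - z0)) C" using mlt_resolvent[OF True] by blast
    \<comment> \<open>The inverse of x - l is -(z0 + 1)(z + 1) / (z - z0), written with a bounded
      resolvent by (z + 1) / (z - z0) = 1 + (1 + z0) / (z - z0).\<close>
    let ?b = "\<lambda>z. - (z0 + 1) * (1 + (1 + z0) * (1 / (complex_of_real z - z0)))"
    have "mlt ?b (cmod (- (z0 + 1)) * (1 + cmod (1 + z0) * C))"
      by (intro mlt.cmult mlt.add mlt.one C)
    moreover have "mlt (\<lambda>z. 1 - ?b z * (1 / (complex_of_real z + 1) - l)) 0"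
    proof (rule mlt_cong[OF mlt.zero[OF order_refl]], rule eventually_at_top_gtE[of 0])
      fix z :: real assume z: "0 < z"
      have "complex_of_real z + 1 \<noteq> 0" "complex_of_real z - z0 \<noteq> 0" "z0 + 1 \<noteq> 0"
        using z True z0(1) by (auto simp: complex_eq_iff)
      then show "0 = 1 - ?b z * (1 / (complex_of_real z + 1) - l)"
        unfolding z0(2)[symmetric] by (simp add: divide_simps) (simp add: algebra_simps)
    qed
    ultimately show ?thesis using qb_mlt zero_less_one by blast
  next
    case False
    then obtain j where j: "cof (R z0) j \<noteq> 0" using rank by force
    obtain b C where b: "mlt b C" "\<forall>\<^sub>F z in at_top. c j z - cof (R z0) j = (1 / (complex_of_real z + 1) - 1 / (z0 + 1)) * b z"
      using c_divisible[OF z0(1)] by blast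
    let ?a = "1 / cof (R z0) j"
    have "mlt (\<lambda>z. (1 - (- ?a * b z) * (1 / (complex_of_real z + 1) - l)) - ?a * c j z) 0"
    proof (rule mlt_cong[OF mlt.zero[OF order_refl]], use b(2) in eventually_elim)
      case (elim z)
      then have "c j z - cof (R z0) j = (1 / (complex_of_real z + 1) - l) * b z" by (simp only: z0(2))
      then have "c j z = cof (R z0) j + (1 / (complex_of_real z + 1) - l) * b z" by (simp add: diff_eq_eq add.commute)
      moreover have "0 = 1 - (- (1 / k) * b) * u - (1 / k) * d" if "d = k + u * b" "k \<noteq> 0" for k b u d :: complex
        using that by (simp add: field_simps)
      ultimately show ?case using j by blast
    qed
    moreover have "J (\<lambda>z. ?a * c j z)" by (rule J_mult[OF mlt.const J_c])
    ultimately have "qb (\<lambda>z. 1 - (- ?a * b z) * (1 / (complex_of_real z + 1) - l)) 0" unfolding qb_def by blast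
    moreover have "qb (\<lambda>z. - ?a * b z) (cmod (- ?a) * C)" by (rule qb_mlt) (rule mlt.cmult[OF b(1)])
    ultimately show ?thesis using zero_less_one by blast
  qed
qed

text \<open>\<open>gelfand_mazur\<close> for the seminorm modulo J: a small bound for 1 is an
  element of J close to 1.\<close>

lemma bezout_approx:
  assumes "\<epsilon> > 0"
  shows "\<exists>b. (\<forall>j. \<exists>C. mlt (b j) C) \<and> mlt (\<lambda>z. 1 - (\<Sum>j\<in>UNIV. b j z * c j z)) \<epsilon>"
proof -
  interpret q: nrm qb by (rule qb_nrm)
  obtain K where "mlt (\<lambda>z. 1 / (complex_of_real z + 1)) K" using mlt_resolvent[of "-1"] by auto
  then have "qb (\<lambda>z. 1 / (complex_of_real z + 1)) K" by (rule qb_mlt)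
  from q.gelfand_mazur[OF this regular assms] show ?thesis
    unfolding qb_def J_def by blast
qed

text \<open>Cutting off the values as well as the support makes the kernels bounded, which later
  gives membership in L2; both cuts are small in L1.\<close>

lemma truncate_L1:
  assumes h: "integrable lborel h" "\<And>t. t < 0 \<Longrightarrow> h t = 0"
  defines "k \<equiv> \<lambda>(n::nat) t. if 0 \<le> t \<and> t \<le> real n \<and> \<bar>Re (h t)\<bar> \<le> real n then Re (h t) else 0"
  shows "(\<lambda>n. \<integral>t. cmod (complex_of_real (Re (h t)) - complex_of_real (k n t)) \<partial>lborel) \<longlonglongrightarrow> 0"
    and "k n \<in> borel_measurable borel"
proof -
  have [measurable]: "h \<in> borel_measurable borel" using h by auto
  show km: "k n \<in> borel_measurable borel" for n unfolding k_def by measurable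
  have [measurable]: "k n \<in> borel_measurable borel" for n by (rule km)
  have "(\<lambda>n. \<integral>t. cmod (complex_of_real (Re (h t)) - complex_of_real (k n t)) \<partial>lborel) \<longlonglongrightarrow> (\<integral>t. 0 \<partial>(lborel :: real measure))"
  proof (rule integral_dominated_convergence[where w="\<lambda>t. cmod (h t)"])
    show "integrable lborel (\<lambda>t. cmod (h t))" using h by auto
    show "AE t in lborel. (\<lambda>n. cmod (complex_of_real (Re (h t)) - complex_of_real (k n t))) \<longlonglongrightarrow> 0"
    proof (rule AE_I2)
      fix t
      have "\<forall>\<^sub>F n in sequentially. cmod (complex_of_real (Re (h t)) - complex_of_real (k n t)) = 0"
      proof (rule eventually_mono[OF eventually_ge_at_top[of "nat \<lceil>max t \<bar>Re (h t)\<bar>\<rceil>"]])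
        fix n assume "nat \<lceil>max t \<bar>Re (h t)\<bar>\<rceil> \<le> n"
        then have "max t \<bar>Re (h t)\<bar> \<le> real n" by linarith
        then show "cmod (complex_of_real (Re (h t)) - complex_of_real (k n t)) = 0" using h(2)[of t] by (auto simp: k_def)
      qed
      then show "(\<lambda>n. cmod (complex_of_real (Re (h t)) - complex_of_real (k n t))) \<longlonglongrightarrow> 0" by (rule tendsto_eventually)
    qed
    show "AE t in lborel. norm (cmod (complex_of_real (Re (h t)) - complex_of_real (k n t))) \<le> cmod (h t)" for n
      using abs_Re_le_cmod[of "h _"] by (auto simp: k_def)
  qed measurable
  then show "(\<lambda>n. \<integral>t. cmod (complex_of_real (Re (h t)) - complex_of_real (k n t)) \<partial>lborel) \<longlonglongrightarrow> 0" by simp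
qed

lemma controller:
  "\<exists>(k :: 'n + unit \<Rightarrow> real \<Rightarrow> real) S W C. S > 0 \<and> (\<forall>j. k j \<in> borel_measurable borel) \<and> (\<forall>j t. \<bar>k j t\<bar> \<le> S)
     \<and> (\<forall>j t. t < 0 \<or> t > S \<longrightarrow> k j t = 0) \<and> mlt W C \<and>
     mlt (\<lambda>z. W z * det (emat (R (complex_of_real z))
        (\<chi> j. (if j = Inr () then 1 else 0) - lap (\<lambda>t. complex_of_real (k j t)) z)) - 1) (1 / 2)"
proof -
  obtain W C where W: "mlt W C" "mlt (\<lambda>z. W z * F z - 1) (1 / 4)" using Finv[of "1/4"] by auto
  have C: "0 \<le> C" using mlt.nonneg[OF W(1)] .
  \<comment> \<open>Error budget: H times the Bezout defect and the truncation cost at most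
    \<epsilon> each; after multiplication by W, of bound C, this is at most 1/4, added to the 1/4
    from W F - 1.\<close>
  define \<epsilon> where "\<epsilon> = 1 / (8 * (C + 1))"
  have \<epsilon>: "\<epsilon> > 0" using C by (simp add: \<epsilon>_def)
  obtain CH where CH: "mlt H CH" using L1h_mlt[OF HL] by blast
  have CH0: "0 \<le> CH" using mlt.nonneg[OF CH] .
  have "0 < \<epsilon> / (CH + 1)" using \<epsilon> CH0 by simp
  then obtain b where b: "\<And>j. \<exists>C. mlt (b j) C" "mlt (\<lambda>z. 1 - (\<Sum>j\<in>UNIV. b j z * c j z)) (\<epsilon> / (CH + 1))"
    using bezout_approx by blast
  have "\<exists>h. integrable lborel h \<and> (\<forall>t<0. h t = 0) \<and> (\<forall>\<^sub>F z in at_top. lap h z = b j z * H z)" for j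
  proof -
    obtain B where "mlt (b j) B" using b(1) by blast
    from L1h_mult[OF this HL] show ?thesis unfolding L1h_def by (auto simp: sig_1)
  qed
  then obtain h where h: "\<And>j. integrable lborel (h j)" "\<And>j t. t < 0 \<Longrightarrow> h j t = 0" "\<And>j. \<forall>\<^sub>F z in at_top. lap (h j) z = b j z * H z"
    by metis
  obtain Cc where Cc: "\<And>j. mlt (c j) (Cc j)" using c_mlt by metis
  have Cc0: "0 \<le> Cc j" for j using mlt.nonneg[OF Cc] .
  define kk where "kk j n t = (if 0 \<le> t \<and> t \<le> real n \<and> \<bar>Re (h j t)\<bar> \<le> real n then Re (h j t) else 0)" for j and n :: nat and t
  have kk: "(\<lambda>n. \<integral>t. cmod (complex_of_real (Re (h j t)) - complex_of_real (kk j n t)) \<partial>lborel) \<longlonglongrightarrow> 0"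
    and kkm[measurable]: "kk j n \<in> borel_measurable borel" for j n
    unfolding kk_def using truncate_L1[OF h(1)[of j] h(2)[of _ j]] by auto
  have "\<forall>\<^sub>F n in sequentially. \<forall>j\<in>UNIV. (\<integral>t. cmod (complex_of_real (Re (h j t)) - complex_of_real (kk j n t)) \<partial>lborel) < \<epsilon> / ((\<Sum>j\<in>UNIV. Cc j) + 1)"
    using \<epsilon> Cc0 by (intro eventually_ball_finite ballI order_tendstoD(2)[OF kk] divide_pos_pos) (auto intro!: add_nonneg_pos sum_nonneg)
  then have "\<forall>\<^sub>F n in sequentially. n > 0 \<and> (\<forall>j. (\<integral>t. cmod (complex_of_real (Re (h j t)) - complex_of_real (kk j n t)) \<partial>lborel) < \<epsilon> / ((\<Sum>j\<in>UNIV. Cc j) + 1))"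
    using eventually_gt_at_top[of 0] by eventually_elim simp
  then obtain n where n: "n > 0" "\<And>j. (\<integral>t. cmod (complex_of_real (Re (h j t)) - complex_of_real (kk j n t)) \<partial>lborel) < \<epsilon> / ((\<Sum>j\<in>UNIV. Cc j) + 1)"
    using eventually_happens'[OF sequentially_bot] by blast
  let ?k = "\<lambda>j. kk j n" and ?Re = "\<lambda>j t. complex_of_real (Re (h j t))"
  let ?kc = "\<lambda>j t. complex_of_real (kk j n t)"
  have Rint: "integrable lborel (?Re j)" for j using h(1)[of j] by auto
  have Rsig: "sig 1 (?Re j) (\<integral>t. cmod (?Re j t) \<partial>lborel)" for j
    by (rule integrable_sig_1[OF Rint]) (use h(2) in auto)
  have kint: "integrable lborel (?kc j)" for j
    by (rule Bochner_Integration.integrable_bound[OF Rint[of j]], measurable) (auto simp: kk_def)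
  have ksig: "sig 1 (?kc j) (\<integral>t. cmod (?kc j t) \<partial>lborel)" for j
    by (rule integrable_sig_1[OF kint]) (auto simp: kk_def)
  have Rlap: "lap (?Re j) z = complex_of_real (Re (lap (h j) z))" if "z > 0" for j z
  proof -
    have "integrable lborel (\<lambda>t. complex_of_real (exp (- (z * t))) * h j t)"
      by (rule sig_lap_integrable[OF integrable_sig_1[OF h(1) h(2)] _ that]) auto
    from integral_Re[OF this, symmetric] show ?thesis
      unfolding lap_def by (simp only: integral_complex_of_real[symmetric]) (auto intro!: Bochner_Integration.integral_cong)
  qed
  have m1: "mlt (\<lambda>z. H z * (1 - (\<Sum>j\<in>UNIV. b j z * c j z))) (CH * (\<epsilon> / (CH + 1)))"
    by (rule mlt.mult[OF CH b(2)])
  have "\<forall>\<^sub>F z in at_top. \<forall>j\<in>UNIV. lap (h j) z = b j z * H z"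
    by (intro eventually_ball_finite ballI h(3)) simp
  \<comment> \<open>H and the minors are real on the real axis, so taking real parts of the whole
    expression only replaces each kernel by its real part.\<close>
  then have ev: "\<forall>\<^sub>F z in at_top. complex_of_real (Re (H z * (1 - (\<Sum>j\<in>UNIV. b j z * c j z)))) = H z - (\<Sum>j\<in>UNIV. lap (?Re j) z * c j z)"
    using Hreal eventually_gt_at_top[of 0]
  proof eventually_elim
    case (elim z)
    have cr: "c j z = complex_of_real (Re (c j z))" for j using c_real[of j z] by (simp add: of_real_Re)
    have "H z * (1 - (\<Sum>j\<in>UNIV. b j z * c j z)) = H z - (\<Sum>j\<in>UNIV. lap (h j) z * c j z)"
      using elim(1) by (simp add: right_diff_distrib sum_distrib_left mult_ac)
    moreover have "complex_of_real (Re (H z - (\<Sum>j\<in>UNIV. lap (h j) z * c j z))) = H z - (\<Sum>j\<in>UNIV. complex_of_real (Re (lap (h j) z)) * c j z)"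
    proof -
      have "complex_of_real (Re (lap (h j) z * c j z)) = complex_of_real (Re (lap (h j) z)) * c j z" for j
        by (subst (1 2) cr) simp
      then show ?thesis using elim(2) by (simp add: of_real_Re)
    qed
    ultimately show ?case using Rlap[OF elim(3)] by simp
  qed
  have m2: "mlt (\<lambda>z. H z - (\<Sum>j\<in>UNIV. lap (?Re j) z * c j z)) (CH * (\<epsilon> / (CH + 1)))"
    by (rule mlt_cong[OF mlt_Re[OF m1] ev])
  have m3: "mlt (\<lambda>z. \<Sum>j\<in>UNIV. lap (\<lambda>t. ?Re j t - ?kc j t) z * c j z) (\<Sum>j\<in>UNIV. \<epsilon> / ((\<Sum>j\<in>UNIV. Cc j) + 1) * Cc j)"
  proof (intro mlt.sum mlt.mult Cc mlt_lap)
    show "sig 1 (\<lambda>t. ?Re j t - ?kc j t) (\<epsilon> / ((\<Sum>j\<in>UNIV. Cc j) + 1))" for j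
      using n(2)[of j] Rint[of j] kint[of j] h(2) by (auto simp: sig_1 kk_def intro: less_imp_le)
  qed
  have m4: "mlt (\<lambda>z. H z - (\<Sum>j\<in>UNIV. lap (?kc j) z * c j z)) (CH * (\<epsilon> / (CH + 1)) + (\<Sum>j\<in>UNIV. \<epsilon> / ((\<Sum>j\<in>UNIV. Cc j) + 1) * Cc j))"
  proof (rule mlt_cong[OF mlt.add[OF m2 m3]], rule eventually_at_top_gtE[of 0])
    fix z :: real assume "0 < z"
    then have "lap (\<lambda>t. ?Re j t - ?kc j t) z = lap (?Re j) z - lap (?kc j) z" for j
      by (intro lap_diff[OF Rsig ksig]) auto
    then show "H z - (\<Sum>j\<in>UNIV. lap (?Re j) z * c j z) + (\<Sum>j\<in>UNIV. lap (\<lambda>t. ?Re j t - ?kc j t) z * c j z) = H z - (\<Sum>j\<in>UNIV. lap (?kc j) z * c j z)"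
      by (simp add: left_diff_distrib sum_subtractf)
  qed
  have "CH * (\<epsilon> / (CH + 1)) \<le> \<epsilon>" using \<epsilon> CH0 by (simp add: field_simps)
  moreover have "(\<Sum>j\<in>UNIV. \<epsilon> / ((\<Sum>j\<in>UNIV. Cc j) + 1) * Cc j) \<le> \<epsilon>"
  proof -
    have s0: "0 \<le> (\<Sum>j\<in>UNIV. Cc j)" using Cc0 by (intro sum_nonneg) auto
    have "(\<Sum>j\<in>UNIV. \<epsilon> / ((\<Sum>j\<in>UNIV. Cc j) + 1) * Cc j) = \<epsilon> / ((\<Sum>j\<in>UNIV. Cc j) + 1) * (\<Sum>j\<in>UNIV. Cc j)"
      by (simp add: sum_distrib_left)
    also have "\<dots> \<le> \<epsilon>" using \<epsilon> s0 by (simp add: field_simps)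
    finally show ?thesis .
  qed
  ultimately have m5: "mlt (\<lambda>z. H z - (\<Sum>j\<in>UNIV. lap (?kc j) z * c j z)) (2 * \<epsilon>)"
    using mlt.mono[OF m4] by simp
  have m6: "mlt (\<lambda>z. (W z * F z - 1) + W z * (H z - (\<Sum>j\<in>UNIV. lap (?kc j) z * c j z))) (1 / 4 + C * (2 * \<epsilon>))"
    by (intro mlt.add mlt.mult W m5)
  have "1 / 4 + C * (2 * \<epsilon>) \<le> 1 / 2" using C by (simp add: \<epsilon>_def field_simps)
  then have m7: "mlt (\<lambda>z. (W z * F z - 1) + W z * (H z - (\<Sum>j\<in>UNIV. lap (?kc j) z * c j z))) (1 / 2)"
    by (rule mlt.mono[OF m6])
  have "mlt (\<lambda>z. W z * det (emat (R (complex_of_real z)) (\<chi> j. (if j = Inr () then 1 else 0) - lap (?kc j) z)) - 1) (1 / 2)"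
  proof (rule mlt_cong[OF m7], use FH in eventually_elim)
    case (elim z)
    have "det (emat (R (complex_of_real z)) (\<chi> j. (if j = Inr () then 1 else 0) - lap (?kc j) z))
      = (\<Sum>j\<in>UNIV. (if j = Inr () then c j z else 0)) - (\<Sum>j\<in>UNIV. lap (?kc j) z * c j z)"
      unfolding det_emat sum_subtractf[symmetric] by (intro sum.cong) (auto simp: c_def left_diff_distrib)
    also have "(\<Sum>j\<in>UNIV. (if j = Inr () then c j z else 0)) = F z + H z"
      using elim by (simp add: c_def)
    finally have d: "det (emat (R (complex_of_real z)) (\<chi> j. (if j = Inr () then 1 else 0) - lap (?kc j) z))
      = F z + H z - (\<Sum>j\<in>UNIV. lap (?kc j) z * c j z)" .
    show ?case unfolding d by (simp add: algebra_simps)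
  qed
  moreover have "\<bar>kk j n t\<bar> \<le> real n" for j t by (auto simp: kk_def)
  moreover have "t < 0 \<or> t > real n \<longrightarrow> kk j n t = 0" for j t by (auto simp: kk_def)
  ultimately show ?thesis using n(1) W(1) kkm
    by (intro exI[of _ ?k] exI[of _ "real n"] exI[of _ W] exI[of _ C]) auto
qed

end

section \<open>Stability of the weighted closed loop\<close>

text \<open>Cramer's numerator is linear in the right-hand side; its coefficients, with unit vectors
  substituted, are the adjugate entries and hence fixed multipliers.\<close>

lemma det_replace_column:
  fixes E :: "complex^'m^'m"
  shows "det (\<chi> i j. if j = k then b $ i else E $ i $ j) = (\<Sum>l\<in>UNIV. b $ l * det (\<chi> i j. if j = k then axis l 1 $ i else E $ i $ j))"
proof -
  have tr: "det (\<chi> i j. if j = k then v $ i else E $ i $ j) = det (\<chi> i. if i = k then v else transpose E $ i)" for v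
    by (subst det_transpose[symmetric]) (auto intro!: arg_cong[where f=det] simp: transpose_def vec_eq_iff)
  have "det (\<chi> i. if i = k then b else transpose E $ i) = det (\<chi> i. if i = k then (\<Sum>l\<in>UNIV. b $ l *s axis l 1) else transpose E $ i)"
    by (simp only: basis_expansion)
  also have "\<dots> = (\<Sum>l\<in>UNIV. det (\<chi> i. if i = k then b $ l *s axis l 1 else transpose E $ i))"
    by (rule det_linear_row_sum) simp
  finally show ?thesis unfolding tr det_row_mul .
qed

lemma lap_cong_AE:
  assumes "AE t in lborel. x t = y t" "x \<in> borel_measurable borel" "y \<in> borel_measurable borel"
  shows "lap x z = lap y z"
proof -
  have [measurable]: "x \<in> borel_measurable borel" "y \<in> borel_measurable borel" by fact+
  show ?thesis unfolding lap_def
    by (rule integral_cong_AE) (use assms(1) in \<open>auto elim: eventually_mono\<close>)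
qed

text \<open>Causality at an arbitrary time: for T >= 0 the signal is shifted to start at 0, the
  multiplier applied and the result shifted back. For T < 0 it is enough that signals vanish before
  0.\<close>

lemma mlt_delayed:
  assumes r: "mlt r C" and q: "q \<ge> 1" and x: "sig q x c" "\<And>t. t < T \<Longrightarrow> x t = 0"
  shows "\<exists>y. sig q y (C * c) \<and> (\<forall>t<T. y t = 0) \<and> (\<forall>\<^sub>F z in at_top. lap y z = r z * lap x z)"
proof (cases "0 \<le> T")
  case True
  let ?x = "\<lambda>t. x (t - (- T))"
  have "sig q ?x c" using Lq_shift[of q x c "- T"] x by (auto simp: sig_def)
  then obtain y where y: "sig q y (C * c)" "\<forall>\<^sub>F z in at_top. lap y z = r z * lap ?x z" using mltD[OF r q] by blast
  have "sig q (\<lambda>t. y (t - T)) (C * c)" using Lq_shift[of q y "C * c" T] y(1) True by (auto simp: sig_def)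
  moreover have "\<forall>t<T. y (t - T) = 0" using y(1) by (auto simp: sig_def)
  moreover have "\<forall>\<^sub>F z in at_top. lap (\<lambda>t. y (t - T)) z = r z * lap x z"
    using y(2)
  proof eventually_elim
    case (elim z)
    have "complex_of_real (exp (- (z * T))) * complex_of_real (exp (- (z * - T))) = 1"
      by (simp flip: of_real_mult add: mult_exp_exp)
    then show ?case unfolding lap_shift elim by (simp add: algebra_simps)
  qed
  ultimately show ?thesis by blast
next
  case False
  obtain y where "sig q y (C * c)" "\<forall>\<^sub>F z in at_top. lap y z = r z * lap x z" using mltD[OF r q x(1)] by blast
  then show ?thesis using False by (intro exI[of _ y]) (auto simp: sig_def)
qed

text \<open>By Cramer, y = -(W det E - 1) y + Co \<phi> + Co \<psi>. The last term lives after T by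
  causality and y lives before T, so it drops out; the first costs half the norm of y and is
  absorbed because that norm is finite. K depends neither on T nor on the sizes of y and
  \<psi>.\<close>

lemma closed_loop_bound:
  fixes E :: "real \<Rightarrow> complex^'m::finite^'m"
  assumes Em: "\<And>i j. \<exists>C. mlt (\<lambda>z. E z $ i $ j) C" and W: "mlt W CW" "mlt (\<lambda>z. W z * det (E z) - 1) (1 / 2)"
    and q: "q \<ge> 1"
  shows "\<exists>K\<ge>0. \<forall>y \<phi> \<psi> T c0. (\<forall>k. \<exists>c. sig q (y k) c) \<longrightarrow> (\<forall>k. sig q (\<phi> k) c0) \<longrightarrow> (\<forall>k. \<exists>c. sig q (\<psi> k) c)
     \<longrightarrow> (\<forall>k. \<forall>t<T. \<psi> k t = 0) \<longrightarrow> (\<forall>k. \<forall>t>T. y k t = 0)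
     \<longrightarrow> (\<forall>\<^sub>F z in at_top. \<forall>i. (\<Sum>j\<in>UNIV. E z $ i $ j * lap (y j) z) = lap (\<phi> i) z + lap (\<psi> i) z)
     \<longrightarrow> (\<forall>k. Lq q (y k) (K * c0))"
proof -
  define Co where "Co k l z = W z * det (\<chi> i j. if j = k then axis l 1 $ i else E z $ i $ j)" for k l z
  have "\<exists>C. mlt (Co k l) C" for k l
  proof -
    have "\<exists>K\<ge>1. \<forall>i j. mlt (\<lambda>z. (\<chi> i j. if j = k then axis l 1 $ i else E z $ i $ j :: complex^'m^'m) $ i $ j) K"
    proof (rule common_bound)
      show "\<exists>C. mlt (\<lambda>z. (\<chi> i j. if j = k then axis l 1 $ i else E z $ i $ j :: complex^'m^'m) $ i $ j) C" for i j
        using Em[of i j] mlt.const[of "axis l 1 $ i"] by (cases "j = k") auto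
    qed
    then obtain K where "\<And>i j. mlt (\<lambda>z. (\<chi> i j. if j = k then axis l 1 $ i else E z $ i $ j :: complex^'m^'m) $ i $ j) K" by blast
    from mlt.det_bnd[OF this] show ?thesis unfolding Co_def[abs_def] using mlt.mult[OF W(1)] by blast
  qed
  then obtain K1 where K1: "K1 \<ge> 1" "\<And>k l. mlt (Co k l) K1" using common_bound[of Co] by blast
  define K where "K = 2 * (real CARD('m) * K1)"
  have "K \<ge> 0" using K1 by (simp add: K_def)
  moreover have "Lq q (y k) (K * c0)"
    if y: "\<And>k. \<exists>c. sig q (y k) c" and \<phi>: "\<And>k. sig q (\<phi> k) c0" and \<psi>: "\<And>k. \<exists>c. sig q (\<psi> k) c"
      and \<psi>T: "\<And>k t. t < T \<Longrightarrow> \<psi> k t = 0" and yT: "\<And>k t. t > T \<Longrightarrow> y k t = 0"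
      and eq: "\<forall>\<^sub>F z in at_top. \<forall>i. (\<Sum>j\<in>UNIV. E z $ i $ j * lap (y j) z) = lap (\<phi> i) z + lap (\<psi> i) z"
    for y \<phi> \<psi> :: "'m \<Rightarrow> real \<Rightarrow> complex" and T c0 k
  proof -
    have r0: "mlt (\<lambda>z. - (W z * det (E z) - 1)) (1 / 2)" by (rule mlt.uminus[OF W(2)])
    have lapk: "\<forall>\<^sub>F z in at_top. lap (y k) z = - (W z * det (E z) - 1) * lap (y k) z + (\<Sum>l\<in>UNIV. Co k l z * lap (\<phi> l) z) + (\<Sum>l\<in>UNIV. Co k l z * lap (\<psi> l) z)"
      using eq
    proof eventually_elim
      case (elim z)
      define v where "v = (\<chi> j. lap (y j) z)"
      have Ev: "E z *v v = (\<chi> i. lap (\<phi> i) z + lap (\<psi> i) z)"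
        using elim by (simp add: matrix_vector_mult_def v_def vec_eq_iff)
      have "v $ k * det (E z) = (\<Sum>l\<in>UNIV. (E z *v v) $ l * det (\<chi> i j. if j = k then axis l 1 $ i else E z $ i $ j))"
        by (rule trans[OF cramer_lemma[symmetric] det_replace_column])
      then have "lap (y k) z * det (E z) = (\<Sum>l\<in>UNIV. (lap (\<phi> l) z + lap (\<psi> l) z) * det (\<chi> i j. if j = k then axis l 1 $ i else E z $ i $ j))"
        by (simp only: Ev) (simp add: v_def)
      then have "W z * det (E z) * lap (y k) z = (\<Sum>l\<in>UNIV. Co k l z * (lap (\<phi> l) z + lap (\<psi> l) z))"
        by (simp add: Co_def sum_distrib_left mult_ac)
      then show ?case by (simp add: distrib_left sum.distrib algebra_simps)
    qed
    have step: "Lq q (y k) (real CARD('m) * K1 * c0 + c / 2)" if c: "Lq q (y k) c" for c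
    proof -
      obtain c' where "sig q (y k) c'" using y by blast
      then have sy: "sig q (y k) c" using c by (auto simp: sig_def)
      obtain y0 where y0: "sig q y0 (1 / 2 * c)" "\<forall>\<^sub>F z in at_top. lap y0 z = - (W z * det (E z) - 1) * lap (y k) z"
        using mltD[OF r0 q sy] by blast
      have "\<exists>a. sig q a (K1 * c0) \<and> (\<forall>\<^sub>F z in at_top. lap a z = Co k l z * lap (\<phi> l) z)" for l
        using mltD[OF K1(2) q \<phi>] by blast
      then obtain a where a: "\<And>l. sig q (a l) (K1 * c0)" "\<And>l. \<forall>\<^sub>F z in at_top. lap (a l) z = Co k l z * lap (\<phi> l) z" by metis
      have "\<exists>d e. sig q d e \<and> (\<forall>t<T. d t = 0) \<and> (\<forall>\<^sub>F z in at_top. lap d z = Co k l z * lap (\<psi> l) z)" for l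
      proof -
        obtain e where "sig q (\<psi> l) e" using \<psi> by blast
        from mlt_delayed[OF K1(2) q this \<psi>T] show ?thesis by blast
      qed
      then obtain d e where d: "\<And>l. sig q (d l) (e l)" "\<And>l t. t < T \<Longrightarrow> d l t = 0" "\<And>l. \<forall>\<^sub>F z in at_top. lap (d l) z = Co k l z * lap (\<psi> l) z"
        by metis
      have sa: "sig q (\<lambda>t. y0 t + (\<Sum>l\<in>UNIV. a l t)) (1 / 2 * c + (\<Sum>l\<in>(UNIV::'m set). K1 * c0))"
        by (intro sig_add sig_sum y0 a q)
      have ss: "sig q (\<lambda>t. \<Sum>l\<in>UNIV. a l t) (\<Sum>l\<in>(UNIV::'m set). K1 * c0)" by (intro sig_sum a q)
      have ls: "lap (\<lambda>t. \<Sum>l\<in>UNIV. a l t) z = (\<Sum>l\<in>UNIV. lap (a l) z)"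
        "lap (\<lambda>t. \<Sum>l\<in>UNIV. d l t) z = (\<Sum>l\<in>UNIV. lap (d l) z)" if "z > 0" for z
        by (rule lap_sum[OF q a(1) that], rule lap_sum[OF q d(1) that])
      have sd: "sig q (\<lambda>t. \<Sum>l\<in>UNIV. d l t) (\<Sum>l\<in>UNIV. e l)" by (intro sig_sum d q)
      have "\<forall>\<^sub>F z in at_top. \<forall>l\<in>UNIV. lap (a l) z = Co k l z * lap (\<phi> l) z \<and> lap (d l) z = Co k l z * lap (\<psi> l) z"
        by (intro eventually_ball_finite ballI eventually_conj a d) simp
      then have "\<forall>\<^sub>F z in at_top. lap (y k) z = lap (\<lambda>t. (y0 t + (\<Sum>l\<in>UNIV. a l t)) + (\<Sum>l\<in>UNIV. d l t)) z"
        using lapk y0(2) eventually_gt_at_top[of 0]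
      proof eventually_elim
        case (elim z)
        then show ?case
          using lap_add[OF sa sd q] lap_add[OF y0(1) ss q] ls by simp
      qed
      then have ae: "AE t in lborel. y k t = (y0 t + (\<Sum>l\<in>UNIV. a l t)) + (\<Sum>l\<in>UNIV. d l t)"
        by (intro lap_inject[OF sy sig_add[OF q sa sd] q])
      \<comment> \<open>Before T the \<psi>-contribution is zero, after T the left side is zero; the
        remaining time t = T is null.\<close>
      have ae2: "AE t in lborel. cmod (y k t) \<le> cmod (y0 t + (\<Sum>l\<in>UNIV. a l t))"
        using ae AE_lborel_singleton[of T]
      proof eventually_elim
        case (elim t)
        show ?case
        proof (cases "t < T")
          case True
          then show ?thesis using elim d(2) by simp
        next
          case False
          then show ?thesis using elim yT[of t k] by simp
        qed
      qed
      have lq: "Lq q (\<lambda>t. y0 t + (\<Sum>l\<in>UNIV. a l t)) (1 / 2 * c + (\<Sum>l\<in>(UNIV::'m set). K1 * c0))"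
        using sa by (simp only: sig_def)
      have "Lq q (y k) (1 / 2 * c + (\<Sum>l\<in>(UNIV::'m set). K1 * c0))"
        by (rule Lq_AE_mono[OF lq LqD(1)[OF c] ae2 order_refl])
      then show ?thesis by (simp add: algebra_simps)
    qed
    obtain c where c: "Lq q (y k) c" using y by (auto simp: sig_def)
    have c0: "0 \<le> c0" using sig_nonneg[OF \<phi>] .
    show ?thesis
    proof (rule Lq_closed)
      fix c' assume "c' > K * c0"
      then have "Lq q (y k) (2 * (real CARD('m) * K1 * c0) + (c' - K * c0))"
        using step c by (intro contraction_le[of "Lq q (y k)"]) (auto intro: Lq_mono)
      then show "Lq q (y k) c'" by (simp add: K_def)
    qed (use c0 \<open>K \<ge> 0\<close> in simp)
  qed
  ultimately show ?thesis by blast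
qed

section \<open>The weighted plant\<close>

locale ide_data =
  fixes ad :: "'n::finite \<Rightarrow> 'n + unit \<Rightarrow> nat \<Rightarrow> real" and td :: "'n + unit \<Rightarrow> nat \<Rightarrow> real"
    and nc :: "'n \<Rightarrow> 'n + unit \<Rightarrow> real \<Rightarrow> real" and Tm :: "'n + unit \<Rightarrow> real" and \<nu> :: real
  assumes ad: "\<And>i j. summable (\<lambda>k. \<bar>ad i j k\<bar>)" and td: "\<And>j k. 0 \<le> td j k \<and> td j k \<le> Tm j"
    and nc: "\<And>i j. integrable lborel (nc i j)" "\<And>i j t. t < 0 \<or> t > Tm j \<Longrightarrow> nc i j t = 0"
    and \<nu>0: "0 \<le> \<nu>"
begin

text \<open>The weight exp(\<nu> t) on signals becomes a factor exp(\<nu> \<tau>) on the kernel at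
  delay \<tau>.\<close>

definition wd :: "'n \<Rightarrow> 'n + unit \<Rightarrow> nat \<Rightarrow> complex" where "wd i j k = complex_of_real (ad i j k * exp (\<nu> * td j k))"
definition wc :: "'n \<Rightarrow> 'n + unit \<Rightarrow> real \<Rightarrow> complex" where "wc i j t = complex_of_real (nc i j t * exp (\<nu> * t))"
text \<open>Delays are clamped to [0, Tm j] so that their range bound holds at every t; outside this
  interval the kernel is zero.\<close>

definition tc :: "'n + unit \<Rightarrow> real \<Rightarrow> real" where "tc j t = max 0 (min t (Tm j))"

lemma Tm0: "0 \<le> Tm j" using td[of j 0] by linarith

lemma dk_d: "delay_kernel (count_space UNIV) (wd i j) (td j)"
proof -
  have "norm (cmod (wd i j k)) \<le> \<bar>ad i j k\<bar> * exp (\<nu> * Tm j)" for k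
    using td[of j k] \<nu>0 by (simp add: wd_def norm_mult mult_left_mono)
  then have "summable (\<lambda>k. cmod (wd i j k))"
    by (intro summable_comparison_test[OF _ summable_mult2[OF ad[of i j], of "exp (\<nu> * Tm j)"]]) auto
  then show ?thesis
    unfolding delay_kernel_def delay_kernel_axioms_def
    by (auto simp: integrable_count_space_nat_iff intro: sigma_finite_measure_count_space_countable)
qed

lemma wc_int: "integrable lborel (wc i j)"
proof (rule Bochner_Integration.integrable_bound)
  have [measurable]: "nc i j \<in> borel_measurable borel" using nc(1)[of i j] by auto
  show "wc i j \<in> borel_measurable lborel" unfolding wc_def[abs_def] by measurable
  show "integrable lborel (\<lambda>t. nc i j t * exp (\<nu> * Tm j))" using nc(1) by auto
  have "cmod (wc i j t) \<le> \<bar>nc i j t\<bar> * exp (\<nu> * Tm j)" for t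
    using nc(2)[of t j i] \<nu>0 by (cases "t < 0 \<or> t > Tm j") (auto simp: wc_def norm_mult mult_left_mono)
  then show "AE t in lborel. norm (wc i j t) \<le> norm (nc i j t * exp (\<nu> * Tm j))" by (simp add: abs_mult)
qed

lemma dk_c: "delay_kernel lborel (wc i j) (tc j)"
  using wc_int[of i j] unfolding delay_kernel_def delay_kernel_axioms_def tc_def[abs_def]
  by (auto intro: sigma_finite_lborel)

lemma tc_range: "0 \<le> tc j t \<and> tc j t \<le> Tm j" using Tm0[of j] by (auto simp: tc_def)

lemma wc_tc: "wc i j t \<noteq> 0 \<Longrightarrow> tc j t = t"
  using nc(2)[of t j i] by (cases "t < 0 \<or> t > Tm j") (auto simp: wc_def tc_def)

definition gd :: "'n \<Rightarrow> 'n + unit \<Rightarrow> complex \<Rightarrow> complex" where "gd i j = tf (count_space UNIV) (wd i j) (td j)"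
definition gc :: "'n \<Rightarrow> 'n + unit \<Rightarrow> complex \<Rightarrow> complex" where "gc i j = tf lborel (wc i j) (tc j)"
definition G :: "'n \<Rightarrow> 'n + unit \<Rightarrow> (real \<Rightarrow> complex) \<Rightarrow> real \<Rightarrow> complex" where
  "G i j x t = cv (count_space UNIV) (wd i j) (td j) x t + cv lborel (wc i j) (tc j) x t"
text \<open>Columns \<open>Inl j\<close> belong to the state components and \<open>Inr ()\<close> to
  the input, so this is the block [q, -p] of the rank condition in weighted form.\<close>

definition R :: "complex \<Rightarrow> complex^('n + unit)^'n" where
  "R z = (\<chi> i j. (if j = Inl i then 1 else 0) - (gd i j z + gc i j z))"
definition GN :: "'n \<Rightarrow> 'n + unit \<Rightarrow> real" where
  "GN i j = (\<integral>k. cmod (wd i j k) \<partial>count_space UNIV) + (\<integral>t. cmod (wc i j t) \<partial>lborel)"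

lemma gd_mlt: "\<exists>C. mlt (\<lambda>z. gd i j (complex_of_real z)) C"
  unfolding gd_def using delay_kernel.tf_mlt[OF dk_d] td by blast

lemma gc_mlt: "\<exists>C. mlt (\<lambda>z. gc i j (complex_of_real z)) C"
  unfolding gc_def using delay_kernel.tf_mlt[OF dk_c] tc_range by blast

lemma gc_L1h: "L1h (\<lambda>z. gc i j (complex_of_real z))"
proof -
  have w0: "wc i j t = 0" if "t < 0" for t using nc(2)[of t j i] that by (simp add: wc_def)
  have "gc i j (complex_of_real z) = lap (wc i j) z" for z
    unfolding gc_def tf_of_real lap_def
  proof (rule Bochner_Integration.integral_cong)
    fix t
    show "wc i j t * complex_of_real (exp (- (z * tc j t))) = complex_of_real (exp (- (z * t))) * wc i j t"
      using wc_tc[of i j t] by (cases "wc i j t = 0") auto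
  qed simp
  then show ?thesis using L1h_lap[OF integrable_sig_1[OF wc_int w0]] by simp
qed

lemma G_Lq: "q \<ge> 1 \<Longrightarrow> Lq q x c \<Longrightarrow> Lq q (G i j x) (GN i j * c)"
  unfolding G_def[abs_def] GN_def distrib_right
  by (intro Lq_add delay_kernel.Lq_cv[OF dk_d] delay_kernel.Lq_cv[OF dk_c])

lemma G_sig: "q \<ge> 1 \<Longrightarrow> sig q x c \<Longrightarrow> sig q (G i j x) (GN i j * c)"
  unfolding G_def[abs_def] GN_def distrib_right
  by (intro sig_add delay_kernel.sig_cv[OF dk_d] delay_kernel.sig_cv[OF dk_c]) (use td tc_range in auto)

lemma G_lap: "q \<ge> 1 \<Longrightarrow> sig q x c \<Longrightarrow> z > 0 \<Longrightarrow> lap (G i j x) z = (gd i j (complex_of_real z) + gc i j (complex_of_real z)) * lap x z"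
proof -
  assume q: "q \<ge> 1" and x: "sig q x c" and z: "z > 0"
  have td': "0 \<le> td j k" for k using td by blast
  have tc': "0 \<le> tc j t" for t using tc_range by blast
  show ?thesis
    unfolding G_def[abs_def] gd_def gc_def tf_of_real distrib_right
    by (subst lap_add[OF delay_kernel.sig_cv[OF dk_d q x td'] delay_kernel.sig_cv[OF dk_c q x tc'] q z])
      (simp add: delay_kernel.lap_cv[OF dk_d q x td' z] delay_kernel.lap_cv[OF dk_c q x tc' z])
qed

lemma G_add_AE:
  assumes q: "q \<ge> 1" and x: "Lq q x c" and y: "Lq q y d"
  shows "AE t in lborel. G i j (\<lambda>t. x t + y t) t = G i j x t + G i j y t"
  using delay_kernel.cv_AE_integrable[OF dk_d q x, of i j] delay_kernel.cv_AE_integrable[OF dk_d q y, of i j]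
    delay_kernel.cv_AE_integrable[OF dk_c q x, of i j] delay_kernel.cv_AE_integrable[OF dk_c q y, of i j]
  by eventually_elim (simp add: G_def cv_def distrib_left)

lemma R_div:
  assumes "z0 \<noteq> - 1"
  shows "\<exists>b C. mlt b C \<and> (\<forall>\<^sub>F z in at_top. R (complex_of_real z) $ i $ j - R z0 $ i $ j = (1 / (complex_of_real z + 1) - 1 / (z0 + 1)) * b z)"
proof -
  obtain b C where b: "mlt b C" "\<forall>\<^sub>F z in at_top. gd i j (complex_of_real z) - gd i j z0 = (1 / (complex_of_real z + 1) - 1 / (z0 + 1)) * b z"
    unfolding gd_def using delay_kernel.tf_divisible[OF dk_d td assms] by blast
  obtain d D where d: "mlt d D" "\<forall>\<^sub>F z in at_top. gc i j (complex_of_real z) - gc i j z0 = (1 / (complex_of_real z + 1) - 1 / (z0 + 1)) * d z"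
    unfolding gc_def using delay_kernel.tf_divisible[OF dk_c tc_range assms] by blast
  have "\<forall>\<^sub>F z in at_top. R (complex_of_real z) $ i $ j - R z0 $ i $ j = (1 / (complex_of_real z + 1) - 1 / (z0 + 1)) * (- (b z + d z))"
    using b(2) d(2)
  proof eventually_elim
    case (elim z)
    have "R (complex_of_real z) $ i $ j - R z0 $ i $ j = - ((gd i j (complex_of_real z) - gd i j z0) + (gc i j (complex_of_real z) - gc i j z0))"
      by (simp add: R_def)
    then show ?case unfolding elim by (simp only: distrib_left mult_minus_right minus_add_distrib)
  qed
  then show ?thesis using mlt.uminus[OF mlt.add[OF b(1) d(1)]] by blast
qed

lemma g_real: "gd i j (complex_of_real z) \<in> \<real>" "gc i j (complex_of_real z) \<in> \<real>"
proof -
  have *: "(\<integral>s. complex_of_real (f s) * complex_of_real (g s) \<partial>M) \<in> \<real>" for f g :: "'x \<Rightarrow> real" and M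
    by (subst of_real_mult[symmetric], subst integral_complex_of_real) (rule Reals_of_real)
  show "gd i j (complex_of_real z) \<in> \<real>" unfolding gd_def tf_of_real wd_def by (rule *)
  show "gc i j (complex_of_real z) \<in> \<real>" unfolding gc_def tf_of_real wc_def by (rule *)
qed

text \<open>Only the point delays \<open>gd\<close> enter: this is the determinant of the principal
  part at a shifted argument, see \<open>FF_Delta0\<close>.\<close>

definition FF :: "real \<Rightarrow> complex" where
  "FF z = det (\<chi> i k. (if k = i then 1 else 0) - gd i (Inl k) (complex_of_real z) :: complex^'n^'n)"

text \<open>H is a difference of determinants whose matrices differ by distributed kernels, so
  \<open>det_ideal\<close> places it in the ideal \<open>L1h\<close>.\<close>

lemma plant_R:
  assumes Finv: "\<And>\<epsilon>. \<epsilon> > 0 \<Longrightarrow> \<exists>W C. mlt W C \<and> mlt (\<lambda>z. W z * FF z - 1) \<epsilon>"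
    and rank: "\<And>z0. Re z0 \<ge> 0 \<Longrightarrow> \<exists>j. cof (R z0) j \<noteq> 0"
  shows "plant R FF (\<lambda>z. cof (R (complex_of_real z)) (Inr ()) - FF z)"
proof
  show Rm: "\<exists>C. mlt (\<lambda>z. R (complex_of_real z) $ i $ j) C" for i j
  proof -
    obtain C D where "mlt (\<lambda>z. gd i j (complex_of_real z)) C" "mlt (\<lambda>z. gc i j (complex_of_real z)) D"
      using gd_mlt gc_mlt by blast
    from mlt.diff[OF mlt.const[of "if j = Inl i then 1 else 0"] mlt.add[OF this]] show ?thesis
      unfolding R_def vec_lambda_beta by blast
  qed
  show Rreal: "R (complex_of_real z) $ i $ j \<in> \<real>" for i j z
    unfolding R_def using g_real by (auto intro!: Reals_diff Reals_add)
  let ?A = "\<lambda>z. \<chi> i k. (if k = i then 1 else 0) - gd i (Inl k) (complex_of_real z) :: complex^'n^'n"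
  let ?D = "\<lambda>z. \<chi> i k. - gc i (Inl k) (complex_of_real z) :: complex^'n^'n"
  have "cof (R (complex_of_real z)) (Inr ()) = det (?A z + ?D z)" for z
    unfolding cof_last by (rule arg_cong[where f=det]) (auto simp: R_def vec_eq_iff)
  then have eq: "cof (R (complex_of_real z)) (Inr ()) - FF z = det (?A z + ?D z) - det (?A z)" for z
    by (simp add: FF_def)
  have "\<exists>K\<ge>1. \<forall>i j. mlt (\<lambda>z. ?A z $ i $ j) K"
  proof (rule common_bound)
    show "\<exists>C. mlt (\<lambda>z. ?A z $ i $ j) C" for i j
    proof -
      obtain C where "mlt (\<lambda>z. gd i (Inl j) (complex_of_real z)) C" using gd_mlt by blast
      from mlt.diff[OF mlt.const[of "if j = i then 1 else 0"] this] show ?thesis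
        unfolding vec_lambda_beta by blast
    qed
  qed
  then obtain K where K: "\<And>i j. mlt (\<lambda>z. ?A z $ i $ j) K" by blast
  have "\<exists>K\<ge>1. \<forall>i j. mlt (\<lambda>z. ?D z $ i $ j) K"
  proof (rule common_bound)
    show "\<exists>C. mlt (\<lambda>z. ?D z $ i $ j) C" for i j
    proof -
      obtain C where "mlt (\<lambda>z. gc i (Inl j) (complex_of_real z)) C" using gc_mlt by blast
      from mlt.uminus[OF this] show ?thesis unfolding vec_lambda_beta by blast
    qed
  qed
  then obtain L where L: "\<And>i j. mlt (\<lambda>z. ?D z $ i $ j) L" by blast
  show "L1h (\<lambda>z. cof (R (complex_of_real z)) (Inr ()) - FF z)"
    unfolding eq
  proof (rule mlt.det_ideal[OF L1h_zero L1h_add L1h_mult K L])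
    show "L1h (\<lambda>z. ?D z $ i $ j)" for i j
      using L1h_mult[OF mlt.const[of "- 1"] gc_L1h[of i "Inl j"]] by simp
  qed
  have "FF z \<in> \<real>" for z
    unfolding FF_def det_def using g_real
    by (intro sum_in_Reals Reals_mult prod_in_Reals Reals_of_int) (auto intro!: Reals_diff)
  moreover have "det (emat (R (complex_of_real z)) (axis (Inr ()) 1)) \<in> \<real>" for z
  proof -
    have "emat (R (complex_of_real z)) (axis (Inr ()) 1) $ i $ k \<in> \<real>" for i k
      by (cases i) (auto simp: emat_def Rreal axis_def)
    then show ?thesis unfolding det_def by (intro sum_in_Reals Reals_mult prod_in_Reals Reals_of_int) auto
  qed
  ultimately show "\<forall>\<^sub>F z in at_top. cof (R (complex_of_real z)) (Inr ()) - FF z \<in> \<real>" by (simp add: cof_def)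
qed (use R_div Finv rank in auto)

end

section \<open>Bounds uniform over finite time windows\<close>

lemma bounded_support_integrable:
  fixes k :: "real \<Rightarrow> real"
  assumes [measurable]: "k \<in> borel_measurable borel" and "\<And>t. \<bar>k t\<bar> \<le> S" "\<And>t. t < 0 \<or> t > S \<Longrightarrow> k t = 0"
  shows "integrable lborel k"
proof (rule Bochner_Integration.integrable_bound)
  show "integrable lborel (\<lambda>t. S * indicator {0..S} t)"
    by (intro integrable_mult_right integrable_real_indicator) (auto simp: emeasure_lborel_Icc_eq)
  have "\<bar>k t\<bar> \<le> \<bar>S * indicator {0..S} t\<bar>" for t
    using assms(2)[of t] assms(3)[of t] by (cases "t < 0 \<or> t > S") (auto simp: indicator_def)
  then show "AE t in lborel. norm (k t) \<le> norm (S * indicator {0..S} t)" by simp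
qed measurable

context ide_data
begin

text \<open>y stands for the weighted solution cut to (0,T] and v for its past. Only the state
  equation sees v: the control integrals stop at min t S and hence use positive times. All constants
  are chosen before y, v, T and c0.\<close>

lemma stable:
  assumes Finv: "\<And>\<epsilon>. \<epsilon> > 0 \<Longrightarrow> \<exists>W C. mlt W C \<and> mlt (\<lambda>z. W z * FF z - 1) \<epsilon>"
    and rank: "\<And>z0. Re z0 \<ge> 0 \<Longrightarrow> \<exists>j. cof (R z0) j \<noteq> 0" and q: "q \<ge> 1"
  shows "\<exists>k S K. S > 0 \<and> K \<ge> 0 \<and> (\<forall>j. k j \<in> borel_measurable borel) \<and> (\<forall>j t. \<bar>k j t\<bar> \<le> S)
     \<and> (\<forall>j t. t < 0 \<or> t > S \<longrightarrow> k j t = 0) \<and>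
     (\<forall>y v T c0. T \<ge> 0 \<longrightarrow> (\<forall>j. \<exists>c. sig q (y j) c) \<longrightarrow> (\<forall>j. \<forall>t>T. y j t = 0) \<longrightarrow> (\<forall>j. Lq q (v j) c0)
       \<longrightarrow> (\<forall>i. AE t in lborel. 0 < t \<and> t < T \<longrightarrow> y (Inl i) t = (\<Sum>j\<in>UNIV. G i j (\<lambda>s. y j s + v j s) t))
       \<longrightarrow> (AE t in lborel. 0 < t \<and> t < T \<longrightarrow> y (Inr ()) t = (\<Sum>j\<in>UNIV. cv lborel (\<lambda>s. complex_of_real (k j s)) (\<lambda>s. max 0 s) (y j) t))
       \<longrightarrow> (\<forall>j. Lq q (y j) (K * c0)))"
proof -
  interpret plant R FF "\<lambda>z. cof (R (complex_of_real z)) (Inr ()) - FF z" by (rule plant_R[OF Finv rank])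
  obtain k S W C where S: "S > 0" and k: "\<And>j. k j \<in> borel_measurable borel" "\<And>j t. \<bar>k j t\<bar> \<le> S"
      "\<And>j t. t < 0 \<or> t > S \<Longrightarrow> k j t = 0" and W: "mlt W C"
      "mlt (\<lambda>z. W z * det (emat (R (complex_of_real z)) (\<chi> j. (if j = Inr () then 1 else 0) - lap (\<lambda>t. complex_of_real (k j t)) z)) - 1) (1 / 2)"
    using controller by blast
  let ?kc = "\<lambda>j s. complex_of_real (k j s)"
  let ?m = "\<lambda>s::real. max 0 s"
  have kint: "integrable lborel (?kc j)" for j using bounded_support_integrable[OF k(1)[of j] k(2)[of j] k(3)[of _ j]] by simp
  have ksig: "sig 1 (?kc j) (\<integral>t. cmod (?kc j t) \<partial>lborel)" for j by (rule integrable_sig_1[OF kint]) (simp add: k(3))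
  have kdk: "delay_kernel lborel (?kc j) ?m" for j by (rule delay_kernel_sig[OF kint])
  define E where "E z = emat (R (complex_of_real z)) (\<chi> j. (if j = Inr () then 1 else 0) - lap (?kc j) z)" for z
  have "\<exists>C. mlt (\<lambda>z. E z $ i $ j) C" for i j
  proof (cases i)
    case (Inl l)
    then show ?thesis using Rm by (simp add: E_def emat_def)
  next
    case (Inr u)
    have "mlt (\<lambda>z. (if j = Inr () then 1 else 0) - lap (?kc j) z) (cmod (if j = Inr () then 1 else 0) + (\<integral>t. cmod (?kc j t) \<partial>lborel))"
      by (intro mlt.diff mlt_lap ksig mlt.const)
    then show ?thesis using Inr by (auto simp: E_def emat_def)
  qed
  from closed_loop_bound[OF this W(1) _ q] W(2)
  obtain K0 where K0: "K0 \<ge> 0" and bound: "\<And>y \<phi> \<psi> T c0. (\<forall>k. \<exists>c. sig q (y k) c) \<Longrightarrow> (\<forall>k. sig q (\<phi> k) c0) \<Longrightarrow> (\<forall>k. \<exists>c. sig q (\<psi> k) c)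
     \<Longrightarrow> (\<forall>k. \<forall>t<T. \<psi> k t = 0) \<Longrightarrow> (\<forall>k. \<forall>t>T. y k t = 0)
     \<Longrightarrow> (\<forall>\<^sub>F z in at_top. \<forall>i. (\<Sum>j\<in>UNIV. E z $ i $ j * lap (y j) z) = lap (\<phi> i) z + lap (\<psi> i) z)
     \<Longrightarrow> (\<forall>k. Lq q (y k) (K0 * c0))"
    unfolding E_def[symmetric] by blast
  define GS where "GS = (\<Sum>i\<in>UNIV. \<Sum>j\<in>UNIV. GN i j)"
  have GN0: "0 \<le> GN i j" for i j by (simp add: GN_def)
  have GS: "(\<Sum>j\<in>UNIV. GN i j) \<le> GS" for i
    unfolding GS_def by (rule member_le_sum[of i _ "\<lambda>i. \<Sum>j\<in>UNIV. GN i j"]) (auto simp: GN0 sum_nonneg)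
  have GS0: "0 \<le> GS" unfolding GS_def by (simp add: GN0 sum_nonneg)
  have main: "Lq q (y j) (K0 * GS * c0)"
    if T: "T \<ge> 0" and y: "\<And>j. \<exists>c. sig q (y j) c" and yT: "\<And>j t. t > T \<Longrightarrow> y j t = 0" and v: "\<And>j. Lq q (v j) c0"
      and eqx: "\<And>i. AE t in lborel. 0 < t \<and> t < T \<longrightarrow> y (Inl i) t = (\<Sum>j\<in>UNIV. G i j (\<lambda>s. y j s + v j s) t)"
      and equ: "AE t in lborel. 0 < t \<and> t < T \<longrightarrow> y (Inr ()) t = (\<Sum>j\<in>UNIV. cv lborel (?kc j) ?m (y j) t)"
    for y v :: "'n + unit \<Rightarrow> real \<Rightarrow> complex" and T c0 j
  proof -
    have c0: "0 \<le> c0" using LqD(2)[OF v] .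
    obtain cy where cy: "\<And>j. sig q (y j) (cy j)" using y by metis
    have [measurable]: "y j \<in> borel_measurable borel" "v j \<in> borel_measurable borel" for j
      using cy[of j] v[of j] by (auto simp: sig_def dest: LqD)
    define P where "P \<iota> = (case \<iota> of Inl i \<Rightarrow> (\<lambda>t. \<Sum>j\<in>UNIV. G i j (y j) t) | Inr _ \<Rightarrow> (\<lambda>t. \<Sum>j\<in>UNIV. cv lborel (?kc j) ?m (y j) t))" for \<iota> :: "'n + unit"
    have Psig: "\<exists>c. sig q (P \<iota>) c" for \<iota>
    proof (cases \<iota>)
      case (Inl i)
      have "sig q (\<lambda>t. \<Sum>j\<in>UNIV. G i j (y j) t) (\<Sum>j\<in>UNIV. GN i j * cy j)" by (intro sig_sum G_sig cy q)
      then show ?thesis using Inl by (auto simp: P_def)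
    next
      case (Inr u)
      have "sig q (\<lambda>t. \<Sum>j\<in>UNIV. cv lborel (?kc j) ?m (y j) t) (\<Sum>j\<in>UNIV. (\<integral>t. cmod (?kc j t) \<partial>lborel) * cy j)"
        by (intro sig_sum delay_kernel.sig_cv[OF kdk] cy q) auto
      then show ?thesis using Inr by (auto simp: P_def)
    qed
    then obtain cP where cP: "\<And>\<iota>. sig q (P \<iota>) (cP \<iota>)" by metis
    define \<Phi> where "\<Phi> \<iota> t = y \<iota> t - P \<iota> t" for \<iota> t
    have \<Phi>sig: "sig q (\<Phi> \<iota>) (cy \<iota> + cP \<iota>)" for \<iota>
      using sig_add[OF q cy[of \<iota>] sig_cmult[OF q cP[of \<iota>], of "- 1"]] by (simp add: \<Phi>_def[abs_def])
    \<comment> \<open>The residual \<Phi> is split at T: inside the window it is the forcing by the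
      past, of norm at most GS c0; from T on it is whatever the cut has produced, of uncontrolled
      size.\<close>
    define \<phi> where "\<phi> \<iota> t = (case \<iota> of Inl i \<Rightarrow> if 0 < t \<and> t < T then \<Sum>j\<in>UNIV. G i j (v j) t else 0 | Inr _ \<Rightarrow> 0)" for \<iota> :: "'n + unit" and t
    define \<psi> where "\<psi> \<iota> t = (if t \<ge> T then \<Phi> \<iota> t else 0)" for \<iota> t
    have [measurable]: "\<Phi> \<iota> \<in> borel_measurable borel" for \<iota> using \<Phi>sig[of \<iota>] by (auto simp: sig_def dest: LqD)
    have \<psi>sig: "sig q (\<psi> \<iota>) (cy \<iota> + cP \<iota>)" for \<iota>
    proof -
      have "Lq q (\<psi> \<iota>) (cy \<iota> + cP \<iota>)"
      proof (rule Lq_AE_mono[OF _ _ _ order_refl])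
        show "Lq q (\<Phi> \<iota>) (cy \<iota> + cP \<iota>)" using \<Phi>sig by (simp add: sig_def)
        show "\<psi> \<iota> \<in> borel_measurable borel" unfolding \<psi>_def[abs_def] by measurable
      qed (simp add: \<psi>_def)
      then show ?thesis using T by (auto simp: sig_def \<psi>_def)
    qed
    have \<phi>sig: "sig q (\<phi> \<iota>) (GS * c0)" for \<iota>
    proof (cases \<iota>)
      case (Inl i)
      have L: "Lq q (\<lambda>t. \<Sum>j\<in>UNIV. G i j (v j) t) (\<Sum>j\<in>UNIV. GN i j * c0)" by (intro Lq_sum G_Lq v q)
      have "(\<Sum>j\<in>UNIV. GN i j * c0) \<le> GS * c0" using GS[of i] c0 by (simp add: sum_distrib_right[symmetric] mult_right_mono)
      note L2 = Lq_mono[OF L this]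
      have [measurable]: "(\<lambda>t. \<Sum>j\<in>UNIV. G i j (v j) t) \<in> borel_measurable borel" using LqD(1)[OF L] .
      have "Lq q (\<lambda>t. if 0 < t \<and> t < T then \<Sum>j\<in>UNIV. G i j (v j) t else 0) (GS * c0)"
        by (rule Lq_AE_mono[OF L2 _ _ order_refl]) auto
      then show ?thesis using Inl by (auto simp: \<phi>_def[abs_def] sig_def)
    next
      case (Inr u)
      then show ?thesis using sig_zero[OF q, of "GS * c0"] GS0 c0 by (simp add: \<phi>_def[abs_def])
    qed
    have ae: "AE t in lborel. \<Phi> \<iota> t = \<phi> \<iota> t + \<psi> \<iota> t" for \<iota>
    proof (cases \<iota>)
      case (Inl i)
      have "AE t in lborel. \<forall>j\<in>UNIV. G i j (\<lambda>s. y j s + v j s) t = G i j (y j) t + G i j (v j) t"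
      proof (intro AE_finite_allI)
        fix j
        have "Lq q (y j) (cy j)" using cy by (simp add: sig_def)
        then show "AE t in lborel. G i j (\<lambda>s. y j s + v j s) t = G i j (y j) t + G i j (v j) t"
          by (rule G_add_AE[OF q _ v])
      qed simp
      then show ?thesis using eqx[of i] AE_lborel_singleton[of 0]
      proof eventually_elim
        case (elim t)
        consider "t < 0" | "0 < t" "t < T" | "t \<ge> T" using elim(3) by linarith
        then show ?case
        proof cases
          case 1
          then have "\<Phi> \<iota> t = 0" using \<Phi>sig[of \<iota>] by (simp add: sig_def)
          then show ?thesis using 1 Inl by (simp add: \<phi>_def \<psi>_def)
        next
          case 2
          then show ?thesis using elim Inl by (simp add: \<phi>_def \<psi>_def \<Phi>_def P_def sum.distrib)
        qed (use Inl in \<open>auto simp: \<phi>_def \<psi>_def\<close>)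
      qed
    next
      case (Inr u)
      show ?thesis using equ AE_lborel_singleton[of 0]
      proof eventually_elim
        case (elim t)
        consider "t < 0" | "0 < t" "t < T" | "t \<ge> T" using elim(2) by linarith
        then show ?case
        proof cases
          case 1
          then have "\<Phi> \<iota> t = 0" using \<Phi>sig[of \<iota>] by (simp add: sig_def)
          then show ?thesis using 1 Inr by (simp add: \<phi>_def \<psi>_def)
        next
          case 2
          then show ?thesis using elim Inr by (simp add: \<phi>_def \<psi>_def \<Phi>_def P_def)
        qed (use Inr in \<open>auto simp: \<phi>_def \<psi>_def\<close>)
      qed
    qed
    have lapeq: "(\<Sum>j\<in>UNIV. E z $ \<iota> $ j * lap (y j) z) = lap (\<phi> \<iota>) z + lap (\<psi> \<iota>) z" if z: "z > 0" for \<iota> z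
    proof -
      have sp: "sig q (\<lambda>t. \<phi> \<iota> t + \<psi> \<iota> t) (GS * c0 + (cy \<iota> + cP \<iota>))" by (rule sig_add[OF q \<phi>sig \<psi>sig])
      have "lap (\<phi> \<iota>) z + lap (\<psi> \<iota>) z = lap (\<Phi> \<iota>) z"
        unfolding lap_add[OF \<phi>sig \<psi>sig q z, symmetric]
        by (rule lap_cong_AE[symmetric, OF ae]) (use sp in \<open>auto simp: sig_def dest: LqD\<close>)
      also have "\<dots> = lap (y \<iota>) z - lap (P \<iota>) z"
        unfolding \<Phi>_def[abs_def] by (rule lap_diff[OF cy cP q z])
      also have "\<dots> = (\<Sum>j\<in>UNIV. E z $ \<iota> $ j * lap (y j) z)"
      proof (cases \<iota>)
        case (Inl i)
        have lP: "lap (P \<iota>) z = (\<Sum>j\<in>UNIV. (gd i j (complex_of_real z) + gc i j (complex_of_real z)) * lap (y j) z)"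
          using lap_sum[OF q G_sig[OF q cy] z, where I=UNIV] Inl by (simp add: P_def G_lap[OF q cy z])
        have "(\<Sum>j\<in>UNIV. E z $ \<iota> $ j * lap (y j) z) = (\<Sum>j\<in>UNIV. (if j = Inl i then lap (y j) z else 0)) - lap (P \<iota>) z"
          unfolding lP sum_subtractf[symmetric] using Inl
          by (intro sum.cong refl) (auto simp: E_def emat_def R_def left_diff_distrib)
        then show ?thesis using Inl by simp
      next
        case (Inr u)
        have lP: "lap (P \<iota>) z = (\<Sum>j\<in>UNIV. lap (?kc j) z * lap (y j) z)"
        proof -
          have l1: "lap (cv lborel (?kc j) ?m (y j)) z = lap (?kc j) z * lap (y j) z" for j
            using delay_kernel.lap_cv[OF kdk q cy _ z, of j j] lap_as_kernel[of "?kc j" z] k(3)[of _ j] by simp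
          have s1: "sig q (cv lborel (?kc j) ?m (y j)) ((\<integral>t. cmod (?kc j t) \<partial>lborel) * cy j)" for j
            by (rule delay_kernel.sig_cv[OF kdk q cy]) auto
          have "lap (\<lambda>t. \<Sum>j\<in>UNIV. cv lborel (?kc j) ?m (y j) t) z = (\<Sum>j\<in>UNIV. lap (cv lborel (?kc j) ?m (y j)) z)"
            by (rule lap_sum[OF q s1 z])
          then show ?thesis using Inr by (simp add: P_def l1)
        qed
        have "(\<Sum>j\<in>UNIV. E z $ \<iota> $ j * lap (y j) z) = (\<Sum>j\<in>UNIV. (if j = Inr () then lap (y j) z else 0)) - lap (P \<iota>) z"
          unfolding lP sum_subtractf[symmetric] using Inr
          by (intro sum.cong refl) (auto simp: E_def emat_def left_diff_distrib)
        then show ?thesis using Inr by simp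
      qed
      finally show ?thesis by simp
    qed
    have "\<forall>k. Lq q (y k) (K0 * (GS * c0))"
    proof (rule bound)
      show "\<forall>\<^sub>F z in at_top. \<forall>i. (\<Sum>j\<in>UNIV. E z $ i $ j * lap (y j) z) = lap (\<phi> i) z + lap (\<psi> i) z"
        by (rule eventually_at_top_gtE[of 0]) (simp add: lapeq)
      show "\<forall>k. \<forall>t<T. \<psi> k t = 0" by (simp add: \<psi>_def)
    qed (use y \<phi>sig \<psi>sig yT in blast)+
    then show ?thesis by (simp add: mult.assoc)
  qed
  show ?thesis
  proof (rule exI[of _ k], rule exI[of _ S], rule exI[of _ "K0 * GS"], intro conjI allI impI)
    fix y v :: "'n + unit \<Rightarrow> real \<Rightarrow> complex" and T c0 j
    assume "0 \<le> T" "\<forall>j. \<exists>c. sig q (y j) c" "\<forall>j. \<forall>t>T. y j t = 0" "\<forall>j. Lq q (v j) c0"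
      "\<forall>i. AE t in lborel. 0 < t \<and> t < T \<longrightarrow> y (Inl i) t = (\<Sum>j\<in>UNIV. G i j (\<lambda>s. y j s + v j s) t)"
      "AE t in lborel. 0 < t \<and> t < T \<longrightarrow> y (Inr ()) t = (\<Sum>j\<in>UNIV. cv lborel (?kc j) ?m (y j) t)"
    then show "Lq q (y j) (K0 * GS * c0)"
      by (intro main[where y = y and v = v and T = T and ?c0.0 = c0 and j = j]) blast+
  qed (use S k K0 GS0 in auto)
qed

end

section \<open>Passage between Lebesgue and Borel functions\<close>

lemma borel_version:
  fixes f :: "real \<Rightarrow> real"
  assumes f: "f \<in> borel_measurable (lebesgue_on S)" and S: "S \<in> sets borel"
  shows "\<exists>g. g \<in> borel_measurable borel \<and> (\<forall>x. x \<notin> S \<longrightarrow> g x = 0) \<and> (AE x in lborel. x \<in> S \<longrightarrow> f x = g x)"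
proof -
  have "(\<lambda>x. indicator S x *\<^sub>R f x) \<in> borel_measurable lebesgue"
    using f S by (subst borel_measurable_restrict_space_iff[symmetric]) auto
  then obtain g where g: "g \<in> borel_measurable lborel" "AE x in lborel. indicator S x *\<^sub>R f x = g x"
    using completion_ex_borel_measurable_real by blast
  have "AE x in lborel. x \<in> S \<longrightarrow> f x = indicator S x * g x"
    using g(2) by eventually_elim (auto simp: indicator_def)
  then show ?thesis using g(1) S by (intro exI[of _ "\<lambda>x. indicator S x * g x"]) auto
qed

lemma nn_integral_lebesgue_on_borel:
  fixes f g :: "real \<Rightarrow> ennreal"
  assumes S: "S \<in> sets borel" and g: "g \<in> borel_measurable borel" "\<And>x. x \<notin> S \<Longrightarrow> g x = 0"
    and ae: "AE x in lborel. x \<in> S \<longrightarrow> f x = g x"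
  shows "(\<integral>\<^sup>+x. f x \<partial>lebesgue_on S) = (\<integral>\<^sup>+x. g x \<partial>lborel)"
proof -
  have "(\<integral>\<^sup>+x. f x \<partial>lebesgue_on S) = (\<integral>\<^sup>+x. f x * indicator S x \<partial>lebesgue)"
    using S by (subst nn_integral_restrict_space) auto
  also have "\<dots> = (\<integral>\<^sup>+x. g x \<partial>lebesgue)"
    by (rule nn_integral_cong_AE, rule AE_completion) (use ae g(2) in \<open>auto elim!: eventually_mono simp: indicator_def\<close>)
  also have "\<dots> = (\<integral>\<^sup>+x. g x \<partial>lborel)"
    by (rule nn_integral_completion)
  finally show ?thesis .
qed

text \<open>The equations are stated with Lebesgue measurable functions on subsets, the signal
  calculus with Borel functions on the line; equality almost everywhere after extension by zero
  links the two.\<close>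

lemma lebesgue_on_transfer:
  fixes f g :: "real \<Rightarrow> 'b::euclidean_space"
  assumes f: "f \<in> borel_measurable (lebesgue_on S)" and S: "S \<in> sets borel" and g: "g \<in> borel_measurable borel"
    and ae: "AE x in lborel. (if x \<in> S then f x else 0) = g x"
  shows "integrable (lebesgue_on S) f \<longleftrightarrow> integrable lborel g" "(\<integral>x. f x \<partial>lebesgue_on S) = (\<integral>x. g x \<partial>lborel)"
proof -
  have m: "(\<lambda>x. indicator S x *\<^sub>R f x) \<in> borel_measurable lebesgue"
    using f S by (subst borel_measurable_restrict_space_iff[symmetric]) auto
  have g': "g \<in> borel_measurable lebesgue" using g by (intro measurable_completion) simp
  have ae': "AE x in lebesgue. indicator S x *\<^sub>R f x = g x"
    by (rule AE_completion) (use ae in \<open>auto elim!: eventually_mono simp: indicator_def\<close>)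
  have "integrable (lebesgue_on S) f \<longleftrightarrow> integrable lebesgue (\<lambda>x. indicator S x *\<^sub>R f x)"
    using S by (subst integrable_restrict_space) auto
  also have "\<dots> \<longleftrightarrow> integrable lebesgue g" by (rule integrable_cong_AE[OF m g' ae'])
  also have "\<dots> \<longleftrightarrow> integrable lborel g" by (rule integrable_completion) (use g in simp)
  finally show "integrable (lebesgue_on S) f \<longleftrightarrow> integrable lborel g" .
  have "(\<integral>x. f x \<partial>lebesgue_on S) = (\<integral>x. indicator S x *\<^sub>R f x \<partial>lebesgue)"
    using S by (subst integral_restrict_space) auto
  also have "\<dots> = (\<integral>x. g x \<partial>lebesgue)" by (rule integral_cong_AE[OF m g' ae'])
  also have "\<dots> = (\<integral>x. g x \<partial>lborel)" by (rule integral_completion) (use g in simp)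
  finally show "(\<integral>x. f x \<partial>lebesgue_on S) = (\<integral>x. g x \<partial>lborel)" .
qed

section \<open>From the original equations to the weighted ones\<close>

lemma integrable_vecI:
  fixes f :: "'a \<Rightarrow> 'b::euclidean_space^'n"
  assumes "\<And>i. integrable M (\<lambda>x. f x $ i)"
  shows "integrable M f"
proof -
  have bl: "bounded_linear (axis i :: 'b \<Rightarrow> 'b^'n)" for i
    by (rule bounded_linear_intro[where K=1])
      (auto simp: axis_def vec_eq_iff norm_vec_def L2_set_def if_distrib[of "\<lambda>v. (norm v)\<^sup>2"] cong: if_cong)
  have "integrable M (\<lambda>x. \<Sum>i\<in>UNIV. axis i (f x $ i))"
    by (intro Bochner_Integration.integrable_sum integrable_bounded_linear[OF bl] assms)
  moreover have "(\<Sum>i\<in>UNIV. axis i (f x $ i)) = f x" for x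
    by (auto simp: vec_eq_iff axis_def)
  ultimately show ?thesis by simp
qed

lemma integral_vec_nth:
  fixes f :: "'a \<Rightarrow> 'b::euclidean_space^'n"
  assumes "integrable M f"
  shows "(\<integral>x. f x \<partial>M) $ i = (\<integral>x. f x $ i \<partial>M)"
  by (rule integral_bounded_linear[OF bounded_linear_vec_nth assms, symmetric])

lemma lebesgue_on_Icc_measurable:
  fixes f :: "real \<Rightarrow> 'b::euclidean_space"
  assumes f: "f \<in> borel_measurable (lebesgue_on {a<..<b})" and ab: "a < b"
  shows "f \<in> borel_measurable (lebesgue_on {a..b})"
proof -
  have m: "(\<lambda>x. indicator {a<..<b} x *\<^sub>R f x) \<in> borel_measurable lebesgue"
    using f by (subst borel_measurable_restrict_space_iff[symmetric]) auto
  have s: "{a} \<in> sets lebesgue" "{b} \<in> sets lebesgue" by auto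
  have "(\<lambda>x. indicator {a<..<b} x *\<^sub>R f x + (indicator {a} x *\<^sub>R f a + indicator {b} x *\<^sub>R f b)) \<in> borel_measurable lebesgue"
    by (intro borel_measurable_add m borel_measurable_scaleR borel_measurable_indicator s borel_measurable_const)
  moreover have "indicator {a<..<b} x *\<^sub>R f x + (indicator {a} x *\<^sub>R f a + indicator {b} x *\<^sub>R f b) = indicator {a..b} x *\<^sub>R f x" for x
    using ab by (auto simp: indicator_def)
  ultimately show ?thesis by (subst borel_measurable_restrict_space_iff) auto
qed

lemma bounded_linear_borel:
  fixes pr :: "'b::euclidean_space \<Rightarrow> real"
  shows "bounded_linear pr \<Longrightarrow> pr \<in> borel_measurable borel"
  by (intro borel_measurable_continuous_onI linear_continuous_on)

lemma AE_lebesgue_on: "S \<in> sets borel \<Longrightarrow> (AE x in lebesgue_on S. P x) \<longleftrightarrow> (AE x in lborel. x \<in> S \<longrightarrow> P x)" for S :: "real set"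
  by (subst AE_restrict_space_iff) (auto simp: AE_completion_iff)

text \<open>|F| <= 1 + |F|^2 gives integrability on a bounded interval. The L2 condition is on the
  open interval, the integrals of the equation on the closed one; the end points are null.\<close>

lemma L2_kernel_version:
  fixes F :: "real \<Rightarrow> 'b::euclidean_space" and pr :: "'b \<Rightarrow> real"
  assumes F: "L2_on {0<..<a} F" and a: "a > 0" and pr: "bounded_linear pr" "\<And>b. \<bar>pr b\<bar> \<le> norm b"
  shows "\<exists>n. integrable lborel n \<and> (\<forall>t. t < 0 \<or> t > a \<longrightarrow> n t = 0)
    \<and> (AE t in lborel. (if t \<in> {0..a} then pr (F t) else 0) = n t) \<and> (\<lambda>t. pr (F t)) \<in> borel_measurable (lebesgue_on {0..a})"
proof -
  have Fm: "F \<in> borel_measurable (lebesgue_on {0<..<a})" and F2: "integrable (lebesgue_on {0<..<a}) (\<lambda>x. norm (F x) ^ 2)"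
    using F by (auto simp: L2_on_def memLp_def)
  have m: "(\<lambda>t. pr (F t)) \<in> borel_measurable (lebesgue_on {0<..<a})"
    using measurable_compose[OF Fm bounded_linear_borel[OF pr(1)]] .
  obtain n where n: "n \<in> borel_measurable borel" "\<And>x. x \<notin> {0<..<a} \<Longrightarrow> n x = 0"
      "AE x in lborel. x \<in> {0<..<a} \<longrightarrow> pr (F x) = n x"
    using borel_version[OF m] by auto
  have "integrable (lebesgue_on {0<..<a}) (\<lambda>t. pr (F t))"
  proof (rule Bochner_Integration.integrable_bound)
    have "integrable (lebesgue_on {0<..<a}) (\<lambda>x. 1 :: real)"
      by (intro finite_measure.integrable_const finite_measure_lebesgue_on lmeasurable_interval)
    then show "integrable (lebesgue_on {0<..<a}) (\<lambda>x. 1 + norm (F x) ^ 2)"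
      using F2 by (rule Bochner_Integration.integrable_add)
    have "norm (pr (F x)) \<le> norm (1 + norm (F x) ^ 2)" for x
    proof -
      have "norm (F x) \<le> 1 + norm (F x) ^ 2"
        using zero_le_power2[of "norm (F x) - 1"] norm_ge_zero[of "F x"]
        unfolding power2_diff power_one mult_1_right by linarith
      then show ?thesis using pr(2)[of "F x"] by simp
    qed
    then show "AE x in lebesgue_on {0<..<a}. norm (pr (F x)) \<le> norm (1 + norm (F x) ^ 2)" by simp
  qed (rule m)
  then have "integrable lborel n"
    by (subst (asm) lebesgue_on_transfer(1)[OF m _ n(1)]) (use n in \<open>auto elim!: eventually_mono\<close>)
  moreover have "AE t in lborel. (if t \<in> {0..a} then pr (F t) else 0) = n t"
    using n(3) AE_lborel_singleton[of 0] AE_lborel_singleton[of a] by eventually_elim (use n(2) in auto)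
  moreover have "\<forall>t. t < 0 \<or> t > a \<longrightarrow> n t = 0" using n(2) by auto
  ultimately show ?thesis using lebesgue_on_Icc_measurable[OF m a] by blast
qed

lemma bounded_support_L2:
  fixes g :: "real \<Rightarrow> real"
  assumes g: "g \<in> borel_measurable borel" and b: "\<And>t. 0 < t \<Longrightarrow> \<bar>g t\<bar> \<le> S" and z: "\<And>t. t > S \<Longrightarrow> g t = 0"
  shows "L2_on {0<..} g"
proof -
  have gm: "g \<in> borel_measurable (lebesgue_on {0<..})"
    using g by (intro measurable_restrict_space1 measurable_completion) simp
  have "integrable lborel (\<lambda>t. indicator {0<..} t * g t ^ 2)"
  proof (rule Bochner_Integration.integrable_bound)
    show "integrable lborel (\<lambda>t. S\<^sup>2 * indicator {0..S} t)"
      by (intro integrable_mult_right integrable_real_indicator) (auto simp: emeasure_lborel_Icc_eq)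
    have "\<bar>indicator {0<..} t * g t ^ 2\<bar> \<le> \<bar>S\<^sup>2 * indicator {0..S} t\<bar>" for t
      using b[of t] z[of t] power_mono[of "\<bar>g t\<bar>" S 2] by (cases "0 < t \<and> t \<le> S") (auto simp: indicator_def)
    then show "AE t in lborel. norm (indicator {0<..} t * g t ^ 2) \<le> norm (S\<^sup>2 * indicator {0..S} t)" by simp
    show "(\<lambda>t. indicator {0<..} t * g t ^ 2) \<in> borel_measurable lborel" using g by simp
  qed
  then have "integrable (lebesgue_on {0<..}) (\<lambda>t. g t ^ 2)"
    by (subst lebesgue_on_transfer(1)[where g = "\<lambda>t. indicator {0<..} t * g t ^ 2"]) (use gm g in auto)
  then show ?thesis using gm by (simp add: L2_on_def memLp_def)
qed

text \<open>For p infinite, the essential supremum of a nonnegative function is bounded below by 0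
  because a > 0 gives the interval positive measure.\<close>

lemma Lp_norm_nonneg: "0 \<le> Lp_norm p {- a..0} h" if "a > 0" for h :: "real \<Rightarrow> 'b::euclidean_space"
proof (cases p)
  case infinity
  let ?M = "lebesgue_on {- a..0}" and ?f = "\<lambda>x. ereal (norm (h x))"
  have e: "emeasure ?M (space ?M) \<noteq> 0"
    using that by (simp add: space_restrict_space emeasure_restrict_space)
  have "0 \<le> esssup ?M ?f"
  proof (rule ccontr)
    assume n: "\<not> 0 \<le> esssup ?M ?f"
    have "AE x in ?M. False" using esssup_AE[where M = ?M and f = ?f]
    proof eventually_elim
      case (elim x)
      have "0 \<le> ?f x" by simp
      from order.trans[OF this elim] n show ?case by simp
    qed
    then have "ae_filter ?M = bot" by (simp add: trivial_limit_def)
    then show False using e by (simp add: ae_filter_eq_bot_iff)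
  qed
  then show ?thesis using infinity by (simp add: Lp_norm_def real_of_ereal_pos)
qed (simp add: Lp_norm_def)

lemma memLp_Lq:
  fixes h :: "real \<Rightarrow> 'b::euclidean_space" and pr :: "'b \<Rightarrow> real"
  assumes h: "memLp p {- a..0} h" and a: "a > 0" and p: "p \<ge> 1" and pr: "bounded_linear pr" "\<And>b. \<bar>pr b\<bar> \<le> norm b"
  shows "\<exists>z. Lq p (\<lambda>t. complex_of_real (z t)) (Lp_norm p {- a..0} h) \<and> (\<forall>t. t \<notin> {- a..0} \<longrightarrow> z t = 0)
     \<and> (AE t in lborel. t \<in> {- a..0} \<longrightarrow> pr (h t) = z t)"
proof -
  let ?M = "lebesgue_on {- a..0}"
  have hm: "h \<in> borel_measurable ?M" using h by (simp add: memLp_def)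
  obtain z where z: "z \<in> borel_measurable borel" "\<And>x. x \<notin> {- a..0} \<Longrightarrow> z x = 0"
      "AE x in lborel. x \<in> {- a..0} \<longrightarrow> pr (h x) = z x"
    using borel_version[OF measurable_compose[OF hm bounded_linear_borel[OF pr(1)]]] by auto
  note [measurable] = z(1)
  have "Lq p (\<lambda>t. complex_of_real (z t)) (Lp_norm p {- a..0} h)"
  proof (cases p)
    case (enat q)
    have q: "q \<ge> 1" using p enat by (simp add: one_enat_def)
    let ?I = "\<integral>x. norm (h x) ^ q \<partial>?M"
    have hi: "integrable ?M (\<lambda>x. norm (h x) ^ q)" using h enat by (simp add: memLp_def)
    have "(\<integral>\<^sup>+t. ennreal (\<bar>z t\<bar> ^ q) \<partial>lborel) = (\<integral>\<^sup>+t. ennreal (\<bar>pr (h t)\<bar> ^ q) \<partial>?M)"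
      by (rule nn_integral_lebesgue_on_borel[symmetric]) (use z q in \<open>auto elim!: eventually_mono\<close>)
    also have "\<dots> \<le> (\<integral>\<^sup>+t. ennreal (norm (h t) ^ q) \<partial>?M)"
      by (intro nn_integral_mono ennreal_leI power_mono pr) auto
    also have "\<dots> = ennreal ?I" by (rule nn_integral_eq_integral[OF hi]) simp
    also have "?I = (Lp_norm p {- a..0} h) ^ q"
    proof -
      have I0: "0 \<le> ?I" by simp
      have "(?I powr (1 / real q)) ^ q = ?I"
      proof (cases "?I = 0")
        case False
        then have "(?I powr (1 / real q)) ^ q = (?I powr (1 / real q)) powr real q"
          using I0 by (subst powr_realpow) auto
        then show ?thesis using q I0 by (simp add: powr_powr)
      qed (use q in \<open>simp add: zero_power\<close>)
      then show ?thesis using enat by (simp add: Lp_norm_def)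
    qed
    finally show ?thesis using enat Lp_norm_nonneg[OF a, of p h] by (simp add: Lq_def)
  next
    case infinity
    let ?e = "esssup ?M (\<lambda>x. ereal (norm (h x)))"
    have fin: "?e < \<infinity>" using h infinity by (simp add: memLp_def)
    have "AE x in ?M. norm (h x) \<le> Lp_norm p {- a..0} h"
      using esssup_AE[where M = ?M and f = "\<lambda>x. ereal (norm (h x))"]
    proof eventually_elim
      case (elim x)
      then show ?case using fin infinity by (cases ?e) (auto simp: Lp_norm_def)
    qed
    then have "AE x in lborel. x \<in> {- a..0} \<longrightarrow> norm (h x) \<le> Lp_norm p {- a..0} h"
      by (subst (asm) AE_lebesgue_on) auto
    then have "AE x in lborel. \<bar>z x\<bar> \<le> Lp_norm p {- a..0} h"
      using z(3)
    proof eventually_elim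
      case (elim x)
      then show ?case using z(2)[of x] pr(2)[of "h x"] Lp_norm_nonneg[OF a, of p h] by (cases "x \<in> {- a..0}") auto
    qed
    then show ?thesis using infinity Lp_norm_nonneg[OF a, of p h] by (simp add: Lq_def)
  qed
  then show ?thesis using z by blast
qed

lemma Lp_norm_le:
  fixes h :: "real \<Rightarrow> 'b::euclidean_space"
  assumes h: "memLp p S h" and p: "p \<ge> 1" and S: "S \<in> sets borel" and z: "Lq p z c"
    and le: "AE t in lborel. t \<in> S \<longrightarrow> norm (h t) \<le> cmod (z t)"
  shows "Lp_norm p S h \<le> c"
proof (cases p)
  case (enat q)
  have [measurable]: "z \<in> borel_measurable borel" using z by (rule LqD)
  have c: "0 \<le> c" using z by (rule LqD)
  have q: "q \<ge> 1" using p enat by (simp add: one_enat_def)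
  let ?I = "\<integral>x. norm (h x) ^ q \<partial>lebesgue_on S"
  have hi: "integrable (lebesgue_on S) (\<lambda>x. norm (h x) ^ q)" using h enat by (simp add: memLp_def)
  have "AE t in lebesgue_on S. norm (h t) \<le> cmod (z t)" using le S by (simp add: AE_lebesgue_on)
  then have "ennreal ?I \<le> (\<integral>\<^sup>+t. ennreal (cmod (z t) ^ q) \<partial>lebesgue_on S)"
    unfolding nn_integral_eq_integral[OF hi, simplified, symmetric]
    by (intro nn_integral_mono_AE) (auto elim!: eventually_mono intro!: ennreal_leI power_mono)
  also have "\<dots> = (\<integral>\<^sup>+t. ennreal (cmod (z t) ^ q) * indicator S t \<partial>lborel)"
    by (rule nn_integral_lebesgue_on_borel) (use S in auto)
  also have "\<dots> \<le> (\<integral>\<^sup>+t. ennreal (cmod (z t) ^ q) \<partial>lborel)"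
    by (intro nn_integral_mono) (auto simp: indicator_def)
  also have "\<dots> \<le> ennreal (c ^ q)" using z enat by (simp add: Lq_def)
  finally have I: "?I \<le> c ^ q" using c by simp
  have I0: "0 \<le> ?I" by simp
  have "?I powr (1 / real q) \<le> (c ^ q) powr (1 / real q)" by (rule powr_mono2[OF _ I0 I]) simp
  also have "\<dots> = c"
  proof (cases "c = 0")
    case False
    then have "(c ^ q) powr (1 / real q) = (c powr real q) powr (1 / real q)" using c by (simp add: powr_realpow)
    then show ?thesis using q c by (simp add: powr_powr)
  qed (use q in \<open>simp add: zero_power\<close>)
  finally show ?thesis using enat by (simp add: Lp_norm_def)
next
  case infinity
  have c: "0 \<le> c" using z by (rule LqD)
  have hm: "h \<in> borel_measurable (lebesgue_on S)" using h by (simp add: memLp_def)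
  have "AE t in lborel. cmod (z t) \<le> c" using z infinity by (simp add: Lq_def)
  with le have "AE t in lborel. t \<in> S \<longrightarrow> ereal (norm (h t)) \<le> ereal c" by eventually_elim auto
  then have "AE t in lebesgue_on S. ereal (norm (h t)) \<le> ereal c" using S by (simp add: AE_lebesgue_on)
  then have "esssup (lebesgue_on S) (\<lambda>t. ereal (norm (h t))) \<le> ereal c"
    using hm by (intro esssup_I) auto
  then have "real_of_ereal (esssup (lebesgue_on S) (\<lambda>t. ereal (norm (h t)))) \<le> c"
    using c by (cases "esssup (lebesgue_on S) (\<lambda>t. ereal (norm (h t)))") auto
  then show ?thesis using infinity by (simp add: Lp_norm_def)
qed

lemma AE_lborel_shift:
  fixes P :: "real \<Rightarrow> bool"
  assumes "AE x in lborel. P x" "c \<noteq> 0"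
  shows "AE x in lborel. P (t + c * x)"
proof -
  obtain Z where Z: "Z \<in> null_sets lborel" "{x. \<not> P x} \<subseteq> Z" using assms(1) by (auto simp: eventually_ae_filter)
  have [measurable]: "Z \<in> sets borel" using Z(1) by auto
  have "AE x in lborel. x \<notin> Z" using Z(1) by (rule AE_not_in)
  then have "AE x in lborel. t + c * x \<notin> Z" by (intro AE_borel_affine assms(2)) measurable
  then show ?thesis using Z(2) by (auto elim!: eventually_mono)
qed

lemma Lq_of_real_measurable: "Lq p (\<lambda>t. complex_of_real (z t)) c \<Longrightarrow> z \<in> borel_measurable borel"
  using LqD(1)[of p "\<lambda>t. complex_of_real (z t)" c] by (simp add: borel_measurable_complex_iff)

text \<open>A solution is only known to be in L^p on windows of length a. Finitely many are glued to
  cover [-a, T]; the bound c is finite but uncontrolled, which is enough for the absorption in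
  \<open>closed_loop_bound\<close>.\<close>

lemma Lq_history:
  fixes h :: "real \<Rightarrow> 'b::euclidean_space" and pr :: "'b \<Rightarrow> real"
  assumes h: "\<And>t. t \<ge> 0 \<Longrightarrow> memLp p {- a..0} (\<lambda>s. h (t + s))" and a: "a > 0" and p: "p \<ge> 1"
    and pr: "bounded_linear pr" "\<And>b. \<bar>pr b\<bar> \<le> norm b" and T: "T \<ge> 0"
  shows "\<exists>z c. Lq p (\<lambda>t. complex_of_real (z t)) c \<and> (\<forall>t. t \<notin> {- a..T} \<longrightarrow> z t = 0)
     \<and> (AE t in lborel. t \<in> {- a..T} \<longrightarrow> pr (h t) = z t)"
proof -
  have "\<exists>z c. Lq p (\<lambda>t. complex_of_real (z t)) c \<and> (AE t in lborel. t \<in> {- a..real m * a} \<longrightarrow> pr (h t) = z t)" for m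
  proof (induction m)
    case 0
    obtain z where "Lq p (\<lambda>t. complex_of_real (z t)) (Lp_norm p {- a..0} (\<lambda>s. h (0 + s)))" "AE t in lborel. t \<in> {- a..0} \<longrightarrow> pr (h (0 + t)) = z t"
      using memLp_Lq[OF h a p pr, of 0] by auto
    then show ?case by auto
  next
    case (Suc m)
    let ?t = "real (Suc m) * a"
    obtain z c where z: "Lq p (\<lambda>t. complex_of_real (z t)) c" "AE t in lborel. t \<in> {- a..real m * a} \<longrightarrow> pr (h t) = z t"
      using Suc by blast
    have t0: "?t \<ge> 0" using a by simp
    obtain w d where w: "Lq p (\<lambda>t. complex_of_real (w t)) d" "AE t in lborel. t \<in> {- a..0} \<longrightarrow> pr (h (?t + t)) = w t"
      using memLp_Lq[OF h[OF t0] a p pr] by auto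
    have [measurable]: "z \<in> borel_measurable borel" "w \<in> borel_measurable borel"
      using z(1) w(1) by (auto dest: Lq_of_real_measurable)
    define u where "u x = (if x \<le> real m * a then z x else w (x - ?t))" for x
    have um[measurable]: "u \<in> borel_measurable borel" unfolding u_def[abs_def] by measurable
    have "Lq p (\<lambda>t. complex_of_real \<bar>z t\<bar> + complex_of_real \<bar>w (t - ?t)\<bar>) (c + d)"
    proof (rule Lq_add[OF p])
      show "Lq p (\<lambda>t. complex_of_real \<bar>z t\<bar>) c" by (rule Lq_AE_mono[OF z(1)]) auto
      show "Lq p (\<lambda>t. complex_of_real \<bar>w (t - ?t)\<bar>) d" by (rule Lq_AE_mono[OF Lq_shift[OF w(1), of ?t]]) auto
    qed
    then have uq: "Lq p (\<lambda>t. complex_of_real (u t)) (c + d)"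
      by (rule Lq_AE_mono) (auto simp: u_def simp flip: of_real_add)
    have wsh: "AE x in lborel. - ?t + 1 * x \<in> {- a..0} \<longrightarrow> pr (h (?t + (- ?t + 1 * x))) = w (- ?t + 1 * x)"
      by (rule AE_lborel_shift[OF w(2)]) simp
    have "AE t in lborel. t \<in> {- a..?t} \<longrightarrow> pr (h t) = u t"
      using z(2) wsh
    proof eventually_elim
      case (elim t)
      then show ?case by (auto simp: u_def algebra_simps)
    qed
    then show ?case using uq by blast
  qed
  moreover obtain m :: nat where m: "T / a \<le> real m" using real_arch_simple by blast
  ultimately obtain z c where z: "Lq p (\<lambda>t. complex_of_real (z t)) c" "AE t in lborel. t \<in> {- a..real m * a} \<longrightarrow> pr (h t) = z t" by blast
  have mT: "T \<le> real m * a" using m a by (simp add: field_simps)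
  have [measurable]: "z \<in> borel_measurable borel" using z(1) by (rule Lq_of_real_measurable)
  have "Lq p (\<lambda>t. complex_of_real (if t \<in> {- a..T} then z t else 0)) c"
    by (rule Lq_AE_mono[OF z(1)]) auto
  moreover have "AE t in lborel. t \<in> {- a..T} \<longrightarrow> pr (h t) = (if t \<in> {- a..T} then z t else 0)"
    using z(2) by eventually_elim (use mT in auto)
  ultimately show ?thesis by (intro exI[of _ "\<lambda>t. if t \<in> {- a..T} then z t else 0"]) auto
qed

lemma sum_UNIV_plus_unit: "(\<Sum>\<kappa>\<in>UNIV. f \<kappa>) = (\<Sum>j\<in>UNIV. f (Inl j)) + f (Inr ())"
  for f :: "'n::finite + unit \<Rightarrow> 'b::comm_monoid_add"
  by (simp add: UNIV_Plus_UNIV[symmetric] sum.Plus UNIV_unit del: UNIV_Plus_UNIV)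

section \<open>Identification of the weighted plant with the given equation\<close>

locale ide_system = ide_data ad td nc Tm \<nu>
  for ad :: "'n::finite \<Rightarrow> 'n + unit \<Rightarrow> nat \<Rightarrow> real" and td nc Tm \<nu> +
  fixes A :: "nat \<Rightarrow> real^'n^'n" and B :: "nat \<Rightarrow> real^'n" and tau theta :: "nat \<Rightarrow> real"
    and N :: "real \<Rightarrow> real^'n^'n" and M :: "real \<Rightarrow> real^'n" and taus thetas :: real
    and ker :: "'n \<Rightarrow> 'n + unit \<Rightarrow> real \<Rightarrow> real"
  assumes ad_eq: "ad i (Inl j) k = A (Suc k) $ i $ j" "ad i (Inr u) k = B k $ i"
    and td_eq: "td (Inl j) k = tau (Suc k)" "td (Inr u) k = theta k"
    and Tm_eq: "Tm (Inl j) = taus" "Tm (Inr u) = thetas"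
    and ker_eq: "ker i (Inl j) t = N t $ i $ j" "ker i (Inr u) t = M t $ i"
    and A_summ: "summable (\<lambda>k. norm (A (Suc k)))" and B_summ: "summable (\<lambda>k. norm (B k))"
    and taus_pos: "taus > 0" and thetas_pos: "thetas > 0"
    and ker_nc: "AE t in lborel. (if t \<in> {0..Tm \<kappa>} then ker i \<kappa> t else 0) = nc i \<kappa> t"
    and ker_meas: "ker i \<kappa> \<in> borel_measurable (lebesgue_on {0..Tm \<kappa>})"
begin

lemma gd_ser: "gd i \<kappa> z = ser (ad i \<kappa>) (td \<kappa>) (z - complex_of_real \<nu>)"
proof -
  have e: "wd i \<kappa> k * exp (- (complex_of_real (td \<kappa> k) * z))
     = complex_of_real (ad i \<kappa> k) * exp (- (complex_of_real (td \<kappa> k) * (z - complex_of_real \<nu>)))" for k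
    by (simp add: wd_def exp_of_real[symmetric] right_diff_distrib exp_diff exp_minus field_simps mult_exp_exp)
  show ?thesis unfolding gd_def tf_def e ser_def
    by (rule integral_count_space_nat) (use ser_summable[OF ad td] in \<open>simp add: integrable_count_space_nat_iff\<close>)
qed

lemma gc_int: "gc i \<kappa> z = (\<integral>t. complex_of_real (nc i \<kappa> t) * exp (- (complex_of_real t * (z - complex_of_real \<nu>))) \<partial>lborel)"
  unfolding gc_def tf_def
proof (rule Bochner_Integration.integral_cong)
  fix t
  show "wc i \<kappa> t * exp (- (complex_of_real (tc \<kappa> t) * z)) = complex_of_real (nc i \<kappa> t) * exp (- (complex_of_real t * (z - complex_of_real \<nu>)))"
  proof (cases "nc i \<kappa> t = 0")
    case False
    then have "tc \<kappa> t = t" using wc_tc[of i \<kappa> t] by (auto simp: wc_def)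
    then show ?thesis
      by (simp add: wc_def exp_of_real[symmetric] right_diff_distrib exp_diff exp_minus field_simps mult_exp_exp)
  qed (simp add: wc_def)
qed simp

lemma ker_transform:
  "integrable (lebesgue_on {0..Tm \<kappa>}) (\<lambda>\<eta>. exp (- complex_of_real \<eta> * z) * complex_of_real (ker i \<kappa> \<eta>))"
  "(\<integral>\<eta>. exp (- complex_of_real \<eta> * z) * complex_of_real (ker i \<kappa> \<eta>) \<partial>lebesgue_on {0..Tm \<kappa>})
    = (\<integral>t. complex_of_real (nc i \<kappa> t) * exp (- (complex_of_real t * z)) \<partial>lborel)"
proof -
  let ?f = "\<lambda>\<eta>. exp (- complex_of_real \<eta> * z) * complex_of_real (ker i \<kappa> \<eta>)"
  let ?g = "\<lambda>t. complex_of_real (nc i \<kappa> t) * exp (- (complex_of_real t * z))"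
  have [measurable]: "nc i \<kappa> \<in> borel_measurable borel" using nc(1)[of i \<kappa>] by auto
  have cor: "complex_of_real \<in> borel_measurable borel" by measurable
  have "(\<lambda>\<eta>. exp (- complex_of_real \<eta> * z)) \<in> borel_measurable lborel" by measurable
  then have "(\<lambda>\<eta>. exp (- complex_of_real \<eta> * z)) \<in> borel_measurable (lebesgue_on {0..Tm \<kappa>})"
    by (intro measurable_restrict_space1 measurable_completion)
  then have f: "?f \<in> borel_measurable (lebesgue_on {0..Tm \<kappa>})"
    by (rule borel_measurable_times[OF _ measurable_compose[OF ker_meas cor]])
  have g: "?g \<in> borel_measurable borel" by measurable
  have ae: "AE t in lborel. (if t \<in> {0..Tm \<kappa>} then ?f t else 0) = ?g t"
    using ker_nc[of \<kappa> i] by eventually_elim (auto split: if_splits)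
  have "integrable lborel ?g"
  proof (rule Bochner_Integration.integrable_bound)
    show "integrable lborel (\<lambda>t. nc i \<kappa> t * exp (\<bar>Re z\<bar> * Tm \<kappa>))" using nc(1) by auto
    have "cmod (?g t) \<le> \<bar>nc i \<kappa> t\<bar> * exp (\<bar>Re z\<bar> * Tm \<kappa>)" for t
      using nc(2)[of t \<kappa> i] cexp_norm_le[of t "Tm \<kappa>" z]
      by (cases "t < 0 \<or> t > Tm \<kappa>") (auto simp: norm_mult intro!: mult_left_mono)
    then show "AE t in lborel. norm (?g t) \<le> norm (nc i \<kappa> t * exp (\<bar>Re z\<bar> * Tm \<kappa>))" by (simp add: abs_mult)
  qed (use g in simp)
  then show "integrable (lebesgue_on {0..Tm \<kappa>}) ?f" by (subst lebesgue_on_transfer(1)[OF f _ g ae]) auto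
  show "integral\<^sup>L (lebesgue_on {0..Tm \<kappa>}) ?f = integral\<^sup>L lborel ?g" by (rule lebesgue_on_transfer(2)[OF f _ g ae]) simp
qed

lemma Delta0_nth_ser: "Delta0 A tau z $ i $ j = (if i = j then 1 else 0) - ser (ad i (Inl j)) (td (Inl j)) z"
proof -
  have "0 \<le> tau (Suc k) \<and> tau (Suc k) \<le> taus" for k
    using td[of "Inl undefined" k] by (simp add: td_eq Tm_eq)
  moreover have "ad i (Inl j) = (\<lambda>k. A (Suc k) $ i $ j)" "td (Inl j) = (\<lambda>k. tau (Suc k))" by (auto simp: ad_eq td_eq)
  ultimately show ?thesis using Delta0_nth[OF A_summ, of tau taus z i j] by (simp add: mat_def)
qed

lemma FF_Delta0: "FF z = det (Delta0 A tau (complex_of_real (z - \<nu>)))"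
  unfolding FF_def
  by (rule arg_cong[where f = det]) (auto simp: vec_eq_iff gd_ser Delta0_nth_ser)

text \<open>Weighting shifts the argument by \<nu>, so the closed right half plane of the weighted
  plant is Re >= -\<nu> for the original one.\<close>

lemma R_block: "R z = block_qp (qfun A tau taus N (z - complex_of_real \<nu>)) (pfun B theta thetas M (z - complex_of_real \<nu>))"
proof -
  let ?s = "z - complex_of_real \<nu>"
  have i1: "integrable (lebesgue_on {0..taus}) (\<lambda>\<eta>. cscaleM (exp (- complex_of_real \<eta> * s)) (cmat (N \<eta>)))" for s
    by (intro integrable_vecI) (use ker_transform(1)[where \<kappa> = "Inl _" and z = s] in \<open>simp add: cscaleM_def cmat_def ker_eq Tm_eq\<close>)
  have i2: "integrable (lebesgue_on {0..thetas}) (\<lambda>\<eta>. cscaleV (exp (- complex_of_real \<eta> * s)) (cvec (M \<eta>)))" for s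
    by (intro integrable_vecI) (use ker_transform(1)[where \<kappa> = "Inr ()" and z = s] in \<open>simp add: cscaleV_def cvec_def ker_eq Tm_eq\<close>)
  have "(\<integral>\<eta>. cscaleM (exp (- complex_of_real \<eta> * ?s)) (cmat (N \<eta>)) \<partial>lebesgue_on {0..taus}) $ i $ j = gc i (Inl j) z" for i j
    unfolding gc_int integral_vec_nth[OF i1] integral_vec_nth[OF integrable_bounded_linear[OF bounded_linear_vec_nth i1]]
    using ker_transform(2)[of "Inl j" ?s i] by (simp add: cscaleM_def cmat_def ker_eq Tm_eq)
  then have q: "qfun A tau taus N ?s $ i $ j = (if i = j then 1 else 0) - (gd i (Inl j) z + gc i (Inl j) z)" for i j
    by (simp add: qfun_def Delta0_nth_ser gd_ser)
  have int2: "(\<integral>\<eta>. cscaleV (exp (- complex_of_real \<eta> * ?s)) (cvec (M \<eta>)) \<partial>lebesgue_on {0..thetas}) $ i = gc i (Inr u) z" for i u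
    unfolding gc_int integral_vec_nth[OF i2]
    using ker_transform(2)[of "Inr u" ?s i] by (simp add: cscaleV_def cvec_def ker_eq Tm_eq)
  have "summable (\<lambda>k. cscaleV (exp (- complex_of_real (theta k) * ?s)) (cvec (B k)))"
  proof (rule summable_norm_cancel, rule summable_comparison_test)
    show "\<exists>n0. \<forall>n\<ge>n0. norm (norm (cscaleV (exp (- complex_of_real (theta n) * ?s)) (cvec (B n)))) \<le> exp (\<bar>Re ?s\<bar> * thetas) * norm (B n)"
      using cexp_norm_le[of "theta _" thetas ?s] td[of "Inr ()"]
      by (intro exI[of _ 0] allI impI) (simp add: norm_cscaleV mult_right_mono td_eq Tm_eq)
  qed (intro summable_mult B_summ)
  from suminf_nth1[OF this]
  have p: "pfun B theta thetas M ?s $ i = gd i (Inr u) z + gc i (Inr u) z" for i u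
    unfolding pfun_def vector_add_component int2[of i u]
    by (simp add: gd_ser ser_def ad_eq td_eq cscaleV_def cvec_def mult.commute)
  show ?thesis
  proof (unfold vec_eq_iff, intro allI)
    fix i \<kappa>
    show "R z $ i $ \<kappa> = block_qp (qfun A tau taus N ?s) (pfun B theta thetas M ?s) $ i $ \<kappa>"
      by (cases \<kappa>) (auto simp: R_def block_qp_def q p[of _ "()"])
  qed
qed

definition hist :: "(real \<Rightarrow> real^'n) \<Rightarrow> (real \<Rightarrow> real) \<Rightarrow> 'n + unit \<Rightarrow> real \<Rightarrow> real" where
  "hist X U \<kappa> t = (case \<kappa> of Inl i \<Rightarrow> X t $ i | Inr _ \<Rightarrow> U t)"

lemma weighted_Lq:
  assumes p: "p \<ge> 1" and z: "Lq p (\<lambda>s. complex_of_real (z s)) c" and z0: "\<And>s. s > T \<Longrightarrow> z s = 0"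
  shows "Lq p (\<lambda>s. complex_of_real (exp (\<nu> * s) * z s)) (exp (\<nu> * T) * c)"
proof -
  have [measurable]: "z \<in> borel_measurable borel" using z by (rule Lq_of_real_measurable)
  have "Lq p (\<lambda>s. complex_of_real (exp (\<nu> * T)) * complex_of_real (z s)) (exp (\<nu> * T) * c)"
    using Lq_cmult[OF z p, of "complex_of_real (exp (\<nu> * T))"] by simp
  then show ?thesis
  proof (rule Lq_AE_mono[OF _ _ _ order_refl])
    have "\<bar>exp (\<nu> * s) * z s\<bar> \<le> \<bar>exp (\<nu> * T) * z s\<bar>" for s
      using z0[of s] \<nu>0 by (cases "s > T") (auto simp: abs_mult intro!: mult_right_mono mult_left_mono)
    then show "AE s in lborel. cmod (complex_of_real (exp (\<nu> * s) * z s)) \<le> cmod (complex_of_real (exp (\<nu> * T)) * complex_of_real (z s))"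
      by (intro AE_I2) (simp only: of_real_mult[symmetric] norm_of_real)
  qed measurable
qed

text \<open>exp(\<nu> t) is distributed as exp(\<nu> \<tau>) exp(\<nu> (t - \<tau>)) over the
  delayed terms. The point delays being countable, for almost every t no shifted time meets the null
  set where \<open>hist\<close> and z differ; under the integrals the exceptions are null in the
  integration variable.\<close>

lemma ide_weighted:
  assumes p: "p \<ge> 1" and z: "\<And>\<kappa>. Lq p (\<lambda>s. complex_of_real (z \<kappa> s)) (c \<kappa>)" and z0: "\<And>\<kappa> s. s > T \<Longrightarrow> z \<kappa> s = 0"
    and hz: "\<And>\<kappa>. AE t in lborel. t \<in> {- Tm \<kappa>..T} \<longrightarrow> hist X U \<kappa> t = z \<kappa> t"
    and ide: "AE t in lebesgue_on {0<..}.
        summable (\<lambda>k. A (Suc k) *v X (t - tau (Suc k))) \<and>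
        summable (\<lambda>j. U (t - theta j) *\<^sub>R B j) \<and>
        integrable (lebesgue_on {0..taus}) (\<lambda>\<eta>. N \<eta> *v X (t - \<eta>)) \<and>
        integrable (lebesgue_on {0..thetas}) (\<lambda>\<eta>. U (t - \<eta>) *\<^sub>R M \<eta>) \<and>
        X t - (\<Sum>k. A (Suc k) *v X (t - tau (Suc k))) - (\<integral>\<eta>. N \<eta> *v X (t - \<eta>) \<partial>lebesgue_on {0..taus})
          = (\<Sum>j. U (t - theta j) *\<^sub>R B j) + (\<integral>\<eta>. U (t - \<eta>) *\<^sub>R M \<eta> \<partial>lebesgue_on {0..thetas})"
  shows "AE t in lborel. 0 < t \<and> t < T \<longrightarrow>
    complex_of_real (exp (\<nu> * t) * z (Inl i) t) = (\<Sum>\<kappa>\<in>UNIV. G i \<kappa> (\<lambda>s. complex_of_real (exp (\<nu> * s) * z \<kappa> s)) t)"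
proof -
  have [measurable]: "z \<kappa> \<in> borel_measurable borel" "nc i \<kappa> \<in> borel_measurable borel" for i \<kappa>
    using Lq_of_real_measurable[OF z] nc(1)[of i \<kappa>] by auto
  have xq: "Lq p (\<lambda>s. complex_of_real (exp (\<nu> * s) * z \<kappa> s)) (exp (\<nu> * T) * c \<kappa>)" for \<kappa>
    by (rule weighted_Lq[OF p z z0])
  have a1: "AE t in lborel. \<forall>\<kappa>\<in>UNIV. \<forall>k. t - td \<kappa> k \<in> {- Tm \<kappa>..T} \<longrightarrow> hist X U \<kappa> (t - td \<kappa> k) = z \<kappa> (t - td \<kappa> k)"
    by (intro AE_finite_allI, simp, subst AE_all_countable, intro allI)
      (use AE_lborel_shift[OF hz, of 1 "- td _ _"] in simp)
  have a2: "AE \<eta> in lborel. t - \<eta> \<in> {- Tm \<kappa>..T} \<longrightarrow> hist X U \<kappa> (t - \<eta>) = z \<kappa> (t - \<eta>)" for \<kappa> t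
    using AE_lborel_shift[OF hz[of \<kappa>], of "- 1" t] by simp
  have e1: "AE t in lborel. integrable (count_space UNIV) (\<lambda>k. wd i \<kappa> k * complex_of_real (exp (\<nu> * (t - td \<kappa> k)) * z \<kappa> (t - td \<kappa> k)))" for \<kappa>
    by (rule delay_kernel.cv_AE_integrable[OF dk_d p xq[of \<kappa>]])
  have e2: "AE t in lborel. integrable lborel (\<lambda>\<eta>. wc i \<kappa> \<eta> * complex_of_real (exp (\<nu> * (t - tc \<kappa> \<eta>)) * z \<kappa> (t - tc \<kappa> \<eta>)))" for \<kappa>
    by (rule delay_kernel.cv_AE_integrable[OF dk_c p xq[of \<kappa>]])
  have a3: "AE t in lborel. \<forall>\<kappa>\<in>UNIV. integrable (count_space UNIV) (\<lambda>k. wd i \<kappa> k * complex_of_real (exp (\<nu> * (t - td \<kappa> k)) * z \<kappa> (t - td \<kappa> k)))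
     \<and> integrable lborel (\<lambda>\<eta>. wc i \<kappa> \<eta> * complex_of_real (exp (\<nu> * (t - tc \<kappa> \<eta>)) * z \<kappa> (t - tc \<kappa> \<eta>)))"
    by (rule AE_finite_allI[OF finite_class.finite_UNIV]) (rule AE_conjI[OF e1 e2])
  have ide': "AE t in lborel. t \<in> {0<..} \<longrightarrow> (summable (\<lambda>k. A (Suc k) *v X (t - tau (Suc k))) \<and>
        summable (\<lambda>j. U (t - theta j) *\<^sub>R B j) \<and>
        integrable (lebesgue_on {0..taus}) (\<lambda>\<eta>. N \<eta> *v X (t - \<eta>)) \<and>
        integrable (lebesgue_on {0..thetas}) (\<lambda>\<eta>. U (t - \<eta>) *\<^sub>R M \<eta>) \<and>
        X t - (\<Sum>k. A (Suc k) *v X (t - tau (Suc k))) - (\<integral>\<eta>. N \<eta> *v X (t - \<eta>) \<partial>lebesgue_on {0..taus})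
          = (\<Sum>j. U (t - theta j) *\<^sub>R B j) + (\<integral>\<eta>. U (t - \<eta>) *\<^sub>R M \<eta> \<partial>lebesgue_on {0..thetas}))"
    using ide by (subst (asm) AE_lebesgue_on) auto
  show ?thesis
    using a1 a3 ide' hz[of "Inl i"]
  proof eventually_elim
    case (elim t)
    show ?case
    proof
      assume t: "0 < t \<and> t < T"
      note I = elim(3)[rule_format, of, simplified, OF conjunct1[OF t]]
      have h1: "hist X U \<kappa> (t - td \<kappa> k) = z \<kappa> (t - td \<kappa> k)" for \<kappa> k
        using elim(1) td[of \<kappa> k] t by auto
      have h1l: "X (t - tau (Suc k)) $ j = z (Inl j) (t - tau (Suc k))" and h1r: "U (t - theta k) = z (Inr ()) (t - theta k)" for j k
        using h1[of "Inl j" k] h1[of "Inr ()" k] by (simp_all add: hist_def td_eq)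
      have h2: "AE \<eta> in lborel. \<eta> \<in> {0..Tm \<kappa>} \<longrightarrow> hist X U \<kappa> (t - \<eta>) = z \<kappa> (t - \<eta>)" for \<kappa>
        using a2[of t \<kappa>] by eventually_elim (use t in auto)
      have ed: "wd i \<kappa> k * complex_of_real (exp (\<nu> * (t - td \<kappa> k)) * z \<kappa> (t - td \<kappa> k))
         = complex_of_real (exp (\<nu> * t)) * complex_of_real (ad i \<kappa> k * z \<kappa> (t - td \<kappa> k))" for \<kappa> k
        by (simp add: wd_def right_diff_distrib exp_diff)
      have ec: "wc i \<kappa> \<eta> * complex_of_real (exp (\<nu> * (t - tc \<kappa> \<eta>)) * z \<kappa> (t - tc \<kappa> \<eta>))
         = complex_of_real (exp (\<nu> * t)) * complex_of_real (nc i \<kappa> \<eta> * z \<kappa> (t - \<eta>))" for \<kappa> \<eta>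
      proof (cases "nc i \<kappa> \<eta> = 0")
        case False
        then have "tc \<kappa> \<eta> = \<eta>" using wc_tc[of i \<kappa> \<eta>] by (auto simp: wc_def)
        then show ?thesis by (simp add: wc_def right_diff_distrib exp_diff)
      qed (simp add: wc_def)
      note J1 = elim(2)[rule_format, OF UNIV_I, THEN conjunct1]
        and J2 = elim(2)[rule_format, OF UNIV_I, THEN conjunct2]
      have sd: "summable (\<lambda>k. ad i \<kappa> k * z \<kappa> (t - td \<kappa> k))" for \<kappa>
      proof (rule summable_rabs_cancel)
        show "summable (\<lambda>k. \<bar>ad i \<kappa> k * z \<kappa> (t - td \<kappa> k)\<bar>)"
          using J1[of \<kappa>] unfolding ed integrable_count_space_nat_iff norm_mult norm_of_real
          by (simp add: abs_mult)
      qed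
      have ic: "integrable lborel (\<lambda>\<eta>. nc i \<kappa> \<eta> * z \<kappa> (t - \<eta>))" for \<kappa>
      proof -
        have "complex_integrable lborel (\<lambda>\<eta>. complex_of_real (exp (\<nu> * t) * (nc i \<kappa> \<eta> * z \<kappa> (t - \<eta>))))"
          unfolding of_real_mult[of "exp (\<nu> * t)"] using J2[of \<kappa>] unfolding ec .
        then have "integrable lborel (\<lambda>\<eta>. exp (\<nu> * t) * (nc i \<kappa> \<eta> * z \<kappa> (t - \<eta>)))"
          by (rule iffD1[OF complex_of_real_integrable_eq])
        then show ?thesis by simp
      qed
      let ?D = "\<lambda>\<kappa>. \<Sum>k. ad i \<kappa> k * z \<kappa> (t - td \<kappa> k)" and ?I = "\<lambda>\<kappa>. \<integral>\<eta>. nc i \<kappa> \<eta> * z \<kappa> (t - \<eta>) \<partial>lborel"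
      have Gt: "G i \<kappa> (\<lambda>s. complex_of_real (exp (\<nu> * s) * z \<kappa> s)) t = complex_of_real (exp (\<nu> * t) * (?D \<kappa> + ?I \<kappa>))" for \<kappa>
      proof -
        have "(\<integral>k. complex_of_real (exp (\<nu> * t)) * complex_of_real (ad i \<kappa> k * z \<kappa> (t - td \<kappa> k)) \<partial>count_space UNIV)
          = (\<Sum>k. complex_of_real (exp (\<nu> * t)) * complex_of_real (ad i \<kappa> k * z \<kappa> (t - td \<kappa> k)))"
          by (rule integral_count_space_nat) (rule J1[unfolded ed])
        also have "\<dots> = complex_of_real (exp (\<nu> * t)) * complex_of_real (?D \<kappa>)"
          by (simp only: suminf_mult[OF summable_of_real[OF sd]] suminf_of_real[OF sd])
        finally show ?thesis
          unfolding G_def cv_def ed ec by (simp del: of_real_mult) (simp add: distrib_left)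
      qed
      have s1: "(\<Sum>k. A (Suc k) *v X (t - tau (Suc k))) $ i = (\<Sum>j\<in>UNIV. ?D (Inl j))"
      proof -
        have "(\<Sum>k. A (Suc k) *v X (t - tau (Suc k))) $ i = (\<Sum>k. (A (Suc k) *v X (t - tau (Suc k))) $ i)"
          using bounded_linear.suminf[OF bounded_linear_vec_nth] I by blast
        also have "\<dots> = (\<Sum>k. \<Sum>j\<in>UNIV. ad i (Inl j) k * z (Inl j) (t - td (Inl j) k))"
          by (simp add: matrix_vector_mult_def h1l ad_eq td_eq)
        also have "\<dots> = (\<Sum>j\<in>UNIV. ?D (Inl j))" by (rule suminf_sum[OF sd])
        finally show ?thesis .
      qed
      have s2: "(\<Sum>k. U (t - theta k) *\<^sub>R B k) $ i = ?D (Inr ())"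
      proof -
        have "(\<Sum>k. U (t - theta k) *\<^sub>R B k) $ i = (\<Sum>k. (U (t - theta k) *\<^sub>R B k) $ i)"
          using bounded_linear.suminf[OF bounded_linear_vec_nth] I by blast
        then show ?thesis by (simp add: h1r ad_eq td_eq mult.commute)
      qed
      have s3: "(\<integral>\<eta>. N \<eta> *v X (t - \<eta>) \<partial>lebesgue_on {0..taus}) $ i = (\<Sum>j\<in>UNIV. ?I (Inl j))"
      proof -
        have int: "integrable (lebesgue_on {0..taus}) (\<lambda>\<eta>. N \<eta> *v X (t - \<eta>))" using I by blast
        have "(\<integral>\<eta>. N \<eta> *v X (t - \<eta>) \<partial>lebesgue_on {0..taus}) $ i = (\<integral>\<eta>. (N \<eta> *v X (t - \<eta>)) $ i \<partial>lebesgue_on {0..taus})"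
          by (rule integral_vec_nth[OF int])
        also have "\<dots> = (\<integral>\<eta>. (\<Sum>j\<in>UNIV. nc i (Inl j) \<eta> * z (Inl j) (t - \<eta>)) \<partial>lborel)"
        proof (rule lebesgue_on_transfer(2))
          show "(\<lambda>\<eta>. (N \<eta> *v X (t - \<eta>)) $ i) \<in> borel_measurable (lebesgue_on {0..taus})"
            using integrable_bounded_linear[OF bounded_linear_vec_nth int] by (rule borel_measurable_integrable)
          have "AE \<eta> in lborel. \<forall>j\<in>UNIV. (\<eta> \<in> {0..taus} \<longrightarrow> X (t - \<eta>) $ j = z (Inl j) (t - \<eta>)) \<and> (if \<eta> \<in> {0..taus} then N \<eta> $ i $ j else 0) = nc i (Inl j) \<eta>"
          proof (rule AE_finite_allI[OF finite_class.finite_UNIV])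
            fix j
            show "AE \<eta> in lborel. (\<eta> \<in> {0..taus} \<longrightarrow> X (t - \<eta>) $ j = z (Inl j) (t - \<eta>)) \<and> (if \<eta> \<in> {0..taus} then N \<eta> $ i $ j else 0) = nc i (Inl j) \<eta>"
              using h2[of "Inl j"] ker_nc[of "Inl j" i] by eventually_elim (auto simp: hist_def Tm_eq ker_eq split: if_splits)
          qed
          then show "AE \<eta> in lborel. (if \<eta> \<in> {0..taus} then (N \<eta> *v X (t - \<eta>)) $ i else 0) = (\<Sum>j\<in>UNIV. nc i (Inl j) \<eta> * z (Inl j) (t - \<eta>))"
            by eventually_elim (auto simp: matrix_vector_mult_def intro!: sum.cong sum.neutral[symmetric] split: if_splits)
        qed measurable
        also have "\<dots> = (\<Sum>j\<in>UNIV. ?I (Inl j))" by (rule Bochner_Integration.integral_sum[OF ic])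
        finally show ?thesis .
      qed
      have s4: "(\<integral>\<eta>. U (t - \<eta>) *\<^sub>R M \<eta> \<partial>lebesgue_on {0..thetas}) $ i = ?I (Inr ())"
      proof -
        have int: "integrable (lebesgue_on {0..thetas}) (\<lambda>\<eta>. U (t - \<eta>) *\<^sub>R M \<eta>)" using I by blast
        have "(\<integral>\<eta>. U (t - \<eta>) *\<^sub>R M \<eta> \<partial>lebesgue_on {0..thetas}) $ i = (\<integral>\<eta>. (U (t - \<eta>) *\<^sub>R M \<eta>) $ i \<partial>lebesgue_on {0..thetas})"
          by (rule integral_vec_nth[OF int])
        also have "\<dots> = ?I (Inr ())"
        proof (rule lebesgue_on_transfer(2))
          show "(\<lambda>\<eta>. (U (t - \<eta>) *\<^sub>R M \<eta>) $ i) \<in> borel_measurable (lebesgue_on {0..thetas})"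
            using integrable_bounded_linear[OF bounded_linear_vec_nth int] by (rule borel_measurable_integrable)
          show "AE \<eta> in lborel. (if \<eta> \<in> {0..thetas} then (U (t - \<eta>) *\<^sub>R M \<eta>) $ i else 0) = nc i (Inr ()) \<eta> * z (Inr ()) (t - \<eta>)"
            using h2[of "Inr ()"] ker_nc[of "Inr ()" i]
            by eventually_elim (auto simp: hist_def Tm_eq ker_eq split: if_splits)
        qed measurable
        finally show ?thesis .
      qed
      have "X t $ i - (\<Sum>k. A (Suc k) *v X (t - tau (Suc k))) $ i - (\<integral>\<eta>. N \<eta> *v X (t - \<eta>) \<partial>lebesgue_on {0..taus}) $ i
          = (\<Sum>j. U (t - theta j) *\<^sub>R B j) $ i + (\<integral>\<eta>. U (t - \<eta>) *\<^sub>R M \<eta> \<partial>lebesgue_on {0..thetas}) $ i"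
        unfolding vector_minus_component[symmetric] vector_add_component[symmetric] using I by simp
      then have "X t $ i = (\<Sum>\<kappa>\<in>UNIV. ?D \<kappa> + ?I \<kappa>)"
        unfolding s1 s2 s3 s4 by (simp add: sum_UNIV_plus_unit sum.distrib)
      moreover have "X t $ i = z (Inl i) t" using elim(4) t taus_pos by (simp add: hist_def Tm_eq)
      ultimately show "complex_of_real (exp (\<nu> * t) * z (Inl i) t) = (\<Sum>\<kappa>\<in>UNIV. G i \<kappa> (\<lambda>s. complex_of_real (exp (\<nu> * s) * z \<kappa> s)) t)"
        unfolding Gt by (simp only: sum_distrib_left of_real_sum)
    qed
  qed
qed

end

context ide_system
begin

text \<open>The implemented kernel is exp(-\<nu> \<eta>) k(\<eta>), so the weight cancels and the
  weighted control law has kernel k. Stopping the integral at min t S amounts to cutting the signal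
  to positive times, up to the null point \<eta> = t.\<close>

lemma control_weighted:
  fixes X :: "real \<Rightarrow> real^'n" and U :: "real \<Rightarrow> real"
  assumes k: "\<And>\<kappa>. k \<kappa> \<in> borel_measurable borel" "\<And>\<kappa> t. t < 0 \<or> t > S \<Longrightarrow> k \<kappa> t = 0"
    and zm: "\<And>\<kappa>. z \<kappa> \<in> borel_measurable borel"
    and hz: "\<And>\<kappa>. AE t in lborel. t \<in> {- Tm \<kappa>..T} \<longrightarrow> hist X U \<kappa> t = z \<kappa> t"
    and ctl: "AE t in lebesgue_on {0<..}.
        (\<forall>i. integrable (lebesgue_on {0..min t S}) (\<lambda>\<eta>. exp (- \<nu> * \<eta>) * k (Inl i) \<eta> * (X (t - \<eta>) $ i))) \<and>
        integrable (lebesgue_on {0..min t S}) (\<lambda>\<eta>. exp (- \<nu> * \<eta>) * k (Inr ()) \<eta> * U (t - \<eta>)) \<and>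
        U t = (\<Sum>i\<in>UNIV. \<integral>\<eta>. exp (- \<nu> * \<eta>) * k (Inl i) \<eta> * (X (t - \<eta>) $ i) \<partial>lebesgue_on {0..min t S})
              + (\<integral>\<eta>. exp (- \<nu> * \<eta>) * k (Inr ()) \<eta> * U (t - \<eta>) \<partial>lebesgue_on {0..min t S})"
  shows "AE t in lborel. 0 < t \<and> t < T \<longrightarrow>
    complex_of_real (exp (\<nu> * t) * z (Inr ()) t) = (\<Sum>\<kappa>\<in>UNIV. cv lborel (\<lambda>s. complex_of_real (k \<kappa> s)) (\<lambda>s. max 0 s)
      (\<lambda>s. complex_of_real (if 0 < s \<and> s \<le> T then exp (\<nu> * s) * z \<kappa> s else 0)) t)"
proof -
  note [measurable] = k(1) zm
  define y where "y \<kappa> s = (if 0 < s \<and> s \<le> T then exp (\<nu> * s) * z \<kappa> s else 0)" for \<kappa> s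
  have [measurable]: "y \<kappa> \<in> borel_measurable borel" for \<kappa> unfolding y_def[abs_def] by measurable
  have a2: "AE \<eta> in lborel. t - \<eta> \<in> {- Tm \<kappa>..T} \<longrightarrow> hist X U \<kappa> (t - \<eta>) = z \<kappa> (t - \<eta>)" for \<kappa> t
    using AE_lborel_shift[OF hz[of \<kappa>], of "- 1" t] by simp
  have cvy: "cv lborel (\<lambda>s. complex_of_real (k \<kappa> s)) (\<lambda>s. max 0 s) (\<lambda>s. complex_of_real (y \<kappa> s)) t
      = complex_of_real (\<integral>\<eta>. k \<kappa> \<eta> * y \<kappa> (t - \<eta>) \<partial>lborel)" for \<kappa> t
  proof -
    have "complex_of_real (k \<kappa> s) * complex_of_real (y \<kappa> (t - max 0 s)) = complex_of_real (k \<kappa> s * y \<kappa> (t - s))" for s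
      using k(2)[of s \<kappa>] by (cases "s < 0") auto
    then show ?thesis unfolding cv_def by (simp del: of_real_mult)
  qed
  have tr: "(\<integral>\<eta>. exp (- \<nu> * \<eta>) * k \<kappa> \<eta> * hist X U \<kappa> (t - \<eta>) \<partial>lebesgue_on {0..min t S})
      = exp (- \<nu> * t) * (\<integral>\<eta>. k \<kappa> \<eta> * y \<kappa> (t - \<eta>) \<partial>lborel)"
    if t: "0 < t" "t < T" and int: "integrable (lebesgue_on {0..min t S}) (\<lambda>\<eta>. exp (- \<nu> * \<eta>) * k \<kappa> \<eta> * hist X U \<kappa> (t - \<eta>))" for \<kappa> t
  proof -
    have "(\<integral>\<eta>. exp (- \<nu> * \<eta>) * k \<kappa> \<eta> * hist X U \<kappa> (t - \<eta>) \<partial>lebesgue_on {0..min t S})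
        = (\<integral>\<eta>. exp (- \<nu> * t) * (k \<kappa> \<eta> * y \<kappa> (t - \<eta>)) \<partial>lborel)"
    proof (rule lebesgue_on_transfer(2)[OF borel_measurable_integrable[OF int]])
      show "AE \<eta> in lborel. (if \<eta> \<in> {0..min t S} then exp (- \<nu> * \<eta>) * k \<kappa> \<eta> * hist X U \<kappa> (t - \<eta>) else 0)
          = exp (- \<nu> * t) * (k \<kappa> \<eta> * y \<kappa> (t - \<eta>))"
        using a2[of t \<kappa>] AE_lborel_singleton[of t]
      proof eventually_elim
        case (elim \<eta>)
        consider "\<eta> < 0 \<or> \<eta> > S" | "\<eta> > t" "\<not> (\<eta> < 0 \<or> \<eta> > S)" | "0 \<le> \<eta>" "\<eta> \<le> S" "\<eta> < t" using elim(2) by linarith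
        then show ?case
        proof cases
          case 1
          then show ?thesis using k(2)[of \<eta> \<kappa>] by auto
        next
          case 2
          then show ?thesis by (simp add: y_def)
        next
          case 3
          have "t - \<eta> \<in> {- Tm \<kappa>..T}" using 3 t Tm0[of \<kappa>] by auto
          then have "hist X U \<kappa> (t - \<eta>) = z \<kappa> (t - \<eta>)" using elim(1) by blast
          moreover have "y \<kappa> (t - \<eta>) = exp (\<nu> * (t - \<eta>)) * z \<kappa> (t - \<eta>)" using 3 t by (simp add: y_def)
          moreover have "exp (- \<nu> * t) * exp (\<nu> * (t - \<eta>)) = exp (- \<nu> * \<eta>)" by (simp add: mult_exp_exp right_diff_distrib)
          ultimately show ?thesis using 3 by simp
        qed
      qed
      show "{0..min t S} \<in> sets borel" by simp
      show "(\<lambda>\<eta>. exp (- \<nu> * t) * (k \<kappa> \<eta> * y \<kappa> (t - \<eta>))) \<in> borel_measurable borel" by measurable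
    qed
    then show ?thesis by simp
  qed
  have ctl': "AE t in lborel. t \<in> {0<..} \<longrightarrow>
        (\<forall>i. integrable (lebesgue_on {0..min t S}) (\<lambda>\<eta>. exp (- \<nu> * \<eta>) * k (Inl i) \<eta> * (X (t - \<eta>) $ i))) \<and>
        integrable (lebesgue_on {0..min t S}) (\<lambda>\<eta>. exp (- \<nu> * \<eta>) * k (Inr ()) \<eta> * U (t - \<eta>)) \<and>
        U t = (\<Sum>i\<in>UNIV. \<integral>\<eta>. exp (- \<nu> * \<eta>) * k (Inl i) \<eta> * (X (t - \<eta>) $ i) \<partial>lebesgue_on {0..min t S})
              + (\<integral>\<eta>. exp (- \<nu> * \<eta>) * k (Inr ()) \<eta> * U (t - \<eta>) \<partial>lebesgue_on {0..min t S})"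
    using ctl by (subst (asm) AE_lebesgue_on) auto
  have "AE t in lborel. 0 < t \<and> t < T \<longrightarrow>
    complex_of_real (exp (\<nu> * t) * z (Inr ()) t) = (\<Sum>\<kappa>\<in>UNIV. cv lborel (\<lambda>s. complex_of_real (k \<kappa> s)) (\<lambda>s. max 0 s) (\<lambda>s. complex_of_real (y \<kappa> s)) t)"
    using ctl' hz[of "Inr ()"]
  proof eventually_elim
    case (elim t)
    show ?case
    proof
      assume t: "0 < t \<and> t < T"
      then have I: "integrable (lebesgue_on {0..min t S}) (\<lambda>\<eta>. exp (- \<nu> * \<eta>) * k (Inl i) \<eta> * hist X U (Inl i) (t - \<eta>))"
        "integrable (lebesgue_on {0..min t S}) (\<lambda>\<eta>. exp (- \<nu> * \<eta>) * k (Inr ()) \<eta> * hist X U (Inr ()) (t - \<eta>))"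
        "U t = (\<Sum>i\<in>UNIV. \<integral>\<eta>. exp (- \<nu> * \<eta>) * k (Inl i) \<eta> * hist X U (Inl i) (t - \<eta>) \<partial>lebesgue_on {0..min t S})
              + (\<integral>\<eta>. exp (- \<nu> * \<eta>) * k (Inr ()) \<eta> * hist X U (Inr ()) (t - \<eta>) \<partial>lebesgue_on {0..min t S})" for i
        using elim(1) unfolding hist_def sum.case by blast+
      have "U t = exp (- \<nu> * t) * (\<Sum>\<kappa>\<in>UNIV. \<integral>\<eta>. k \<kappa> \<eta> * y \<kappa> (t - \<eta>) \<partial>lborel)"
        using I(3) t unfolding sum_UNIV_plus_unit distrib_left sum_distrib_left
        by (simp only: tr[OF _ _ I(1)] tr[OF _ _ I(2)])
      moreover have "U t = z (Inr ()) t" using elim(2) t thetas_pos by (simp add: hist_def Tm_eq)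
      ultimately have "exp (\<nu> * t) * z (Inr ()) t = (\<Sum>\<kappa>\<in>UNIV. \<integral>\<eta>. k \<kappa> \<eta> * y \<kappa> (t - \<eta>) \<partial>lborel)"
        by (simp add: exp_minus)
      then show "complex_of_real (exp (\<nu> * t) * z (Inr ()) t) = (\<Sum>\<kappa>\<in>UNIV. cv lborel (\<lambda>s. complex_of_real (k \<kappa> s)) (\<lambda>s. max 0 s) (\<lambda>s. complex_of_real (y \<kappa> s)) t)"
        unfolding cvy by (simp only: of_real_sum)
    qed
  qed
  then show ?thesis unfolding y_def .
qed

text \<open>exp(\<nu> s) <= 1 for s <= 0 bounds v by the initial data, so the weighted signal up to
  T has norm at most (K + 1) c0. Removing the weight on the last window costs exp(\<nu> Tm)
  exp(-\<nu> T), and summing the components gives the factor \<open>CARD('n)\<close>.\<close>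

lemma solution_bound:
  fixes X X0 :: "real \<Rightarrow> real^'n" and U U0 :: "real \<Rightarrow> real"
  assumes p: "p \<ge> 1" and K: "K \<ge> 0"
    and k: "\<And>\<kappa>. k \<kappa> \<in> borel_measurable borel" "\<And>\<kappa> t. t < 0 \<or> t > S \<Longrightarrow> k \<kappa> t = 0"
    and main: "\<forall>y v T c0. T \<ge> 0 \<longrightarrow> (\<forall>j. \<exists>c. sig p (y j) c) \<longrightarrow> (\<forall>j. \<forall>t>T. y j t = 0) \<longrightarrow> (\<forall>j. Lq p (v j) c0)
       \<longrightarrow> (\<forall>i. AE t in lborel. 0 < t \<and> t < T \<longrightarrow> y (Inl i) t = (\<Sum>j\<in>UNIV. G i j (\<lambda>s. y j s + v j s) t))
       \<longrightarrow> (AE t in lborel. 0 < t \<and> t < T \<longrightarrow> y (Inr ()) t = (\<Sum>j\<in>UNIV. cv lborel (\<lambda>s. complex_of_real (k j s)) (\<lambda>s. max 0 s) (y j) t))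
       \<longrightarrow> (\<forall>j. Lq p (y j) (K * c0))"
    and X0: "memLp p {- taus..0} X0" and U0: "memLp p {- thetas..0} U0"
    and sol: "closed_loop_solution p taus thetas A tau B theta N M (\<lambda>i \<eta>. exp (- \<nu> * \<eta>) * k (Inl i) \<eta>) (\<lambda>_. S)
      (\<lambda>\<eta>. exp (- \<nu> * \<eta>) * k (Inr ()) \<eta>) S X0 U0 X U"
    and T: "T \<ge> 0"
  shows "Lp_norm p {- taus..0} (\<lambda>s. X (T + s)) + Lp_norm p {- thetas..0} (\<lambda>s. U (T + s))
    \<le> (real CARD('n) * exp (\<nu> * taus) + exp (\<nu> * thetas)) * (K + 1) * exp (- \<nu> * T) * (Lp_norm p {- taus..0} X0 + Lp_norm p {- thetas..0} U0)"
proof -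
  define c0 where "c0 = Lp_norm p {- taus..0} X0 + Lp_norm p {- thetas..0} U0"
  have LX0: "0 \<le> Lp_norm p {- taus..0} X0" and LU0: "0 \<le> Lp_norm p {- thetas..0} U0"
    by (rule Lp_norm_nonneg[OF taus_pos], rule Lp_norm_nonneg[OF thetas_pos])
  have c00: "0 \<le> c0" using LX0 LU0 by (simp add: c0_def)
  note sol' = sol[unfolded closed_loop_solution_def]
  have mem: "\<And>t. t \<ge> 0 \<Longrightarrow> memLp p {- taus..0} (\<lambda>s. X (t + s))" "\<And>t. t \<ge> 0 \<Longrightarrow> memLp p {- thetas..0} (\<lambda>s. U (t + s))"
    and init: "AE t in lebesgue_on {- taus..0}. X t = X0 t" "AE t in lebesgue_on {- thetas..0}. U t = U0 t"
    using sol unfolding closed_loop_solution_def by blast+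
  have bl: "bounded_linear (\<lambda>v :: real^'n. v $ i)" "\<bar>v $ i\<bar> \<le> norm v" "bounded_linear (\<lambda>u :: real. u)" for i and v :: "real^'n"
    using component_le_norm_cart[of v i] by (auto intro: bounded_linear_vec_nth bounded_linear_ident)
  have "\<exists>z c. Lq p (\<lambda>t. complex_of_real (z t)) c \<and> (\<forall>t. t \<notin> {- Tm \<kappa>..T} \<longrightarrow> z t = 0)
     \<and> (AE t in lborel. t \<in> {- Tm \<kappa>..T} \<longrightarrow> hist X U \<kappa> t = z t)" for \<kappa>
  proof (cases \<kappa>)
    case (Inl i)
    then show ?thesis using Lq_history[OF mem(1) taus_pos p bl(1) bl(2) T, of i] by (simp add: hist_def Tm_eq)
  next
    case (Inr u)
    then show ?thesis using Lq_history[OF mem(2) thetas_pos p bl(3) _ T] by (simp add: hist_def Tm_eq)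
  qed
  then obtain z c where z: "\<And>\<kappa>. Lq p (\<lambda>t. complex_of_real (z \<kappa> t)) (c \<kappa>)" "\<And>\<kappa> t. t \<notin> {- Tm \<kappa>..T} \<Longrightarrow> z \<kappa> t = 0"
     and hz: "\<And>\<kappa>. AE t in lborel. t \<in> {- Tm \<kappa>..T} \<longrightarrow> hist X U \<kappa> t = z \<kappa> t" by metis
  have zT: "z \<kappa> s = 0" if "s > T" for \<kappa> s using z(2)[of s \<kappa>] that by auto
  have zm[measurable]: "z \<kappa> \<in> borel_measurable borel" for \<kappa> by (rule Lq_of_real_measurable[OF z(1)])
  have "\<exists>w. Lq p (\<lambda>t. complex_of_real (w t)) c0 \<and> (AE t in lborel. t \<in> {- Tm \<kappa>..0} \<longrightarrow> hist X U \<kappa> t = w t)" for \<kappa>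
  proof (cases \<kappa>)
    case (Inl i)
    obtain w where w: "Lq p (\<lambda>t. complex_of_real (w t)) (Lp_norm p {- taus..0} X0)" "AE t in lborel. t \<in> {- taus..0} \<longrightarrow> X0 t $ i = w t"
      using memLp_Lq[OF X0 taus_pos p bl(1) bl(2), of i] by auto
    have "AE t in lborel. t \<in> {- taus..0} \<longrightarrow> X t = X0 t" using init(1) by (subst (asm) AE_lebesgue_on) auto
    with w(2) have "AE t in lborel. t \<in> {- Tm \<kappa>..0} \<longrightarrow> hist X U \<kappa> t = w t"
      by eventually_elim (auto simp: Inl hist_def Tm_eq)
    moreover have "Lq p (\<lambda>t. complex_of_real (w t)) c0" by (rule Lq_mono[OF w(1)]) (simp add: c0_def LU0)
    ultimately show ?thesis by blast
  next
    case (Inr u)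
    obtain w where w: "Lq p (\<lambda>t. complex_of_real (w t)) (Lp_norm p {- thetas..0} U0)" "AE t in lborel. t \<in> {- thetas..0} \<longrightarrow> U0 t = w t"
      using memLp_Lq[OF U0 thetas_pos p bl(3)] by auto
    have "AE t in lborel. t \<in> {- thetas..0} \<longrightarrow> U t = U0 t" using init(2) by (subst (asm) AE_lebesgue_on) auto
    with w(2) have "AE t in lborel. t \<in> {- Tm \<kappa>..0} \<longrightarrow> hist X U \<kappa> t = w t"
      by eventually_elim (auto simp: Inr hist_def Tm_eq)
    moreover have "Lq p (\<lambda>t. complex_of_real (w t)) c0" by (rule Lq_mono[OF w(1)]) (simp add: c0_def LX0)
    ultimately show ?thesis by blast
  qed
  then obtain w where w: "\<And>\<kappa>. Lq p (\<lambda>t. complex_of_real (w \<kappa> t)) c0"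
      "\<And>\<kappa>. AE t in lborel. t \<in> {- Tm \<kappa>..0} \<longrightarrow> hist X U \<kappa> t = w \<kappa> t" by metis
  define y where "y \<kappa> s = complex_of_real (if 0 < s \<and> s \<le> T then exp (\<nu> * s) * z \<kappa> s else 0)" for \<kappa> s
  define v where "v \<kappa> s = complex_of_real (if s \<le> 0 then exp (\<nu> * s) * z \<kappa> s else 0)" for \<kappa> s
  have yv: "y \<kappa> s + v \<kappa> s = complex_of_real (exp (\<nu> * s) * z \<kappa> s)" for \<kappa> s
    using zT[of s \<kappa>] by (auto simp: y_def v_def)
  have xq: "Lq p (\<lambda>s. complex_of_real (exp (\<nu> * s) * z \<kappa> s)) (exp (\<nu> * T) * c \<kappa>)" for \<kappa>
    by (rule weighted_Lq[OF p z(1) zT])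
  have ym: "y \<kappa> \<in> borel_measurable borel" and vm: "v \<kappa> \<in> borel_measurable borel" for \<kappa>
    unfolding y_def[abs_def] v_def[abs_def] by measurable
  have ysig: "sig p (y \<kappa>) (exp (\<nu> * T) * c \<kappa>)" for \<kappa>
  proof -
    have "Lq p (y \<kappa>) (exp (\<nu> * T) * c \<kappa>)"
      by (rule Lq_AE_mono[OF xq[of \<kappa>] ym _ order_refl]) (rule AE_I2, auto simp: y_def norm_mult abs_mult)
    then show ?thesis by (simp add: sig_def y_def)
  qed
  have vq: "Lq p (v \<kappa>) c0" for \<kappa>
  proof (rule Lq_AE_mono[OF w(1)[of \<kappa>] vm _ order_refl])
    show "AE t in lborel. cmod (v \<kappa> t) \<le> cmod (complex_of_real (w \<kappa> t))"
      using w(2)[of \<kappa>] hz[of \<kappa>]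
    proof eventually_elim
      case (elim t)
      show ?case
      proof (cases "t \<in> {- Tm \<kappa>..0}")
        case True
        then have "z \<kappa> t = w \<kappa> t" using elim T by auto
        moreover have "exp (\<nu> * t) \<le> 1" using True \<nu>0 by (auto simp: mult_nonneg_nonpos)
        ultimately show ?thesis using True by (simp add: v_def norm_mult mult_left_le_one_le)
      qed (use z(2)[of t \<kappa>] T in \<open>auto simp: v_def\<close>)
    qed
  qed
  have yq_all: "\<forall>\<kappa>. Lq p (y \<kappa>) (K * c0)"
  proof (rule main[THEN spec[of _ y], THEN spec[of _ v], THEN spec[of _ T], THEN spec[of _ c0], THEN mp, THEN mp, THEN mp, THEN mp, THEN mp, THEN mp])
    show "0 \<le> T" by (rule T)
    show "\<forall>j. \<exists>c. sig p (y j) c" using ysig by blast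
    show "\<forall>j. \<forall>t>T. y j t = 0" by (simp add: y_def)
    show "\<forall>j. Lq p (v j) c0" using vq by blast
    have ide: "AE t in lborel. 0 < t \<and> t < T \<longrightarrow>
      complex_of_real (exp (\<nu> * t) * z (Inl i) t) = (\<Sum>\<kappa>\<in>UNIV. G i \<kappa> (\<lambda>s. complex_of_real (exp (\<nu> * s) * z \<kappa> s)) t)" for i
      by (rule ide_weighted[OF p z(1) zT hz sol'[THEN conjunct2, THEN conjunct2, THEN conjunct2, THEN conjunct1]])
    show "\<forall>i. AE t in lborel. 0 < t \<and> t < T \<longrightarrow> y (Inl i) t = (\<Sum>j\<in>UNIV. G i j (\<lambda>s. y j s + v j s) t)"
      unfolding yv
    proof
      fix i
      show "AE t in lborel. 0 < t \<and> t < T \<longrightarrow> y (Inl i) t = (\<Sum>j\<in>UNIV. G i j (\<lambda>s. complex_of_real (exp (\<nu> * s) * z j s)) t)"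
        using ide[of i] by eventually_elim (auto simp: y_def)
    qed
    have ctl: "AE t in lborel. 0 < t \<and> t < T \<longrightarrow>
      complex_of_real (exp (\<nu> * t) * z (Inr ()) t) = (\<Sum>\<kappa>\<in>UNIV. cv lborel (\<lambda>s. complex_of_real (k \<kappa> s)) (\<lambda>s. max 0 s)
      (\<lambda>s. complex_of_real (if 0 < s \<and> s \<le> T then exp (\<nu> * s) * z \<kappa> s else 0)) t)"
      by (rule control_weighted[OF k zm hz sol'[THEN conjunct2, THEN conjunct2, THEN conjunct2, THEN conjunct2]])
    show "AE t in lborel. 0 < t \<and> t < T \<longrightarrow> y (Inr ()) t = (\<Sum>j\<in>UNIV. cv lborel (\<lambda>s. complex_of_real (k j s)) (\<lambda>s. max 0 s) (y j) t)"
      using ctl unfolding y_def[abs_def] by eventually_elim auto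
  qed
  then have yq: "Lq p (y \<kappa>) (K * c0)" for \<kappa> by (rule spec)
  have xK: "Lq p (\<lambda>s. complex_of_real (exp (\<nu> * s) * z \<kappa> s)) ((K + 1) * c0)" for \<kappa>
    using Lq_add[OF p yq[of \<kappa>] vq[of \<kappa>]] unfolding yv by (simp add: distrib_right)
  \<comment> \<open>On the window ending at T the weight is at least exp(\<nu> (T - Tm)), so the
    prefactor makes zz dominate the unweighted signal. The absolute value lets moduli be summed over
    components.\<close>
  define zz where "zz \<kappa> s = complex_of_real (exp (\<nu> * (Tm \<kappa> - T)) * \<bar>exp (\<nu> * (s + T)) * z \<kappa> (s + T)\<bar>)" for \<kappa> s
  have zzq: "Lq p (zz \<kappa>) (exp (\<nu> * (Tm \<kappa> - T)) * ((K + 1) * c0))" for \<kappa>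
  proof -
    have "Lq p (\<lambda>s. complex_of_real (exp (\<nu> * (Tm \<kappa> - T))) * complex_of_real (exp (\<nu> * (s - (- T))) * z \<kappa> (s - (- T)))) (exp (\<nu> * (Tm \<kappa> - T)) * ((K + 1) * c0))"
      using Lq_cmult[OF Lq_shift[OF xK, of "- T"] p, of "complex_of_real (exp (\<nu> * (Tm \<kappa> - T)))"] by simp
    then show ?thesis
    proof (rule Lq_AE_mono[OF _ _ _ order_refl])
      show "zz \<kappa> \<in> borel_measurable borel" unfolding zz_def[abs_def] by measurable
    qed (simp add: zz_def norm_mult abs_mult)
  qed
  have zzle: "AE s in lborel. s \<in> {- Tm \<kappa>..0} \<longrightarrow> \<bar>hist X U \<kappa> (T + s)\<bar> \<le> cmod (zz \<kappa> s)" for \<kappa>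
  proof -
    have "AE s in lborel. T + 1 * s \<in> {- Tm \<kappa>..T} \<longrightarrow> hist X U \<kappa> (T + 1 * s) = z \<kappa> (T + 1 * s)"
      by (rule AE_lborel_shift[OF hz]) simp
    then show ?thesis
    proof eventually_elim
      case (elim s)
      show ?case
      proof
        assume s: "s \<in> {- Tm \<kappa>..0}"
        then have h: "hist X U \<kappa> (T + s) = z \<kappa> (s + T)" using elim T by (auto simp: add.commute)
        have "1 \<le> exp (\<nu> * (Tm \<kappa> - T)) * exp (\<nu> * (s + T))"
        proof -
          have "0 \<le> \<nu> * ((Tm \<kappa> - T) + (s + T))" using s \<nu>0 by (intro mult_nonneg_nonneg) auto
          then have "1 \<le> exp (\<nu> * ((Tm \<kappa> - T) + (s + T)))" by simp
          then show ?thesis by (simp only: distrib_left exp_add)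
        qed
        then have "\<bar>z \<kappa> (s + T)\<bar> \<le> (exp (\<nu> * (Tm \<kappa> - T)) * exp (\<nu> * (s + T))) * \<bar>z \<kappa> (s + T)\<bar>"
          using mult_right_mono[of 1 _ "\<bar>z \<kappa> (s + T)\<bar>"] by simp
        then show "\<bar>hist X U \<kappa> (T + s)\<bar> \<le> cmod (zz \<kappa> s)" unfolding h zz_def norm_of_real by (simp add: abs_mult mult.assoc)
      qed
    qed
  qed
  have eT: "exp (\<nu> * (a - T)) = exp (\<nu> * a) * exp (- \<nu> * T)" for a by (simp add: mult_exp_exp right_diff_distrib)
  have "Lp_norm p {- taus..0} (\<lambda>s. X (T + s)) \<le> (\<Sum>i\<in>(UNIV :: 'n set). exp (\<nu> * (taus - T)) * ((K + 1) * c0))"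
  proof (rule Lp_norm_le[OF mem(1)[OF T] p])
    show "Lq p (\<lambda>s. \<Sum>i\<in>(UNIV :: 'n set). zz (Inl i) s) (\<Sum>i\<in>(UNIV :: 'n set). exp (\<nu> * (taus - T)) * ((K + 1) * c0))"
      by (rule Lq_sum[OF p]) (rule zzq[of "Inl _", unfolded Tm_eq])
    have "AE s in lborel. \<forall>i\<in>UNIV. s \<in> {- taus..0} \<longrightarrow> \<bar>X (T + s) $ i\<bar> \<le> cmod (zz (Inl i) s)"
      by (rule AE_finite_allI[OF finite_class.finite_UNIV]) (use zzle[of "Inl _"] in \<open>simp add: hist_def Tm_eq\<close>)
    then show "AE s in lborel. s \<in> {- taus..0} \<longrightarrow> norm (X (T + s)) \<le> cmod (\<Sum>i\<in>UNIV. zz (Inl i) s)"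
    proof eventually_elim
      case (elim s)
      have zc: "zz \<kappa> s = complex_of_real (cmod (zz \<kappa> s))" for \<kappa>
        unfolding zz_def norm_of_real by (simp add: abs_mult)
      have "(\<Sum>i\<in>(UNIV :: 'n set). zz (Inl i) s) = complex_of_real (\<Sum>i\<in>(UNIV :: 'n set). cmod (zz (Inl i) s))"
        unfolding of_real_sum by (rule sum.cong[OF refl zc])
      then have zs: "cmod (\<Sum>i\<in>(UNIV :: 'n set). zz (Inl i) s) = (\<Sum>i\<in>(UNIV :: 'n set). cmod (zz (Inl i) s))"
        by (simp only: norm_of_real abs_of_nonneg[OF sum_nonneg[OF norm_ge_zero]])
      show ?case
      proof
        assume "s \<in> {- taus..0}"
        then have "\<bar>X (T + s) $ i\<bar> \<le> cmod (zz (Inl i) s)" for i using elim by blast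
        then have "(\<Sum>i\<in>UNIV. \<bar>X (T + s) $ i\<bar>) \<le> (\<Sum>i\<in>UNIV. cmod (zz (Inl i) s))" by (intro sum_mono)
        with norm_le_l1_cart[of "X (T + s)"] show "norm (X (T + s)) \<le> cmod (\<Sum>i\<in>UNIV. zz (Inl i) s)"
          unfolding zs by (rule order.trans)
      qed
    qed
  qed simp
  moreover have "Lp_norm p {- thetas..0} (\<lambda>s. U (T + s)) \<le> exp (\<nu> * (thetas - T)) * ((K + 1) * c0)"
  proof (rule Lp_norm_le[where z = "zz (Inr ())", OF mem(2)[OF T] p])
    show "Lq p (zz (Inr ())) (exp (\<nu> * (thetas - T)) * ((K + 1) * c0))" using zzq[of "Inr ()"] unfolding Tm_eq .
    show "AE s in lborel. s \<in> {- thetas..0} \<longrightarrow> norm (U (T + s)) \<le> cmod (zz (Inr ()) s)"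
      using zzle[of "Inr ()"] by (simp add: hist_def Tm_eq)
  qed simp
  ultimately show ?thesis
    unfolding c0_def[symmetric] eT by (simp add: algebra_simps)
qed

end

section \<open>Choice of the decay rate and assembly of the controller\<close>

theorem theorem1:
  fixes p :: enat and taus thetas :: real
    and A :: "nat \<Rightarrow> real^'n^'n" and B :: "nat \<Rightarrow> real^'n"
    and tau theta :: "nat \<Rightarrow> real"
    and N :: "real \<Rightarrow> real^'n^'n" and M :: "real \<Rightarrow> real^'n"
  assumes p_pos: "p \<ge> 1"
    and taus_pos: "taus > 0" and thetas_pos: "thetas > 0"
    and A_summ: "summable (\<lambda>k. norm (A (Suc k)))"
    and B_summ: "summable (\<lambda>j. norm (B j))"
    and tau_mono: "\<forall>k\<ge>1. tau k < tau (Suc k)"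
    and tau_range: "\<forall>k\<ge>1. 0 < tau k \<and> tau k \<le> taus"
    and theta_mono: "strict_mono theta"
    and theta_range: "\<forall>j. 0 \<le> theta j \<and> theta j \<le> thetas"
    and N_L2: "L2_on {0<..<taus} N"
    and M_L2: "L2_on {0<..<thetas} M"
    and A1: "\<exists>\<nu>t>0. \<exists>\<eta>>0. \<forall>z::complex. Re z > - \<nu>t \<longrightarrow> cmod (det (Delta0 A tau z)) > \<eta>"
    and A2: "\<exists>\<nu>b>0. \<forall>z::complex. Re z > - \<nu>b \<longrightarrow>
               rank (block_qp (qfun A tau taus N z) (pfun B theta thetas M z)) = CARD('n)"
  shows "\<exists>(g :: 'n \<Rightarrow> real \<Rightarrow> real) (S :: 'n \<Rightarrow> real) (f :: real \<Rightarrow> real) (Sf :: real).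
           (\<forall>i. 0 < S i \<and> L2_on {0<..} (g i) \<and> (\<forall>\<eta>. \<eta> > S i \<longrightarrow> g i \<eta> = 0)) \<and>
           0 < Sf \<and> L2_on {0<..} f \<and> (\<forall>\<eta>. \<eta> > Sf \<longrightarrow> f \<eta> = 0) \<and>
           (\<exists>\<nu>>0. \<exists>C\<ge>1. \<forall>X0 U0 X U.
              memLp p {-taus..0} X0 \<longrightarrow> memLp p {-thetas..0} U0 \<longrightarrow>
              closed_loop_solution p taus thetas A tau B theta N M g S f Sf X0 U0 X U \<longrightarrow>
              (\<forall>t\<ge>0. Lp_norm p {-taus..0} (\<lambda>s. X (t + s)) + Lp_norm p {-thetas..0} (\<lambda>s. U (t + s))
                  \<le> C * exp (- \<nu> * t) * (Lp_norm p {-taus..0} X0 + Lp_norm p {-thetas..0} U0)))"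
proof -
  obtain \<nu>t \<eta>0 where \<nu>t: "\<nu>t > 0" "\<eta>0 > 0" "\<And>z. Re z > - \<nu>t \<Longrightarrow> cmod (det (Delta0 A tau z)) > \<eta>0" using A1 by blast
  obtain \<nu>b where \<nu>b: "\<nu>b > 0" "\<And>z. Re z > - \<nu>b \<Longrightarrow> rank (block_qp (qfun A tau taus N z) (pfun B theta thetas M z)) = CARD('n)"
    using A2 by blast
  \<comment> \<open>Strictly below both margins: \<nu> < \<nu>t leaves room for the vertical line of
    Newman's argument, and \<nu> < \<nu>b keeps the rank condition valid on Re z >= -\<nu>.\<close>
  define \<nu> where "\<nu> = min \<nu>t \<nu>b / 2"
  have \<nu>: "0 < \<nu>" "\<nu> < \<nu>t" "\<nu> < \<nu>b" using \<nu>t(1) \<nu>b(1) by (auto simp: \<nu>_def min_def)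
  define ad where "ad i \<kappa> k = (case \<kappa> of Inl j \<Rightarrow> A (Suc k) $ i $ j | Inr _ \<Rightarrow> B k $ i)" for i and \<kappa> :: "'n + unit" and k
  define td where "td \<kappa> k = (case \<kappa> of Inl _ \<Rightarrow> tau (Suc k) | Inr _ \<Rightarrow> theta k)" for \<kappa> :: "'n + unit" and k
  define Tm where "Tm \<kappa> = (case \<kappa> of Inl _ \<Rightarrow> taus | Inr _ \<Rightarrow> thetas)" for \<kappa> :: "'n + unit"
  define ker where "ker i \<kappa> t = (case \<kappa> of Inl j \<Rightarrow> N t $ i $ j | Inr _ \<Rightarrow> M t $ i)" for i and \<kappa> :: "'n + unit" and t
  let ?P = "\<lambda>i \<kappa> n. integrable lborel n \<and> (\<forall>t. t < 0 \<or> t > Tm \<kappa> \<longrightarrow> n t = 0)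
    \<and> (AE t in lborel. (if t \<in> {0..Tm \<kappa>} then ker i \<kappa> t else 0) = n t) \<and> ker i \<kappa> \<in> borel_measurable (lebesgue_on {0..Tm \<kappa>})"
  have ex: "\<exists>n. ?P i \<kappa> n" for i \<kappa>
  proof (cases \<kappa>)
    case (Inl j)
    have "bounded_linear (\<lambda>m :: real^'n^'n. m $ i $ j)"
      by (rule bounded_linear_compose[OF bounded_linear_vec_nth bounded_linear_vec_nth])
    from L2_kernel_version[OF N_L2 taus_pos this abs_nth2_le]
    show ?thesis unfolding Inl Tm_def ker_def[abs_def] sum.case .
  next
    case (Inr u)
    from L2_kernel_version[OF M_L2 thetas_pos bounded_linear_vec_nth[of i] component_le_norm_cart]
    show ?thesis unfolding Inr Tm_def ker_def[abs_def] sum.case .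
  qed
  define nc where "nc i \<kappa> = (SOME n. ?P i \<kappa> n)" for i \<kappa>
  have P: "?P i \<kappa> (nc i \<kappa>)" for i \<kappa> unfolding nc_def by (rule someI_ex[OF ex])
  have nc: "integrable lborel (nc i \<kappa>)" "t < 0 \<or> t > Tm \<kappa> \<Longrightarrow> nc i \<kappa> t = 0"
    "AE t in lborel. (if t \<in> {0..Tm \<kappa>} then ker i \<kappa> t else 0) = nc i \<kappa> t"
    "ker i \<kappa> \<in> borel_measurable (lebesgue_on {0..Tm \<kappa>})" for i \<kappa> t
    using P[of i \<kappa>] by blast+
  have tau: "0 < tau (Suc k) \<and> tau (Suc k) \<le> taus" for k using tau_range by simp
  have ad_summ: "summable (\<lambda>k. \<bar>ad i \<kappa> k\<bar>)" for i \<kappa>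
  proof (cases \<kappa>)
    case (Inl j)
    have "\<exists>n0. \<forall>n\<ge>n0. norm \<bar>ad i \<kappa> n\<bar> \<le> norm (A (Suc n))"
      by (intro exI[of _ 0] allI impI) (simp add: ad_def Inl abs_nth2_le)
    then show ?thesis by (rule summable_comparison_test[OF _ A_summ])
  next
    case (Inr u)
    have "\<exists>n0. \<forall>n\<ge>n0. norm \<bar>ad i \<kappa> n\<bar> \<le> norm (B n)"
      by (intro exI[of _ 0] allI impI) (simp add: ad_def Inr component_le_norm_cart)
    then show ?thesis by (rule summable_comparison_test[OF _ B_summ])
  qed
  have td_range: "0 \<le> td \<kappa> k \<and> td \<kappa> k \<le> Tm \<kappa>" for \<kappa> k
    using tau[of k] theta_range by (cases \<kappa>) (auto simp: td_def Tm_def)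
  have "ide_data ad td nc Tm \<nu>" by (rule ide_data.intro[OF ad_summ td_range nc(1,2)]) (use \<nu> in auto)
  then have "ide_system ad td nc Tm \<nu> A B tau theta N M taus thetas ker"
    by (rule ide_system.intro, intro ide_system_axioms.intro)
      (rule A_summ B_summ taus_pos thetas_pos nc(3) nc(4) | simp add: ad_def td_def Tm_def ker_def)+
  then interpret ide_system ad td nc Tm \<nu> A B tau theta N M taus thetas ker .
  have Finv: "\<exists>W C. mlt W C \<and> mlt (\<lambda>z. W z * FF z - 1) \<epsilon>" if "\<epsilon> > 0" for \<epsilon>
    unfolding FF_Delta0 by (rule Delta0_approx_inverse[OF A_summ tau _ \<nu>(2) \<nu>t(2,3) that]) (use \<nu> in auto)
  have rk: "\<exists>j. cof (R z0) j \<noteq> 0" if "Re z0 \<ge> 0" for z0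
    by (rule rank_cof, unfold R_block, rule \<nu>b(2)) (use \<nu> that in simp)
  have "\<exists>k S K. S > 0 \<and> K \<ge> 0 \<and> (\<forall>j. k j \<in> borel_measurable borel) \<and> (\<forall>j t. \<bar>k j t\<bar> \<le> S)
     \<and> (\<forall>j t. t < 0 \<or> t > S \<longrightarrow> k j t = 0) \<and>
     (\<forall>y v T c0. T \<ge> 0 \<longrightarrow> (\<forall>j. \<exists>c. sig p (y j) c) \<longrightarrow> (\<forall>j. \<forall>t>T. y j t = 0) \<longrightarrow> (\<forall>j. Lq p (v j) c0)
       \<longrightarrow> (\<forall>i. AE t in lborel. 0 < t \<and> t < T \<longrightarrow> y (Inl i) t = (\<Sum>j\<in>UNIV. G i j (\<lambda>s. y j s + v j s) t))
       \<longrightarrow> (AE t in lborel. 0 < t \<and> t < T \<longrightarrow> y (Inr ()) t = (\<Sum>j\<in>UNIV. cv lborel (\<lambda>s. complex_of_real (k j s)) (\<lambda>s. max 0 s) (y j) t))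
       \<longrightarrow> (\<forall>j. Lq p (y j) (K * c0)))"
    by (rule stable[OF Finv rk p_pos])
  then obtain k S K where kSK: "S > 0 \<and> K \<ge> 0 \<and> (\<forall>j. k j \<in> borel_measurable borel) \<and> (\<forall>j t. \<bar>k j t\<bar> \<le> S)
     \<and> (\<forall>j t. t < 0 \<or> t > S \<longrightarrow> k j t = 0) \<and>
     (\<forall>y v T c0. T \<ge> 0 \<longrightarrow> (\<forall>j. \<exists>c. sig p (y j) c) \<longrightarrow> (\<forall>j. \<forall>t>T. y j t = 0) \<longrightarrow> (\<forall>j. Lq p (v j) c0)
       \<longrightarrow> (\<forall>i. AE t in lborel. 0 < t \<and> t < T \<longrightarrow> y (Inl i) t = (\<Sum>j\<in>UNIV. G i j (\<lambda>s. y j s + v j s) t))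
       \<longrightarrow> (AE t in lborel. 0 < t \<and> t < T \<longrightarrow> y (Inr ()) t = (\<Sum>j\<in>UNIV. cv lborel (\<lambda>s. complex_of_real (k j s)) (\<lambda>s. max 0 s) (y j) t))
       \<longrightarrow> (\<forall>j. Lq p (y j) (K * c0)))"
    by - ((erule exE)+, (rule that, assumption | blast))
  note S = kSK[THEN conjunct1] and K = kSK[THEN conjunct2, THEN conjunct1]
    and main = kSK[THEN conjunct2, THEN conjunct2, THEN conjunct2, THEN conjunct2, THEN conjunct2]
  have k: "k \<kappa> \<in> borel_measurable borel" "\<bar>k \<kappa> t\<bar> \<le> S" "t < 0 \<or> t > S \<Longrightarrow> k \<kappa> t = 0" for \<kappa> t
    using kSK[THEN conjunct2, THEN conjunct2, THEN conjunct1] kSK[THEN conjunct2, THEN conjunct2, THEN conjunct2, THEN conjunct1]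
      kSK[THEN conjunct2, THEN conjunct2, THEN conjunct2, THEN conjunct2, THEN conjunct1] by blast+
  define C where "C = max 1 ((real CARD('n) * exp (\<nu> * taus) + exp (\<nu> * thetas)) * (K + 1))"
  have L2: "L2_on {0<..} (\<lambda>\<eta>. exp (- \<nu> * \<eta>) * k \<kappa> \<eta>)" for \<kappa>
  proof (rule bounded_support_L2)
    show "(\<lambda>\<eta>. exp (- \<nu> * \<eta>) * k \<kappa> \<eta>) \<in> borel_measurable borel" using k(1)[of \<kappa>] by measurable
    show "\<bar>exp (- \<nu> * t) * k \<kappa> t\<bar> \<le> S" if "0 < t" for t
    proof -
      have "exp (- \<nu> * t) \<le> 1" using \<nu> that by simp
      then have "exp (- \<nu> * t) * \<bar>k \<kappa> t\<bar> \<le> 1 * \<bar>k \<kappa> t\<bar>" by (rule mult_right_mono) simp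
      then show ?thesis using k(2)[of \<kappa> t] by (simp add: abs_mult)
    qed
    show "exp (- \<nu> * t) * k \<kappa> t = 0" if "t > S" for t using k(3)[of t \<kappa>] that by simp
  qed
  have bound: "Lp_norm p {-taus..0} (\<lambda>s. X (t + s)) + Lp_norm p {-thetas..0} (\<lambda>s. U (t + s))
      \<le> C * exp (- \<nu> * t) * (Lp_norm p {-taus..0} X0 + Lp_norm p {-thetas..0} U0)"
    if "memLp p {-taus..0} X0" "memLp p {-thetas..0} U0"
      "closed_loop_solution p taus thetas A tau B theta N M (\<lambda>i \<eta>. exp (- \<nu> * \<eta>) * k (Inl i) \<eta>) (\<lambda>_. S)
      (\<lambda>\<eta>. exp (- \<nu> * \<eta>) * k (Inr ()) \<eta>) S X0 U0 X U" "t \<ge> 0" for X0 U0 X U t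
  proof -
    let ?L = "Lp_norm p {-taus..0} X0 + Lp_norm p {-thetas..0} U0"
    have "0 \<le> ?L" using Lp_norm_nonneg[OF taus_pos, of p X0] Lp_norm_nonneg[OF thetas_pos, of p U0] by simp
    then have "(real CARD('n) * exp (\<nu> * taus) + exp (\<nu> * thetas)) * (K + 1) * exp (- \<nu> * t) * ?L \<le> C * exp (- \<nu> * t) * ?L"
      by (intro mult_right_mono) (auto simp: C_def)
    with solution_bound[OF p_pos K k(1,3) main that] show ?thesis by (rule order.trans)
  qed
  let ?g = "\<lambda>i \<eta>. exp (- \<nu> * \<eta>) * k (Inl i) \<eta>" and ?f = "\<lambda>\<eta>. exp (- \<nu> * \<eta>) * k (Inr ()) \<eta>"
  have C1: "C \<ge> 1" by (simp add: C_def)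
  have stab: "\<exists>\<nu>>0. \<exists>C\<ge>1. \<forall>X0 U0 X U. memLp p {-taus..0} X0 \<longrightarrow> memLp p {-thetas..0} U0 \<longrightarrow>
      closed_loop_solution p taus thetas A tau B theta N M ?g (\<lambda>_. S) ?f S X0 U0 X U \<longrightarrow>
      (\<forall>t\<ge>0. Lp_norm p {-taus..0} (\<lambda>s. X (t + s)) + Lp_norm p {-thetas..0} (\<lambda>s. U (t + s))
        \<le> C * exp (- \<nu> * t) * (Lp_norm p {-taus..0} X0 + Lp_norm p {-thetas..0} U0))"
    by (rule exI[of _ \<nu>], rule conjI[OF \<nu>(1)], rule exI[of _ C], rule conjI[OF C1], intro allI impI) (rule bound)
  show ?thesis
    by (rule exI[of _ ?g], rule exI[of _ "\<lambda>_. S"], rule exI[of _ ?f], rule exI[of _ S], intro conjI allI impI)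
      (rule S L2 stab | simp add: k(3))+
qed

end
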